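(* Let $N\ge2$, $d\ge2$, $0<g_1<\cdots<g_N$, $f_{ij}=g_i+g_j$ ($i\ne j$), let $\Omega\subset\mathbb R^d$ be a bounded domain of class $C^{2+\alpha}$, $0<\alpha<1$, and $p>d+2$. Let $y$ be the concentration variable of a global maximal-$L^p$ strong solution of the normalized additive Maxwell--Stefan system (so $y$ takes values in the open simplex, $y\in C([0,\infty);C^1(\overline\Omega))$, and $y$ is classical on every positive-time strip), with $y^0=y(0,\cdot)$, and let $z,U,w$ be the associated root, moment and entropy variables. Set $\overline y_i=|\Omega|^{-1}\int_\Omega y_i^0\,dx$ and $$\mathcal R_0:=\prod_{j=1}^{N-1}\Bigl[\min_{\overline\Omega}z_j(0,\cdot),\max_{\overline\Omega}z_j(0,\cdot)\Bigr].$$ Then $\mathcal R_0$ is a compact subset of $\prod_{j=1}^{N-1}(g_j,g_{j+1})$ and $z([0,\infty)\times\overline\Omega)\subset\mathcal R_0$. Let $f_{\max}=\max_{i\ne j}f_{ij}$ and $\kappa_{\rm LS}:=\dfrac{4}{f_{\max}C_{\rm LS}(\Omega)}>0$. Then $$\mathcal H(y(t)\mid\overline y)\le e^{-\kappa_{\rm LS}t}\,\mathcal H(y^0\mid\overline y),\qquad t\ge0.$$ Moreover there is $C_{\mathcal R_0}<\infty$ such that for all $t\ge0$ $$\|y(t)-\overline y\|_{L^2}+\|z(t)-z(\overline y)\|_{L^2}+\|U(t)-U(\overline y)\|_{L^2}+\|w(t)-w(\overline y)\|_{L^2}\le C_{\mathcal R_0}e^{-\kappa_{\rm LS}t/2}\,\mathcal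 H(y^0\mid\overline y)^{1/2}.$$ The entropy decay rate $\kappa_{\rm LS}$ depends only on $f_{\max}$ and the logarithmic Sobolev constant of the domain, not on the distance of the initial state from the boundary of the concentration simplex.
   Context: System: $\partial_ty_i+\operatorname{div}J_i=0$, $\nabla y=B(y)J$ (i.e. $\partial_{x_k}y=B(y)J^k$ for each column $J^k\in\mathbb R^N$ of $J$), $\sum_iJ_i=0$ in $\Omega$, $J_i\cdot\nu=0$ on $\partial\Omega$, with $B_{ij}(y)=y_if_{ij}$ ($i\ne j$), $B_{ii}(y)=-\sum_{\ell\ne i}f_{i\ell}y_\ell$; $y_i>0$, $\sum_iy_i=1$. Coordinates: $z_j(y)$ is the unique zero of $\zeta\mapsto\sum_iy_i/(g_i-\zeta)$ in $(g_j,g_{j+1})$, $j=1,\dots,N-1$; $U_\ell(y)=\sum_ig_i^\ell y_i$, $\ell=1,\dots,N-1$ (an affine bijection from the simplex, inverse $y(U)$); $w=Dh(U)$ with $h(U)=\sum_iy_i(U)\log y_i(U)$; equivalently $y_i=\exp(\sum_\ell g_i^\ell w_\ell)/\sum_r\exp(\sum_\ell g_r^\ell w_\ell)$. Strong class: with $m=N-1$, $X_0=L^p(\Omega;\mathbb R^m)$, $X_1=\{v\in W^{2,p}(\Omega;\mathbb R^m):\partial_\nu v=0\}$, $X_{\gamma,p}=(X_0,X_1)_{1-1/p,p}$, a global maximal-$L^p$ strong solution means $w\in W^{1,p}_{\rm loc}([0,\infty);X_0)\cap L^p_{\rm loc}([0,\infty);X_1)\cap C([0,\infty);X_{\gamma,p})$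 with the equation (in entropy variables) satisfied in $X_0$ for a.e. $t$. Classical on positive-time strips: for all $0<\tau<T'<\infty$, $w\in C^{1+\sigma/2,2+\sigma}_{t,x}([\tau,T']\times\overline\Omega)$ for some $\sigma>0$. Such solutions exist globally for every $w(0)\in X_{\gamma,p}$. Relative entropy: $\mathcal H(y\mid\overline y)=\int_\Omega\sum_iy_i\log(y_i/\overline y_i)\,dx$. $C_{\rm LS}(\Omega)<\infty$ is a constant, depending only on $\Omega$, such that $\int_\Omega\rho\log(\rho/\bar\rho)\,dx\le C_{\rm LS}(\Omega)\int_\Omega|\nabla\sqrt\rho|^2dx$ for every $\rho\ge0$ with $\sqrt\rho\in H^1(\Omega)$ and positive mean $\bar\rho=|\Omega|^{-1}\int_\Omega\rho\,dx$ (such a constant exists for bounded $C^2$ domains). *)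

theory Defs
  imports "HOL-Analysis.Analysis"
begin

text \<open>
  Vectors of \<open>\<real>\<^sup>N\<close> and \<open>\<real>\<^sup>m\<close>, \<open>m = N - 1\<close>, are functions \<open>nat \<Rightarrow> real\<close> of which only the values at the
  indices \<open>1..N\<close> (resp. \<open>1..m\<close>) matter; \<open>\<real>\<^sup>d\<close> is a type of class \<open>euclidean_space\<close>.  Elements of
  function spaces are represented by functions; the norms below do not see null sets.
\<close>

type_synonym 'a vfield = "'a \<Rightarrow> nat \<Rightarrow> real"


section \<open>Bounded domains of class \<open>C\<^sup>2\<^sup>+\<^sup>\<alpha>\<close>\<close>

definition C2_holder :: "real \<Rightarrow> ('a::euclidean_space \<Rightarrow> real) \<Rightarrow> bool" where
  "C2_holder \<alpha> u \<longleftrightarrow> (\<exists>Du D2u.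
     (\<forall>x. (u has_derivative (\<lambda>h. Du x \<bullet> h)) (at x)) \<and>
     (\<forall>x. (Du has_derivative D2u x) (at x)) \<and>
     (\<forall>b\<in>Basis. \<exists>C. \<forall>x y. norm (D2u x b - D2u y b) \<le> C * norm (x - y) powr \<alpha>))"

text \<open>
  Near each boundary point, \<open>\<Omega>\<close> is the strict epigraph, in some direction \<open>e\<close>, of a \<open>C\<^sup>2\<^sup>+\<^sup>\<alpha>\<close> function
  \<open>\<gamma>\<close> of the coordinates orthogonal to \<open>e\<close>.
\<close>

definition C2_holder_domain :: "real \<Rightarrow> 'a::euclidean_space set \<Rightarrow> bool" where
  "C2_holder_domain \<alpha> \<Omega> \<longleftrightarrow> open \<Omega> \<and> connected \<Omega> \<and> \<Omega> \<noteq> {} \<and>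
     (\<forall>x0\<in>frontier \<Omega>. \<exists>r>0. \<exists>e \<gamma>. norm e = 1 \<and> C2_holder \<alpha> \<gamma> \<and>
        \<Omega> \<inter> ball x0 r = {x \<in> ball x0 r. \<gamma> (x - (x \<bullet> e) *\<^sub>R e) < x \<bullet> e})"

text \<open>
  The outward unit normal is the normalised gradient of any local \<open>C\<^sup>1\<close> defining function that is
  negative inside \<open>\<Omega>\<close> and has nonzero gradient at the boundary point.
\<close>

definition is_outward_normal :: "'a::euclidean_space set \<Rightarrow> 'a \<Rightarrow> 'a \<Rightarrow> bool" where
  "is_outward_normal \<Omega> x \<nu> \<longleftrightarrow> (\<exists>r>0. \<exists>\<phi> D\<phi>.
     (\<forall>y\<in>ball x r. (\<phi> has_derivative (\<lambda>h. D\<phi> y \<bullet> h)) (at y)) \<and>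
     continuous_on (ball x r) D\<phi> \<and> D\<phi> x \<noteq> 0 \<and>
     \<Omega> \<inter> ball x r = {y \<in> ball x r. \<phi> y < 0} \<and>
     \<nu> = D\<phi> x /\<^sub>R norm (D\<phi> x))"

definition outward_normal :: "'a::euclidean_space set \<Rightarrow> 'a \<Rightarrow> 'a" where
  "outward_normal \<Omega> x = (THE \<nu>. is_outward_normal \<Omega> x \<nu>)"


section \<open>Sobolev spaces\<close>

primrec C_k :: "nat \<Rightarrow> ('a::euclidean_space \<Rightarrow> real) \<Rightarrow> bool" where
  "C_k 0 f \<longleftrightarrow> continuous_on UNIV f"
| "C_k (Suc k) f \<longleftrightarrow> (\<exists>Df. (\<forall>x. (f has_derivative (\<lambda>h. Df x \<bullet> h)) (at x)) \<and>
     (\<forall>b\<in>Basis. C_k k (\<lambda>x. Df x \<bullet> b)))"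

definition test_function :: "'a::euclidean_space set \<Rightarrow> ('a \<Rightarrow> real) \<Rightarrow> bool" where
  "test_function \<Omega> \<phi> \<longleftrightarrow> (\<forall>k. C_k k \<phi>) \<and>
     (\<exists>K. compact K \<and> K \<subseteq> \<Omega> \<and> (\<forall>x. x \<notin> K \<longrightarrow> \<phi> x = 0))"

definition locally_integrable :: "'a::euclidean_space set \<Rightarrow> ('a \<Rightarrow> 'b::euclidean_space) \<Rightarrow> bool" where
  "locally_integrable \<Omega> u \<longleftrightarrow> (\<forall>K. compact K \<and> K \<subseteq> \<Omega> \<longrightarrow> integrable (lebesgue_on K) u)"

definition has_weak_deriv ::
  "'a::euclidean_space set \<Rightarrow> 'a \<Rightarrow> ('a \<Rightarrow> real) \<Rightarrow> ('a \<Rightarrow> real) \<Rightarrow> bool" where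
  "has_weak_deriv \<Omega> b u v \<longleftrightarrow> locally_integrable \<Omega> u \<and> locally_integrable \<Omega> v \<and>
     (\<forall>\<phi>. test_function \<Omega> \<phi> \<longrightarrow>
        (LINT x|lebesgue_on \<Omega>. u x * frechet_derivative \<phi> (at x) b) =
          - (LINT x|lebesgue_on \<Omega>. v x * \<phi> x))"

text \<open>Determined up to null sets, hence well defined under integrals and almost-everywhere quantifiers.\<close>

definition weak_deriv :: "'a::euclidean_space set \<Rightarrow> 'a \<Rightarrow> ('a \<Rightarrow> real) \<Rightarrow> 'a \<Rightarrow> real" where
  "weak_deriv \<Omega> b u = (SOME v. has_weak_deriv \<Omega> b u v)"

text \<open>Here \<open>frechet_derivative \<phi> (at x) (J x)\<close> is \<open>J(x) \<cdot> \<nabla>\<phi>(x)\<close>.\<close>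

definition has_weak_div ::
  "'a::euclidean_space set \<Rightarrow> ('a \<Rightarrow> 'a) \<Rightarrow> ('a \<Rightarrow> real) \<Rightarrow> bool" where
  "has_weak_div \<Omega> J q \<longleftrightarrow> locally_integrable \<Omega> J \<and> locally_integrable \<Omega> q \<and>
     (\<forall>\<phi>. test_function \<Omega> \<phi> \<longrightarrow>
        (LINT x|lebesgue_on \<Omega>. frechet_derivative \<phi> (at x) (J x)) =
          - (LINT x|lebesgue_on \<Omega>. q x * \<phi> x))"

definition in_Lp :: "real \<Rightarrow> 'a::euclidean_space set \<Rightarrow> ('a \<Rightarrow> real) \<Rightarrow> bool" where
  "in_Lp p \<Omega> u \<longleftrightarrow> u \<in> borel_measurable (lebesgue_on \<Omega>) \<and>
     integrable (lebesgue_on \<Omega>) (\<lambda>x. \<bar>u x\<bar> powr p)"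

definition Lp_norm :: "real \<Rightarrow> 'a::euclidean_space set \<Rightarrow> ('a \<Rightarrow> real) \<Rightarrow> real" where
  "Lp_norm p \<Omega> u = (LINT x|lebesgue_on \<Omega>. \<bar>u x\<bar> powr p) powr (1 / p)"

definition in_W1p :: "real \<Rightarrow> 'a::euclidean_space set \<Rightarrow> ('a \<Rightarrow> real) \<Rightarrow> bool" where
  "in_W1p p \<Omega> u \<longleftrightarrow> in_Lp p \<Omega> u \<and>
     (\<forall>b\<in>Basis. \<exists>v. has_weak_deriv \<Omega> b u v \<and> in_Lp p \<Omega> v)"

definition in_W2p :: "real \<Rightarrow> 'a::euclidean_space set \<Rightarrow> ('a \<Rightarrow> real) \<Rightarrow> bool" where
  "in_W2p p \<Omega> u \<longleftrightarrow> in_W1p p \<Omega> u \<and> (\<forall>b\<in>Basis. in_W1p p \<Omega> (weak_deriv \<Omega> b u))"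

definition W2p_norm :: "real \<Rightarrow> 'a::euclidean_space set \<Rightarrow> ('a \<Rightarrow> real) \<Rightarrow> real" where
  "W2p_norm p \<Omega> u = Lp_norm p \<Omega> u + (\<Sum>b\<in>Basis. Lp_norm p \<Omega> (weak_deriv \<Omega> b u))
     + (\<Sum>b\<in>Basis. \<Sum>c\<in>Basis. Lp_norm p \<Omega> (weak_deriv \<Omega> c (weak_deriv \<Omega> b u)))"

text \<open>
  The trace of \<open>\<nabla>v\<close> is taken as the boundary value of its representative \<open>G\<close> that is continuous on
  the closure; for \<open>v \<in> W\<^sup>2\<^sup>,\<^sup>p\<close> and \<open>p > d\<close> this representative exists by Morrey's embedding.
\<close>

definition zero_normal_deriv :: "'a::euclidean_space set \<Rightarrow> ('a \<Rightarrow> real) \<Rightarrow> bool" where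
  "zero_normal_deriv \<Omega> v \<longleftrightarrow> (\<exists>G. continuous_on (closure \<Omega>) G \<and>
     (AE x in lebesgue_on \<Omega>. \<forall>b\<in>Basis. G x \<bullet> b = weak_deriv \<Omega> b v x) \<and>
     (\<forall>x\<in>frontier \<Omega>. G x \<bullet> outward_normal \<Omega> x = 0))"

definition X0 :: "real \<Rightarrow> nat \<Rightarrow> 'a::euclidean_space set \<Rightarrow> 'a vfield set" where
  "X0 p m \<Omega> = {v. \<forall>i\<in>{1..m}. in_Lp p \<Omega> (\<lambda>x. v x i)}"

definition X0_norm :: "real \<Rightarrow> nat \<Rightarrow> 'a::euclidean_space set \<Rightarrow> 'a vfield \<Rightarrow> real" where
  "X0_norm p m \<Omega> v = (\<Sum>i=1..m. Lp_norm p \<Omega> (\<lambda>x. v x i))"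

definition X1 :: "real \<Rightarrow> nat \<Rightarrow> 'a::euclidean_space set \<Rightarrow> 'a vfield set" where
  "X1 p m \<Omega> = {v. \<forall>i\<in>{1..m}. in_W2p p \<Omega> (\<lambda>x. v x i) \<and> zero_normal_deriv \<Omega> (\<lambda>x. v x i)}"

definition X1_norm :: "real \<Rightarrow> nat \<Rightarrow> 'a::euclidean_space set \<Rightarrow> 'a vfield \<Rightarrow> real" where
  "X1_norm p m \<Omega> v = (\<Sum>i=1..m. W2p_norm p \<Omega> (\<lambda>x. v x i))"

text \<open>
  The real interpolation space \<open>(X\<^sub>0, X\<^sub>1)\<^sub>\<theta>\<^sub>,\<^sub>p\<close>, \<open>\<theta> = 1 - 1/p\<close>, by the K-method.  Since \<open>X\<^sub>1 \<subseteq> X\<^sub>0\<close>, a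
  decomposition of \<open>v\<close> is given by its \<open>X\<^sub>1\<close>-part \<open>u\<close>.
\<close>

definition K_functional ::
  "real \<Rightarrow> nat \<Rightarrow> 'a::euclidean_space set \<Rightarrow> real \<Rightarrow> 'a vfield \<Rightarrow> real" where
  "K_functional p m \<Omega> t v =
     (INF u\<in>X1 p m \<Omega>. X0_norm p m \<Omega> (\<lambda>x i. v x i - u x i) + t * X1_norm p m \<Omega> u)"

definition K_integral :: "real \<Rightarrow> nat \<Rightarrow> 'a::euclidean_space set \<Rightarrow> 'a vfield \<Rightarrow> ennreal" where
  "K_integral p m \<Omega> v =
     (\<integral>\<^sup>+t\<in>{0<..}. ennreal ((t powr - (1 - 1 / p) * K_functional p m \<Omega> t v) powr p / t) \<partial>lborel)"

definition Xgamma :: "real \<Rightarrow> nat \<Rightarrow> 'a::euclidean_space set \<Rightarrow> 'a vfield set" where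
  "Xgamma p m \<Omega> = {v \<in> X0 p m \<Omega>. K_integral p m \<Omega> v < \<infinity>}"

definition Xgamma_norm :: "real \<Rightarrow> nat \<Rightarrow> 'a::euclidean_space set \<Rightarrow> 'a vfield \<Rightarrow> real" where
  "Xgamma_norm p m \<Omega> v = enn2real (K_integral p m \<Omega> v) powr (1 / p)"


section \<open>Functions of time with values in a normed space of fields\<close>

text \<open>\<open>L\<^sup>p(0,T;X)\<close>, strong measurability being approximability by \<open>X\<close>-valued simple functions.\<close>

definition in_Lp_time ::
  "real \<Rightarrow> 'a vfield set \<Rightarrow> ('a vfield \<Rightarrow> real) \<Rightarrow> real \<Rightarrow> (real \<Rightarrow> 'a vfield) \<Rightarrow> bool" where
  "in_Lp_time p X nrm T f \<longleftrightarrow>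
     (AE t in lebesgue_on {0..T}. f t \<in> X) \<and>
     (\<exists>s. (\<forall>n. simple_function (lebesgue_on {0..T}) (s n) \<and> (\<forall>t\<in>{0..T}. s n t \<in> X)) \<and>
       (AE t in lebesgue_on {0..T}. (\<lambda>n. nrm (\<lambda>x i. s n t x i - f t x i)) \<longlonglongrightarrow> 0)) \<and>
     integrable (lebesgue_on {0..T}) (\<lambda>t. nrm (f t) powr p)"

definition simple_field_integral :: "real \<Rightarrow> (real \<Rightarrow> 'a vfield) \<Rightarrow> 'a vfield" where
  "simple_field_integral T s =
     (\<lambda>x i. \<Sum>v\<in>s ` {0..T}. measure lebesgue {t \<in> {0..T}. s t = v} * v x i)"

text \<open>\<open>v\<close> is the Bochner integral of \<open>f\<close> over \<open>(0,T)\<close> in the space \<open>X\<close>.\<close>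

definition has_field_integral ::
  "'a vfield set \<Rightarrow> ('a vfield \<Rightarrow> real) \<Rightarrow> real \<Rightarrow> (real \<Rightarrow> 'a vfield) \<Rightarrow> 'a vfield \<Rightarrow> bool" where
  "has_field_integral X nrm T f v \<longleftrightarrow> v \<in> X \<and>
     (\<exists>s. (\<forall>n. simple_function (lebesgue_on {0..T}) (s n) \<and> (\<forall>t\<in>{0..T}. s n t \<in> X)) \<and>
       (\<lambda>n. \<integral>\<^sup>+t. ennreal (nrm (\<lambda>x i. s n t x i - f t x i)) \<partial>lebesgue_on {0..T}) \<longlonglongrightarrow> 0 \<and>
       (\<lambda>n. nrm (\<lambda>x i. simple_field_integral T (s n) x i - v x i)) \<longlonglongrightarrow> 0)"

text \<open>\<open>f \<in> W\<^sup>1\<^sup>,\<^sup>p(0,T;X)\<close> with weak time derivative \<open>f'\<close>.\<close>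

definition in_W1p_time ::
  "real \<Rightarrow> 'a vfield set \<Rightarrow> ('a vfield \<Rightarrow> real) \<Rightarrow> real \<Rightarrow>
     (real \<Rightarrow> 'a vfield) \<Rightarrow> (real \<Rightarrow> 'a vfield) \<Rightarrow> bool" where
  "in_W1p_time p X nrm T f f' \<longleftrightarrow> in_Lp_time p X nrm T f \<and> in_Lp_time p X nrm T f' \<and>
     (\<forall>\<eta>. test_function {0<..<T} \<eta> \<longrightarrow> (\<exists>I.
        has_field_integral X nrm T (\<lambda>t x i. deriv \<eta> t * f t x i) I \<and>
        has_field_integral X nrm T (\<lambda>t x i. \<eta> t * f' t x i) (\<lambda>x i. - I x i)))"

definition continuous_in_time ::
  "'a vfield set \<Rightarrow> ('a vfield \<Rightarrow> real) \<Rightarrow> (real \<Rightarrow> 'a vfield) \<Rightarrow> bool" where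
  "continuous_in_time X nrm f \<longleftrightarrow> (\<forall>t\<ge>0. f t \<in> X \<and>
     ((\<lambda>s. nrm (\<lambda>x i. f s x i - f t x i)) \<longlongrightarrow> 0) (at t within {0..}))"

text \<open>\<open>u \<in> C([0,\<infinity>); C\<^sup>1(\<Omega>'))\<close>, \<open>\<Omega>'\<close> the closure of \<open>\<Omega>\<close>; \<open>G\<close> is the gradient extended to \<open>\<Omega>'\<close>.\<close>

definition continuous_C1 :: "'a::euclidean_space set \<Rightarrow> (real \<Rightarrow> 'a \<Rightarrow> real) \<Rightarrow> bool" where
  "continuous_C1 \<Omega> u \<longleftrightarrow> (\<exists>G. \<forall>t\<ge>0.
     continuous_on (closure \<Omega>) (u t) \<and> continuous_on (closure \<Omega>) (G t) \<and>
     (\<forall>x\<in>\<Omega>. (u t has_derivative (\<lambda>h. G t x \<bullet> h)) (at x)) \<and>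
     uniform_limit (closure \<Omega>) u (u t) (at t within {0..}) \<and>
     uniform_limit (closure \<Omega>) G (G t) (at t within {0..}))"

definition parabolic_holder_on ::
  "real \<Rightarrow> real \<Rightarrow> real set \<Rightarrow> 'a::euclidean_space set \<Rightarrow> (real \<Rightarrow> 'a \<Rightarrow> 'b::real_normed_vector) \<Rightarrow> bool"
  where
  "parabolic_holder_on a b I S f \<longleftrightarrow> (\<exists>C. \<forall>t\<in>I. \<forall>s\<in>I. \<forall>x\<in>S. \<forall>y\<in>S.
     norm (f t x - f s y) \<le> C * (\<bar>t - s\<bar> powr a + norm (x - y) powr b))"

text \<open>
  \<open>u \<in> C\<^sup>1\<^sup>+\<^sup>\<sigma>\<^sup>/\<^sup>2\<^sup>,\<^sup>2\<^sup>+\<^sup>\<sigma>([\<tau>,T] \<times> \<Omega>')\<close> for \<open>0 < \<sigma> < 1\<close>, in the sense of Ladyzhenskaya, Solonnikov and Uraltseva;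
  the derivatives are those on \<open>\<Omega>\<close>, extended to the closure.
\<close>

definition parabolic_C12 ::
  "real \<Rightarrow> real \<Rightarrow> real \<Rightarrow> 'a::euclidean_space set \<Rightarrow> (real \<Rightarrow> 'a \<Rightarrow> real) \<Rightarrow> bool" where
  "parabolic_C12 \<sigma> \<tau> T \<Omega> u \<longleftrightarrow> (\<exists>ut Du D2u.
     (\<forall>t\<in>{\<tau>..T}. \<forall>x\<in>\<Omega>.
        ((\<lambda>s. u s x) has_real_derivative ut t x) (at t within {\<tau>..T}) \<and>
        (u t has_derivative (\<lambda>h. Du t x \<bullet> h)) (at x) \<and>
        (Du t has_derivative D2u t x) (at x)) \<and>
     continuous_on ({\<tau>..T} \<times> closure \<Omega>) (\<lambda>(t, x). u t x) \<and>
     parabolic_holder_on (\<sigma> / 2) \<sigma> {\<tau>..T} (closure \<Omega>) ut \<and>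
     parabolic_holder_on ((1 + \<sigma>) / 2) \<sigma> {\<tau>..T} (closure \<Omega>) Du \<and>
     (\<forall>b\<in>Basis. parabolic_holder_on (\<sigma> / 2) \<sigma> {\<tau>..T} (closure \<Omega>) (\<lambda>t x. D2u t x b)))"


section \<open>Root, moment and entropy coordinates\<close>

definition open_simplex :: "nat \<Rightarrow> (nat \<Rightarrow> real) set" where
  "open_simplex N = {y. (\<forall>i\<in>{1..N}. 0 < y i) \<and> (\<Sum>i=1..N. y i) = 1}"

definition root_coord :: "(nat \<Rightarrow> real) \<Rightarrow> nat \<Rightarrow> (nat \<Rightarrow> real) \<Rightarrow> nat \<Rightarrow> real" where
  "root_coord g N y j =
     (THE \<zeta>. g j < \<zeta> \<and> \<zeta> < g (Suc j) \<and> (\<Sum>i=1..N. y i / (g i - \<zeta>)) = 0)"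

definition moment :: "(nat \<Rightarrow> real) \<Rightarrow> nat \<Rightarrow> (nat \<Rightarrow> real) \<Rightarrow> nat \<Rightarrow> real" where
  "moment g N y l = (\<Sum>i=1..N. g i ^ l * y i)"

text \<open>
  The inverse \<open>y(U)\<close> of the moment map; its values at \<open>1..N\<close> do not depend on the choice, since
  the moment map is injective on the simplex.
\<close>

definition conc_of_moment :: "(nat \<Rightarrow> real) \<Rightarrow> nat \<Rightarrow> (nat \<Rightarrow> real) \<Rightarrow> nat \<Rightarrow> real" where
  "conc_of_moment g N U = (SOME y. y \<in> open_simplex N \<and> (\<forall>l\<in>{1..N-1}. moment g N y l = U l))"

definition entropy_density :: "(nat \<Rightarrow> real) \<Rightarrow> nat \<Rightarrow> (nat \<Rightarrow> real) \<Rightarrow> real" where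
  "entropy_density g N U =
     (\<Sum>i=1..N. conc_of_moment g N U i * ln (conc_of_moment g N U i))"

text \<open>\<open>w = Dh(U)\<close> at \<open>U = U(y)\<close>, componentwise.\<close>

definition entropy_var :: "(nat \<Rightarrow> real) \<Rightarrow> nat \<Rightarrow> (nat \<Rightarrow> real) \<Rightarrow> nat \<Rightarrow> real" where
  "entropy_var g N y l =
     deriv (\<lambda>s. entropy_density g N ((moment g N y)(l := s))) (moment g N y l)"

text \<open>The inverse map \<open>y(w)\<close>, in the closed form known for it, and its directional derivatives.\<close>

definition conc_of_entropy :: "(nat \<Rightarrow> real) \<Rightarrow> nat \<Rightarrow> (nat \<Rightarrow> real) \<Rightarrow> nat \<Rightarrow> real" where
  "conc_of_entropy g N w i =
     exp (\<Sum>l=1..N-1. g i ^ l * w l) / (\<Sum>r=1..N. exp (\<Sum>l=1..N-1. g r ^ l * w l))"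

definition conc_deriv ::
  "(nat \<Rightarrow> real) \<Rightarrow> nat \<Rightarrow> (nat \<Rightarrow> real) \<Rightarrow> (nat \<Rightarrow> real) \<Rightarrow> nat \<Rightarrow> real" where
  "conc_deriv g N w v i = deriv (\<lambda>s. conc_of_entropy g N (\<lambda>l. w l + s * v l) i) 0"


section \<open>The additive Maxwell--Stefan system\<close>

definition MS_matrix :: "(nat \<Rightarrow> nat \<Rightarrow> real) \<Rightarrow> nat \<Rightarrow> (nat \<Rightarrow> real) \<Rightarrow> nat \<Rightarrow> nat \<Rightarrow> real" where
  "MS_matrix f N y i j =
     (if i = j then - (\<Sum>l\<in>{1..N} - {i}. f i l * y l) else y i * f i j)"

definition additive_coeff :: "(nat \<Rightarrow> real) \<Rightarrow> nat \<Rightarrow> nat \<Rightarrow> real" where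
  "additive_coeff g i j = g i + g j"

text \<open>
  The system at a fixed time, written in the entropy variables: \<open>w\<close> is the state and \<open>w'\<close> its time
  derivative, and \<open>\<partial>\<^sub>ty\<close>, \<open>\<nabla>y\<close> are expressed through \<open>w'\<close>, \<open>\<nabla>w\<close> by the chain rule for \<open>y = y(w)\<close>.
  The flux \<open>J\<close> is uniquely determined by \<open>\<nabla>y = B(y) J\<close> and \<open>\<Sum>\<^sub>iJ\<^sub>i = 0\<close>.
\<close>

definition MS_equation ::
  "(nat \<Rightarrow> real) \<Rightarrow> nat \<Rightarrow> 'a::euclidean_space set \<Rightarrow> 'a vfield \<Rightarrow> 'a vfield \<Rightarrow> bool" where
  "MS_equation g N \<Omega> w w' \<longleftrightarrow> (\<exists>J :: nat \<Rightarrow> 'a \<Rightarrow> 'a.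
     (\<forall>i\<in>{1..N}. continuous_on (closure \<Omega>) (J i)) \<and>
     (AE x in lebesgue_on \<Omega>.
        (\<forall>i\<in>{1..N}. \<forall>k\<in>Basis.
           conc_deriv g N (w x) (\<lambda>l. weak_deriv \<Omega> k (\<lambda>x. w x l) x) i =
             (\<Sum>j=1..N. MS_matrix (additive_coeff g) N (conc_of_entropy g N (w x)) i j * (J j x \<bullet> k))) \<and>
        (\<Sum>i=1..N. J i x) = 0) \<and>
     (\<forall>i\<in>{1..N}. has_weak_div \<Omega> (J i) (\<lambda>x. - conc_deriv g N (w x) (w' x) i)) \<and>
     (\<forall>i\<in>{1..N}. \<forall>x\<in>frontier \<Omega>. J i x \<bullet> outward_normal \<Omega> x = 0))"

text \<open>\<open>y\<close> is the concentration variable of a global maximal-\<open>L\<^sup>p\<close> strong solution.\<close>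

definition maximal_Lp_solution ::
  "real \<Rightarrow> (nat \<Rightarrow> real) \<Rightarrow> nat \<Rightarrow> 'a::euclidean_space set \<Rightarrow> (real \<Rightarrow> 'a vfield) \<Rightarrow> bool" where
  "maximal_Lp_solution p g N \<Omega> y \<longleftrightarrow>
     (\<forall>t\<ge>0. \<forall>x\<in>closure \<Omega>. y t x \<in> open_simplex N) \<and>
     (let m = N - 1; w = (\<lambda>t x. entropy_var g N (y t x)) in
       (\<forall>T>0. in_Lp_time p (X1 p m \<Omega>) (X1_norm p m \<Omega>) T w) \<and>
       continuous_in_time (Xgamma p m \<Omega>) (Xgamma_norm p m \<Omega>) w \<and>
       (\<exists>w'. (\<forall>T>0. in_W1p_time p (X0 p m \<Omega>) (X0_norm p m \<Omega>) T w w') \<and>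
             (AE t in lebesgue_on {0..}. MS_equation g N \<Omega> (w t) (w' t))))"

definition classical_on_strips ::
  "(nat \<Rightarrow> real) \<Rightarrow> nat \<Rightarrow> 'a::euclidean_space set \<Rightarrow> (real \<Rightarrow> 'a vfield) \<Rightarrow> bool" where
  "classical_on_strips g N \<Omega> y \<longleftrightarrow>
     (\<forall>\<tau> T. 0 < \<tau> \<and> \<tau> < T \<longrightarrow> (\<exists>\<sigma>. 0 < \<sigma> \<and> \<sigma> < 1 \<and>
        (\<forall>l\<in>{1..N-1}. parabolic_C12 \<sigma> \<tau> T \<Omega> (\<lambda>t x. entropy_var g N (y t x) l))))"

text \<open>
  A solution together with the two regularity properties that accompany the strong class for
  \<open>p > d + 2\<close>.  The first one also selects the representative of \<open>y\<close> that is continuous up to the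
  boundary, whose pointwise values are used for the root box.
\<close>

definition global_solution ::
  "real \<Rightarrow> (nat \<Rightarrow> real) \<Rightarrow> nat \<Rightarrow> 'a::euclidean_space set \<Rightarrow> (real \<Rightarrow> 'a vfield) \<Rightarrow> bool" where
  "global_solution p g N \<Omega> y \<longleftrightarrow> maximal_Lp_solution p g N \<Omega> y \<and>
     (\<forall>i\<in>{1..N}. continuous_C1 \<Omega> (\<lambda>t x. y t x i)) \<and> classical_on_strips g N \<Omega> y"


section \<open>Entropy and convergence to equilibrium\<close>

definition mean :: "'a::euclidean_space set \<Rightarrow> ('a \<Rightarrow> real) \<Rightarrow> real" where
  "mean \<Omega> u = (LINT x|lebesgue_on \<Omega>. u x) / measure lebesgue \<Omega>"

definition rel_entropy :: "nat \<Rightarrow> 'a::euclidean_space set \<Rightarrow> 'a vfield \<Rightarrow> (nat \<Rightarrow> real) \<Rightarrow> real" where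
  "rel_entropy N \<Omega> y yb = (LINT x|lebesgue_on \<Omega>. (\<Sum>i=1..N. y x i * ln (y x i / yb i)))"

definition L2_dist :: "nat \<Rightarrow> 'a::euclidean_space set \<Rightarrow> 'a vfield \<Rightarrow> (nat \<Rightarrow> real) \<Rightarrow> real" where
  "L2_dist n \<Omega> u c = sqrt (LINT x|lebesgue_on \<Omega>. (\<Sum>i=1..n. (u x i - c i)\<^sup>2))"

text \<open>
  The entropy integral has a value in \<open>(-\<infinity>,\<infinity>]\<close>; the inequality entails its finiteness, which is
  stated separately because a divergent \<open>LINT\<close> is \<open>0\<close>.
\<close>

definition log_sobolev_constant :: "'a::euclidean_space set \<Rightarrow> real \<Rightarrow> bool" where
  "log_sobolev_constant \<Omega> C \<longleftrightarrow> (\<forall>\<rho>.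
     (\<forall>x\<in>\<Omega>. 0 \<le> \<rho> x) \<and> in_W1p 2 \<Omega> (\<lambda>x. sqrt (\<rho> x)) \<and> 0 < mean \<Omega> \<rho> \<longrightarrow>
       integrable (lebesgue_on \<Omega>) (\<lambda>x. \<rho> x * ln (\<rho> x / mean \<Omega> \<rho>)) \<and>
       (LINT x|lebesgue_on \<Omega>. \<rho> x * ln (\<rho> x / mean \<Omega> \<rho>)) \<le>
         C * (LINT x|lebesgue_on \<Omega>. (\<Sum>b\<in>Basis. (weak_deriv \<Omega> b (\<lambda>x. sqrt (\<rho> x)) x)\<^sup>2)))"

definition f_max :: "(nat \<Rightarrow> real) \<Rightarrow> nat \<Rightarrow> real" where
  "f_max g N = Max {additive_coeff g i j |i j. i \<in> {1..N} \<and> j \<in> {1..N} \<and> i \<noteq> j}"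

definition kappa_LS :: "(nat \<Rightarrow> real) \<Rightarrow> nat \<Rightarrow> real \<Rightarrow> real" where
  "kappa_LS g N C = 4 / (f_max g N * C)"

text \<open>
  As subset of \<open>\<real>\<^sup>N\<^sup>-\<^sup>1\<close>.  Minimum and maximum are written as infimum and supremum; they are attained,
  the roots being continuous functions on the compact closure of \<open>\<Omega>\<close>.
\<close>

definition root_box ::
  "(nat \<Rightarrow> real) \<Rightarrow> nat \<Rightarrow> 'a::euclidean_space set \<Rightarrow> 'a vfield \<Rightarrow> (nat \<Rightarrow> real) set" where
  "root_box g N \<Omega> y0 = (\<Pi>\<^sub>E j\<in>{1..N-1}.
     {(INF x\<in>closure \<Omega>. root_coord g N (y0 x) j)..(SUP x\<in>closure \<Omega>. root_coord g N (y0 x) j)})"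

end

theory Submission
  imports Defs
begin

text \<open>
  At a root \<open>z\<^sub>j\<close> the equations for the \<open>y\<^sub>i\<close> combine into a scalar parabolic equation for \<open>z\<^sub>j\<close> whose only
  lower-order term is a drift along \<open>\<nabla>z\<^sub>j\<close>, so that the maximum principle confines \<open>z\<^sub>j\<close> to its initial
  range.  By the product formula for \<open>y\<close> in terms of \<open>z\<close> this keeps \<open>y\<close> away from the boundary of the
  simplex, where all coordinates are Lipschitz functions of \<open>y\<close>.  The entropy production dominates
  \<open>(4 / f\<^sub>m\<^sub>a\<^sub>x) \<Sum>\<^sub>i \<integral>|\<nabla>\<surd>y\<^sub>i|\<^sup>2\<close> without any lower bound on \<open>y\<close>; since the means are conserved, the logarithmic
  Sobolev inequality for each \<open>y\<^sub>i\<close> and Gronwall's lemma give the rate.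

  For \<open>t > 0\<close> the weak time derivative of the strong solution is the classical one, which turns the weak
  equation into a Neumann form that can be tested with \<open>C\<^sup>1\<close> functions on the closure.
\<close>

text \<open>Additivity turns the flux relation, for fluxes of zero sum, into P_i = y_i T - (g_i + s)
  J_i, where P_i is the gradient of y_i, s the average of g with weights y and T the sum of the g_j
  J_j: a diagonal matrix plus a rank-one term. Dividing by g_i - \<zeta> and summing multiplies T by
  the sum of the y_i / (g_i - \<zeta>), which vanishes exactly at a root; only the gradient of the
  root survives.

  The obstacle is the initial time. Time derivatives and second derivatives exist only for t > 0 and
  are not controlled as t tends to 0, so differential inequalities are integrated over strips
  starting at a positive time, which is then sent to 0 by the continuity of y. The Gronwall constant
  for the roots depends on the strip; this is harmless, because the energy starts from zero once the
  threshold has been relaxed by \<epsilon>. The entropy rate is the same on all strips.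

  Tangential fluxes allow integration by parts without a surface integral: a cutoff near the
  boundary costs its slope n times a strip of measure O(1/n) times a normal component that tends to
  0.\<close>

section \<open>Smooth functions and compactly supported bumps\<close>

lemma C_k_Suc_imp: "C_k (Suc k) f \<Longrightarrow> C_k k f"
proof (induction k arbitrary: f)
  case 0
  then show ?case
    by (auto intro!: continuous_at_imp_continuous_on dest: has_derivative_continuous)
next
  case (Suc k)
  from Suc.prems obtain Df where "\<forall>x. (f has_derivative (\<lambda>h. Df x \<bullet> h)) (at x)"
    "\<forall>b\<in>Basis. C_k (Suc k) (\<lambda>x. Df x \<bullet> b)"
    by (auto simp only: C_k.simps(2)[of "Suc k"])
  with Suc.IH show ?case by (auto simp only: C_k.simps(2))
qed

lemma C_k_const: "C_k k (\<lambda>x. c)"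
proof (induction k arbitrary: c)
  case (Suc k)
  then show ?case by (auto intro!: exI[of _ "\<lambda>x. 0"])
qed simp

lemma C_k_add: "C_k k f \<Longrightarrow> C_k k g \<Longrightarrow> C_k k (\<lambda>x. f x + g x)"
proof (induction k arbitrary: f g)
  case (Suc k)
  then obtain Df Dg where "\<And>x. (f has_derivative (\<lambda>h. Df x \<bullet> h)) (at x)" "\<forall>b\<in>Basis. C_k k (\<lambda>x. Df x \<bullet> b)"
     "\<And>x. (g has_derivative (\<lambda>h. Dg x \<bullet> h)) (at x)" "\<forall>b\<in>Basis. C_k k (\<lambda>x. Dg x \<bullet> b)"
    unfolding C_k.simps by blast
  with Suc.IH show ?case
    by (auto intro!: exI[of _ "\<lambda>x. Df x + Dg x"] derivative_eq_intros simp: inner_add_left)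
qed (auto intro: continuous_on_add)

lemma C_k_mult: "C_k k f \<Longrightarrow> C_k k g \<Longrightarrow> C_k k (\<lambda>x. f x * g x)"
proof (induction k arbitrary: f g)
  case (Suc k)
  then obtain Df Dg where *: "\<And>x. (f has_derivative (\<lambda>h. Df x \<bullet> h)) (at x)" "\<And>b. b\<in>Basis \<Longrightarrow> C_k k (\<lambda>x. Df x \<bullet> b)"
     "\<And>x. (g has_derivative (\<lambda>h. Dg x \<bullet> h)) (at x)" "\<And>b. b\<in>Basis \<Longrightarrow> C_k k (\<lambda>x. Dg x \<bullet> b)"
    unfolding C_k.simps by blast
  have kk: "C_k k f" "C_k k g" using Suc.prems C_k_Suc_imp by blast+
  have "C_k k (\<lambda>x. (f x *\<^sub>R Dg x + g x *\<^sub>R Df x) \<bullet> b)" if "b \<in> Basis" for b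
    unfolding inner_add_left inner_scaleR_left
    by (intro C_k_add Suc.IH kk * that)
  moreover have "((\<lambda>x. f x * g x) has_derivative (\<lambda>h. (f x *\<^sub>R Dg x + g x *\<^sub>R Df x) \<bullet> h)) (at x)" for x
    by (rule derivative_eq_intros *)+ (auto simp: inner_add_left algebra_simps)
  ultimately show ?case by (auto intro!: exI[of _ "\<lambda>x. f x *\<^sub>R Dg x + g x *\<^sub>R Df x"])
qed (auto intro: continuous_on_mult)

lemma C_k_prod:
  assumes "finite I" "\<And>i. i \<in> I \<Longrightarrow> C_k k (f i)"
  shows "C_k k (\<lambda>x. \<Prod>i\<in>I. f i x)"
  using assms by (induction I rule: finite_induct) (auto intro: C_k_const C_k_mult)

text \<open>All derivatives of \<open>smooth_cut 0\<close> are linear combinations of the functions \<open>smooth_cut n\<close>.\<close>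

definition smooth_cut :: "nat \<Rightarrow> real \<Rightarrow> real" where
  "smooth_cut n s = (if s \<le> 0 then 0 else inverse s ^ n * exp (- inverse s))"

text \<open>From the right the exponential beats every power of \<open>inverse s\<close>; on the
  left the function is zero. All smoothness at the origin rests on this limit.\<close>

lemma smooth_cut_tendsto_0: "(smooth_cut n \<longlongrightarrow> 0) (at 0)"
proof -
  have "((\<lambda>x::real. x ^ n / exp x) \<longlongrightarrow> 0) at_top"
    by (rule tendsto_power_div_exp_0)
  then have "((\<lambda>s::real. inverse s ^ n / exp (inverse s)) \<longlongrightarrow> 0) (at_right 0)"
    using filterlim_compose filterlim_inverse_at_top_right by blast
  then have "(smooth_cut n \<longlongrightarrow> 0) (at_right 0)"
    by (rule Lim_transform_eventually)
       (auto simp: smooth_cut_def exp_minus divide_inverse intro!: eventually_at_right_less[THEN eventually_mono])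
  moreover have "(smooth_cut n \<longlongrightarrow> 0) (at_left 0)"
    by (rule Lim_transform_eventually[OF tendsto_const])
       (auto simp: smooth_cut_def eventually_at_filter)
  ultimately show ?thesis by (simp add: filterlim_split_at)
qed

lemma smooth_cut_deriv:
  "(smooth_cut n has_real_derivative (smooth_cut (n+2) s - n * smooth_cut (n+1) s)) (at s)"
proof -
  consider "s < 0" | "s > 0" | "s = 0" by linarith
  then show ?thesis
  proof cases
    case 1
    have "((\<lambda>s::real. 0) has_real_derivative 0) (at s)" by simp
    then have "(smooth_cut n has_real_derivative 0) (at s)"
      by (rule has_field_derivative_transform_within_open[where S="{..<0}"]) (use 1 in \<open>auto simp: smooth_cut_def\<close>)
    then show ?thesis using 1 by (simp add: smooth_cut_def)
  next
    case 2
    have "((\<lambda>s::real. inverse s ^ n * exp (- inverse s)) has_real_derivative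
        (inverse s ^ (n+2) * exp (- inverse s) - n * (inverse s ^ (n+1) * exp (- inverse s)))) (at s)"
      using 2 by (auto intro!: derivative_eq_intros simp: power2_eq_square algebra_simps)
         (cases n; auto simp: field_simps)
    then have "(smooth_cut n has_real_derivative
        (inverse s ^ (n+2) * exp (- inverse s) - n * (inverse s ^ (n+1) * exp (- inverse s)))) (at s)"
      by (rule has_field_derivative_transform_within_open[where S="{0<..}"]) (use 2 in \<open>auto simp: smooth_cut_def\<close>)
    then show ?thesis using 2 by (simp add: smooth_cut_def)
  next
    case 3
    \<comment> \<open>At the origin the difference quotient of \<open>smooth_cut n\<close> is
      \<open>smooth_cut (Suc n)\<close>, so differentiability there is once more the vanishing
      limit.\<close>
    have "((\<lambda>h. smooth_cut n h / h) \<longlongrightarrow> 0) (at 0)"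
      by (rule Lim_transform_eventually[OF smooth_cut_tendsto_0[of "Suc n"]])
         (auto simp: smooth_cut_def eventually_at_filter divide_inverse)
    then show ?thesis using 3 by (simp add: DERIV_def smooth_cut_def)
  qed
qed

text \<open>The family is closed under differentiation up to linear combinations, so the induction
  on k has to treat all n at once. The affine argument is the form in which the faces of a box
  occur.\<close>

lemma C_k_smooth_cut: "C_k k (\<lambda>x::'a::euclidean_space. smooth_cut n (c + x \<bullet> v))"
proof (induction k arbitrary: n)
  case 0
  have "continuous_on UNIV (smooth_cut n)"
    using smooth_cut_deriv DERIV_isCont continuous_at_imp_continuous_on by blast
  then show ?case
    by (auto intro!: continuous_intros continuous_on_compose2[where f="\<lambda>x. c + x \<bullet> v" and g="smooth_cut n"])
next
  case (Suc k)
  let ?D = "\<lambda>x::'a. (smooth_cut (n+2) (c + x \<bullet> v) + (-real n) * smooth_cut (n+1) (c + x \<bullet> v)) *\<^sub>R v"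
  have "((\<lambda>x::'a. smooth_cut n (c + x \<bullet> v)) has_derivative (\<lambda>h. ?D x \<bullet> h)) (at x)" for x
  proof -
    have "((\<lambda>x::'a. c + x \<bullet> v) has_derivative (\<lambda>h. h \<bullet> v)) (at x)"
      by (auto intro!: derivative_eq_intros)
    from has_derivative_compose[OF this smooth_cut_deriv[unfolded has_field_derivative_def]]
    show ?thesis by (simp add: inner_commute algebra_simps)
  qed
  moreover have "C_k k (\<lambda>x. ?D x \<bullet> b)" for b
    unfolding inner_scaleR_left by (intro C_k_mult C_k_add Suc.IH C_k_const)
  ultimately show ?case unfolding C_k.simps(2) by (intro exI[of _ ?D] conjI allI ballI)
qed

text \<open>One factor for each face of the box, applied to n times the signed distance from that
  face. As n grows the functions tend to the indicator of the open box, while all of them vanish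
  outside it. The arguments are spelled out as constant plus inner product to match
  \<open>C_k_smooth_cut\<close>.\<close>

definition box_bump :: "'a::euclidean_space \<Rightarrow> 'a \<Rightarrow> nat \<Rightarrow> 'a \<Rightarrow> real" where
  "box_bump a c n x = (\<Prod>b\<in>Basis. smooth_cut 0 (- real n * (a \<bullet> b) + x \<bullet> (real n *\<^sub>R b)) *
                                   smooth_cut 0 (real n * (c \<bullet> b) + x \<bullet> (- real n *\<^sub>R b)))"

lemma C_k_box_bump: "C_k k (box_bump a c n)"
  unfolding box_bump_def by (intro C_k_prod C_k_mult C_k_smooth_cut) auto

lemma smooth_cut_0_bounds: "0 \<le> smooth_cut 0 s" "smooth_cut 0 s \<le> 1"
  by (auto simp: smooth_cut_def)

lemma box_bump_outside: "x \<notin> box a c \<Longrightarrow> box_bump a c n x = 0"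
proof -
  assume "x \<notin> box a c"
  then obtain b where b: "b \<in> Basis" "\<not> (a \<bullet> b < x \<bullet> b \<and> x \<bullet> b < c \<bullet> b)" by (auto simp: mem_box)
  have "real n * (x \<bullet> b) \<le> real n * (a \<bullet> b) \<or> real n * (c \<bullet> b) \<le> real n * (x \<bullet> b)"
    using b by (auto simp: not_less intro!: mult_left_mono)
  then show ?thesis unfolding box_bump_def prod_zero_iff[OF finite_Basis]
    by (intro bexI[OF _ b(1)]) (auto simp: smooth_cut_def)
qed

lemma box_bump_bounds: "0 \<le> box_bump a c n x" "box_bump a c n x \<le> 1"
  unfolding box_bump_def
  by (auto intro!: prod_nonneg prod_le_1 mult_nonneg_nonneg smooth_cut_0_bounds mult_le_one)

lemma box_bump_tendsto: "(\<lambda>n. box_bump a c n x) \<longlonglongrightarrow> indicator (box a c) x"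
proof (cases "x \<in> box a c")
  case True
  have *: "(\<lambda>n. smooth_cut 0 (real n * d)) \<longlonglongrightarrow> 1" if "d > 0" for d :: real
  proof -
    have "(\<lambda>n. exp (- (inverse (real n) * inverse d))) \<longlonglongrightarrow> exp (- (0 * inverse d))"
      by (intro tendsto_intros lim_inverse_n)
    then have "(\<lambda>n. exp (- (inverse (real n) * inverse d))) \<longlonglongrightarrow> 1" by simp
    moreover have "\<forall>\<^sub>F n in sequentially. exp (- (inverse (real n) * inverse d)) = smooth_cut 0 (real n * d)"
      using eventually_gt_at_top[of 0]
    proof eventually_elim
      case (elim n)
      then have "0 < real n * d" using that by simp
      then show ?case by (simp add: smooth_cut_def)
    qed
    ultimately show ?thesis by (rule Lim_transform_eventually)
  qed
  have "(\<lambda>n. box_bump a c n x) \<longlonglongrightarrow> (\<Prod>b\<in>(Basis::'a set). 1 * 1)"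
    unfolding box_bump_def
  proof (intro tendsto_prod tendsto_mult)
    fix b :: 'a assume "b \<in> Basis"
    then have "x \<bullet> b - a \<bullet> b > 0" "c \<bullet> b - x \<bullet> b > 0" using True by (auto simp: mem_box)
    from this[THEN *]
    show "(\<lambda>n. smooth_cut 0 (- real n * (a \<bullet> b) + x \<bullet> (real n *\<^sub>R b))) \<longlonglongrightarrow> 1"
      "(\<lambda>n. smooth_cut 0 (real n * (c \<bullet> b) + x \<bullet> (- real n *\<^sub>R b))) \<longlonglongrightarrow> 1"
      by (simp_all add: algebra_simps)
  qed
  then show ?thesis using True by simp
qed (simp add: box_bump_outside)

lemma test_function_box_bump: "cbox a c \<subseteq> \<Omega> \<Longrightarrow> test_function \<Omega> (box_bump a c n)"
  unfolding test_function_def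
proof (intro conjI allI exI[of _ "cbox a c"] impI)
  show "box_bump a c n x = 0" if "x \<notin> cbox a c" for x
    using that box_subset_cbox[of a c] by (intro box_bump_outside) auto
qed (simp_all add: C_k_box_bump)

section \<open>Functions with vanishing integrals vanish almost everywhere\<close>

text \<open>Countably many closed boxes fill an open set and their boundaries are null sets, so an
  almost-everywhere property may be checked on one open box at a time.\<close>

lemma AE_open_boxI:
  fixes \<Omega> :: "'a::euclidean_space set"
  assumes "open \<Omega>" and ae: "\<And>a c. cbox a c \<subseteq> \<Omega> \<Longrightarrow> AE x in lebesgue. x \<in> box a c \<longrightarrow> P x"
  shows "AE x in lebesgue. x \<in> \<Omega> \<longrightarrow> P x"
proof -
  obtain D where D: "countable D" "D \<subseteq> Pow \<Omega>" "\<And>X. X \<in> D \<Longrightarrow> \<exists>a b. X = cbox a b" "\<Union>D = \<Omega>"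
    using open_countable_Union_open_cbox[OF \<open>open \<Omega>\<close>] by metis
  have "AE x in lebesgue. \<forall>X\<in>D. x \<in> X \<longrightarrow> P x"
  proof (rule AE_ball_countable'[OF _ D(1)])
    fix X assume X: "X \<in> D"
    then obtain a b where ab: "X = cbox a b" using D(3) by blast
    have "cbox a b - box a b \<in> null_sets lebesgue"
      using negligible_iff_null_sets negligible_frontier_interval by blast
    from AE_not_in[OF this] have "AE x in lebesgue. x \<notin> cbox a b - box a b" .
    moreover have "AE x in lebesgue. x \<in> box a b \<longrightarrow> P x" using ae[of a b] X D(2) ab by blast
    ultimately show "AE x in lebesgue. x \<in> X \<longrightarrow> P x"
      unfolding ab by eventually_elim blast
  qed
  then show ?thesis by eventually_elim (use D(4) in blast)
qed

text \<open>Open boxes are an intersection-stable generator of the Borel sets, so the integral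
  vanishes over every Borel set by the Dynkin argument. The whole space is not a box; the assumption
  \<open>full\<close> supplies its integral for the complements.\<close>

lemma AE_0_if_box_integrals_0:
  fixes u :: "'a::euclidean_space \<Rightarrow> real"
  assumes int: "integrable lebesgue u" and box0: "\<And>a c. (LINT x|lebesgue. indicator (box a c) x * u x) = 0"
    and full: "(LINT x|lebesgue. u x) = 0"
  shows "AE x in lebesgue. u x = 0"
proof -
  have ii: "integrable lebesgue (\<lambda>x. indicator A x * u x)" if "A \<in> sets lebesgue" for A
    using integrable_mult_indicator[OF that int] by simp
  have borel: "(LINT x|lebesgue. indicator A x * u x) = 0" if "A \<in> sets borel" for A
  proof -
    let ?G = "range (\<lambda>(a, b). box a b :: 'a set)"
    have G: "Int_stable ?G" "?G \<subseteq> Pow UNIV" by (auto simp: Int_stable_def box_Int_box)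
    have "A \<in> sigma_sets UNIV ?G" using that unfolding borel_eq_box by simp
    then show ?thesis
    proof (induct A rule: sigma_sets_induct_disjoint[OF G, consumes 1, case_names basic empty compl union])
      case (basic A)
      then show ?case using box0 by auto
    next
      case empty
      show ?case by simp
    next
      case (compl A)
      then have "A \<in> sets borel" unfolding borel_eq_box by simp
      then have A: "A \<in> sets lebesgue" by simp
      have "(LINT x|lebesgue. indicator (UNIV - A) x * u x) = (LINT x|lebesgue. u x - indicator A x * u x)"
        by (rule Bochner_Integration.integral_cong) (auto simp: indicator_def)
      also have "\<dots> = 0" using compl full ii[OF A] int by simp
      finally show ?case .
    next
      case (union A)
      have A: "A i \<in> sets lebesgue" for i
      proof -
        have "A i \<in> sets borel" using union(2) unfolding borel_eq_box by auto
        then show ?thesis by simp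
      qed
      have "(LINT x:(\<Union>i. A i)|lebesgue. u x) = (\<Sum>i. LINT x:(A i)|lebesgue. u x)"
      proof (rule lebesgue_integral_countable_add)
        show "A i \<inter> A j = {}" if "i \<noteq> j" for i j
          using union(1) that by (simp add: disjoint_family_on_def)
        show "set_integrable lebesgue (\<Union>i. A i) u"
          unfolding set_integrable_def by (rule integrable_mult_indicator[OF _ int]) (use A in blast)
      qed (rule A)
      then show ?case using union(3) by (simp add: set_lebesgue_integral_def)
    qed
  qed
  show ?thesis
  proof (rule density_unique_real)
    show "integrable lebesgue u" by fact
    show "integrable lebesgue (\<lambda>x::'a. 0::real)" by simp
    fix A :: "'a set" assume A: "A \<in> sets lebesgue"
    then obtain B N N' where BN: "A = B \<union> N" "N \<subseteq> N'" "N' \<in> null_sets lborel" "B \<in> sets lborel"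
      by (rule sets_completionE)
    then have B: "B \<in> sets borel" by simp
    have "AE x in lebesgue. x \<notin> N'" using AE_completion[OF AE_not_in[OF BN(3)]] .
    then have "AE x in lebesgue. indicator A x * u x = indicator B x * u x"
      by eventually_elim (use BN(1,2) in \<open>auto simp: indicator_def\<close>)
    then have "(LINT x|lebesgue. indicator A x * u x) = (LINT x|lebesgue. indicator B x * u x)"
      by (rule integral_cong_AE[rotated 2])
         (use ii[OF A] ii[of B] B in \<open>auto intro: borel_measurable_integrable\<close>)
    then show "(LINT x:A|lebesgue. u x) = (LINT x:A|lebesgue. 0)"
      using borel[OF B] by (simp add: set_lebesgue_integral_def)
  qed
qed

lemma integrable_lebesgue_onI:
  fixes f :: "'a::euclidean_space \<Rightarrow> 'b::{banach, second_countable_topology}"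
  assumes "S \<in> sets lebesgue"
  shows "integrable (lebesgue_on S) f \<longleftrightarrow> integrable lebesgue (\<lambda>x. indicator S x *\<^sub>R f x)"
    and "integral\<^sup>L (lebesgue_on S) f = integral\<^sup>L lebesgue (\<lambda>x. indicator S x *\<^sub>R f x)"
  using assms by (simp_all add: integrable_restrict_space integral_restrict_space)

lemma integrable_indicator_subset:
  fixes u :: "'a::euclidean_space \<Rightarrow> real"
  assumes "integrable (lebesgue_on K) u" "K \<in> sets lebesgue" "A \<in> sets lebesgue" "A \<subseteq> K"
  shows "integrable lebesgue (\<lambda>x. indicator A x * u x)"
proof -
  have "integrable lebesgue (\<lambda>x. indicator A x *\<^sub>R (indicator K x *\<^sub>R u x))"
    using assms(3) assms(1)[unfolded integrable_lebesgue_onI(1)[OF assms(2)]]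
    by (rule integrable_mult_indicator)
  also have "(\<lambda>x. indicator A x *\<^sub>R (indicator K x *\<^sub>R u x)) = (\<lambda>x. indicator A x * u x)"
    using assms(4) by (intro ext) (auto simp: indicator_def)
  finally show ?thesis .
qed

text \<open>After multiplication by the indicator of a box whose closure lies in
  \<open>\<Omega>\<close> the function is integrable on the whole space, and its box integrals are
  integrals of u over intersections of two boxes, which are boxes again.\<close>

lemma AE_0_if_local_box_integrals_0:
  fixes u :: "'a::euclidean_space \<Rightarrow> real"
  assumes o: "open \<Omega>" and int: "locally_integrable \<Omega> u"
    and box: "\<And>a c. cbox a c \<subseteq> \<Omega> \<Longrightarrow> (LINT x|lebesgue. indicator (box a c) x * u x) = 0"
  shows "AE x in lebesgue_on \<Omega>. u x = 0"
proof -
  have S: "\<Omega> \<in> sets lebesgue" using o by simp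
  have "AE x in lebesgue. x \<in> \<Omega> \<longrightarrow> u x = 0"
  proof (rule AE_open_boxI[OF o])
    fix a c assume ac: "cbox a c \<subseteq> \<Omega>"
    have iu: "integrable lebesgue (\<lambda>x. indicator (box a c) x * u x)"
      using int ac unfolding locally_integrable_def
      by (intro integrable_indicator_subset[of "cbox a c"]) (auto simp: box_subset_cbox)
    have "AE x in lebesgue. indicator (box a c) x * u x = 0"
    proof (rule AE_0_if_box_integrals_0[OF iu])
      fix a' c' :: 'a
      \<comment> \<open>Corners of the intersection of the two boxes, coordinate by coordinate;
        disjoint boxes give an empty box, for which the argument is still valid.\<close>
      define A C where "A = (\<Sum>b\<in>Basis. max (a \<bullet> b) (a' \<bullet> b) *\<^sub>R b)" and "C = (\<Sum>b\<in>Basis. min (c \<bullet> b) (c' \<bullet> b) *\<^sub>R b)"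
      have AC: "A \<bullet> b = max (a \<bullet> b) (a' \<bullet> b)" "C \<bullet> b = min (c \<bullet> b) (c' \<bullet> b)" if "b \<in> Basis" for b
        unfolding A_def C_def inner_sum_left_Basis[OF that] by simp_all
      have eq: "box a' c' \<inter> box a c = box A C"
        unfolding box_def using AC by force
      have "cbox A C \<subseteq> cbox a c" unfolding cbox_def using AC by force
      then have "(LINT x|lebesgue. indicator (box A C) x * u x) = 0" using box ac by blast
      then show "(LINT x|lebesgue. indicator (box a' c') x * (indicator (box a c) x * u x)) = 0"
        unfolding eq[symmetric] by (simp add: indicator_inter_arith mult.assoc)
    qed (use box[OF ac] in simp)
    then show "AE x in lebesgue. x \<in> box a c \<longrightarrow> u x = 0" by eventually_elim (auto simp: indicator_def)
  qed
  then show ?thesis using S by (simp add: AE_restrict_space_iff)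
qed

text \<open>The bumps of a box are admissible test functions, bounded by 1 and convergent to its
  indicator; dominated convergence turns vanishing test integrals into vanishing box
  integrals.\<close>

lemma AE_0_if_test_integrals_0:
  fixes u :: "'a::euclidean_space \<Rightarrow> real"
  assumes o: "open \<Omega>" and int: "locally_integrable \<Omega> u"
    and test: "\<And>\<phi>. test_function \<Omega> \<phi> \<Longrightarrow> (LINT x|lebesgue_on \<Omega>. u x * \<phi> x) = 0"
  shows "AE x in lebesgue_on \<Omega>. u x = 0"
proof -
  have S: "\<Omega> \<in> sets lebesgue" using o by simp
  have box: "(LINT x|lebesgue. indicator (box a c) x * u x) = 0" if "cbox a c \<subseteq> \<Omega>" for a c
  proof -
    have iu2: "integrable lebesgue (\<lambda>x. indicator (box a c) x * u x)"
      using int that unfolding locally_integrable_def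
      by (intro integrable_indicator_subset[of "cbox a c"]) (auto simp: box_subset_cbox)
    have mb: "box_bump a c n \<in> borel_measurable lebesgue" for n
    proof -
      have "box_bump a c n \<in> borel_measurable borel"
        using C_k_box_bump[of 0 a c n] borel_measurable_continuous_onI by simp
      then show ?thesis by (simp add: measurable_completion)
    qed
    have "(\<lambda>n. LINT x|lebesgue. indicator (box a c) x * u x * box_bump a c n x)
            \<longlonglongrightarrow> (LINT x|lebesgue. indicator (box a c) x * u x)"
    proof (rule integral_dominated_convergence[where w="\<lambda>x. norm (indicator (box a c) x * u x)"])
      show "AE x in lebesgue. (\<lambda>n. indicator (box a c) x * u x * box_bump a c n x) \<longlonglongrightarrow> indicator (box a c) x * u x"
      proof (rule AE_I2)
        fix x
        have "(\<lambda>n. indicator (box a c) x * u x * box_bump a c n x) \<longlonglongrightarrow> indicator (box a c) x * u x * indicator (box a c) x"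
          by (intro tendsto_intros box_bump_tendsto)
        moreover have "indicator (box a c) x * u x * indicator (box a c) x = indicator (box a c) x * u x"
          by (simp add: indicator_def)
        ultimately show "(\<lambda>n. indicator (box a c) x * u x * box_bump a c n x) \<longlonglongrightarrow> indicator (box a c) x * u x"
          by metis
      qed
      show "AE x in lebesgue. norm (indicator (box a c) x * u x * box_bump a c n x) \<le> norm (indicator (box a c) x * u x)" for n
      proof (rule AE_I2)
        fix x
        show "norm (indicator (box a c) x * u x * box_bump a c n x) \<le> norm (indicator (box a c) x * u x)"
          unfolding norm_mult using box_bump_bounds[of a c n x] by (intro mult_left_le) auto
      qed
      show "(\<lambda>x. indicator (box a c) x * u x) \<in> borel_measurable lebesgue"
        using iu2 by (rule borel_measurable_integrable)
      then show "(\<lambda>x. indicator (box a c) x * u x * box_bump a c n x) \<in> borel_measurable lebesgue" for n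
        using mb by (rule borel_measurable_times)
      show "integrable lebesgue (\<lambda>x. norm (indicator (box a c) x * u x))"
        using iu2 by (rule integrable_norm)
    qed
    moreover have "(LINT x|lebesgue. indicator (box a c) x * u x * box_bump a c n x) = 0" for n
    proof -
      have "(LINT x|lebesgue. indicator (box a c) x * u x * box_bump a c n x) = (LINT x|lebesgue. indicator \<Omega> x * (u x * box_bump a c n x))"
      proof (rule Bochner_Integration.integral_cong[OF refl])
        fix x show "indicator (box a c) x * u x * box_bump a c n x = indicator \<Omega> x * (u x * box_bump a c n x)"
          using that box_subset_cbox[of a c] box_bump_outside[of x a c n] by (cases "x \<in> box a c") auto
      qed
      also have "\<dots> = 0" using test[OF test_function_box_bump[OF that]] S by (simp add: integrable_lebesgue_onI)
      finally show ?thesis .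
    qed
    ultimately show ?thesis by (simp add: LIMSEQ_const_iff)
  qed
  then show ?thesis by (rule AE_0_if_local_box_integrals_0[OF o int])
qed

section \<open>Bounded derivatives and integration by parts with compact support\<close>

lemma has_derivative_imp_continuous_on:
  assumes "\<And>x. x \<in> S \<Longrightarrow> (f has_derivative f' x) (at x)"
  shows "continuous_on S f"
  by (intro continuous_at_imp_continuous_on ballI has_derivative_continuous[OF assms])

text \<open>The derivative has an operator bound that is uniform on S, but is asked to be neither
  continuous nor measurable. Measurability of divergences is recovered in the proofs below, as that
  of pointwise limits.\<close>

definition bdd_deriv ::
  "'a::euclidean_space set \<Rightarrow> ('a \<Rightarrow> 'b::real_normed_vector) \<Rightarrow> ('a \<Rightarrow> 'a \<Rightarrow> 'b) \<Rightarrow> bool" where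
  "bdd_deriv S V V' \<longleftrightarrow> (\<exists>C. \<forall>x\<in>S. (V has_derivative V' x) (at x) \<and> (\<forall>h. norm (V' x h) \<le> C * norm h))"

lemma bdd_derivE:
  assumes "bdd_deriv S V V'"
  obtains C where "0 < C" "\<And>x. x \<in> S \<Longrightarrow> (V has_derivative V' x) (at x)"
    "\<And>x h. x \<in> S \<Longrightarrow> norm (V' x h) \<le> C * norm h"
proof -
  obtain C where C: "\<And>x. x \<in> S \<Longrightarrow> (V has_derivative V' x) (at x) \<and> (\<forall>h. norm (V' x h) \<le> C * norm h)"
    using assms unfolding bdd_deriv_def by blast
  have "norm (V' x h) \<le> max C 1 * norm h" if "x \<in> S" for x h
    using C[OF that] by (meson max.cobounded1 mult_right_mono norm_ge_zero order_trans)
  with C show ?thesis by (intro that[of "max C 1"]) auto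
qed

lemma bdd_deriv_scaleR:
  fixes u :: "'a::euclidean_space \<Rightarrow> real"
  assumes u: "bdd_deriv S u u'" "\<And>x. x \<in> S \<Longrightarrow> norm (u x) \<le> B"
    and V: "bdd_deriv S V V'" "\<And>x. x \<in> S \<Longrightarrow> norm (V x) \<le> B'"
  shows "bdd_deriv S (\<lambda>x. u x *\<^sub>R V x) (\<lambda>x h. u x *\<^sub>R V' x h + u' x h *\<^sub>R V x)"
proof -
  obtain C where C: "0 < C" "\<And>x. x \<in> S \<Longrightarrow> (u has_derivative u' x) (at x)"
    "\<And>x h. x \<in> S \<Longrightarrow> norm (u' x h) \<le> C * norm h" using bdd_derivE[OF u(1)] by blast
  obtain C' where C': "0 < C'" "\<And>x. x \<in> S \<Longrightarrow> (V has_derivative V' x) (at x)"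
    "\<And>x h. x \<in> S \<Longrightarrow> norm (V' x h) \<le> C' * norm h" using bdd_derivE[OF V(1)] by blast
  have "((\<lambda>x. u x *\<^sub>R V x) has_derivative (\<lambda>h. u x *\<^sub>R V' x h + u' x h *\<^sub>R V x)) (at x)" if "x \<in> S" for x
    by (rule has_derivative_scaleR[OF C(2) C'(2)]) fact+
  moreover have "norm (u x *\<^sub>R V' x h + u' x h *\<^sub>R V x) \<le> (B * C' + C * B') * norm h" if "x \<in> S" for x h
  proof -
    have "norm (u x *\<^sub>R V' x h + u' x h *\<^sub>R V x) \<le> norm (u x) * norm (V' x h) + norm (u' x h) * norm (V x)"
      by (rule norm_triangle_le) simp
    also have "\<dots> \<le> B * (C' * norm h) + (C * norm h) * B'"
      using u(2)[OF that] V(2)[OF that] C(3)[OF that, of h] C'(3)[OF that, of h] C(1)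
      by (intro add_mono mult_mono) (auto intro: order_trans[OF norm_ge_zero])
    finally show ?thesis by (simp add: algebra_simps)
  qed
  ultimately show ?thesis unfolding bdd_deriv_def by blast
qed

lemma bdd_deriv_add:
  assumes "bdd_deriv S U U'" "bdd_deriv S V V'"
  shows "bdd_deriv S (\<lambda>x. U x + V x) (\<lambda>x h. U' x h + V' x h)"
proof -
  obtain C where C: "0 < C" "\<And>x. x \<in> S \<Longrightarrow> (U has_derivative U' x) (at x)"
    "\<And>x h. x \<in> S \<Longrightarrow> norm (U' x h) \<le> C * norm h" using bdd_derivE[OF assms(1)] by blast
  obtain C' where C': "0 < C'" "\<And>x. x \<in> S \<Longrightarrow> (V has_derivative V' x) (at x)"
    "\<And>x h. x \<in> S \<Longrightarrow> norm (V' x h) \<le> C' * norm h" using bdd_derivE[OF assms(2)] by blast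
  have "norm (U' x h + V' x h) \<le> (C + C') * norm h" if "x \<in> S" for x h
    using norm_triangle_mono[OF C(3)[OF that, of h] C'(3)[OF that, of h]] by (simp add: algebra_simps)
  then show ?thesis unfolding bdd_deriv_def using has_derivative_add[OF C(2) C'(2)] by blast
qed

lemma bdd_deriv_const: "bdd_deriv S (\<lambda>x. c) (\<lambda>x h. 0)"
  unfolding bdd_deriv_def by (intro exI[of _ 0]) auto

lemma integrable_lborel_bounded_support:
  fixes f :: "'a::euclidean_space \<Rightarrow> real"
  assumes "f \<in> borel_measurable borel" "\<And>x. x \<notin> cball 0 R \<Longrightarrow> f x = 0" "\<And>x. \<bar>f x\<bar> \<le> B"
  shows "integrable lborel f"
proof (rule Bochner_Integration.integrable_bound[where f="\<lambda>x. B * indicator (cball 0 R) x"])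
  show "integrable lborel (\<lambda>x. B * indicator (cball (0::'a) R) x)"
    by (intro integrable_mult_right integrable_real_indicator emeasure_lborel_cball_finite) simp
  show "AE x in lborel. norm (f x) \<le> norm (B * indicator (cball 0 R) x)"
  proof (rule AE_I2)
    fix x show "norm (f x) \<le> norm (B * indicator (cball 0 R) x)"
      using assms(2)[of x] assms(3)[of x] by (cases "x \<in> cball 0 R") auto
  qed
qed (use assms in simp)

text \<open>By translation invariance every difference quotient of F has integral zero. The
  quotients are bounded by the Lipschitz constant and live in one ball, so dominated convergence
  passes both the measurability and the vanishing integral on to the derivative.\<close>

lemma integral_deriv_compact_support:
  fixes F :: "'a::euclidean_space \<Rightarrow> real"
  assumes K: "bounded K" "\<And>x. x \<notin> K \<Longrightarrow> F x = 0"
    and F: "\<And>x. (F has_derivative F' x) (at x)" "\<And>x h. \<bar>F' x h\<bar> \<le> C * norm h"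
  shows "integrable lebesgue (\<lambda>x. F' x b)" "(LINT x|lebesgue. F' x b) = 0"
proof -
  obtain R where "\<forall>x\<in>K. norm x \<le> R" using K(1) unfolding bounded_iff by blast
  then have R: "K \<subseteq> cball 0 R" by auto
  have cont: "continuous_on UNIV F" by (rule has_derivative_imp_continuous_on[OF F(1)])
  then have Fm: "F \<in> borel_measurable borel" by (rule borel_measurable_continuous_onI)
  \<comment> \<open>Steps of length at most 1 keep the supports of all difference quotients inside
    the ball of radius \<open>R + norm b\<close>.\<close>
  define q where "q n = (1::real) / real (Suc n)" for n
  have q: "0 < q n" "q n \<le> 1" for n by (auto simp: q_def)
  define D where "D n x = (F (q n *\<^sub>R b + x) - F x) / q n" for n x
  have "(\<lambda>x. F (q n *\<^sub>R b + x)) \<in> borel_measurable borel" for n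
    using Fm by measurable
  then have Dm: "D n \<in> borel_measurable borel" for n
    unfolding D_def using Fm by measurable
  have lip: "\<bar>F x - F y\<bar> \<le> C * norm (x - y)" for x y
  proof -
    have "norm (F x - F y) \<le> C * norm (x - y)"
    proof (rule differentiable_bound[of UNIV])
      show "onorm (F' z) \<le> C" for z by (rule onorm_le) (use F(2) in auto)
    qed (use F(1) in auto)
    then show ?thesis by simp
  qed
  have Db: "\<bar>D n x\<bar> \<le> C * norm b" for n x
  proof -
    have "\<bar>D n x\<bar> \<le> (C * norm (q n *\<^sub>R b)) / q n"
      unfolding D_def using lip[of "q n *\<^sub>R b + x" x] q[of n]
      by (simp only: abs_divide) (intro frac_le, auto)
    then show ?thesis using q[of n] by simp
  qed
  have D0: "D n x = 0" if "x \<notin> cball 0 (R + norm b)" for n x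
  proof -
    have "norm x \<le> norm (q n *\<^sub>R b + x) + norm (q n *\<^sub>R b)"
      using norm_triangle_ineq4[of "q n *\<^sub>R b + x" "q n *\<^sub>R b"] by simp
    moreover have "norm (q n *\<^sub>R b) \<le> norm b" using q[of n] by (simp add: mult_left_le_one_le)
    moreover have "R + norm b < norm x" using that by (simp add: not_le)
    ultimately have "norm x > R" "norm (q n *\<^sub>R b + x) > R" using norm_ge_zero[of b] by linarith+
    then have "x \<notin> K" "q n *\<^sub>R b + x \<notin> K" using R by (auto simp: subset_iff)
    then show ?thesis using K(2) by (simp add: D_def)
  qed
  have lim: "(\<lambda>n. D n x) \<longlonglongrightarrow> F' x b" for x
  proof -
    have "((\<lambda>t. (F (x + t *\<^sub>R b) - F x) / t) \<longlongrightarrow> F' x b) (at 0)"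
    proof -
      have "((\<lambda>t. F (x + t *\<^sub>R b)) has_derivative (\<lambda>t. F' x (t *\<^sub>R b))) (at 0)"
        by (rule has_derivative_compose[where g=F and f="\<lambda>t. x + t *\<^sub>R b"])
           (use F(1)[of x] in \<open>auto intro!: derivative_eq_intros\<close>)
      moreover have "F' x (t *\<^sub>R b) = t * F' x b" for t
        using linear_cmul[OF has_derivative_linear[OF F(1)[of x]], of t b] by simp
      ultimately have "((\<lambda>t. F (x + t *\<^sub>R b)) has_real_derivative F' x b) (at 0)"
        by (simp add: has_field_derivative_def mult_commute_abs)
      then show ?thesis by (simp add: DERIV_def)
    qed
    moreover have "filterlim q (at 0) sequentially"
    proof -
      have "q \<longlonglongrightarrow> 0" unfolding q_def[abs_def] by (rule LIMSEQ_Suc[OF lim_1_over_n])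
      moreover have "\<forall>\<^sub>F n in sequentially. q n \<in> UNIV \<and> q n \<noteq> 0"
        using q(1) by (intro always_eventually) (simp add: less_imp_neq[symmetric])
      ultimately show ?thesis unfolding filterlim_at by simp
    qed
    ultimately have "(\<lambda>n. (F (x + q n *\<^sub>R b) - F x) / q n) \<longlonglongrightarrow> F' x b"
      by (rule filterlim_compose)
    then show ?thesis by (simp add: D_def add.commute)
  qed
  have "bounded (F ` cball 0 R)"
    by (intro compact_imp_bounded compact_continuous_image continuous_on_subset[OF cont]) auto
  then obtain B where B: "\<forall>x\<in>cball 0 R. norm (F x) \<le> B" by (auto simp: bounded_iff)
  have F0: "F x = 0" if "x \<notin> cball 0 R" for x
    by (rule K(2)) (use that R in auto)
  have "\<bar>F x\<bar> \<le> max B 0" for x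
  proof (cases "x \<in> cball 0 R")
    case True
    then show ?thesis using B[rule_format, of x] by auto
  next
    case False
    then show ?thesis using F0[of x] by simp
  qed
  from integrable_lborel_bounded_support[OF Fm F0 this] have Fi: "integrable lborel F" .
  have tr: "(LINT x|lborel. F (c + x)) = (LINT x|lborel. F x)" "integrable lborel (\<lambda>x. F (c + x))" for c
    using integral_distr[of "(+) c" lborel borel F] integrable_distr_eq[of "(+) c" lborel borel F] Fm Fi
    by (simp_all add: lborel_distr_plus)
  have int0: "(LINT x|lborel. D n x) = 0" for n
    unfolding D_def using tr[of "q n *\<^sub>R b"] Fi by simp
  have di: "integrable lborel (\<lambda>x. F' x b)" "(\<lambda>n. LINT x|lborel. D n x) \<longlonglongrightarrow> (LINT x|lborel. F' x b)"
  proof -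
    have w: "integrable lborel (\<lambda>x. (C * norm b) * indicator (cball (0::'a) (R + norm b)) x)"
      by (intro integrable_mult_right integrable_real_indicator emeasure_lborel_cball_finite) simp
    have m: "(\<lambda>x. F' x b) \<in> borel_measurable lborel"
      by (rule borel_measurable_LIMSEQ_real[of lborel D]) (use lim Dm in auto)
    have bd: "AE x in lborel. norm (D n x) \<le> (C * norm b) * indicator (cball (0::'a) (R + norm b)) x" for n
    proof (rule AE_I2)
      fix x show "norm (D n x) \<le> (C * norm b) * indicator (cball 0 (R + norm b)) x"
        using D0[of x n] Db[of n x] by (cases "x \<in> cball 0 (R + norm b)") auto
    qed
    have l: "AE x in lborel. (\<lambda>n. D n x) \<longlonglongrightarrow> F' x b" using lim by simp
    have m': "D n \<in> borel_measurable lborel" for n using Dm by simp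
    show "integrable lborel (\<lambda>x. F' x b)"
      by (rule integrable_dominated_convergence[OF m m' w l bd])
    show "(\<lambda>n. LINT x|lborel. D n x) \<longlonglongrightarrow> (LINT x|lborel. F' x b)"
      by (rule integral_dominated_convergence[OF m m' w l bd])
  qed
  have m: "(\<lambda>x. F' x b) \<in> borel_measurable lborel" using di(1) by simp
  show "integrable lebesgue (\<lambda>x. F' x b)" using di(1) integrable_completion[OF m] by simp
  show "(LINT x|lebesgue. F' x b) = 0"
    using di(2) int0 integral_completion[OF m] by (simp add: LIMSEQ_const_iff)
qed

text \<open>The trace of a linear map; at the Frechet derivative of a vector field it is the
  divergence.\<close>

definition dvg :: "('a::euclidean_space \<Rightarrow> 'a) \<Rightarrow> real" where
  "dvg L = (\<Sum>b\<in>Basis. L b \<bullet> b)"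

lemma dvg_add: "dvg (\<lambda>h. L h + M h) = dvg L + dvg M"
  by (simp add: dvg_def inner_add_left sum.distrib)

lemma dvg_scaleR: "dvg (\<lambda>h. c *\<^sub>R L h) = c * dvg L"
  by (simp add: dvg_def sum_distrib_left)

text \<open>Together with additivity and homogeneity this is the product rule for the divergence:
  differentiating a scalar factor contributes a map of rank one.\<close>

lemma dvg_rank_one: "dvg (\<lambda>h. (p \<bullet> h) *\<^sub>R v) = p \<bullet> v"
  by (simp add: dvg_def euclidean_inner[of p v])

lemma abs_dvg_le:
  fixes L :: "'a::euclidean_space \<Rightarrow> 'a"
  assumes "\<And>h. norm (L h) \<le> C * norm h"
  shows "\<bar>dvg L\<bar> \<le> real DIM('a) * C"
proof -
  have "\<bar>L b \<bullet> b\<bar> \<le> C" if "b \<in> Basis" for b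
    using Cauchy_Schwarz_ineq2[of "L b" b] assms[of b] that by simp
  then have "\<bar>dvg L\<bar> \<le> (\<Sum>b\<in>(Basis::'a set). C)"
    unfolding dvg_def by (rule order_trans[OF sum_abs sum_mono])
  then show ?thesis by simp
qed

text \<open>Where the field vanishes on an open set its derivative vanishes too, so each component
  extends by zero to a function differentiable on the whole space, to which the scalar statement
  applies in its own coordinate direction.\<close>

lemma integral_div_compact_support:
  fixes V :: "'a::euclidean_space \<Rightarrow> 'a"
  assumes o: "open \<Omega>" and K: "compact K" "K \<subseteq> \<Omega>" "\<And>x. x \<in> \<Omega> - K \<Longrightarrow> V x = 0"
    and V: "\<And>x. x \<in> \<Omega> \<Longrightarrow> (V has_derivative V' x) (at x)" "\<And>x h. x \<in> K \<Longrightarrow> norm (V' x h) \<le> C * norm h"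
  shows "integrable (lebesgue_on \<Omega>) (\<lambda>x. dvg (V' x))" "(LINT x|lebesgue_on \<Omega>. dvg (V' x)) = 0"
proof -
  have V0: "V' x h = 0" if "x \<in> \<Omega> - K" for x h
  proof -
    have "open (\<Omega> - K)" using o K(1) by (simp add: compact_imp_closed open_Diff)
    from has_derivative_transform_within_open[OF V(1) this that, of "\<lambda>x. 0"]
    have "((\<lambda>x. 0) has_derivative V' x) (at x)" using K(3) that by simp
    from has_derivative_unique[OF this has_derivative_const] show ?thesis by metis
  qed
  define F where "F b x = (if x \<in> K then V x \<bullet> b else 0)" for b x
  define F' where "F' b x h = (if x \<in> K then V' x h \<bullet> b else 0)" for b x h
  have dF: "(F b has_derivative F' b x) (at x)" for b x
  proof (cases "x \<in> \<Omega>")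
    case True
    have eq: "F b y = V y \<bullet> b" if "y \<in> \<Omega>" for y using K(3)[of y] that by (auto simp: F_def)
    have "((\<lambda>y. V y \<bullet> b) has_derivative (\<lambda>h. V' x h \<bullet> b)) (at x)"
      using V(1)[OF True] by (auto intro!: derivative_eq_intros)
    then have "(F b has_derivative (\<lambda>h. V' x h \<bullet> b)) (at x)"
      by (rule has_derivative_transform_within_open[OF _ o True]) (simp add: eq)
    moreover have "(\<lambda>h. V' x h \<bullet> b) = F' b x" using V0[of x] True by (auto simp: F'_def)
    ultimately show ?thesis by simp
  next
    case False
    then have x: "x \<in> - K" using K(2) by blast
    have oK: "open (- K)" using K(1) by (simp add: compact_imp_closed open_Compl)
    have "((\<lambda>x. 0) has_derivative F' b x) (at x)"
      using x by (simp add: F'_def[abs_def])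
    then show ?thesis
      by (rule has_derivative_transform_within_open[OF _ oK x]) (simp add: F_def)
  qed
  have bF: "\<bar>F' b x h\<bar> \<le> max C 0 * norm h" if "b \<in> Basis" for b x h
  proof (cases "x \<in> K")
    case True
    have "\<bar>V' x h \<bullet> b\<bar> \<le> C * norm h"
      using Cauchy_Schwarz_ineq2[of "V' x h" b] V(2)[OF True, of h] that by simp
    also have "\<dots> \<le> max C 0 * norm h" by (intro mult_right_mono) auto
    finally show ?thesis using True by (simp add: F'_def)
  qed (simp add: F'_def)
  have i: "integrable lebesgue (\<lambda>x. F' b x b)" "(LINT x|lebesgue. F' b x b) = 0" if "b \<in> Basis" for b
    using integral_deriv_compact_support[where F="F b" and F'="F' b" and K=K and C="max C 0" and b=b]
      compact_imp_bounded[OF K(1)] dF[of b] bF[OF that] by (simp_all add: F_def)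
  have eq: "indicator \<Omega> x *\<^sub>R dvg (V' x) = (\<Sum>b\<in>Basis. F' b x b)" for x
    using V0[of x] K(2) by (cases "x \<in> \<Omega>"; cases "x \<in> K") (auto simp: F'_def dvg_def)
  have S: "\<Omega> \<in> sets lebesgue" using o by simp
  show "integrable (lebesgue_on \<Omega>) (\<lambda>x. dvg (V' x))" "(LINT x|lebesgue_on \<Omega>. dvg (V' x)) = 0"
    unfolding integrable_lebesgue_onI[OF S] eq using i by (simp_all add: integral_sum)
qed

lemma integrable_continuous_compact:
  fixes f :: "'a::euclidean_space \<Rightarrow> 'b::euclidean_space"
  assumes "compact K" "continuous_on K f" "S \<in> sets lebesgue" "S \<subseteq> K"
  shows "integrable (lebesgue_on S) f"
proof -
  have "integrable lborel (\<lambda>x. indicator K x *\<^sub>R f x)" using assms by (intro borel_integrable_compact)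
  then have "integrable lebesgue (\<lambda>x. indicator K x *\<^sub>R f x)"
    using integrable_completion borel_measurable_integrable by blast
  then have "integrable lebesgue (\<lambda>x. indicator S x *\<^sub>R (indicator K x *\<^sub>R f x))"
    by (rule integrable_mult_indicator[OF assms(3)])
  also have "(\<lambda>x. indicator S x *\<^sub>R (indicator K x *\<^sub>R f x)) = (\<lambda>x. indicator S x *\<^sub>R f x)"
    using assms(4) by (intro ext) (auto simp: indicator_def)
  finally show ?thesis by (simp add: integrable_lebesgue_onI(1)[OF assms(3)])
qed

text \<open>What remains of a test function in all later uses: a compact support, one continuous
  gradient given as a vector field, and the translation of \<open>frechet_derivative\<close> into
  that gradient.\<close>

definition cutoff_data ::
  "'a::euclidean_space set \<Rightarrow> ('a \<Rightarrow> real) \<Rightarrow> 'a set \<Rightarrow> ('a \<Rightarrow> 'a) \<Rightarrow> bool" where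
  "cutoff_data \<Omega> \<phi> K D \<longleftrightarrow> compact K \<and> K \<subseteq> \<Omega> \<and> (\<forall>x. x \<notin> K \<longrightarrow> \<phi> x = 0) \<and>
     continuous_on UNIV \<phi> \<and> continuous_on UNIV D \<and>
     (\<forall>x. (\<phi> has_derivative (\<lambda>h. D x \<bullet> h)) (at x)) \<and>
     (\<forall>x h. frechet_derivative \<phi> (at x) h = D x \<bullet> h) \<and> (\<forall>x. x \<notin> K \<longrightarrow> D x = 0)"

lemma cutoff_dataD:
  assumes "cutoff_data \<Omega> \<phi> K D"
  shows "compact K" "K \<subseteq> \<Omega>" "\<And>x. x \<notin> K \<Longrightarrow> \<phi> x = 0" "continuous_on UNIV \<phi>" "continuous_on UNIV D"
    "\<And>x. (\<phi> has_derivative (\<lambda>h. D x \<bullet> h)) (at x)" "\<And>x h. frechet_derivative \<phi> (at x) h = D x \<bullet> h"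
    "\<And>x. x \<notin> K \<Longrightarrow> D x = 0"
  using assms unfolding cutoff_data_def by auto

lemma test_function_cutoff_data:
  assumes "test_function \<Omega> \<phi>"
  shows "\<exists>K D. cutoff_data \<Omega> \<phi> K D"
proof -
  obtain K where K: "compact K" "K \<subseteq> \<Omega>" "\<And>x. x \<notin> K \<Longrightarrow> \<phi> x = 0"
    using assms unfolding test_function_def by blast
  have "C_k (Suc 0) \<phi>" "C_k 0 \<phi>" using assms unfolding test_function_def by blast+
  then obtain D where D: "\<And>x. (\<phi> has_derivative (\<lambda>h. D x \<bullet> h)) (at x)"
    "\<And>b. b \<in> Basis \<Longrightarrow> continuous_on UNIV (\<lambda>x. D x \<bullet> b)" "continuous_on UNIV \<phi>"
    unfolding C_k.simps by blast
  have c: "continuous_on UNIV D" using D(2) by (rule continuous_on_componentwise[THEN iffD2, rule_format])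
  have f: "frechet_derivative \<phi> (at x) h = D x \<bullet> h" for x h
    using frechet_derivative_at[OF D(1)[of x]] by metis
  have "D x = 0" if "x \<notin> K" for x
  proof -
    have "open (- K)" using K(1) by (simp add: compact_imp_closed open_Compl)
    from has_derivative_transform_within_open[OF D(1) this, of x "\<lambda>x. 0"]
    have "((\<lambda>x. 0) has_derivative (\<lambda>h. D x \<bullet> h)) (at x)" using K(3) that by simp
    from has_derivative_unique[OF this has_derivative_const] have "D x \<bullet> D x = 0" by metis
    then show ?thesis by simp
  qed
  with K D(1,3) c f have "cutoff_data \<Omega> \<phi> K D" unfolding cutoff_data_def by simp
  then show ?thesis by blast
qed

text \<open>The field \<phi> J has compact support in \<open>\<Omega>\<close>, so its divergence
  integrates to zero, and the product rule splits that divergence into the two terms.\<close>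

lemma integral_test_div:
  fixes J :: "'a::euclidean_space \<Rightarrow> 'a"
  assumes o: "open \<Omega>" and J: "\<And>x. x \<in> \<Omega> \<Longrightarrow> (J has_derivative J' x) (at x)"
    and bd: "\<And>K. compact K \<Longrightarrow> K \<subseteq> \<Omega> \<Longrightarrow> \<exists>C. \<forall>x\<in>K. \<forall>h. norm (J' x h) \<le> C * norm h"
    and \<phi>: "test_function \<Omega> \<phi>"
  shows "integrable (lebesgue_on \<Omega>) (\<lambda>x. dvg (J' x) * \<phi> x)"
    "integrable (lebesgue_on \<Omega>) (\<lambda>x. frechet_derivative \<phi> (at x) (J x))"
    "(LINT x|lebesgue_on \<Omega>. frechet_derivative \<phi> (at x) (J x)) = - (LINT x|lebesgue_on \<Omega>. dvg (J' x) * \<phi> x)"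
proof -
  obtain K D where KD: "cutoff_data \<Omega> \<phi> K D" using test_function_cutoff_data[OF \<phi>] by blast
  note K = cutoff_dataD[OF KD]
  obtain C where C: "\<And>x h. x \<in> K \<Longrightarrow> norm (J' x h) \<le> C * norm h" using bd[OF K(1,2)] by blast
  have Jc: "continuous_on \<Omega> J" by (rule has_derivative_imp_continuous_on[OF J])
  have contK: "continuous_on K (\<lambda>x. norm (\<phi> x))" "continuous_on K (\<lambda>x. norm (D x) * norm (J x))"
    using K(2,4,5) Jc by (auto intro!: continuous_intros intro: continuous_on_subset)
  obtain B1 where B1: "\<And>x. x \<in> K \<Longrightarrow> norm (\<phi> x) \<le> B1"
    using compact_imp_bounded[OF compact_continuous_image[OF contK(1) K(1)]] by (auto simp: bounded_iff)
  obtain B2 where B2: "\<And>x. x \<in> K \<Longrightarrow> norm (D x) * norm (J x) \<le> B2"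
    using compact_imp_bounded[OF compact_continuous_image[OF contK(2) K(1)]] by (auto simp: bounded_iff)
  let ?V = "\<lambda>x. \<phi> x *\<^sub>R J x" and ?V' = "\<lambda>x h. \<phi> x *\<^sub>R J' x h + (D x \<bullet> h) *\<^sub>R J x"
  have dV: "(?V has_derivative ?V' x) (at x)" if "x \<in> \<Omega>" for x
    using has_derivative_scaleR[OF K(6) J[OF that]] by simp
  have bV: "norm (?V' x h) \<le> (B1 * max C 0 + B2) * norm h" if "x \<in> K" for x h
  proof -
    have "norm (?V' x h) \<le> norm (\<phi> x) * norm (J' x h) + \<bar>D x \<bullet> h\<bar> * norm (J x)"
      by (rule norm_triangle_le) simp
    also have "\<dots> \<le> B1 * (max C 0 * norm h) + (norm (D x) * norm h) * norm (J x)"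
    proof (intro add_mono mult_mono)
      show "norm (J' x h) \<le> max C 0 * norm h"
        using C[OF that, of h] by (meson max.cobounded1 mult_right_mono norm_ge_zero order_trans)
    qed (use B1[OF that] Cauchy_Schwarz_ineq2 in \<open>auto intro: order_trans[OF norm_ge_zero]\<close>)
    also have "\<dots> \<le> B1 * (max C 0 * norm h) + B2 * norm h"
      using mult_right_mono[OF B2[OF that] norm_ge_zero[of h]] by (simp add: mult_ac)
    finally show ?thesis by (simp add: algebra_simps)
  qed
  have eq: "dvg (?V' x) = dvg (J' x) * \<phi> x + D x \<bullet> J x" for x
    by (simp add: dvg_add dvg_scaleR dvg_rank_one)
  have V: "integrable (lebesgue_on \<Omega>) (\<lambda>x. dvg (J' x) * \<phi> x + D x \<bullet> J x)"
    "(LINT x|lebesgue_on \<Omega>. dvg (J' x) * \<phi> x + D x \<bullet> J x) = 0"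
    using integral_div_compact_support[OF o K(1,2) _ dV bV] K(3) unfolding eq by auto
  have S: "\<Omega> \<in> sets lebesgue" using o by simp
  have KS: "K \<in> sets lebesgue" using K(1) by (simp add: compact_imp_closed)
  have DJ: "integrable (lebesgue_on \<Omega>) (\<lambda>x. D x \<bullet> J x)"
  proof -
    have "integrable (lebesgue_on K) (\<lambda>x. D x \<bullet> J x)"
      by (rule integrable_continuous_compact[OF K(1) _ KS order_refl])
         (use K(2,5) Jc in \<open>auto intro!: continuous_intros intro: continuous_on_subset\<close>)
    moreover have "(\<lambda>x. indicator \<Omega> x *\<^sub>R (D x \<bullet> J x)) = (\<lambda>x. indicator K x *\<^sub>R (D x \<bullet> J x))"
      using K(2,8) by (intro ext) (auto simp: indicator_def)
    ultimately show ?thesis unfolding integrable_lebesgue_onI(1)[OF S] integrable_lebesgue_onI(1)[OF KS] by simp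
  qed
  \<comment> \<open>The term with the divergence of J is not known to be measurable by itself; it is
    obtained as the difference of two integrable functions.\<close>
  have "integrable (lebesgue_on \<Omega>) (\<lambda>x. (dvg (J' x) * \<phi> x + D x \<bullet> J x) - D x \<bullet> J x)"
    by (rule Bochner_Integration.integrable_diff[OF V(1) DJ])
  then show i: "integrable (lebesgue_on \<Omega>) (\<lambda>x. dvg (J' x) * \<phi> x)" by simp
  show "integrable (lebesgue_on \<Omega>) (\<lambda>x. frechet_derivative \<phi> (at x) (J x))" using DJ K(7) by simp
  show "(LINT x|lebesgue_on \<Omega>. frechet_derivative \<phi> (at x) (J x)) = - (LINT x|lebesgue_on \<Omega>. dvg (J' x) * \<phi> x)"
    using V(2) i DJ by (simp add: K(7))
qed

section \<open>Weak derivatives of classically differentiable functions\<close>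

text \<open>A partial derivative of u in direction b is the divergence of the field u b, so
  integration by parts against the divergence suffices.\<close>

lemma has_weak_deriv_classical:
  fixes u :: "'a::euclidean_space \<Rightarrow> real"
  assumes o: "open \<Omega>" and u: "\<And>x. x \<in> \<Omega> \<Longrightarrow> (u has_derivative (\<lambda>h. Du x \<bullet> h)) (at x)"
    and c: "continuous_on \<Omega> Du" and b: "b \<in> Basis"
  shows "has_weak_deriv \<Omega> b u (\<lambda>x. Du x \<bullet> b)"
proof -
  have uc: "continuous_on \<Omega> u" by (rule has_derivative_imp_continuous_on[OF u])
  have li: "locally_integrable \<Omega> f" if "continuous_on \<Omega> f" for f :: "'a \<Rightarrow> real"
    unfolding locally_integrable_def
  proof (intro allI impI)
    fix K :: "'a set" assume "compact K \<and> K \<subseteq> \<Omega>"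
    then show "integrable (lebesgue_on K) f"
      using continuous_on_subset[OF that]
      by (intro integrable_continuous_compact[where K=K]) (auto dest: compact_imp_closed)
  qed
  have "(LINT x|lebesgue_on \<Omega>. u x * frechet_derivative \<phi> (at x) b) = - (LINT x|lebesgue_on \<Omega>. Du x \<bullet> b * \<phi> x)"
    if t: "test_function \<Omega> \<phi>" for \<phi>
  proof -
    have d: "((\<lambda>x. u x *\<^sub>R b) has_derivative (\<lambda>h. (Du x \<bullet> h) *\<^sub>R b)) (at x)" if "x \<in> \<Omega>" for x
      using u[OF that] by (auto intro!: derivative_eq_intros)
    have bd: "\<exists>C. \<forall>x\<in>K. \<forall>h. norm ((Du x \<bullet> h) *\<^sub>R b) \<le> C * norm h" if K: "compact K" "K \<subseteq> \<Omega>" for K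
    proof -
      obtain B where B: "\<And>x. x \<in> K \<Longrightarrow> norm (Du x) \<le> B"
        using compact_imp_bounded[OF compact_continuous_image[OF continuous_on_subset[OF c K(2)] K(1)]]
        by (auto simp: bounded_iff)
      have "norm ((Du x \<bullet> h) *\<^sub>R b) \<le> B * norm h" if "x \<in> K" for x h
        using Cauchy_Schwarz_ineq2[of "Du x" h] mult_right_mono[OF B[OF that] norm_ge_zero[of h]] b by simp
      then show ?thesis by blast
    qed
    have l: "frechet_derivative \<phi> (at x) (u x *\<^sub>R b) = u x * frechet_derivative \<phi> (at x) b" for x
    proof -
      obtain K D where KD: "cutoff_data \<Omega> \<phi> K D" using test_function_cutoff_data[OF t] by blast
  note K = cutoff_dataD[OF KD]
      show ?thesis by (simp add: K(7))
    qed
    show ?thesis using integral_test_div(3)[OF o d bd t] by (simp add: l dvg_rank_one)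
  qed
  then show ?thesis unfolding has_weak_deriv_def using li[OF uc] li[of "\<lambda>x. Du x \<bullet> b"] c
    by (simp add: continuous_on_inner)
qed

lemma locally_integrable_test:
  fixes f :: "'a::euclidean_space \<Rightarrow> real"
  assumes "locally_integrable \<Omega> f" "test_function \<Omega> \<phi>" "open \<Omega>"
  shows "integrable (lebesgue_on \<Omega>) (\<lambda>x. f x * \<phi> x)"
proof -
  obtain K D where KD: "cutoff_data \<Omega> \<phi> K D" using test_function_cutoff_data[OF assms(2)] by blast
  note K = cutoff_dataD[OF KD]
  have KS: "K \<in> sets lebesgue" "\<Omega> \<in> sets lebesgue" using K(1) assms(3) by (simp_all add: compact_imp_closed)
  have fi: "integrable (lebesgue_on K) f" using assms(1) K unfolding locally_integrable_def by blast
  obtain B where B: "\<And>x. x \<in> K \<Longrightarrow> norm (\<phi> x) \<le> B"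
    using compact_imp_bounded[OF compact_continuous_image[OF continuous_on_subset[OF K(4) subset_UNIV] K(1)]]
    by (auto simp: bounded_iff)
  have "integrable (lebesgue_on K) (\<lambda>x. f x * \<phi> x)"
  proof (rule Bochner_Integration.integrable_bound[where f="\<lambda>x. B * f x"])
    show "integrable (lebesgue_on K) (\<lambda>x. B * f x)" using fi by simp
    have "\<phi> \<in> borel_measurable (lebesgue_on K)"
      using integrable_continuous_compact[OF K(1) continuous_on_subset[OF K(4) subset_UNIV] KS(1) order_refl]
      by simp
    then show "(\<lambda>x. f x * \<phi> x) \<in> borel_measurable (lebesgue_on K)"
      using fi by (intro borel_measurable_times) auto
    show "AE x in lebesgue_on K. norm (f x * \<phi> x) \<le> norm (B * f x)"
    proof (rule AE_I2)
      fix x assume "x \<in> space (lebesgue_on K)"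
      then have "norm (\<phi> x) \<le> B" using B by simp
      then have "norm (\<phi> x) \<le> norm B" by simp
      then show "norm (f x * \<phi> x) \<le> norm (B * f x)"
        unfolding norm_mult mult.commute[of "norm (f x)"] by (rule mult_right_mono) simp
    qed
  qed
  moreover have "(\<lambda>x. indicator \<Omega> x *\<^sub>R (f x * \<phi> x)) = (\<lambda>x. indicator K x *\<^sub>R (f x * \<phi> x))"
    using K(2,3) by (intro ext) (auto simp: indicator_def)
  ultimately show ?thesis unfolding integrable_lebesgue_onI(1)[OF KS(1)] integrable_lebesgue_onI(1)[OF KS(2)] by simp
qed

lemma has_weak_deriv_unique:
  assumes o: "open \<Omega>" and v: "has_weak_deriv \<Omega> b u v" and w: "has_weak_deriv \<Omega> b u w"
  shows "AE x in lebesgue_on \<Omega>. v x = w x"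
proof -
  have lv: "locally_integrable \<Omega> v" and lw: "locally_integrable \<Omega> w"
    using v w unfolding has_weak_deriv_def by auto
  have "AE x in lebesgue_on \<Omega>. v x - w x = 0"
  proof (rule AE_0_if_test_integrals_0[OF o])
    show "locally_integrable \<Omega> (\<lambda>x. v x - w x)"
      using lv lw unfolding locally_integrable_def by auto
    fix \<phi> assume t: "test_function \<Omega> \<phi>"
    have "- (LINT x|lebesgue_on \<Omega>. v x * \<phi> x) = - (LINT x|lebesgue_on \<Omega>. w x * \<phi> x)"
      using v[unfolded has_weak_deriv_def, THEN conjunct2, THEN conjunct2, rule_format, OF t]
        w[unfolded has_weak_deriv_def, THEN conjunct2, THEN conjunct2, rule_format, OF t] by simp
    then show "(LINT x|lebesgue_on \<Omega>. (v x - w x) * \<phi> x) = 0"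
      using locally_integrable_test[OF lv t o] locally_integrable_test[OF lw t o] by (simp add: left_diff_distrib)
  qed
  then show ?thesis by simp
qed

text \<open>The choice inside \<open>weak_deriv\<close> affects only null sets. This is the bridge
  from the weak derivatives in the definitions to the classical gradients used in all
  estimates.\<close>

lemma weak_deriv_classical_AE:
  assumes "open \<Omega>" "\<And>x. x \<in> \<Omega> \<Longrightarrow> (u has_derivative (\<lambda>h. Du x \<bullet> h)) (at x)"
    "continuous_on \<Omega> Du" "b \<in> Basis"
  shows "AE x in lebesgue_on \<Omega>. weak_deriv \<Omega> b u x = Du x \<bullet> b"
  using has_weak_deriv_unique[OF assms(1) someI[of "has_weak_deriv \<Omega> b u"]]
    has_weak_deriv_classical[OF assms] unfolding weak_deriv_def by blast

section \<open>The divergence theorem for fields tangential at the boundary\<close>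

lemma compact_continuous_bounded:
  assumes "compact S" "continuous_on S f"
  shows "\<exists>B. \<forall>x\<in>S. norm (f x) \<le> B"
  using compact_imp_bounded[OF compact_continuous_image[OF assms(2,1)]] unfolding bounded_iff by blast

text \<open>With u and v the normalised vectors, the vector v - u - e u lies in the open half-space
  of u for every e > 0, even if u and v coincide. The inclusion bounds its product with v, and e
  tending to 0 gives v \<bullet> u \<ge> 1, the case of equality in the Cauchy-Schwarz
  inequality.\<close>

lemma halfspace_subset_imp_parallel:
  fixes p q :: "'a::euclidean_space"
  assumes "p \<noteq> 0" "q \<noteq> 0" and sub: "\<And>h. p \<bullet> h < 0 \<Longrightarrow> q \<bullet> h \<le> 0"
  shows "p /\<^sub>R norm p = q /\<^sub>R norm q"
proof -
  define u where "u = p /\<^sub>R norm p"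
  define v where "v = q /\<^sub>R norm q"
  have n: "norm u = 1" "norm v = 1" using assms(1,2) by (simp_all add: u_def v_def)
  have "v \<bullet> (v - u - e *\<^sub>R u) \<le> 0" if "e > 0" for e
  proof (cases "u \<bullet> (v - u - e *\<^sub>R u) < 0")
    case True
    then have "p \<bullet> (v - u - e *\<^sub>R u) < 0"
      using assms(1) by (simp add: u_def zero_less_mult_iff mult_less_0_iff)
    then have "q \<bullet> (v - u - e *\<^sub>R u) \<le> 0" by (rule sub)
    then show ?thesis using assms(2) by (simp add: v_def mult_le_0_iff zero_le_mult_iff)
  next
    case False
    have "u \<bullet> u = 1" using n by (simp add: norm_eq_1)
    moreover have "u \<bullet> v \<le> 1" using norm_cauchy_schwarz[of u v] n by simp
    ultimately show ?thesis using False that by (simp add: inner_diff_right)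
  qed
  then have "v \<bullet> (v - u) \<le> e * (v \<bullet> u)" if "e > 0" for e
    using that by (simp add: inner_diff_right)
  moreover have "v \<bullet> u \<le> 1" using norm_cauchy_schwarz[of v u] n by simp
  ultimately have "v \<bullet> (v - u) \<le> e" if "e > 0" for e
    using that mult_left_le[of "v \<bullet> u" e] by (meson less_imp_le order_trans)
  then have "v \<bullet> (v - u) \<le> 0" by (rule field_le_epsilon[of _ 0, simplified])
  then have "1 \<le> v \<bullet> u" using n by (simp add: inner_diff_right norm_eq_1)
  have "(norm (u - v))\<^sup>2 = 2 - 2 * (v \<bullet> u)"
    using n by (simp add: power2_norm_eq_inner inner_diff_left inner_diff_right norm_eq_1 inner_commute)
  then have "(norm (u - v))\<^sup>2 \<le> 0" using \<open>1 \<le> v \<bullet> u\<close> by simp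
  then show ?thesis by (simp add: u_def v_def)
qed

text \<open>The body of \<open>is_outward_normal\<close> with its witnesses turned into parameters,
  so that two such functions at the same point can be compared.\<close>

definition defining_function :: "'a::euclidean_space set \<Rightarrow> 'a \<Rightarrow> real \<Rightarrow> ('a \<Rightarrow> real) \<Rightarrow> ('a \<Rightarrow> 'a) \<Rightarrow> bool" where
  "defining_function \<Omega> x r \<phi> D \<longleftrightarrow> 0 < r \<and>
     (\<forall>y\<in>ball x r. (\<phi> has_derivative (\<lambda>h. D y \<bullet> h)) (at y)) \<and> continuous_on (ball x r) D \<and> D x \<noteq> 0 \<and>
     \<Omega> \<inter> ball x r = {y \<in> ball x r. \<phi> y < 0}"

lemma defining_functionD:
  assumes "defining_function \<Omega> x r \<phi> D"
  shows "0 < r" "\<And>y. y \<in> ball x r \<Longrightarrow> (\<phi> has_derivative (\<lambda>h. D y \<bullet> h)) (at y)"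
    "continuous_on (ball x r) D" "D x \<noteq> 0" "\<Omega> \<inter> ball x r = {y \<in> ball x r. \<phi> y < 0}"
    "(\<phi> has_derivative (\<lambda>h. D x \<bullet> h)) (at x)"
proof -
  note c = assms[unfolded defining_function_def]
  show r: "0 < r" by (rule c[THEN conjunct1])
  show d: "\<And>y. y \<in> ball x r \<Longrightarrow> (\<phi> has_derivative (\<lambda>h. D y \<bullet> h)) (at y)"
    by (rule c[THEN conjunct2, THEN conjunct1, rule_format])
  show "continuous_on (ball x r) D" by (rule c[THEN conjunct2, THEN conjunct2, THEN conjunct1])
  show "D x \<noteq> 0" by (rule c[THEN conjunct2, THEN conjunct2, THEN conjunct2, THEN conjunct1])
  show "\<Omega> \<inter> ball x r = {y \<in> ball x r. \<phi> y < 0}"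
    by (rule c[THEN conjunct2, THEN conjunct2, THEN conjunct2, THEN conjunct2])
  show "(\<phi> has_derivative (\<lambda>h. D x \<bullet> h)) (at x)" by (rule d) (simp add: r)
qed

text \<open>A negative value would put the boundary point into the open set itself; a positive value
  would, by continuity, keep a neighbourhood of it away from the set.\<close>

lemma defining_function_zero:
  assumes \<phi>: "defining_function \<Omega> x r \<phi> D" and o: "open \<Omega>" and x: "x \<in> frontier \<Omega>"
  shows "\<phi> x = 0"
proof -
  note r = defining_functionD(1)[OF \<phi>] and d = defining_functionD(6)[OF \<phi>] and eq = defining_functionD(5)[OF \<phi>]
  have "x \<notin> \<Omega>" "x \<in> closure \<Omega>" using x o by (auto simp: frontier_def interior_open)
  then have ge: "\<not> \<phi> x < 0" using eq r centre_in_ball[of x r] by blast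
  have "isCont \<phi> x" by (rule has_derivative_continuous[OF d])
  have "\<not> \<phi> x > 0"
  proof
    assume "\<phi> x > 0"
    then have "\<forall>\<^sub>F y in nhds x. \<phi> y > 0"
      using \<open>isCont \<phi> x\<close> unfolding isCont_def tendsto_at_iff_tendsto_nhds by (rule order_tendstoD(1)[rotated])
    moreover have "\<forall>\<^sub>F y in nhds x. y \<in> ball x r" using r by (intro eventually_nhds_in_open) auto
    ultimately have "\<forall>\<^sub>F y in nhds x. y \<notin> \<Omega>"
    proof eventually_elim
      case (elim y)
      then have "y \<notin> \<Omega> \<inter> ball x r" unfolding eq by simp
      then show ?case using elim(2) by blast
    qed
    then obtain S where "open S" "x \<in> S" "\<And>y. y \<in> S \<Longrightarrow> y \<notin> \<Omega>" unfolding eventually_nhds by blast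
    then show False using \<open>x \<in> closure \<Omega>\<close> by (meson closure_iff_nhds_not_empty disjoint_iff order_refl)
  qed
  with ge show ?thesis by simp
qed

text \<open>A direction along which one defining function decreases leads into
  \<open>\<Omega>\<close>, so no other defining function can increase along it. Hence their
  gradients have nested half-spaces and are positively parallel, which makes the definite
  description in \<open>outward_normal\<close> meaningful.\<close>

lemma outward_normal_eq:
  assumes \<phi>: "defining_function \<Omega> x r \<phi> D" and o: "open \<Omega>" and x: "x \<in> frontier \<Omega>"
  shows "outward_normal \<Omega> x = D x /\<^sub>R norm (D x)"
proof -
  have isn: "is_outward_normal \<Omega> x \<nu> \<longleftrightarrow> (\<exists>r \<phi> D. defining_function \<Omega> x r \<phi> D \<and> \<nu> = D x /\<^sub>R norm (D x))" for \<nu>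
    unfolding is_outward_normal_def defining_function_def by blast
  have dec: "\<exists>d>0. \<forall>t. 0 < t \<and> t < d \<longrightarrow> \<phi> (x + t *\<^sub>R h) < 0"
    if d: "defining_function \<Omega> x r \<phi> D" "D x \<bullet> h < 0" for r \<phi> D h
  proof -
    have "(\<phi> has_derivative (\<lambda>h. D x \<bullet> h)) (at x)" by (rule defining_functionD(6)[OF d(1)])
    then have "((\<lambda>t. \<phi> (x + t *\<^sub>R h)) has_derivative (\<lambda>t. D x \<bullet> (t *\<^sub>R h))) (at 0)"
      by (intro has_derivative_compose[where g=\<phi> and f="\<lambda>t. x + t *\<^sub>R h"])
         (auto intro!: derivative_eq_intros)
    then have "((\<lambda>t. \<phi> (x + t *\<^sub>R h)) has_real_derivative (D x \<bullet> h)) (at 0)"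
      by (simp add: has_field_derivative_def mult_commute_abs)
    from DERIV_neg_dec_right[OF this d(2)] show ?thesis
      using defining_function_zero[OF d(1) o x] by auto
  qed
  have uniq: "D x /\<^sub>R norm (D x) = D2 x /\<^sub>R norm (D2 x)" if d2: "defining_function \<Omega> x r2 \<phi>2 D2" for r2 \<phi>2 D2
  proof (rule halfspace_subset_imp_parallel)
    show "D x \<noteq> 0" "D2 x \<noteq> 0" by (rule defining_functionD(4)[OF \<phi>] defining_functionD(4)[OF d2])+
    fix h assume h: "D x \<bullet> h < 0"
    show "D2 x \<bullet> h \<le> 0"
    proof (rule ccontr)
      assume "\<not> D2 x \<bullet> h \<le> 0"
      then have pos: "D2 x \<bullet> h > 0" by simp
      obtain d where d: "0 < d" "\<And>t. 0 < t \<Longrightarrow> t < d \<Longrightarrow> \<phi> (x + t *\<^sub>R h) < 0" using dec[OF \<phi> h] by blast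
      have "(\<phi>2 has_derivative (\<lambda>h. D2 x \<bullet> h)) (at x)" by (rule defining_functionD(6)[OF d2])
      then have "((\<lambda>t. \<phi>2 (x + t *\<^sub>R h)) has_derivative (\<lambda>t. D2 x \<bullet> (t *\<^sub>R h))) (at 0)"
        by (intro has_derivative_compose[where g=\<phi>2 and f="\<lambda>t. x + t *\<^sub>R h"])
           (auto intro!: derivative_eq_intros)
      then have "((\<lambda>t. \<phi>2 (x + t *\<^sub>R h)) has_real_derivative (D2 x \<bullet> h)) (at 0)"
        by (simp add: has_field_derivative_def mult_commute_abs)
      from DERIV_pos_inc_right[OF this pos] obtain d' where d': "0 < d'" "\<And>t. 0 < t \<Longrightarrow> t < d' \<Longrightarrow> 0 < \<phi>2 (x + t *\<^sub>R h)"
        using defining_function_zero[OF d2 o x] by auto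
      have r: "0 < r" "0 < r2" by (rule defining_functionD(1)[OF \<phi>] defining_functionD(1)[OF d2])+
      \<comment> \<open>A bound for the step length that serves both one-sided derivative tests and
        both balls; adding 1 to the norm of h avoids dividing by it, and half of m satisfies all
        bounds strictly.\<close>
      define m where "m = Min {d, d', r / (norm h + 1), r2 / (norm h + 1)}"
      have np: "norm h + 1 > 0" using norm_ge_zero[of h] by linarith
      have m: "0 < m" "m \<le> d" "m \<le> d'" "m \<le> r / (norm h + 1)" "m \<le> r2 / (norm h + 1)"
        unfolding m_def using d(1) d'(1) r np by auto
      define t where "t = m / 2"
      have t: "0 < t" "t < d" "t < d'" using m by (auto simp: t_def)
      have "t * (norm h + 1) < r" "t * (norm h + 1) < r2"
        using m np r by (auto simp: t_def field_simps)
      then have "t * norm h < r" "t * norm h < r2" using t(1) by (auto simp: algebra_simps)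
      then have "x + t *\<^sub>R h \<in> ball x r" "x + t *\<^sub>R h \<in> ball x r2" using t(1) by (auto simp: dist_norm)
      then have "\<phi>2 (x + t *\<^sub>R h) < 0"
        using d(2)[OF t(1,2)] defining_functionD(5)[OF \<phi>] defining_functionD(5)[OF d2] by blast
      then show False using d'(2)[OF t(1,3)] by simp
    qed
  qed
  show ?thesis unfolding outward_normal_def isn
  proof (rule the_equality)
    show "\<exists>r \<phi> D'. defining_function \<Omega> x r \<phi> D' \<and> D x /\<^sub>R norm (D x) = D' x /\<^sub>R norm (D' x)"
      using \<phi> by blast
    fix \<nu> assume "\<exists>r \<phi> D. defining_function \<Omega> x r \<phi> D \<and> \<nu> = D x /\<^sub>R norm (D x)"
    then obtain r2 \<phi>2 D2 where d2: "defining_function \<Omega> x r2 \<phi>2 D2" and \<nu>: "\<nu> = D2 x /\<^sub>R norm (D2 x)" by blast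
    show "\<nu> = D x /\<^sub>R norm (D x)" unfolding \<nu> by (rule uniq[OF d2, symmetric])
  qed
qed

section \<open>Boundary charts and the boundary strip\<close>

text \<open>A local defining function that decreases with exact unit slope along e on the whole
  space. Translation along e therefore shifts its level sets into each other, which is what measures
  the boundary strip.\<close>

definition graph_chart :: "'a::euclidean_space set \<Rightarrow> 'a \<Rightarrow> real \<Rightarrow> 'a \<Rightarrow> ('a \<Rightarrow> real) \<Rightarrow> ('a \<Rightarrow> 'a) \<Rightarrow> bool" where
  "graph_chart \<Omega> x0 r e \<phi> D \<longleftrightarrow> 0 < r \<and> norm e = 1 \<and>
     (\<forall>y. (\<phi> has_derivative (\<lambda>h. D y \<bullet> h)) (at y)) \<and> continuous_on UNIV D \<and>
     (\<forall>y s. \<phi> (y + s *\<^sub>R e) = \<phi> y - s) \<and>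
     \<Omega> \<inter> ball x0 r = {y \<in> ball x0 r. \<phi> y < 0}"

lemma graph_chartD:
  assumes "graph_chart \<Omega> x0 r e \<phi> D"
  shows "0 < r" "norm e = 1" "\<And>y. (\<phi> has_derivative (\<lambda>h. D y \<bullet> h)) (at y)" "continuous_on UNIV D"
    "\<And>y s. \<phi> (y + s *\<^sub>R e) = \<phi> y - s" "\<Omega> \<inter> ball x0 r = {y \<in> ball x0 r. \<phi> y < 0}"
    "continuous_on UNIV \<phi>"
proof -
  show "\<And>y. (\<phi> has_derivative (\<lambda>h. D y \<bullet> h)) (at y)" using assms unfolding graph_chart_def by simp
  then show "continuous_on UNIV \<phi>" by (rule has_derivative_imp_continuous_on)
qed (use assms in \<open>auto simp: graph_chart_def\<close>)

text \<open>Take the graph function at the projection orthogonal to e, minus the coordinate along e: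
  moving along e leaves the projection fixed and changes the second term linearly.\<close>

lemma graph_chart_exists:
  fixes \<Omega> :: "'a::euclidean_space set"
  assumes "C2_holder_domain \<alpha> \<Omega>" "x0 \<in> frontier \<Omega>"
  shows "\<exists>r e \<phi> D. graph_chart \<Omega> x0 r e \<phi> D"
proof -
  obtain r e \<gamma> where *: "0 < r" "norm e = 1" "C2_holder \<alpha> \<gamma>"
    "\<Omega> \<inter> ball x0 r = {x \<in> ball x0 r. \<gamma> (x - (x \<bullet> e) *\<^sub>R e) < x \<bullet> e}"
    using assms unfolding C2_holder_domain_def by blast
  then obtain Du D2u where D: "\<And>x. (\<gamma> has_derivative (\<lambda>h. Du x \<bullet> h)) (at x)" "\<And>x. (Du has_derivative D2u x) (at x)"
    unfolding C2_holder_def by blast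
  have Dc: "continuous_on UNIV Du" by (rule has_derivative_imp_continuous_on[OF D(2)])
  define P where "P x = x - (x \<bullet> e) *\<^sub>R e" for x :: 'a
  define \<phi> where "\<phi> x = \<gamma> (P x) - x \<bullet> e" for x
  define D where "D x = Du (P x) - (Du (P x) \<bullet> e) *\<^sub>R e - e" for x
  have ee: "e \<bullet> e = 1" using *(2) by (simp add: norm_eq_1)
  have "(\<phi> has_derivative (\<lambda>h. D y \<bullet> h)) (at y)" for y
  proof -
    have "(P has_derivative (\<lambda>h. h - (h \<bullet> e) *\<^sub>R e)) (at y)"
      unfolding P_def[abs_def] by (auto intro!: derivative_eq_intros)
    from has_derivative_compose[OF this D(1)[of "P y"]]
    have "(\<phi> has_derivative (\<lambda>h. Du (P y) \<bullet> (h - (h \<bullet> e) *\<^sub>R e) - h \<bullet> e)) (at y)"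
      unfolding \<phi>_def[abs_def] by (auto intro!: derivative_eq_intros)
    then show ?thesis by (simp add: D_def algebra_simps inner_commute)
  qed
  moreover have "continuous_on UNIV D"
    unfolding D_def[abs_def] P_def[abs_def]
    by (intro continuous_intros continuous_on_compose2[OF Dc]) auto
  moreover have "\<phi> (y + s *\<^sub>R e) = \<phi> y - s" for y s
    by (simp add: \<phi>_def P_def ee algebra_simps)
  moreover have "\<Omega> \<inter> ball x0 r = {y \<in> ball x0 r. \<phi> y < 0}" using *(4) by (simp add: \<phi>_def P_def)
  ultimately show ?thesis using *(1,2) unfolding graph_chart_def by blast
qed

lemma graph_chart_normal:
  assumes c: "graph_chart \<Omega> x0 r e \<phi> D" and o: "open \<Omega>" and x: "x \<in> frontier \<Omega>" "x \<in> ball x0 r"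
  shows "outward_normal \<Omega> x = D x /\<^sub>R norm (D x)" "D x \<noteq> 0"
proof -
  note c = graph_chartD[OF c]
  have "((\<lambda>s. \<phi> (x + s *\<^sub>R e)) has_derivative (\<lambda>s. D x \<bullet> (s *\<^sub>R e))) (at 0)"
    by (rule has_derivative_compose[where g=\<phi> and f="\<lambda>s. x + s *\<^sub>R e"])
       (use c(3)[of x] in \<open>auto intro!: derivative_eq_intros\<close>)
  moreover have "((\<lambda>s. \<phi> (x + s *\<^sub>R e)) has_derivative (\<lambda>s. - s)) (at 0)"
    unfolding c(5) by (auto intro!: derivative_eq_intros)
  ultimately have "(\<lambda>s. D x \<bullet> (s *\<^sub>R e)) = (\<lambda>s. - s)" by (rule has_derivative_unique)
  \<comment> \<open>Comparing the two derivatives along e at increment 1 gives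
    \<open>D x \<bullet> e = - 1\<close>, so the gradient cannot vanish at any point.\<close>
  from fun_cong[OF this, of 1] show n: "D x \<noteq> 0" by auto
  define r' where "r' = r - dist x0 x"
  have r': "0 < r'" using x(2) by (simp add: r'_def)
  have sub: "ball x r' \<subseteq> ball x0 r"
  proof
    fix y assume "y \<in> ball x r'"
    then show "y \<in> ball x0 r" using dist_triangle[of x0 y x] by (simp add: r'_def)
  qed
  have "defining_function \<Omega> x r' \<phi> D"
    unfolding defining_function_def
  proof (intro conjI)
    show "\<Omega> \<inter> ball x r' = {y \<in> ball x r'. \<phi> y < 0}" using c(6) sub by blast
  qed (use r' c n in \<open>auto intro: continuous_on_subset\<close>)
  then show "outward_normal \<Omega> x = D x /\<^sub>R norm (D x)" by (rule outward_normal_eq[OF _ o x(1)])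
qed

text \<open>
  The strip \<open>0 \<le> - \<phi> < 1/n\<close> has measure \<open>O(1/n)\<close>, since its translates by the multiples of \<open>e/n\<close> are
  disjoint.
\<close>

lemma graph_strip_measure:
  assumes c: "graph_chart \<Omega> x0 r e \<phi> D" and n: "0 < n"
  shows "measure lebesgue {x \<in> ball x0 R. 0 \<le> - \<phi> x \<and> - \<phi> x < 1 / real n} \<le> measure lebesgue (ball x0 (R + 1)) / n"
proof -
  note c = graph_chartD[OF c]
  define S where "S = {x \<in> ball x0 R. 0 \<le> - \<phi> x \<and> - \<phi> x < 1 / real n}"
  define T where "T j = (+) ((real j / n) *\<^sub>R e) ` S" for j
  have Sb: "S \<in> sets borel"
  proof -
    have [measurable]: "\<phi> \<in> borel_measurable borel" using c(7) by (rule borel_measurable_continuous_onI)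
    have "S = ball x0 R \<inter> {x \<in> space borel. 0 \<le> - \<phi> x \<and> - \<phi> x < 1 / real n}" by (auto simp: S_def)
    also have "\<dots> \<in> sets borel" by measurable
    finally show ?thesis .
  qed
  have "bounded S" unfolding S_def by (rule bounded_subset[OF bounded_ball[of x0 R]]) auto
  then have Sm: "S \<in> lmeasurable" using Sb by (intro bounded_set_imp_lmeasurable) auto
  have Tm: "T j \<in> lmeasurable" "measure lebesgue (T j) = measure lebesgue S" for j
    unfolding T_def using Sm by (simp_all add: measurable_translation measure_translation)
  have \<phi>T: "real j / n \<le> - \<phi> x \<and> - \<phi> x < real (Suc j) / n" if x: "x \<in> T j" for j x
  proof -
    obtain y where "y \<in> S" "x = (real j / n) *\<^sub>R e + y" using x unfolding T_def by blast
    then show ?thesis using c(5)[of y "real j / n"] by (auto simp: S_def add_divide_distrib add.commute)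
  qed
  have disj: "disjnt (T i) (T j)" if "i < j" for i j
  proof -
    have "real (Suc i) / n \<le> real j / n" using that n by (intro divide_right_mono) auto
    then show ?thesis using \<phi>T[of _ i] \<phi>T[of _ j] unfolding disjnt_def by force
  qed
  \<comment> \<open>The translations have length j / n with j < n, so a margin of 1 around the ball
    is enough for all of them.\<close>
  have sub: "(\<Union>j<n. T j) \<subseteq> ball x0 (R + 1)"
  proof
    fix x assume "x \<in> (\<Union>j<n. T j)"
    then obtain j y where j: "j < n" "y \<in> S" "x = (real j / n) *\<^sub>R e + y" unfolding T_def by blast
    have "dist x0 x \<le> dist x0 y + norm ((real j / n) *\<^sub>R e)"
      using dist_triangle[of x0 x y] j(3) by (simp add: dist_norm)
    also have "norm ((real j / n) *\<^sub>R e) \<le> 1" using j(1) c(2) by (simp add: divide_le_eq)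
    finally show "x \<in> ball x0 (R + 1)" using j(2) by (simp add: S_def)
  qed
  have "n * measure lebesgue S = (\<Sum>j<n. measure lebesgue (T j))" by (simp add: Tm(2))
  also have "\<dots> = measure lebesgue (\<Union>j<n. T j)"
    by (rule measure_UNION'[symmetric])
       (use Tm(1) disj in \<open>auto simp: pairwise_def disjnt_sym neq_iff\<close>)
  also have "\<dots> \<le> measure lebesgue (ball x0 (R + 1))"
    by (rule measure_mono_fmeasurable[OF sub]) (use Tm(1) in \<open>auto intro!: sets.finite_UN\<close>)
  finally show ?thesis using n by (simp add: S_def field_simps)
qed

definition smooth_step :: "real \<Rightarrow> real" where
  "smooth_step s = smooth_cut 0 s / (smooth_cut 0 s + smooth_cut 0 (1 - s))"

lemma smooth_step_values: "s \<le> 0 \<Longrightarrow> smooth_step s = 0" "1 \<le> s \<Longrightarrow> smooth_step s = 1"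
  "0 \<le> smooth_step s" "smooth_step s \<le> 1"
  by (auto simp: smooth_step_def smooth_cut_def divide_le_eq_1 add_pos_pos)

lemma smooth_step_deriv:
  "\<exists>h C. continuous_on UNIV h \<and> (\<forall>s. (smooth_step has_real_derivative h s) (at s)) \<and> (\<forall>s. \<bar>h s\<bar> \<le> C)"
proof -
  define den where "den s = smooth_cut 0 s + smooth_cut 0 (1 - s)" for s
  have den: "den s > 0" for s
    by (auto simp: den_def smooth_cut_def add_pos_pos)
  have dcut: "(smooth_cut 0 has_real_derivative smooth_cut 2 s) (at s)" for s
    using smooth_cut_deriv[of 0 s] by (simp add: numeral_2_eq_2)
  have dcut': "((\<lambda>s. smooth_cut 0 (1 - s)) has_real_derivative - smooth_cut 2 (1 - s)) (at s)" for s
  proof -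
    have "((\<lambda>s::real. 1 - s) has_real_derivative -1) (at s)" by (auto intro!: derivative_eq_intros)
    with dcut[of "1 - s"] have "((\<lambda>s. smooth_cut 0 (1 - s)) has_real_derivative smooth_cut 2 (1 - s) * -1) (at s)"
      by (rule DERIV_chain2[where f="smooth_cut 0" and g="\<lambda>s. 1 - s"])
    then show ?thesis by simp
  qed
  have cc: "continuous_on UNIV (smooth_cut n)" for n
    by (rule DERIV_continuous_on[OF smooth_cut_deriv])
  have cc': "continuous_on UNIV (\<lambda>s. smooth_cut n (1 - s))" for n
    by (rule continuous_on_compose2[OF cc]) (auto intro!: continuous_intros)
  define h where "h s = (smooth_cut 2 s * den s - smooth_cut 0 s * (smooth_cut 2 s - smooth_cut 2 (1 - s))) / (den s * den s)" for s
  have d: "(smooth_step has_real_derivative h s) (at s)" for s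
  proof -
    have "(den has_real_derivative (smooth_cut 2 s - smooth_cut 2 (1 - s))) (at s)"
      unfolding den_def[abs_def] using DERIV_add[OF dcut dcut'] by simp
    from DERIV_divide[OF dcut this] den[of s] show ?thesis
      unfolding smooth_step_def[abs_def] h_def by (simp add: den_def)
  qed
  have dc: "continuous_on UNIV den" unfolding den_def[abs_def] by (intro continuous_intros cc cc')
  have hc: "continuous_on UNIV h"
    unfolding h_def[abs_def] using den
    by (intro continuous_intros cc cc' dc) (auto simp: less_imp_neq[symmetric])
  obtain C where C: "\<forall>s\<in>{0..1}. norm (h s) \<le> C"
    using compact_imp_bounded[OF compact_continuous_image[OF continuous_on_subset[OF hc subset_UNIV] compact_Icc[of 0 1]]]
    by (auto simp: bounded_iff)
  have "h s = 0" if "s \<notin> {0..1}" for s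
    using that by (auto simp: h_def den_def smooth_cut_def)
  then have "\<bar>h s\<bar> \<le> max C 0" for s using C[rule_format, of s] by (cases "s \<in> {0..1}") auto
  then show ?thesis using hc d by blast
qed

lemma bdd_deriv_dvg_integrable:
  assumes o: "open \<Omega>" and b: "bounded \<Omega>" and V: "bdd_deriv \<Omega> V V'"
    and m: "(\<lambda>x. dvg (V' x)) \<in> borel_measurable (lebesgue_on \<Omega>)"
  shows "integrable (lebesgue_on \<Omega>) (\<lambda>x. dvg (V' x))"
proof -
  obtain C where C: "0 < C" "\<And>x. x \<in> \<Omega> \<Longrightarrow> (V has_derivative V' x) (at x)"
    "\<And>x h. x \<in> \<Omega> \<Longrightarrow> norm (V' x h) \<le> C * norm h" using bdd_derivE[OF V] by blast
  have "\<Omega> \<in> lmeasurable" using o b by (simp add: lmeasurable_open)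
  then have fm: "finite_measure (lebesgue_on \<Omega>)" by (rule finite_measure_lebesgue_on)
  show ?thesis
    by (rule finite_measure.integrable_const_bound[OF fm _ m, of "DIM('a) * C"])
       (use abs_dvg_le[OF C(3)] in \<open>auto intro!: AE_I2\<close>)
qed

lemma has_derivative_zero_if_locally_zero:
  assumes "(V has_derivative L) (at x)" "open U" "x \<in> U" "\<And>y. y \<in> U \<Longrightarrow> V y = 0"
  shows "L = (\<lambda>h. 0)"
proof -
  have "((\<lambda>x. 0) has_derivative L) (at x)"
    by (rule has_derivative_transform_within_open[OF assms(1-3)]) (rule assms(4))
  then show ?thesis by (rule has_derivative_unique[OF _ has_derivative_const])
qed

lemma smooth_step_deriv_gt_1:
  assumes "\<And>s. (smooth_step has_real_derivative h s) (at s)" "1 < s"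
  shows "h s = 0"
proof -
  have "((\<lambda>s. 1) has_real_derivative h s) (at s)"
    by (rule has_field_derivative_transform_within_open[OF assms(1), where S="{1<..}"])
       (use assms(2) in \<open>auto simp: smooth_step_values\<close>)
  then show ?thesis using DERIV_unique[OF _ DERIV_const] by blast
qed

text \<open>At the end of the transition the step attains its maximum. The point needs its own
  argument, as the step is not constant on both sides of it.\<close>

lemma smooth_step_deriv_1:
  assumes h: "\<And>s. (smooth_step has_real_derivative h s) (at s)"
  shows "h 1 = 0"
  by (rule DERIV_local_max[OF h zero_less_one]) (simp add: smooth_step_values)

lemma integrable_indicator_lebesgue_on:
  assumes "T \<in> lmeasurable" "S \<in> sets lebesgue"
  shows "integrable (lebesgue_on T) (\<lambda>x. indicator S x :: real)"
proof -
  have T: "T \<in> sets lebesgue" using assms(1) by (simp add: fmeasurable_def)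
  have "T \<inter> S \<in> lmeasurable" using assms by (simp add: fmeasurable_Int_fmeasurable)
  then have "integrable lebesgue (\<lambda>x. indicator (T \<inter> S) x :: real)"
    by (intro integrable_real_indicator) (auto simp: fmeasurable_def)
  then show ?thesis by (simp add: integrable_lebesgue_onI(1)[OF T] indicator_inter_arith)
qed

lemma integral_indicator_lebesgue_on_le:
  assumes "T \<in> lmeasurable" "S \<in> lmeasurable"
  shows "(LINT x|lebesgue_on T. indicator S x) \<le> measure lebesgue S"
proof -
  have T: "T \<in> sets lebesgue" using assms(1) by (simp add: fmeasurable_def)
  have "(LINT x|lebesgue_on T. indicator S x :: real) = (LINT x|lebesgue. indicator (T \<inter> S) x)"
    by (subst integrable_lebesgue_onI(2)[OF T], rule Bochner_Integration.integral_cong) (auto simp: indicator_def)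
  also have "\<dots> = measure lebesgue (T \<inter> S)" by simp
  also have "\<dots> \<le> measure lebesgue S" by (rule measure_mono_fmeasurable) (use assms T in \<open>auto simp: fmeasurable_def\<close>)
  finally show ?thesis .
qed

text \<open>Cutting V off at distance 1/n from the boundary gives a compactly supported field, whose
  divergence has integral zero. The error is the gradient of the cutoff times V: its size is n times
  the normal component of V, on a strip of measure O(1/n). The normal component vanishes at the
  boundary and is continuous, hence uniformly small in the strip, and the error tends to 0.\<close>

lemma integral_div_chart:
  fixes V :: "'a::euclidean_space \<Rightarrow> 'a"
  assumes c: "graph_chart \<Omega> x0 r e \<phi> D" and r': "0 < r'" "r' < r" and o: "open \<Omega>" and b: "bounded \<Omega>"
    and Vc: "continuous_on (closure \<Omega>) V" and V: "bdd_deriv \<Omega> V V'"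
    and V0: "\<And>x. x \<in> closure \<Omega> \<Longrightarrow> x \<notin> ball x0 r' \<Longrightarrow> V x = 0"
    and nrm: "\<And>x. x \<in> frontier \<Omega> \<Longrightarrow> V x \<bullet> outward_normal \<Omega> x = 0"
  shows "integrable (lebesgue_on \<Omega>) (\<lambda>x. dvg (V' x))" "(LINT x|lebesgue_on \<Omega>. dvg (V' x)) = 0"
proof -
  note cd = graph_chartD[OF c]
  obtain C where C: "0 < C" "\<And>x. x \<in> \<Omega> \<Longrightarrow> (V has_derivative V' x) (at x)"
    "\<And>x h. x \<in> \<Omega> \<Longrightarrow> norm (V' x h) \<le> C * norm h" using bdd_derivE[OF V] by blast
  obtain h Ch where h: "continuous_on UNIV h" "\<And>s. (smooth_step has_real_derivative h s) (at s)" "\<And>s. \<bar>h s\<bar> \<le> Ch"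
    using smooth_step_deriv by blast
  have Ch0: "0 \<le> Ch" using h(3)[of 0] by linarith
  define Z where "Z = closure \<Omega> \<inter> cball x0 r'"
  have Zc: "compact Z" unfolding Z_def using b by (simp add: compact_Int_closed closed_Int_compact)
  have Zball: "Z \<subseteq> ball x0 r" using r' by (auto simp: Z_def)
  have Zneg: "\<phi> x \<le> 0" if "x \<in> Z" for x
  proof -
    have "x \<in> closure \<Omega>" "x \<in> ball x0 r" using that Zball by (auto simp: Z_def)
    then have "x \<in> closure (\<Omega> \<inter> ball x0 r)"
      using open_Int_closure_subset[of "ball x0 r" \<Omega>] by (auto simp: Int_commute)
    moreover have "closure (\<Omega> \<inter> ball x0 r) \<subseteq> {x. \<phi> x \<le> 0}"
      by (rule closure_minimal) (use cd(6) closed_Collect_le[OF cd(7) continuous_on_const] in auto)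
    ultimately show ?thesis by blast
  qed
  have Zin: "x \<in> \<Omega>" if "x \<in> Z" "\<phi> x < 0" for x using that cd(6) Zball by blast
  have Zfr: "V x \<bullet> D x = 0" if "x \<in> Z" "\<phi> x = 0" for x
  proof -
    have "x \<notin> \<Omega>" using that cd(6) Zball by force
    then have f: "x \<in> frontier \<Omega>" using that(1) o by (simp add: frontier_def interior_open Z_def)
    have "x \<in> ball x0 r" using that Zball by blast
    from nrm[OF f] graph_chart_normal[OF c o f this] show ?thesis by simp
  qed
  define \<omega> where "\<omega> x = \<bar>V x \<bullet> D x\<bar>" for x
  have \<omega>c: "continuous_on Z \<omega>" unfolding \<omega>_def
    by (intro continuous_intros continuous_on_subset[OF Vc] continuous_on_subset[OF cd(4)]) (auto simp: Z_def)
  have small: "\<exists>n0>0. \<forall>x\<in>Z. - \<phi> x < 1 / real n0 \<longrightarrow> \<omega> x < \<rho>" if "0 < \<rho>" for \<rho>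
  proof -
    \<comment> \<open>Compactness replaces a modulus of continuity: where the normal component is at
      least \<rho> the function \<phi> cannot vanish, so on this compact set \<open>- \<phi>\<close>
      has a positive minimum, and a strip below that minimum avoids it.\<close>
    define W where "W = {x \<in> Z. \<rho> \<le> \<omega> x}"
    have Wc: "compact W"
    proof -
      have "W = Z \<inter> \<omega> -` {\<rho>..}" by (auto simp: W_def)
      then have "closed W"
        using continuous_closed_preimage[OF \<omega>c compact_imp_closed[OF Zc] closed_atLeast] by simp
      moreover have "bounded W"
        by (rule bounded_subset[OF compact_imp_bounded[OF Zc]]) (auto simp: W_def)
      ultimately show ?thesis by (simp add: compact_eq_bounded_closed)
    qed
    show ?thesis
    proof (cases "W = {}")
      case True
      then show ?thesis by (intro exI[of _ 1]) (auto simp: W_def not_le)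
    next
      case False
      have "continuous_on W (\<lambda>x. - \<phi> x)" by (intro continuous_intros continuous_on_subset[OF cd(7)]) auto
      from continuous_attains_inf[OF Wc False this] obtain w where w: "w \<in> W" "\<And>x. x \<in> W \<Longrightarrow> - \<phi> w \<le> - \<phi> x" by blast
      have "\<phi> w \<noteq> 0" using w(1) Zfr[of w] that by (auto simp: W_def \<omega>_def)
      then have "0 < - \<phi> w" using Zneg[of w] w(1) by (auto simp: W_def)
      then obtain n where n: "n > 0" "inverse (real n) < - \<phi> w" using ex_inverse_of_nat_less by blast
      have "\<omega> x < \<rho>" if "x \<in> Z" "- \<phi> x < 1 / real n" for x
        using w(2)[of x] that n(2) by (auto simp: W_def inverse_eq_divide not_le[symmetric])
      then show ?thesis using n(1) by blast
    qed
  qed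
  obtain BV where BV: "\<forall>x\<in>closure \<Omega>. norm (V x) \<le> BV"
    using compact_imp_bounded[OF compact_continuous_image[OF Vc]] b by (auto simp: bounded_iff compact_closure)
  obtain BD where BD: "\<forall>x\<in>cball x0 r. norm (D x) \<le> BD"
    using compact_continuous_bounded[OF compact_cball continuous_on_subset[OF cd(4) subset_UNIV]] by blast
  \<comment> \<open>Zero where \<open>- \<phi>\<close> is at most 1/(2n), one where it is at least
    1/n, with slope of order n in between.\<close>
  define \<psi> where "\<psi> n x = smooth_step (- \<phi> x * (2 * real n) - 1)" for n x
  define \<psi>' where "\<psi>' n x k = - (2 * real n) * h (- \<phi> x * (2 * real n) - 1) * (D x \<bullet> k)" for n x k
  have \<psi>d: "(\<psi> n has_derivative \<psi>' n x) (at x)" for n x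
  proof -
    have "((\<lambda>x. - \<phi> x * (2 * real n) - 1) has_derivative (\<lambda>k. - (D x \<bullet> k) * (2 * real n))) (at x)"
      using cd(3)[of x] by (auto intro!: derivative_eq_intros)
    from has_derivative_compose[OF this h(2)[unfolded has_field_derivative_def]]
    show ?thesis unfolding \<psi>_def[abs_def] \<psi>'_def by (simp add: mult_ac)
  qed
  have \<psi>c: "continuous_on UNIV (\<psi> n)" for n by (rule has_derivative_imp_continuous_on[OF \<psi>d])
  have \<psi>b: "0 \<le> \<psi> n x" "\<psi> n x \<le> 1" for n x unfolding \<psi>_def by (rule smooth_step_values)+
  define W where "W n x = \<psi> n x *\<^sub>R V x" for n x
  define W' where "W' n x k = \<psi> n x *\<^sub>R V' x k + \<psi>' n x k *\<^sub>R V x" for n x k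
  define K where "K n = {x \<in> cball x0 r'. \<phi> x \<le> - 1 / (2 * real n)}" for n
  have Kc: "compact (K n)" for n
  proof -
    have "closed {x. \<phi> x \<le> - 1 / (2 * real n)}" by (intro closed_Collect_le cd(7) continuous_on_const)
    then have "compact (cball x0 r' \<inter> {x. \<phi> x \<le> - 1 / (2 * real n)})" by (intro compact_Int_closed compact_cball)
    moreover have "cball x0 r' \<inter> {x. \<phi> x \<le> - 1 / (2 * real n)} = K n" unfolding K_def by blast
    ultimately show ?thesis by simp
  qed
  have Ksub: "K n \<subseteq> \<Omega>" "K n \<subseteq> cball x0 r" if "0 < n" for n
  proof -
    have "- 1 / (2 * real n) < 0" using that by simp
    then have neg: "\<phi> x < 0" if "x \<in> K n" for x using that unfolding K_def by (auto intro: le_less_trans)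
    have sub: "K n \<subseteq> ball x0 r" using r' by (auto simp: K_def)
    then show "K n \<subseteq> cball x0 r" by auto
    show "K n \<subseteq> \<Omega>"
    proof
      fix x assume "x \<in> K n"
      then have "x \<in> \<Omega> \<inter> ball x0 r" unfolding cd(6) using neg sub by blast
      then show "x \<in> \<Omega>" by blast
    qed
  qed
  have Wd: "(W n has_derivative W' n x) (at x)" if "x \<in> \<Omega>" for n x
    unfolding W_def[abs_def] W'_def by (rule has_derivative_scaleR[OF \<psi>d C(2)[OF that]])
  have W0: "W n x = 0" if "x \<in> \<Omega> - K n" "0 < n" for n x
  proof (cases "x \<in> ball x0 r'")
    case True
    then have "- 1 / (2 * real n) < \<phi> x" using that by (auto simp: K_def not_le)
    then have "- \<phi> x * (2 * real n) - 1 \<le> 0" using that(2) by (simp add: field_simps)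
    then show ?thesis by (simp add: W_def \<psi>_def smooth_step_values)
  next
    case False
    then show ?thesis using V0[of x] that closure_subset[of \<Omega>] by (auto simp: W_def)
  qed
  have Wb: "norm (W' n x k) \<le> (C + 2 * real n * Ch * BD * BV) * norm k" if "x \<in> K n" "0 < n" for n x k
  proof -
    have x: "x \<in> \<Omega>" "x \<in> cball x0 r" "x \<in> closure \<Omega>" using Ksub[OF that(2)] that(1) closure_subset[of \<Omega>] by blast+
    have "\<bar>D x \<bullet> k\<bar> \<le> norm (D x) * norm k" by (rule Cauchy_Schwarz_ineq2)
    also have "\<dots> \<le> BD * norm k" using BD x(2) by (intro mult_right_mono) auto
    finally have "\<bar>D x \<bullet> k\<bar> \<le> BD * norm k" .
    then have p: "\<bar>\<psi>' n x k\<bar> \<le> 2 * real n * Ch * (BD * norm k)"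
      unfolding \<psi>'_def abs_mult using h(3) Ch0 by (intro mult_mono) auto
    have "norm (\<psi>' n x k *\<^sub>R V x) \<le> (2 * real n * Ch * (BD * norm k)) * BV"
      unfolding norm_scaleR
      by (rule mult_mono[OF p bspec[OF BV x(3)] order_trans[OF abs_ge_zero p] norm_ge_zero])
    moreover have "norm (\<psi> n x *\<^sub>R V' x k) \<le> 1 * (C * norm k)"
      unfolding norm_scaleR using \<psi>b[of n x] C(3)[OF x(1), of k] C(1) by (intro mult_mono) auto
    ultimately show ?thesis unfolding W'_def by (intro norm_triangle_le) (simp add: algebra_simps)
  qed
  have Wint: "integrable (lebesgue_on \<Omega>) (\<lambda>x. dvg (W' n x))" "(LINT x|lebesgue_on \<Omega>. dvg (W' n x)) = 0" if "0 < n" for n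
    using integral_div_compact_support[OF o Kc Ksub(1)[OF that] W0[OF _ that] Wd Wb[OF _ that]] by simp_all
  have Wdvg: "dvg (W' n x) = \<psi> n x * dvg (V' x) - 2 * real n * h (- \<phi> x * (2 * real n) - 1) * (V x \<bullet> D x)" for n x
  proof -
    have "W' n x = (\<lambda>k. \<psi> n x *\<^sub>R V' x k + (((- (2 * real n) * h (- \<phi> x * (2 * real n) - 1)) *\<^sub>R D x) \<bullet> k) *\<^sub>R V x)"
      by (simp add: W'_def \<psi>'_def fun_eq_iff)
    then show ?thesis
      by (simp only: dvg_add dvg_scaleR dvg_rank_one) (simp add: inner_commute[of "V x"])
  qed
  have out: "dvg (V' x) = 0 \<and> V x \<bullet> D x = 0" if x: "x \<in> \<Omega>" "x \<notin> cball x0 r'" for x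
  proof -
    have "V' x = (\<lambda>h. 0)"
    proof (rule has_derivative_zero_if_locally_zero[OF C(2)[OF x(1)]])
      show "open (\<Omega> - cball x0 r')" using o by (simp add: open_Diff)
      show "V y = 0" if "y \<in> \<Omega> - cball x0 r'" for y
        using that V0[of y] closure_subset[of \<Omega>] by auto
    qed (use x in simp)
    moreover have "V x = 0" using x V0[of x] closure_subset[of \<Omega>] by auto
    ultimately show ?thesis by (simp add: dvg_def)
  qed
  have lim: "(\<lambda>n. \<psi> n x * dvg (V' x)) \<longlonglongrightarrow> dvg (V' x)" if x: "x \<in> \<Omega>" for x
  proof (cases "x \<in> cball x0 r'")
    case True
    then have "x \<in> Z" "x \<in> ball x0 r" using x r' closure_subset[of \<Omega>] by (auto simp: Z_def)
    then have "\<phi> x < 0" using cd(6) x by blast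
    then obtain m where m: "m > 0" "inverse (real m) < - \<phi> x" using ex_inverse_of_nat_less[of "- \<phi> x"] by auto
    have "\<forall>\<^sub>F n in sequentially. dvg (V' x) = \<psi> n x * dvg (V' x)"
      using eventually_ge_at_top[of m]
    proof eventually_elim
      case (elim n)
      have "1 < - \<phi> x * real m" using m by (simp add: field_simps)
      also have "\<dots> \<le> - \<phi> x * real n" using elim \<open>\<phi> x < 0\<close> by (intro mult_left_mono) auto
      finally have "1 \<le> - \<phi> x * (2 * real n) - 1" by simp
      then show ?case by (simp add: \<psi>_def smooth_step_values)
    qed
    then show ?thesis by (rule Lim_transform_eventually[OF tendsto_const])
  next
    case False
    then show ?thesis using out[OF x] by simp
  qed
  have \<Omega>m: "\<Omega> \<in> lmeasurable" using o b by (simp add: lmeasurable_open)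
  have \<psi>m: "\<psi> n \<in> borel_measurable (lebesgue_on \<Omega>)" for n
    using \<psi>c[of n] by (intro continuous_imp_measurable_on_sets_lebesgue) (auto intro: continuous_on_subset simp: o)
  have sm: "(\<lambda>x. 2 * real n * h (- \<phi> x * (2 * real n) - 1) * (V x \<bullet> D x)) \<in> borel_measurable (lebesgue_on \<Omega>)" for n
  proof (rule continuous_imp_measurable_on_sets_lebesgue)
    show "continuous_on \<Omega> (\<lambda>x. 2 * real n * h (- \<phi> x * (2 * real n) - 1) * (V x \<bullet> D x))"
      by (intro continuous_intros continuous_on_compose2[OF h(1)] continuous_on_subset[OF cd(7)]
          continuous_on_subset[OF cd(4)] continuous_on_subset[OF Vc]) (auto simp: closure_subset)
  qed (use o in simp)
  \<comment> \<open>The divergence of V is the limit of its products with the cutoffs, and each of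
    these equals the integrable divergence of \<open>W\<close> plus a continuous term. The index
    starts at \<open>Suc n\<close> because the support of \<open>W\<close> is controlled for
    positive n only.\<close>
  have dm: "(\<lambda>x. dvg (V' x)) \<in> borel_measurable (lebesgue_on \<Omega>)"
  proof (rule borel_measurable_LIMSEQ_real[where u="\<lambda>n x. \<psi> (Suc n) x * dvg (V' x)"])
    show "(\<lambda>n. \<psi> (Suc n) x * dvg (V' x)) \<longlonglongrightarrow> dvg (V' x)" if "x \<in> space (lebesgue_on \<Omega>)" for x
      using LIMSEQ_Suc[OF lim] that by simp
    fix n
    have eq: "\<psi> (Suc n) x * dvg (V' x) =
        dvg (W' (Suc n) x) + 2 * real (Suc n) * h (- \<phi> x * (2 * real (Suc n)) - 1) * (V x \<bullet> D x)" for x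
      unfolding Wdvg by simp
    show "(\<lambda>x. \<psi> (Suc n) x * dvg (V' x)) \<in> borel_measurable (lebesgue_on \<Omega>)"
      unfolding eq by (intro borel_measurable_add borel_measurable_integrable[OF Wint(1)] sm) simp
  qed
  show di: "integrable (lebesgue_on \<Omega>) (\<lambda>x. dvg (V' x))" by (rule bdd_deriv_dvg_integrable[OF o b V dm])
  have L1: "(\<lambda>n. LINT x|lebesgue_on \<Omega>. \<psi> n x * dvg (V' x)) \<longlonglongrightarrow> (LINT x|lebesgue_on \<Omega>. dvg (V' x))"
  proof (rule integral_dominated_convergence[where w="\<lambda>x. \<bar>dvg (V' x)\<bar>"])
    show "AE x in lebesgue_on \<Omega>. (\<lambda>n. \<psi> n x * dvg (V' x)) \<longlonglongrightarrow> dvg (V' x)" using lim by (intro AE_I2) simp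
    show "AE x in lebesgue_on \<Omega>. norm (\<psi> n x * dvg (V' x)) \<le> \<bar>dvg (V' x)\<bar>" for n
      using \<psi>b by (intro AE_I2) (simp add: abs_mult mult_left_le_one_le)
  qed (use dm \<psi>m di in \<open>auto intro: borel_measurable_times\<close>)
  have \<psi>i: "integrable (lebesgue_on \<Omega>) (\<lambda>x. \<psi> n x * dvg (V' x))" for n
  proof (rule Bochner_Integration.integrable_bound[OF di])
    show "AE x in lebesgue_on \<Omega>. norm (\<psi> n x * dvg (V' x)) \<le> norm (dvg (V' x))"
      using \<psi>b by (intro AE_I2) (simp add: abs_mult mult_left_le_one_le)
  qed (use dm \<psi>m in \<open>auto intro: borel_measurable_times\<close>)
  define M where "M = measure lebesgue (ball x0 (r + 1))"
  have L2: "(\<lambda>n. LINT x|lebesgue_on \<Omega>. \<psi> n x * dvg (V' x)) \<longlonglongrightarrow> 0"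
  proof (rule LIMSEQ_I)
    fix \<epsilon> :: real assume \<epsilon>: "0 < \<epsilon>"
    \<comment> \<open>The final estimate of the error is 2 Ch M \<rho>; the added 1 keeps the
      denominator positive and the inequality strict.\<close>
    define \<rho> where "\<rho> = \<epsilon> / (2 * Ch * M + 1)"
    have den: "0 < 2 * Ch * M + 1" using Ch0 by (simp add: M_def add_nonneg_pos)
    then have \<rho>: "0 < \<rho>" using \<epsilon> by (simp add: \<rho>_def)
    obtain n0 where n0: "n0 > 0" "\<And>x. x \<in> Z \<Longrightarrow> - \<phi> x < 1 / real n0 \<Longrightarrow> \<omega> x < \<rho>" using small[OF \<rho>] by blast
    have "norm ((LINT x|lebesgue_on \<Omega>. \<psi> n x * dvg (V' x)) - 0) < \<epsilon>" if n: "n \<ge> n0" for n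
    proof -
      have np: "0 < n" using n n0(1) by simp
      define S where "S = {x \<in> ball x0 r. 0 \<le> - \<phi> x \<and> - \<phi> x < 1 / real n}"
      let ?f = "\<lambda>x. 2 * real n * h (- \<phi> x * (2 * real n) - 1) * (V x \<bullet> D x)"
      have Sb: "S \<in> sets lebesgue"
      proof -
        have [measurable]: "\<phi> \<in> borel_measurable borel" using cd(7) by (rule borel_measurable_continuous_onI)
        have "S = ball x0 r \<inter> {x \<in> space borel. 0 \<le> - \<phi> x \<and> - \<phi> x < 1 / real n}" by (auto simp: S_def)
        also have "\<dots> \<in> sets borel" by measurable
        finally show ?thesis by simp
      qed
      have "bounded S" unfolding S_def by (rule bounded_subset[OF bounded_ball[of x0 r]]) auto
      then have Sm: "S \<in> lmeasurable" using Sb by (intro bounded_set_imp_lmeasurable)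
      have fb: "\<bar>?f x\<bar> \<le> 2 * real n * Ch * \<rho> * indicator S x" if x: "x \<in> \<Omega>" for x
      proof (cases "x \<in> cball x0 r' \<and> - \<phi> x < 1 / real n")
        case True
        then have xZ: "x \<in> Z" "x \<in> ball x0 r" using x r' closure_subset[of \<Omega>] by (auto simp: Z_def)
        then have "x \<in> S" using cd(6) x True unfolding S_def by force
        have "1 / real n \<le> 1 / real n0" using n n0(1) by (simp add: frac_le)
        then have "\<omega> x < \<rho>" using n0(2)[OF xZ(1)] True by simp
        then have "\<bar>?f x\<bar> \<le> 2 * real n * Ch * \<rho>"
          unfolding abs_mult \<omega>_def using h(3) Ch0 by (intro mult_mono) auto
        then show ?thesis using \<open>x \<in> S\<close> by simp
      next
        case False
        have z: "?f x = 0"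
        proof (cases "x \<in> cball x0 r'")
          case True
          then have "1 / real n \<le> - \<phi> x" using False by simp
          then have s: "1 \<le> - \<phi> x * (2 * real n) - 1" using np by (simp add: field_simps)
          \<comment> \<open>Where \<open>- \<phi>\<close> is at least 1/n the step has finished, so
            the derivative is zero; equality is the end point of the transition and is treated
            separately.\<close>
          show ?thesis
          proof (cases "1 = - \<phi> x * (2 * real n) - 1")
            case True
            have "h 1 = 0" by (rule smooth_step_deriv_1[OF h(2)])
            then show ?thesis using True by simp
          next
            case False
            have "h (- \<phi> x * (2 * real n) - 1) = 0" by (rule smooth_step_deriv_gt_1[OF h(2)]) (use False s in simp)
            then show ?thesis by simp
          qed
        next
          case False
          then show ?thesis using out[OF x] by simp
        qed
        show ?thesis unfolding z using Ch0 \<rho> by simp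
      qed
      have fi: "integrable (lebesgue_on \<Omega>) ?f"
        using Bochner_Integration.integrable_diff[OF \<psi>i[of n] Wint(1)[OF np]] by (simp add: Wdvg)
      have "(LINT x|lebesgue_on \<Omega>. \<psi> n x * dvg (V' x)) = (LINT x|lebesgue_on \<Omega>. dvg (W' n x) + ?f x)"
        by (simp add: Wdvg)
      also have "\<dots> = (LINT x|lebesgue_on \<Omega>. ?f x)"
        using Bochner_Integration.integral_add[OF Wint(1)[OF np] fi] Wint(2)[OF np] by simp
      finally have eq: "(LINT x|lebesgue_on \<Omega>. \<psi> n x * dvg (V' x)) = (LINT x|lebesgue_on \<Omega>. ?f x)" .
      have "\<bar>LINT x|lebesgue_on \<Omega>. ?f x\<bar> \<le> (LINT x|lebesgue_on \<Omega>. 2 * real n * Ch * \<rho> * indicator S x)"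
      proof (rule order_trans[OF integral_abs_bound integral_mono])
        show "integrable (lebesgue_on \<Omega>) (\<lambda>x. 2 * real n * Ch * \<rho> * indicator S x)"
          by (intro integrable_mult_right integrable_indicator_lebesgue_on \<Omega>m Sb)
        show "\<bar>?f x\<bar> \<le> 2 * real n * Ch * \<rho> * indicator S x" if "x \<in> space (lebesgue_on \<Omega>)" for x
          using fb that by simp
      qed (use fi in auto)
      also have "\<dots> \<le> 2 * real n * Ch * \<rho> * measure lebesgue S"
        using integral_indicator_lebesgue_on_le[OF \<Omega>m Sm] Ch0 \<rho>
        by (simp add: mult_left_mono)
      also have "measure lebesgue S \<le> M / n" unfolding S_def M_def by (rule graph_strip_measure[OF c np])
      finally have "\<bar>LINT x|lebesgue_on \<Omega>. ?f x\<bar> \<le> 2 * real n * Ch * \<rho> * (M / n)"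
        using Ch0 \<rho> by (simp add: mult_left_mono)
      also have "\<dots> = (2 * Ch * M) * \<rho>" using np by simp
      also have "\<dots> < \<epsilon>" using \<rho> den by (simp add: \<rho>_def field_simps)
      finally show ?thesis using eq by simp
    qed
    then show "\<exists>no. \<forall>n\<ge>no. norm ((LINT x|lebesgue_on \<Omega>. \<psi> n x * dvg (V' x)) - 0) < \<epsilon>" by blast
  qed
  show "(LINT x|lebesgue_on \<Omega>. dvg (V' x)) = 0" by (rule LIMSEQ_unique[OF L1 L2])
qed

text \<open>The constants place the value 0 of the argument at distance 3r/4 and the value 1 at
  distance r/2. The squared distance keeps the function differentiable at the centre.\<close>

definition ball_bump :: "'a::euclidean_space \<Rightarrow> real \<Rightarrow> 'a \<Rightarrow> real" where
  "ball_bump x0 r x = smooth_step (9 / 5 - 16 / 5 * ((x - x0) \<bullet> (x - x0)) / r\<^sup>2)"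

lemma ball_bump_values:
  assumes "0 < r"
  shows "x \<notin> ball x0 (3 / 4 * r) \<Longrightarrow> ball_bump x0 r x = 0" "x \<in> ball x0 (r / 2) \<Longrightarrow> ball_bump x0 r x = 1"
    "0 \<le> ball_bump x0 r x" "ball_bump x0 r x \<le> 1"
proof -
  have d: "(x - x0) \<bullet> (x - x0) = (dist x0 x)\<^sup>2" by (simp add: dist_norm power2_norm_eq_inner norm_minus_commute)
  show "ball_bump x0 r x = 0" if "x \<notin> ball x0 (3 / 4 * r)"
  proof -
    have "(3 / 4 * r)\<^sup>2 \<le> (dist x0 x)\<^sup>2" using that assms by (intro power_mono) auto
    then have "9 / 5 - 16 / 5 * (dist x0 x)\<^sup>2 / r\<^sup>2 \<le> 0" using assms by (simp add: field_simps power2_eq_square)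
    then show ?thesis unfolding ball_bump_def d by (rule smooth_step_values)
  qed
  show "ball_bump x0 r x = 1" if "x \<in> ball x0 (r / 2)"
  proof -
    have "(dist x0 x)\<^sup>2 \<le> (r / 2)\<^sup>2" using that assms by (intro power_mono) auto
    then have "1 \<le> 9 / 5 - 16 / 5 * (dist x0 x)\<^sup>2 / r\<^sup>2" using assms by (simp add: field_simps power2_eq_square)
    then show ?thesis unfolding ball_bump_def d by (rule smooth_step_values)
  qed
qed (simp_all add: ball_bump_def smooth_step_values)

lemma ball_bump_continuous: "continuous_on S (ball_bump x0 r)"
proof -
  obtain h where h: "\<And>s. (smooth_step has_real_derivative h s) (at s)" using smooth_step_deriv by blast
  have sc: "continuous_on UNIV smooth_step" by (rule DERIV_continuous_on[OF h])
  define c where "c = inverse (r\<^sup>2)"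
  show ?thesis unfolding ball_bump_def[abs_def] divide_inverse[of _ "r\<^sup>2"] c_def[symmetric]
    by (rule continuous_on_compose2[OF sc]) (auto intro!: continuous_intros)
qed

lemma ball_bump_bdd_deriv:
  fixes x0 :: "'a::euclidean_space"
  assumes "bounded S"
  shows "\<exists>u'. bdd_deriv S (ball_bump x0 r) u'"
proof -
  obtain h Ch where h: "continuous_on UNIV h" "\<And>s. (smooth_step has_real_derivative h s) (at s)" "\<And>s. \<bar>h s\<bar> \<le> Ch"
    using smooth_step_deriv by blast
  have Ch0: "0 \<le> Ch" using h(3)[of 0] by linarith
  define c where "c = - (16 / 5) / r\<^sup>2"
  define a where "a x = 9 / 5 + c * ((x - x0) \<bullet> (x - x0))" for x
  have ba: "ball_bump x0 r x = smooth_step (a x)" for x by (simp add: ball_bump_def a_def c_def)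
  have d: "(ball_bump x0 r has_derivative (\<lambda>k. h (a x) * ((2 * c) * ((x - x0) \<bullet> k)))) (at x)" for x
  proof -
    have "(a has_derivative (\<lambda>k. c * ((x - x0) \<bullet> k + k \<bullet> (x - x0)))) (at x)"
      unfolding a_def[abs_def] by (auto intro!: derivative_eq_intros)
    then have "(a has_derivative (\<lambda>k. (2 * c) * ((x - x0) \<bullet> k))) (at x)"
      by (simp add: inner_commute mult_ac)
    from has_derivative_compose[OF this h(2)[unfolded has_field_derivative_def]]
    show ?thesis unfolding ba[abs_def] by simp
  qed
  obtain R where R: "\<forall>x\<in>S. norm (x - x0) \<le> R"
  proof -
    obtain R where "\<forall>x\<in>S. norm x \<le> R" using assms by (auto simp: bounded_iff)
    then have "\<forall>x\<in>S. norm (x - x0) \<le> R + norm x0"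
      using norm_triangle_ineq4[of _ x0] by (meson add_right_mono order_trans)
    then show thesis by (rule that)
  qed
  have "norm (h (a x) * ((2 * c) * ((x - x0) \<bullet> k))) \<le> Ch * (\<bar>2 * c\<bar> * R) * norm k" if "x \<in> S" for x k
  proof -
    have "\<bar>(x - x0) \<bullet> k\<bar> \<le> norm (x - x0) * norm k" by (rule Cauchy_Schwarz_ineq2)
    also have "\<dots> \<le> R * norm k" using R that by (intro mult_right_mono) auto
    finally have "\<bar>(2 * c) * ((x - x0) \<bullet> k)\<bar> \<le> \<bar>2 * c\<bar> * (R * norm k)" unfolding abs_mult by (rule mult_left_mono) simp
    then have "\<bar>h (a x)\<bar> * \<bar>(2 * c) * ((x - x0) \<bullet> k)\<bar> \<le> Ch * (\<bar>2 * c\<bar> * (R * norm k))" using h(3) Ch0 by (intro mult_mono) auto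
    then show ?thesis by (simp add: abs_mult mult_ac)
  qed
  with d show ?thesis unfolding bdd_deriv_def
    by (intro exI[of _ "\<lambda>x k. h (a x) * ((2 * c) * ((x - x0) \<bullet> k))"] exI[of _ "Ch * (\<bar>2 * c\<bar> * R)"] ballI conjI allI) auto
qed

text \<open>
  Splitting off bump functions around finitely many boundary points, one after the other, leaves a
  field that vanishes near the boundary.
\<close>

lemma integral_div_cover:
  fixes \<Omega> :: "'a::euclidean_space set"
  assumes F: "finite F" and ch: "\<And>x. x \<in> F \<Longrightarrow> graph_chart \<Omega> x (r x) (e x) (\<phi> x) (D x)"
    and o: "open \<Omega>" and b: "bounded \<Omega>"
    and Vc: "continuous_on (closure \<Omega>) V" and V: "bdd_deriv \<Omega> V V'"
    and nrm: "\<And>x. x \<in> frontier \<Omega> \<Longrightarrow> V x \<bullet> outward_normal \<Omega> x = 0"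
    and U: "open U" "frontier \<Omega> \<subseteq> U \<union> (\<Union>x\<in>F. ball x (r x / 2))"
    and V0: "\<And>x. x \<in> closure \<Omega> \<Longrightarrow> x \<in> U \<Longrightarrow> V x = 0"
  shows "integrable (lebesgue_on \<Omega>) (\<lambda>x. dvg (V' x)) \<and> (LINT x|lebesgue_on \<Omega>. dvg (V' x)) = 0"
  using F ch Vc V nrm U V0
proof (induction F arbitrary: V V' U rule: finite_induct)
  case empty
  obtain C where C: "0 < C" "\<And>x. x \<in> \<Omega> \<Longrightarrow> (V has_derivative V' x) (at x)"
    "\<And>x h. x \<in> \<Omega> \<Longrightarrow> norm (V' x h) \<le> C * norm h" using bdd_derivE[OF empty.prems(3)] by blast
  \<comment> \<open>With no chart left, U contains the whole boundary and V vanishes there, so V is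
    supported in a compact subset of the open set.\<close>
  have K: "compact (closure \<Omega> - U)" using b empty.prems(5) by (simp add: compact_closure compact_diff)
  have KO: "closure \<Omega> - U \<subseteq> \<Omega>"
    using empty.prems(6) o by (auto simp: frontier_def interior_open)
  have z: "V x = 0" if "x \<in> \<Omega> - (closure \<Omega> - U)" for x
    using that empty.prems(7)[of x] closure_subset[of \<Omega>] by auto
  have bd: "norm (V' x h) \<le> C * norm h" if "x \<in> closure \<Omega> - U" for x h
    by (rule C(3)) (use that KO in blast)
  show ?case
    using integral_div_compact_support(1)[OF o K KO z C(2) bd] integral_div_compact_support(2)[OF o K KO z C(2) bd]
    by simp
next
  case (insert x0 F)
  have b_cl: "compact (closure \<Omega>)" using b by (simp add: compact_closure)
  have ch0: "graph_chart \<Omega> x0 (r x0) (e x0) (\<phi> x0) (D x0)" using insert.prems(1) by simp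
  have r: "0 < r x0" by (rule graph_chartD(1)[OF ch0])
  let ?\<beta> = "ball_bump x0 (r x0)"
  note \<beta>v = ball_bump_values[OF r, where ?x0.0=x0]
  obtain \<beta>' where \<beta>: "bdd_deriv \<Omega> ?\<beta> \<beta>'" using ball_bump_bdd_deriv[OF b] by blast
  have \<beta>c: "continuous_on (closure \<Omega>) ?\<beta>" by (rule ball_bump_continuous)
  have \<beta>n: "norm (?\<beta> x) \<le> 1" for x using \<beta>v(3,4)[of x] by simp
  have \<gamma>n: "norm (1 - ?\<beta> x) \<le> 1" for x using \<beta>v(3,4)[of x] by simp
  have \<gamma>: "bdd_deriv \<Omega> (\<lambda>x. 1 - ?\<beta> x) (\<lambda>x h. - \<beta>' x h)"
  proof -
    obtain C where C: "0 < C" "\<And>x. x \<in> \<Omega> \<Longrightarrow> (?\<beta> has_derivative \<beta>' x) (at x)"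
      "\<And>x h. x \<in> \<Omega> \<Longrightarrow> norm (\<beta>' x h) \<le> C * norm h" using bdd_derivE[OF \<beta>] by blast
    have "((\<lambda>x. 1 - ?\<beta> x) has_derivative (\<lambda>h. - \<beta>' x h)) (at x)" if "x \<in> \<Omega>" for x
      using has_derivative_diff[OF has_derivative_const C(2)[OF that], of 1] by simp
    then show ?thesis unfolding bdd_deriv_def using C(3) by (intro exI[of _ C]) simp
  qed
  obtain BV where BV: "\<forall>x\<in>closure \<Omega>. norm (V x) \<le> BV"
    using compact_continuous_bounded[OF b_cl insert.prems(2)] by blast
  then have BV': "norm (V x) \<le> BV" if "x \<in> \<Omega>" for x using subsetD[OF closure_subset that] by (rule bspec)
  let ?V1 = "\<lambda>x h. ?\<beta> x *\<^sub>R V' x h + \<beta>' x h *\<^sub>R V x"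
  let ?V2 = "\<lambda>x h. (1 - ?\<beta> x) *\<^sub>R V' x h + (- \<beta>' x h) *\<^sub>R V x"
  have 1: "integrable (lebesgue_on \<Omega>) (\<lambda>x. dvg (?V1 x))" "(LINT x|lebesgue_on \<Omega>. dvg (?V1 x)) = 0"
  proof -
    have c: "continuous_on (closure \<Omega>) (\<lambda>x. ?\<beta> x *\<^sub>R V x)" by (intro continuous_on_scaleR \<beta>c insert.prems(2))
    have d: "bdd_deriv \<Omega> (\<lambda>x. ?\<beta> x *\<^sub>R V x) ?V1" by (rule bdd_deriv_scaleR[OF \<beta> \<beta>n insert.prems(3) BV'])
    have z: "?\<beta> x *\<^sub>R V x = 0" if "x \<in> closure \<Omega>" "x \<notin> ball x0 (3 / 4 * r x0)" for x
      using \<beta>v(1)[OF that(2)] by simp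
    have n: "(?\<beta> x *\<^sub>R V x) \<bullet> outward_normal \<Omega> x = 0" if "x \<in> frontier \<Omega>" for x
      using insert.prems(4)[OF that] by simp
    have r': "0 < 3 / 4 * r x0" "3 / 4 * r x0 < r x0" using r by auto
    show "integrable (lebesgue_on \<Omega>) (\<lambda>x. dvg (?V1 x))" "(LINT x|lebesgue_on \<Omega>. dvg (?V1 x)) = 0"
      by (rule integral_div_chart[OF ch0 r' o b c d z n]; assumption)+
  qed
  \<comment> \<open>The remainder vanishes on the ball of half the radius, where the bump equals 1;
    this ball joins the region U in which the field is already known to be zero.\<close>
  have 2: "integrable (lebesgue_on \<Omega>) (\<lambda>x. dvg (?V2 x)) \<and> (LINT x|lebesgue_on \<Omega>. dvg (?V2 x)) = 0"
  proof (rule insert.IH[where U="U \<union> ball x0 (r x0 / 2)" and V="\<lambda>x. (1 - ?\<beta> x) *\<^sub>R V x"])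
    show "continuous_on (closure \<Omega>) (\<lambda>x. (1 - ?\<beta> x) *\<^sub>R V x)"
      by (intro continuous_intros \<beta>c insert.prems(2))
    show "bdd_deriv \<Omega> (\<lambda>x. (1 - ?\<beta> x) *\<^sub>R V x) ?V2" by (rule bdd_deriv_scaleR[OF \<gamma> \<gamma>n insert.prems(3) BV'])
    show "((1 - ?\<beta> x) *\<^sub>R V x) \<bullet> outward_normal \<Omega> x = 0" if "x \<in> frontier \<Omega>" for x
      using insert.prems(4)[OF that] by simp
    show "(1 - ?\<beta> x) *\<^sub>R V x = 0" if "x \<in> closure \<Omega>" "x \<in> U \<union> ball x0 (r x0 / 2)" for x
      using that(2)
    proof
      assume "x \<in> U"
      then show ?thesis using insert.prems(7)[OF that(1)] by simp
    next
      assume "x \<in> ball x0 (r x0 / 2)"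
      then show ?thesis using \<beta>v(2) by simp
    qed
    show "open (U \<union> ball x0 (r x0 / 2))" by (intro open_Un open_ball insert.prems(5))
    show "frontier \<Omega> \<subseteq> (U \<union> ball x0 (r x0 / 2)) \<union> (\<Union>x\<in>F. ball x (r x / 2))"
      using insert.prems(6) by (simp add: Un_assoc Un_commute)
    show "graph_chart \<Omega> x (r x) (e x) (\<phi> x) (D x)" if "x \<in> F" for x using insert.prems(1) that by simp
  qed
  have eq: "dvg (V' x) = dvg (?V1 x) + dvg (?V2 x)" for x
    unfolding dvg_add[symmetric] by (simp add: algebra_simps)
  show ?case unfolding eq
    using 1 2 Bochner_Integration.integrable_add[of "lebesgue_on \<Omega>" "\<lambda>x. dvg (?V1 x)" "\<lambda>x. dvg (?V2 x)"]
      Bochner_Integration.integral_add[of "lebesgue_on \<Omega>" "\<lambda>x. dvg (?V1 x)" "\<lambda>x. dvg (?V2 x)"] by simp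
qed

text \<open>The boundary is compact, so finitely many chart balls of half radius cover it. The half
  radius is where the corresponding bump is equal to 1.\<close>

theorem divergence_theorem_tangential:
  fixes \<Omega> :: "'a::euclidean_space set"
  assumes "C2_holder_domain \<alpha> \<Omega>" and b: "bounded \<Omega>"
    and "continuous_on (closure \<Omega>) V" and "bdd_deriv \<Omega> V V'"
    and "\<And>x. x \<in> frontier \<Omega> \<Longrightarrow> V x \<bullet> outward_normal \<Omega> x = 0"
  shows "integrable (lebesgue_on \<Omega>) (\<lambda>x. dvg (V' x))" "(LINT x|lebesgue_on \<Omega>. dvg (V' x)) = 0"
proof -
  have o: "open \<Omega>" using assms(1) unfolding C2_holder_domain_def by blast
  obtain r e \<phi> D where ch: "\<And>x. x \<in> frontier \<Omega> \<Longrightarrow> graph_chart \<Omega> x (r x) (e x) (\<phi> x) (D x)"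
    using graph_chart_exists[OF assms(1)] by metis
  have c: "compact (frontier \<Omega>)" using b by (rule compact_frontier_bounded)
  have cov: "frontier \<Omega> \<subseteq> (\<Union>x\<in>frontier \<Omega>. ball x (r x / 2))"
    using graph_chartD(1)[OF ch] by fastforce
  obtain F where F: "F \<subseteq> frontier \<Omega>" "finite F" "frontier \<Omega> \<subseteq> (\<Union>x\<in>F. ball x (r x / 2))"
    by (rule compactE_image[OF c _ cov]) auto
  have ch': "graph_chart \<Omega> x (r x) (e x) (\<phi> x) (D x)" if "x \<in> F" for x using ch F(1) that by blast
  have U: "open ({}::'a set)" "frontier \<Omega> \<subseteq> {} \<union> (\<Union>x\<in>F. ball x (r x / 2))"
    "\<And>x. x \<in> closure \<Omega> \<Longrightarrow> x \<in> {} \<Longrightarrow> V x = 0" using F(3) by auto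
  from integral_div_cover[OF F(2) ch' o b assms(3,4,5) U]
  show "integrable (lebesgue_on \<Omega>) (\<lambda>x. dvg (V' x))" "(LINT x|lebesgue_on \<Omega>. dvg (V' x)) = 0" by blast+
qed

section \<open>The algebra of the additive system\<close>

locale additive_MS =
  fixes N :: nat and g :: "nat \<Rightarrow> real"
  assumes N2: "2 \<le> N" and g1_pos: "0 < g 1" and g_mono: "strict_mono_on {1..N} g"
begin

definition width :: real where "width = g N - g 1"

lemma g_less: "i \<in> {1..N} \<Longrightarrow> j \<in> {1..N} \<Longrightarrow> i < j \<Longrightarrow> g i < g j"
  using g_mono by (rule strict_mono_onD)

lemma g_le: "i \<in> {1..N} \<Longrightarrow> j \<in> {1..N} \<Longrightarrow> i \<le> j \<Longrightarrow> g i \<le> g j"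
  using g_less[of i j] by (cases "i = j") auto

lemma g_bounds: "i \<in> {1..N} \<Longrightarrow> g 1 \<le> g i" "i \<in> {1..N} \<Longrightarrow> g i \<le> g N"
  using g_le[of 1 i] g_le[of i N] by auto

lemma g_pos: "i \<in> {1..N} \<Longrightarrow> 0 < g i"
  using g_bounds(1)[of i] g1_pos by linarith

lemma g_inj: "i \<in> {1..N} \<Longrightarrow> j \<in> {1..N} \<Longrightarrow> i \<noteq> j \<Longrightarrow> g i \<noteq> g j"
  using g_less[of i j] g_less[of j i] by (cases i j rule: linorder_cases) auto

lemma width_pos: "0 < width"
  using g_less[of 1 N] N2 by (simp add: width_def)

text \<open>No g_i lies strictly between two neighbouring ones, so it is on the same side of both
  points, and the factors have equal signs.\<close>

lemma interval_signs:
  assumes "i \<in> {1..N}" "j \<in> {1..N-1}" "g j < \<zeta>" "\<zeta> < g (Suc j)" "g j < \<xi>" "\<xi> < g (Suc j)"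
  shows "0 < (g i - \<zeta>) * (g i - \<xi>)" "(g i - \<zeta>) * (g i - \<xi>) \<le> width\<^sup>2" "g i \<noteq> \<zeta>" "\<bar>g i - \<zeta>\<bar> \<le> width"
proof -
  have j: "j \<in> {1..N}" "Suc j \<in> {1..N}" using assms(2) by auto
  have b: "g 1 \<le> g j" "g (Suc j) \<le> g N" "g 1 \<le> g i" "g i \<le> g N" using g_bounds j assms(1) by auto
  then have w: "\<bar>g i - \<zeta>\<bar> \<le> width" "\<bar>g i - \<xi>\<bar> \<le> width" using assms(3-6) by (auto simp: width_def)
  show p: "0 < (g i - \<zeta>) * (g i - \<xi>)"
  proof (cases "i \<le> j")
    case True
    then have "g i \<le> g j" using g_le assms(1) j by blast
    then show ?thesis using assms by (intro mult_neg_neg) auto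
  next
    case False
    then have "g (Suc j) \<le> g i" using g_le[of "Suc j" i] assms(1) j by auto
    then show ?thesis using assms by (intro mult_pos_pos) auto
  qed
  have "\<bar>(g i - \<zeta>) * (g i - \<xi>)\<bar> \<le> width * width" unfolding abs_mult using w width_pos by (intro mult_mono) auto
  then show "(g i - \<zeta>) * (g i - \<xi>) \<le> width\<^sup>2" by (simp add: power2_eq_square)
  show "g i \<noteq> \<zeta>" using p by auto
  show "\<bar>g i - \<zeta>\<bar> \<le> width" by (rule w)
qed

section \<open>Roots between neighbouring poles\<close>

definition rat :: "(nat \<Rightarrow> real) \<Rightarrow> real \<Rightarrow> real" where
  "rat Y \<zeta> = (\<Sum>i=1..N. Y i / (g i - \<zeta>))"

text \<open>The divided difference of \<open>rat\<close> in its second argument; on the diagonal it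
  is the derivative of \<open>rat\<close> at that point.\<close>

definition dquot :: "(nat \<Rightarrow> real) \<Rightarrow> real \<Rightarrow> real \<Rightarrow> real" where
  "dquot Y \<zeta> \<xi> = (\<Sum>i=1..N. Y i / ((g i - \<zeta>) * (g i - \<xi>)))"

lemma simplexD: "Y \<in> open_simplex N \<Longrightarrow> i \<in> {1..N} \<Longrightarrow> 0 < Y i" "Y \<in> open_simplex N \<Longrightarrow> (\<Sum>i=1..N. Y i) = 1"
  by (auto simp: open_simplex_def)

lemma simplex_le_1: "Y \<in> open_simplex N \<Longrightarrow> i \<in> {1..N} \<Longrightarrow> Y i \<le> 1"
  using member_le_sum[of i "{1..N}" Y] simplexD by (force intro: less_imp_le)

text \<open>Every denominator is positive and at most \<open>width\<^sup>2\<close>, and the weights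
  sum to 1. The bound is uniform over the whole open simplex, so near its boundary only the poles
  can spoil estimates.\<close>

lemma dquot_ge:
  assumes Y: "Y \<in> open_simplex N" and "j \<in> {1..N-1}" "g j < \<zeta>" "\<zeta> < g (Suc j)" "g j < \<xi>" "\<xi> < g (Suc j)"
  shows "1 / width\<^sup>2 \<le> dquot Y \<zeta> \<xi>" "0 < dquot Y \<zeta> \<xi>"
proof -
  have "Y i / width\<^sup>2 \<le> Y i / ((g i - \<zeta>) * (g i - \<xi>))" if i: "i \<in> {1..N}" for i
    using interval_signs[OF i assms(2-)] simplexD(1)[OF Y i] width_pos by (intro divide_left_mono) auto
  then have "(\<Sum>i=1..N. Y i / width\<^sup>2) \<le> dquot Y \<zeta> \<xi>" unfolding dquot_def by (rule sum_mono)
  then show ge: "1 / width\<^sup>2 \<le> dquot Y \<zeta> \<xi>" using simplexD(2)[OF Y] by (simp add: sum_divide_distrib[symmetric])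
  have "0 < 1 / width\<^sup>2" using width_pos by simp
  with ge show "0 < dquot Y \<zeta> \<xi>" by linarith
qed

lemma rat_diff:
  assumes "j \<in> {1..N-1}" "g j < \<zeta>" "\<zeta> < g (Suc j)" "g j < \<xi>" "\<xi> < g (Suc j)"
  shows "rat Y \<zeta> - rat Y \<xi> = (\<zeta> - \<xi>) * dquot Y \<zeta> \<xi>"
proof -
  have "Y i / (g i - \<zeta>) - Y i / (g i - \<xi>) = (\<zeta> - \<xi>) * (Y i / ((g i - \<zeta>) * (g i - \<xi>)))" if i: "i \<in> {1..N}" for i
    using interval_signs(3)[OF i assms] interval_signs(3)[OF i assms(1,4,5,2,3)] by (simp add: field_simps)
  then show ?thesis unfolding rat_def dquot_def sum_subtractf[symmetric] sum_distrib_left by (intro sum.cong) auto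
qed

text \<open>\<open>R\<close> is the rational function multiplied by its two singular denominators.
  It is continuous up to both ends of the interval, negative at the left end and positive at the
  right one, and the intermediate value theorem applies.\<close>

lemma root_exists:
  assumes Y: "Y \<in> open_simplex N" and j: "j \<in> {1..N-1}"
  shows "\<exists>\<zeta>. g j < \<zeta> \<and> \<zeta> < g (Suc j) \<and> rat Y \<zeta> = 0"
proof -
  have jj: "j \<in> {1..N}" "Suc j \<in> {1..N}" using j by auto
  have gj: "g j < g (Suc j)" using g_less jj by simp
  let ?I = "{1..N} - {j, Suc j}"
  define R where "R \<zeta> = (\<zeta> - g j) * (g (Suc j) - \<zeta>) * (\<Sum>i\<in>?I. Y i / (g i - \<zeta>))
      - Y j * (g (Suc j) - \<zeta>) + Y (Suc j) * (\<zeta> - g j)" for \<zeta>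
  have ne: "g i \<noteq> \<zeta>" if "i \<in> ?I" "g j \<le> \<zeta>" "\<zeta> \<le> g (Suc j)" for i \<zeta>
  proof (cases "i < j")
    case True
    then show ?thesis using g_less[of i j] that jj by auto
  next
    case False
    then have "Suc j < i" using that(1) by auto
    then show ?thesis using g_less[of "Suc j" i] that jj by auto
  qed
  have "continuous_on {g j..g (Suc j)} R"
    unfolding R_def[abs_def] using ne by (intro continuous_intros) auto
  moreover have "R (g j) \<le> 0" "0 \<le> R (g (Suc j))"
    using gj simplexD(1)[OF Y jj(1)] simplexD(1)[OF Y jj(2)] by (auto simp: R_def mult_nonneg_nonneg)
  ultimately obtain \<zeta> where \<zeta>: "g j \<le> \<zeta>" "\<zeta> \<le> g (Suc j)" "R \<zeta> = 0"
    using IVT'[of R "g j" 0 "g (Suc j)"] gj by auto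
  have "\<zeta> \<noteq> g j" "\<zeta> \<noteq> g (Suc j)"
    using \<zeta>(3) gj simplexD(1)[OF Y jj(1)] simplexD(1)[OF Y jj(2)] by (auto simp: R_def)
  then have s: "g j < \<zeta>" "\<zeta> < g (Suc j)" using \<zeta> by auto
  have "rat Y \<zeta> = (\<Sum>i\<in>?I. Y i / (g i - \<zeta>)) + Y j / (g j - \<zeta>) + Y (Suc j) / (g (Suc j) - \<zeta>)"
  proof -
    have "{1..N} = insert j (insert (Suc j) ?I)" using jj by auto
    then have "rat Y \<zeta> = (\<Sum>i\<in>insert j (insert (Suc j) ?I). Y i / (g i - \<zeta>))" unfolding rat_def by simp
    then show ?thesis by simp
  qed
  also have "\<dots> = R \<zeta> / ((\<zeta> - g j) * (g (Suc j) - \<zeta>))"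
  proof -
    have "S + p / (- a) + q / b = (a * b * S - p * b + q * a) / (a * b)" if "0 < a" "0 < b" for a b S p q :: real
      using that by (simp add: field_simps)
    from this[of "\<zeta> - g j" "g (Suc j) - \<zeta>"] show ?thesis using s unfolding R_def by simp
  qed
  finally show ?thesis using s \<zeta>(3) by auto
qed

text \<open>Positivity of the divided difference makes \<open>rat\<close> injective between
  neighbouring poles, so the definite description of the root has a unique solution.\<close>

lemma root_coord:
  assumes Y: "Y \<in> open_simplex N" and j: "j \<in> {1..N-1}"
  shows "g j < root_coord g N Y j" "root_coord g N Y j < g (Suc j)" "rat Y (root_coord g N Y j) = 0"
proof -
  have "\<exists>!\<zeta>. g j < \<zeta> \<and> \<zeta> < g (Suc j) \<and> rat Y \<zeta> = 0"
  proof (rule ex_ex1I[OF root_exists[OF Y j]], elim conjE)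
    fix \<zeta> \<xi> assume *: "g j < \<zeta>" "\<zeta> < g (Suc j)" "g j < \<xi>" "\<xi> < g (Suc j)" "rat Y \<zeta> = 0" "rat Y \<xi> = 0"
    then have "(\<zeta> - \<xi>) * dquot Y \<zeta> \<xi> = 0" using rat_diff[OF j *(1-4), of Y] by simp
    then show "\<zeta> = \<xi>" using dquot_ge(2)[OF Y j *(1-4)] by simp
  qed
  from theI'[OF this] show "g j < root_coord g N Y j" "root_coord g N Y j < g (Suc j)" "rat Y (root_coord g N Y j) = 0"
    unfolding root_coord_def rat_def by auto
qed

text \<open>An exact identity, not a first-order expansion: \<open>rat\<close> is linear in the
  concentrations, and its increment between the two roots is the divided difference. Both the
  Lipschitz estimate and the differentiability of the roots are read off from it.\<close>

lemma root_diff: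
  assumes Y: "Y \<in> open_simplex N" and Y': "Y' \<in> open_simplex N" and j: "j \<in> {1..N-1}"
  shows "root_coord g N Y' j - root_coord g N Y j =
    (\<Sum>i=1..N. - 1 / ((g i - root_coord g N Y' j) * dquot Y (root_coord g N Y' j) (root_coord g N Y j)) * (Y' i - Y i))"
proof -
  let ?z = "root_coord g N Y j" and ?z' = "root_coord g N Y' j"
  note z = root_coord[OF Y j] and z' = root_coord[OF Y' j]
  have "(?z' - ?z) * dquot Y ?z' ?z = rat Y ?z' - rat Y' ?z'"
    using rat_diff[OF j z'(1,2) z(1,2), of Y] z(3) z'(3) by simp
  also have "\<dots> = (\<Sum>i=1..N. - (Y' i - Y i) / (g i - ?z'))"
    unfolding rat_def sum_subtractf[symmetric] by (intro sum.cong) (simp_all add: diff_divide_distrib)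
  finally have "?z' - ?z = (\<Sum>i=1..N. - (Y' i - Y i) / (g i - ?z')) / dquot Y ?z' ?z"
    using dquot_ge(2)[OF Y j z'(1,2) z(1,2)] by (simp add: field_simps)
  moreover have eq: "- a / b / c = - 1 / (b * c) * a" for a b c :: real by simp
  ultimately show ?thesis by (simp only: sum_divide_distrib eq)
qed

text \<open>The divided difference is bounded below on the whole simplex, so the constant involves
  only the distance of the root of Y' from the poles. Either of two states can be put into that
  role.\<close>

lemma root_lipschitz:
  assumes Y: "Y \<in> open_simplex N" and Y': "Y' \<in> open_simplex N" and j: "j \<in> {1..N-1}"
    and \<delta>: "0 < \<delta>" "\<And>i. i \<in> {1..N} \<Longrightarrow> \<delta> \<le> \<bar>g i - root_coord g N Y' j\<bar>"
  shows "\<bar>root_coord g N Y' j - root_coord g N Y j\<bar> \<le> width\<^sup>2 / \<delta> * (\<Sum>i=1..N. \<bar>Y' i - Y i\<bar>)"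
proof -
  let ?z = "root_coord g N Y j" and ?z' = "root_coord g N Y' j"
  note z = root_coord[OF Y j] and z' = root_coord[OF Y' j]
  note D = dquot_ge[OF Y j z'(1,2) z(1,2)]
  have "1 / dquot Y ?z' ?z \<le> width\<^sup>2" using D width_pos by (simp add: field_simps)
  then have "\<bar>- 1 / ((g i - ?z') * dquot Y ?z' ?z) * (Y' i - Y i)\<bar> \<le> width\<^sup>2 / \<delta> * \<bar>Y' i - Y i\<bar>" if "i \<in> {1..N}" for i
  proof -
    have "\<bar>- 1 / ((g i - ?z') * dquot Y ?z' ?z)\<bar> = (1 / dquot Y ?z' ?z) * (1 / \<bar>g i - ?z'\<bar>)"
      using D(2) by (simp add: abs_mult)
    also have "\<dots> \<le> width\<^sup>2 * (1 / \<delta>)"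
      using \<delta>(1) \<delta>(2)[OF that] D \<open>1 / dquot Y ?z' ?z \<le> width\<^sup>2\<close> by (intro mult_mono divide_left_mono) auto
    finally show ?thesis unfolding abs_mult by (intro mult_right_mono) auto
  qed
  then have "\<bar>?z' - ?z\<bar> \<le> (\<Sum>i=1..N. width\<^sup>2 / \<delta> * \<bar>Y' i - Y i\<bar>)"
    unfolding root_diff[OF assms(1-3)] by (rule order_trans[OF sum_abs sum_mono])
  then show ?thesis by (simp add: sum_distrib_left)
qed

lemma poly_linear_prod:
  assumes "finite A"
  shows "degree (\<Prod>k\<in>A. [:c k, -1:] :: real poly) \<le> card A" "coeff (\<Prod>k\<in>A. [:c k, -1:] :: real poly) (card A) = (-1) ^ card A"
proof -
  have "degree (\<Prod>k\<in>A. [:c k, -1:] :: real poly) \<le> card A \<and> coeff (\<Prod>k\<in>A. [:c k, -1:] :: real poly) (card A) = (-1) ^ card A"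
    using assms
  proof (induction A rule: finite_induct)
    case (insert a A)
    let ?p = "\<Prod>k\<in>A. [:c k, -1:] :: real poly"
    have "degree ([:c a, -1:] * ?p) \<le> Suc (card A)"
      using degree_mult_le[of "[:c a, -1:]" ?p] insert.IH by simp
    moreover have "coeff ([:c a, -1:] * ?p) (Suc (card A)) = c a * coeff ?p (Suc (card A)) - coeff ?p (card A)"
      by simp
    moreover have "coeff ?p (Suc (card A)) = 0" using insert.IH by (intro coeff_eq_0) simp
    ultimately show ?case using insert by simp
  qed simp
  then show "degree (\<Prod>k\<in>A. [:c k, -1:] :: real poly) \<le> card A" "coeff (\<Prod>k\<in>A. [:c k, -1:] :: real poly) (card A) = (-1) ^ card A"
    by auto
qed

text \<open>Two polynomials of degree at most N - 1 coincide: the numerator of the rational function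
  and the product of the linear factors of its roots. They agree at the N - 1 roots, and their
  leading coefficients agree because the concentrations sum to 1. Evaluation at the pole g_i leaves
  a single term of the numerator.\<close>

lemma conc_root_formula:
  assumes Y: "Y \<in> open_simplex N" and i: "i \<in> {1..N}"
  shows "Y i * (\<Prod>k\<in>{1..N}-{i}. g k - g i) = (\<Prod>k=1..N-1. root_coord g N Y k - g i)"
proof -
  let ?z = "root_coord g N Y"
  define p where "p = (\<Sum>i=1..N. smult (Y i) (\<Prod>k\<in>{1..N}-{i}. [:g k, -1:]))"
  define q where "q = (\<Prod>k=1..N-1. [:?z k, -1:])"
  have c: "card ({1..N}-{i}) = N - 1" if "i \<in> {1..N}" for i using that by simp
  have "p = q"
  proof (rule poly_eqI_degree_lead_coeff[where n="N-1" and A="?z ` {1..N-1}"])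
    have zl: "?z a < ?z b" if "a \<in> {1..N-1}" "b \<in> {1..N-1}" "a < b" for a b
      using root_coord(2)[OF Y that(1)] root_coord(1)[OF Y that(2)] g_le[of "Suc a" b] that by force
    have "inj_on ?z {1..N-1}"
      by (rule linorder_inj_onI) (use zl in force)+
    then show "card (?z ` {1..N-1}) \<ge> N - 1" by (simp add: card_image)
    have "degree (smult (Y i) (\<Prod>k\<in>{1..N}-{i}. [:g k, -1:])) \<le> N - 1" if "i \<in> {1..N}" for i
      using order_trans[OF degree_smult_le poly_linear_prod(1)[of "{1..N}-{i}" g]] c[OF that] by simp
    then show "degree p \<le> N - 1" unfolding p_def by (intro degree_sum_le) auto
    show "degree q \<le> N - 1" unfolding q_def using poly_linear_prod(1)[of "{1..N-1}" ?z] by simp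
    have "coeff p (N - 1) = (\<Sum>i=1..N. Y i * (-1) ^ (N - 1))"
      unfolding p_def coeff_sum coeff_smult
      by (intro sum.cong refl) (metis c poly_linear_prod(2) finite_Diff finite_atLeastAtMost)
    also have "\<dots> = (-1) ^ (N - 1)" using simplexD(2)[OF Y] by (simp add: sum_distrib_right[symmetric])
    finally show "coeff p (N - 1) = coeff q (N - 1)"
      unfolding q_def using poly_linear_prod(2)[of "{1..N-1}" ?z] by simp
    fix x assume "x \<in> ?z ` {1..N-1}"
    then obtain m where m: "m \<in> {1..N-1}" "x = ?z m" by blast
    have ne: "g k - x \<noteq> 0" if "k \<in> {1..N}" for k
      using interval_signs(3)[OF that m(1) root_coord(1,2)[OF Y m(1)] root_coord(1,2)[OF Y m(1)]] m(2) by simp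
    have "poly p x = (\<Sum>i=1..N. (\<Prod>k=1..N. g k - x) * (Y i / (g i - x)))"
      unfolding p_def poly_sum poly_smult poly_prod
    proof (rule sum.cong[OF refl])
      fix i assume i: "i \<in> {1..N}"
      have "(\<Prod>k=1..N. g k - x) = (g i - x) * (\<Prod>k\<in>{1..N}-{i}. g k - x)"
        by (rule prod.remove) (use i in auto)
      then show "Y i * (\<Prod>k\<in>{1..N}-{i}. poly [:g k, -1:] x) = (\<Prod>k=1..N. g k - x) * (Y i / (g i - x))"
        using ne[OF i] by simp
    qed
    also have "\<dots> = 0"
      unfolding sum_distrib_left[symmetric] rat_def[symmetric] m(2) root_coord(3)[OF Y m(1)] by simp
    also have "\<dots> = poly q x" unfolding q_def poly_prod using m by (auto intro!: prod_zero[symmetric] bexI[of _ m])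
    finally show "poly p x = poly q x" .
  qed
  then have "poly p (g i) = poly q (g i)" by simp
  moreover have "poly p (g i) = Y i * (\<Prod>k\<in>{1..N}-{i}. g k - g i)"
  proof -
    have "poly p (g i) = (\<Sum>j=1..N. if j = i then Y i * (\<Prod>k\<in>{1..N}-{i}. g k - g i) else 0)"
      unfolding p_def poly_sum poly_smult poly_prod
    proof (rule sum.cong[OF refl])
      fix j assume j: "j \<in> {1..N}"
      have "(\<Prod>k\<in>{1..N}-{j}. poly [:g k, -1:] (g i)) = 0" if "j \<noteq> i"
        by (rule prod_zero) (use that i in \<open>auto intro!: bexI[of _ i]\<close>)
      then show "Y j * (\<Prod>k\<in>{1..N}-{j}. poly [:g k, -1:] (g i)) = (if j = i then Y i * (\<Prod>k\<in>{1..N}-{i}. g k - g i) else 0)"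
        by auto
    qed
    then show ?thesis using i by simp
  qed
  moreover have "poly q (g i) = (\<Prod>k=1..N-1. ?z k - g i)" by (simp add: q_def poly_prod)
  ultimately show ?thesis by simp
qed

lemma root_gap:
  assumes Y: "Y \<in> open_simplex N" and \<delta>: "\<And>j. j \<in> {1..N-1} \<Longrightarrow> g j + \<delta> \<le> root_coord g N Y j \<and> root_coord g N Y j \<le> g (Suc j) - \<delta>"
    and i: "i \<in> {1..N}" and j: "j \<in> {1..N-1}"
  shows "\<delta> \<le> \<bar>g i - root_coord g N Y j\<bar>"
proof (cases "i \<le> j")
  case True
  then have "g i \<le> g j" using g_le[of i j] i j by auto
  then show ?thesis using \<delta>[OF j] by linarith
next
  case False
  then have "g (Suc j) \<le> g i" using g_le[of "Suc j" i] i j by auto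
  then show ?thesis using \<delta>[OF j] by linarith
qed

text \<open>In the product formula every factor with a root is at least \<delta> in absolute value
  and every factor with two poles is at most \<open>width\<close>. This converts distance of the
  roots from the poles into distance of the state from the boundary of the simplex.\<close>

lemma conc_lower_bound:
  assumes Y: "Y \<in> open_simplex N" and \<delta>0: "0 < \<delta>"
    and \<delta>: "\<And>j. j \<in> {1..N-1} \<Longrightarrow> g j + \<delta> \<le> root_coord g N Y j \<and> root_coord g N Y j \<le> g (Suc j) - \<delta>"
    and i: "i \<in> {1..N}"
  shows "(\<delta> / width) ^ (N - 1) \<le> Y i"
proof -
  have "\<delta> ^ (N - 1) = (\<Prod>k=1..N-1. \<delta>)" by simp
  also have "\<dots> \<le> (\<Prod>k=1..N-1. \<bar>root_coord g N Y k - g i\<bar>)"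
    using root_gap[OF Y \<delta> i] \<delta>0 by (intro prod_mono) (auto simp: abs_minus_commute)
  also have "\<dots> = \<bar>Y i * (\<Prod>k\<in>{1..N}-{i}. g k - g i)\<bar>" unfolding conc_root_formula[OF Y i] by (simp add: abs_prod)
  also have "\<dots> = Y i * (\<Prod>k\<in>{1..N}-{i}. \<bar>g k - g i\<bar>)"
    using simplexD(1)[OF Y i] by (simp add: abs_mult abs_prod)
  also have "\<dots> \<le> Y i * (\<Prod>k\<in>{1..N}-{i}. width)"
  proof (intro mult_left_mono prod_mono)
    show "0 \<le> \<bar>g k - g i\<bar> \<and> \<bar>g k - g i\<bar> \<le> width" if "k \<in> {1..N}-{i}" for k
      using g_bounds[of k] g_bounds[OF i] that by (auto simp: width_def)
  qed (use simplexD(1)[OF Y i] in simp)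
  also have "\<dots> = Y i * width ^ (N - 1)" using i by simp
  finally show ?thesis using width_pos by (simp add: power_divide divide_le_eq)
qed

section \<open>Moments, entropy variables and the inverse Vandermonde matrix\<close>

definition lagrange :: "nat \<Rightarrow> real poly" where
  "lagrange k = smult (1 / (\<Prod>j\<in>{1..N}-{k}. g j - g k)) (\<Prod>j\<in>{1..N}-{k}. [:g j, -1:])"

lemma lagrange:
  assumes k: "k \<in> {1..N}"
  shows "degree (lagrange k) < N" "\<And>i. i \<in> {1..N} \<Longrightarrow> poly (lagrange k) (g i) = (if i = k then 1 else 0)"
proof -
  have "degree (\<Prod>j\<in>{1..N}-{k}. [:g j, -1:]) \<le> N - 1"
    using poly_linear_prod(1)[of "{1..N}-{k}" g] k by simp
  then show "degree (lagrange k) < N" unfolding lagrange_def using degree_smult_le N2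
    by (meson diff_less le_less_trans less_le_trans pos2 zero_less_one)
  fix i assume i: "i \<in> {1..N}"
  have ne: "(\<Prod>j\<in>{1..N}-{k}. g j - g k) \<noteq> 0" using g_inj k by auto
  show "poly (lagrange k) (g i) = (if i = k then 1 else 0)"
  proof (cases "i = k")
    case True
    then show ?thesis using ne by (simp add: lagrange_def poly_prod)
  next
    case False
    then have "(\<Prod>j\<in>{1..N}-{k}. poly [:g j, -1:] (g i)) = 0"
      using i by (intro prod_zero) (auto intro!: bexI[of _ i])
    then show ?thesis using False by (simp add: lagrange_def poly_prod)
  qed
qed

text \<open>The entries of the inverse of the Vandermonde matrix with entries
  \<open>g i ^ l\<close>. The next two lemmas are the two orders of multiplication.\<close>

definition lc :: "nat \<Rightarrow> nat \<Rightarrow> real" where "lc k l = coeff (lagrange k) l"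

lemma lc_sum:
  assumes "k \<in> {1..N}" "i \<in> {1..N}"
  shows "(\<Sum>l<N. lc k l * g i ^ l) = (if i = k then 1 else 0)"
proof -
  have "poly (lagrange k) (g i) = (\<Sum>l\<le>degree (lagrange k). lc k l * g i ^ l)" by (simp add: poly_altdef lc_def)
  also have "\<dots> = (\<Sum>l<N. lc k l * g i ^ l)"
    by (rule sum.mono_neutral_left) (use lagrange(1)[OF assms(1)] in \<open>auto simp: lc_def coeff_eq_0\<close>)
  finally show ?thesis using lagrange(2)[OF assms] by simp
qed

text \<open>Lagrange interpolation at the N distinct nodes reproduces each monomial of degree below
  N; comparing coefficients gives the claim.\<close>

lemma lc_dual:
  assumes "l < N" "m < N"
  shows "(\<Sum>k=1..N. lc k l * g k ^ m) = (if l = m then 1 else 0)"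
proof -
  let ?p = "\<Sum>k=1..N. smult (g k ^ m) (lagrange k)"
  have "?p = monom 1 m"
  proof (rule poly_eqI_degree[where A="g ` {1..N}"])
    have "inj_on g {1..N}" by (rule strict_mono_on_imp_inj_on[OF g_mono])
    then have c: "card (g ` {1..N}) = N" by (simp add: card_image)
    have "degree ?p \<le> N - 1"
      by (rule degree_sum_le) (use lagrange(1) in \<open>force intro: order_trans[OF degree_smult_le]\<close>)+
    then show "degree ?p < card (g ` {1..N})" using c N2 by simp
    show "degree (monom (1::real) m) < card (g ` {1..N})" using c assms(2) by (simp add: degree_monom_eq)
    fix x assume "x \<in> g ` {1..N}"
    then obtain i where i: "i \<in> {1..N}" "x = g i" by blast
    have "poly ?p x = (\<Sum>k=1..N. if k = i then g k ^ m else 0)"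
      unfolding poly_sum poly_smult i(2) by (intro sum.cong) (use lagrange(2) i in auto)
    then show "poly ?p x = poly (monom 1 m) x" using i by (simp add: poly_monom)
  qed
  then have "coeff ?p l = coeff (monom 1 m) l" by simp
  then show ?thesis by (simp add: coeff_sum lc_def mult.commute)
qed

text \<open>The zeroth moment is 1 on the simplex and completes the moments of orders 1 to N - 1 to
  a full, invertible Vandermonde system.\<close>

lemma simplex_moment_inj:
  assumes "Y \<in> open_simplex N" "Y' \<in> open_simplex N" "\<And>l. l \<in> {1..N-1} \<Longrightarrow> moment g N Y l = moment g N Y' l"
    and k: "k \<in> {1..N}"
  shows "Y k = Y' k"
proof -
  have m: "(\<Sum>i=1..N. g i ^ l * (Y i - Y' i)) = 0" if "l < N" for l
  proof (cases "l = 0")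
    case True
    then show ?thesis using assms(1,2) by (simp add: open_simplex_def sum_subtractf)
  next
    case False
    then show ?thesis using assms(3)[of l] that by (simp add: moment_def right_diff_distrib sum_subtractf)
  qed
  have "Y k - Y' k = (\<Sum>i=1..N. (\<Sum>l<N. lc k l * g i ^ l) * (Y i - Y' i))"
  proof -
    have "(\<Sum>i=1..N. (\<Sum>l<N. lc k l * g i ^ l) * (Y i - Y' i)) = (\<Sum>i=1..N. if i = k then Y k - Y' k else 0)"
      by (intro sum.cong refl) (use lc_sum[OF k] in auto)
    then show ?thesis using k by simp
  qed
  also have "\<dots> = (\<Sum>l<N. lc k l * (\<Sum>i=1..N. g i ^ l * (Y i - Y' i)))"
    unfolding sum_distrib_right sum_distrib_left by (subst sum.swap) (simp add: mult_ac)
  also have "\<dots> = 0" using m by simp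
  finally show ?thesis by simp
qed

text \<open>Varying one moment moves the concentrations along a line in the direction of one column
  of the inverse Vandermonde matrix. The entropy is differentiated along that line; the contribution
  of the derivative of the logarithm is the sum of that column, which is zero because l is
  positive.\<close>

lemma entropy_var_eq:
  assumes Y: "Y \<in> open_simplex N" and l: "l \<in> {1..N-1}"
  shows "entropy_var g N Y l = (\<Sum>k=1..N. lc k l * ln (Y k))"
proof -
  define U where "U = moment g N Y"
  \<comment> \<open>The state whose l-th moment is s and whose other moments are those of Y. It is
    in the simplex only for s close to \<open>U l\<close>, so below the entropy density is
    identified only on a neighbourhood, which determines its derivative.\<close>
  define Ys where "Ys s i = Y i + (s - U l) * lc i l" for s i
  have lN: "l < N" "0 < N" using l by auto
  have sum1: "(\<Sum>i=1..N. Ys s i) = 1" for s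
    using lc_dual[OF lN] l simplexD(2)[OF Y] by (simp add: Ys_def sum.distrib sum_distrib_left[symmetric])
  have mom: "moment g N (Ys s) m = (U(l := s)) m" if m: "m \<in> {1..N-1}" for s m
  proof -
    have "moment g N (Ys s) m = (\<Sum>i=1..N. g i ^ m * Y i) + (s - U l) * (\<Sum>i=1..N. lc i l * g i ^ m)"
      unfolding moment_def Ys_def by (simp add: distrib_left sum.distrib sum_distrib_left mult_ac)
    also have "\<dots> = (U(l := s)) m"
    proof -
      have "m < N" using m by auto
      then show ?thesis using lc_dual[OF lN(1), of m] by (auto simp: U_def moment_def)
    qed
    finally show ?thesis .
  qed
  have Ys0: "Ys (U l) = Y" by (simp add: Ys_def fun_eq_iff)
  have "\<forall>\<^sub>F s in nhds (U l). \<forall>i\<in>{1..N}. 0 < Ys s i"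
  proof (intro eventually_ball_finite ballI)
    fix i assume "i \<in> {1..N}"
    then have "0 < Ys (U l) i" using simplexD(1)[OF Y] Ys0 by simp
    moreover have "isCont (\<lambda>s. Ys s i) (U l)" unfolding Ys_def by (intro continuous_intros)
    ultimately show "\<forall>\<^sub>F s in nhds (U l). 0 < Ys s i"
      unfolding isCont_def tendsto_at_iff_tendsto_nhds[of "\<lambda>s. Ys s i" "U l"] by (rule order_tendstoD(1)[rotated])
  qed simp
  then have ev: "\<forall>\<^sub>F s in nhds (U l). entropy_density g N (U(l := s)) = (\<Sum>i=1..N. Ys s i * ln (Ys s i))"
  proof eventually_elim
    case (elim s)
    let ?P = "\<lambda>y. y \<in> open_simplex N \<and> (\<forall>m\<in>{1..N-1}. moment g N y m = (U(l := s)) m)"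
    have P: "?P (Ys s)" using elim sum1 mom by (simp add: open_simplex_def)
    then have P': "?P (conc_of_moment g N (U(l := s)))" unfolding conc_of_moment_def by (rule someI[of ?P])
    have "conc_of_moment g N (U(l := s)) i = Ys s i" if "i \<in> {1..N}" for i
      by (rule simplex_moment_inj[OF conjunct1[OF P'] conjunct1[OF P] _ that])
         (simp only: bspec[OF conjunct2[OF P]] bspec[OF conjunct2[OF P']])
    then show ?case unfolding entropy_density_def by simp
  qed
  have d: "((\<lambda>s. \<Sum>i=1..N. Ys s i * ln (Ys s i)) has_real_derivative (\<Sum>k=1..N. lc k l * ln (Y k))) (at (U l))"
  proof -
    have "((\<lambda>s. Ys s i * ln (Ys s i)) has_real_derivative lc i l * ln (Y i) + lc i l) (at (U l))" if i: "i \<in> {1..N}" for i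
    proof -
      have p: "0 < Ys (U l) i" using simplexD(1)[OF Y i] Ys0 by simp
      have y: "((\<lambda>s. Ys s i) has_real_derivative lc i l) (at (U l))"
        unfolding Ys_def by (auto intro!: derivative_eq_intros)
      show ?thesis by (rule derivative_eq_intros y p refl)+ (use p in \<open>simp add: Ys0\<close>)
    qed
    then have "((\<lambda>s. \<Sum>i=1..N. Ys s i * ln (Ys s i)) has_real_derivative (\<Sum>i=1..N. lc i l * ln (Y i) + lc i l)) (at (U l))"
      by (rule DERIV_sum)
    moreover have "(\<Sum>i=1..N. lc i l) = 0" using lc_dual[OF lN] l by simp
    ultimately show ?thesis by (simp add: sum.distrib)
  qed
  have "((\<lambda>s. entropy_density g N (U(l := s))) has_real_derivative (\<Sum>k=1..N. lc k l * ln (Y k))) (at (U l))"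
    using d DERIV_cong_ev[OF refl ev refl] by simp
  then show ?thesis unfolding entropy_var_def U_def[symmetric] by (rule DERIV_imp_deriv)
qed

text \<open>By the inverse Vandermonde relation the exponent of species i is the logarithm of its
  concentration minus a number \<kappa>, the missing coefficient of order 0. It does not depend on i
  and cancels in the normalisation.\<close>

lemma conc_of_entropy_var:
  assumes Y: "Y \<in> open_simplex N" and i: "i \<in> {1..N}"
  shows "conc_of_entropy g N (entropy_var g N Y) i = Y i"
proof -
  define \<kappa> where "\<kappa> = (\<Sum>k=1..N. lc k 0 * ln (Y k))"
  have e: "exp (\<Sum>l=1..N-1. g i ^ l * entropy_var g N Y l) = Y i * exp (- \<kappa>)" if i: "i \<in> {1..N}" for i
  proof -
    have "{..<N} = insert 0 {1..N-1}" using N2 by auto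
    then have s: "(\<Sum>l=1..N-1. lc k l * g i ^ l) = (if i = k then 1 else 0) - lc k 0" if "k \<in> {1..N}" for k
      using lc_sum[OF that i] by simp
    have "(\<Sum>l=1..N-1. g i ^ l * entropy_var g N Y l) = (\<Sum>l=1..N-1. \<Sum>k=1..N. g i ^ l * (lc k l * ln (Y k)))"
      by (intro sum.cong refl) (simp add: entropy_var_eq[OF Y] sum_distrib_left)
    also have "\<dots> = (\<Sum>k=1..N. (\<Sum>l=1..N-1. lc k l * g i ^ l) * ln (Y k))"
      by (subst sum.swap, intro sum.cong refl) (simp add: sum_distrib_left mult_ac)
    also have "\<dots> = (\<Sum>k=1..N. (if i = k then ln (Y k) else 0) - lc k 0 * ln (Y k))"
      by (intro sum.cong refl) (simp only: s left_diff_distrib, simp)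
    also have "\<dots> = ln (Y i) - \<kappa>" using i by (simp add: sum_subtractf \<kappa>_def)
    finally show ?thesis using simplexD(1)[OF Y i] by (simp add: exp_diff exp_minus divide_inverse)
  qed
  have "(\<Sum>r=1..N. exp (\<Sum>l=1..N-1. g r ^ l * entropy_var g N Y l)) = exp (- \<kappa>)"
    using e simplexD(2)[OF Y] by (simp add: sum_distrib_right[symmetric])
  then show ?thesis unfolding conc_of_entropy_def using e[OF i] by simp
qed

text \<open>The derivative of the normalised exponential map: each species is weighted by the
  deviation of its exponent from the mean. Directions may be vectors, so the same formula yields
  time derivatives and gradients.\<close>

definition conc_lin :: "(nat \<Rightarrow> real) \<Rightarrow> (nat \<Rightarrow> 'v::real_vector) \<Rightarrow> nat \<Rightarrow> 'v" where
  "conc_lin Y v i = Y i *\<^sub>R ((\<Sum>l=1..N-1. g i ^ l *\<^sub>R v l) - (\<Sum>r=1..N. Y r *\<^sub>R (\<Sum>l=1..N-1. g r ^ l *\<^sub>R v l)))"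

lemma conc_of_entropy_has_derivative:
  assumes "\<And>l. l \<in> {1..N-1} \<Longrightarrow> ((\<lambda>x. W x l) has_derivative W' l) (at x within S)"
  shows "((\<lambda>x. conc_of_entropy g N (W x) i) has_derivative
    (\<lambda>h. conc_lin (conc_of_entropy g N (W x)) (\<lambda>l. W' l h) i)) (at x within S)"
proof -
  define a where "a r x = (\<Sum>l=1..N-1. g r ^ l * W x l)" for r x
  define a' where "a' r h = (\<Sum>l=1..N-1. g r ^ l * W' l h)" for r h
  define Z where "Z x = (\<Sum>r=1..N. exp (a r x))" for x
  have Z: "0 < Z x" for x unfolding Z_def using N2 by (intro sum_pos) auto
  have da: "(a r has_derivative a' r) (at x within S)" for r
    unfolding a_def[abs_def] a'_def[abs_def]
    by (intro has_derivative_sum has_derivative_mult_right assms)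
  have de: "((\<lambda>x. exp (a r x)) has_derivative (\<lambda>h. exp (a r x) * a' r h)) (at x within S)" for r
    by (rule derivative_eq_intros da)+ (simp add: mult.commute)
  have dZ: "(Z has_derivative (\<lambda>h. \<Sum>r=1..N. exp (a r x) * a' r h)) (at x within S)"
    unfolding Z_def[abs_def] by (intro has_derivative_sum de)
  have "((\<lambda>x. exp (a i x) / Z x) has_derivative
      (\<lambda>h. - exp (a i x) * (inverse (Z x) * (\<Sum>r=1..N. exp (a r x) * a' r h) * inverse (Z x)) + (exp (a i x) * a' i h) / Z x)) (at x within S)"
    by (rule has_derivative_divide[OF de dZ]) (use Z[of x] in simp)
  moreover have "- exp (a i x) * (inverse (Z x) * (\<Sum>r=1..N. exp (a r x) * a' r h) * inverse (Z x)) + (exp (a i x) * a' i h) / Z x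
     = exp (a i x) / Z x * (a' i h - (\<Sum>r=1..N. exp (a r x) / Z x * a' r h))" for h
  proof -
    have "(\<Sum>r=1..N. exp (a r x) / Z x * a' r h) = (\<Sum>r=1..N. exp (a r x) * a' r h) / Z x"
      by (simp add: sum_divide_distrib)
    then show ?thesis by (simp add: right_diff_distrib divide_inverse mult_ac)
  qed
  ultimately show ?thesis
    unfolding conc_of_entropy_def conc_lin_def real_scaleR_def a_def a'_def Z_def by simp
qed

lemma conc_deriv_eq: "conc_deriv g N w v i = conc_lin (conc_of_entropy g N w) v i"
proof -
  have "((\<lambda>s. w l + s * v l) has_derivative (\<lambda>h. h * v l)) (at 0)" for l
    by (auto intro!: derivative_eq_intros)
  then have "((\<lambda>s. conc_of_entropy g N (\<lambda>l. w l + s * v l) i) has_derivative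
     (\<lambda>h. conc_lin (conc_of_entropy g N w) (\<lambda>l. h * v l) i)) (at 0)"
    using conc_of_entropy_has_derivative[of "\<lambda>s l. w l + s * v l" "\<lambda>l h. h * v l" 0 UNIV i] by simp
  moreover have "conc_lin (conc_of_entropy g N w) (\<lambda>l. h * v l) i = conc_lin (conc_of_entropy g N w) v i * h" for h
    unfolding conc_lin_def real_scaleR_def
    by (simp add: sum_distrib_left sum_distrib_right right_diff_distrib left_diff_distrib mult_ac)
  ultimately have "((\<lambda>s. conc_of_entropy g N (\<lambda>l. w l + s * v l) i) has_real_derivative conc_lin (conc_of_entropy g N w) v i) (at 0)"
    by (simp add: has_field_derivative_def)
  then show ?thesis unfolding conc_deriv_def by (rule DERIV_imp_deriv)
qed

lemma conc_lin_inner: "conc_lin Y v i \<bullet> k = conc_lin Y (\<lambda>l. v l \<bullet> k) i"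
  by (simp add: conc_lin_def inner_diff_left inner_sum_left)

lemma conc_lin_sum_0:
  assumes "Y \<in> open_simplex N"
  shows "(\<Sum>i=1..N. conc_lin Y v i) = 0"
  using simplexD(2)[OF assms]
  by (simp add: conc_lin_def scaleR_diff_right sum_subtractf scaleR_sum_left[symmetric])

section \<open>Explicit inversion of the flux relation\<close>

definition shift :: "(nat \<Rightarrow> real) \<Rightarrow> real" where "shift Y = (\<Sum>i=1..N. g i * Y i)"

text \<open>The common vector T in P_i = y_i T - (g_i + s) J_i, expressed through P alone: divide by
  g_i + s and sum over i, so that the fluxes disappear because their sum is zero.\<close>

definition drive :: "(nat \<Rightarrow> real) \<Rightarrow> (nat \<Rightarrow> 'v::real_vector) \<Rightarrow> 'v" where
  "drive Y P = inverse (\<Sum>i=1..N. Y i * inverse (g i + shift Y)) *\<^sub>R (\<Sum>i=1..N. inverse (g i + shift Y) *\<^sub>R P i)"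

definition flux :: "(nat \<Rightarrow> real) \<Rightarrow> (nat \<Rightarrow> 'v::real_vector) \<Rightarrow> nat \<Rightarrow> 'v" where
  "flux Y P i = inverse (g i + shift Y) *\<^sub>R (Y i *\<^sub>R drive Y P - P i)"

lemma shift_pos: "Y \<in> open_simplex N \<Longrightarrow> 0 < shift Y"
  unfolding shift_def using N2 g_pos simplexD(1) by (intro sum_pos mult_pos_pos) auto

lemma shift_le: "Y \<in> open_simplex N \<Longrightarrow> shift Y \<le> g N"
proof -
  assume Y: "Y \<in> open_simplex N"
  have "shift Y \<le> (\<Sum>i=1..N. g N * Y i)"
    unfolding shift_def by (intro sum_mono mult_right_mono) (use g_bounds simplexD(1)[OF Y] in \<open>auto intro: less_imp_le\<close>)
  then show ?thesis using simplexD(2)[OF Y] by (simp add: sum_distrib_left[symmetric])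
qed

lemma flux_denominators:
  assumes "Y \<in> open_simplex N"
  shows "i \<in> {1..N} \<Longrightarrow> 0 < g i + shift Y" "0 < (\<Sum>i=1..N. Y i * inverse (g i + shift Y))"
proof -
  show p: "0 < g i + shift Y" if "i \<in> {1..N}" for i using g_pos[OF that] shift_pos[OF assms] by simp
  show "0 < (\<Sum>i=1..N. Y i * inverse (g i + shift Y))"
    using N2 p simplexD(1)[OF assms] by (intro sum_pos mult_pos_pos) auto
qed

text \<open>In the coefficient g_i + g_j the part with g_i is annihilated by the zero sum of the
  fluxes, and the part with g_j produces one vector common to all species. The diagonal entry is -
  (g_i + s) plus 2 g_i y_i, and the last term fills the gap left at j = i.\<close>

lemma MS_matrix_apply:
  fixes J :: "nat \<Rightarrow> 'v::real_vector"
  assumes Y: "Y \<in> open_simplex N" and J0: "(\<Sum>j=1..N. J j) = 0" and i: "i \<in> {1..N}"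
  shows "(\<Sum>j=1..N. MS_matrix (additive_coeff g) N Y i j *\<^sub>R J j)
    = Y i *\<^sub>R (\<Sum>j=1..N. g j *\<^sub>R J j) - (g i + shift Y) *\<^sub>R J i"
proof -
  have sp: "{1..N} = insert i ({1..N} - {i})" using i by auto
  have rem: "(\<Sum>j\<in>{1..N}-{i}. f j) = (\<Sum>j=1..N. f j) - f i" for f :: "nat \<Rightarrow> 'w::ab_group_add"
    using i by (simp add: sum_diff1)
  have "(\<Sum>j=1..N. MS_matrix (additive_coeff g) N Y i j *\<^sub>R J j)
      = MS_matrix (additive_coeff g) N Y i i *\<^sub>R J i + (\<Sum>j\<in>{1..N}-{i}. MS_matrix (additive_coeff g) N Y i j *\<^sub>R J j)"
    using i by (simp add: sum.remove)
  also have "(\<Sum>j\<in>{1..N}-{i}. MS_matrix (additive_coeff g) N Y i j *\<^sub>R J j) = (\<Sum>j\<in>{1..N}-{i}. (Y i * (g i + g j)) *\<^sub>R J j)"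
    by (intro sum.cong) (auto simp: MS_matrix_def additive_coeff_def)
  also have "\<dots> = (\<Sum>j=1..N. (Y i * (g i + g j)) *\<^sub>R J j) - (Y i * (g i + g i)) *\<^sub>R J i" by (rule rem)
  also have "(\<Sum>j=1..N. (Y i * (g i + g j)) *\<^sub>R J j) = (Y i * g i) *\<^sub>R (\<Sum>j=1..N. J j) + Y i *\<^sub>R (\<Sum>j=1..N. g j *\<^sub>R J j)"
    by (simp add: scaleR_sum_right sum.distrib[symmetric] algebra_simps)
  also have "MS_matrix (additive_coeff g) N Y i i = - (g i + shift Y - 2 * (g i * Y i))"
  proof -
    have "(\<Sum>l\<in>{1..N}-{i}. (g i + g l) * Y l) = (\<Sum>l=1..N. (g i + g l) * Y l) - (g i + g i) * Y i" by (rule rem)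
    also have "(\<Sum>l=1..N. (g i + g l) * Y l) = g i + shift Y"
      using simplexD(2)[OF Y] by (simp add: distrib_right sum.distrib shift_def sum_distrib_left[symmetric])
    finally show ?thesis by (simp add: MS_matrix_def additive_coeff_def algebra_simps)
  qed
  finally show ?thesis using J0 by (simp add: algebra_simps)
qed

text \<open>The relation and the zero sum determine the common vector and through it each flux. This
  ties the existentially quantified flux of \<open>MS_equation\<close> to a formula.\<close>

lemma flux_unique:
  fixes J :: "nat \<Rightarrow> 'v::real_vector"
  assumes Y: "Y \<in> open_simplex N" and J0: "(\<Sum>j=1..N. J j) = 0"
    and P: "\<And>i. i \<in> {1..N} \<Longrightarrow> P i = (\<Sum>j=1..N. MS_matrix (additive_coeff g) N Y i j *\<^sub>R J j)" and i: "i \<in> {1..N}"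
  shows "J i = flux Y P i"
proof -
  define T where "T = (\<Sum>j=1..N. g j *\<^sub>R J j)"
  have P': "P i = Y i *\<^sub>R T - (g i + shift Y) *\<^sub>R J i" if "i \<in> {1..N}" for i
    using P[OF that] MS_matrix_apply[OF Y J0 that] by (simp add: T_def)
  have pos: "g i + shift Y \<noteq> 0" if "i \<in> {1..N}" for i using flux_denominators(1)[OF Y that] by simp
  have "(\<Sum>i=1..N. inverse (g i + shift Y) *\<^sub>R P i) = (\<Sum>i=1..N. (Y i * inverse (g i + shift Y)) *\<^sub>R T - J i)"
    by (intro sum.cong refl) (simp add: P' pos scaleR_diff_right mult.commute)
  also have "\<dots> = (\<Sum>i=1..N. Y i * inverse (g i + shift Y)) *\<^sub>R T"
    using J0 by (simp add: sum_subtractf scaleR_sum_left)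
  finally have "drive Y P = T" unfolding drive_def using flux_denominators(2)[OF Y] by simp
  then show ?thesis unfolding flux_def using P'[OF i] pos[OF i] by simp
qed

text \<open>The zero sum of the fluxes is the normalisation built into \<open>drive\<close>; summing
  the relation over all species then identifies \<open>drive\<close> with the g-weighted sum of the
  fluxes.\<close>

lemma flux_identities:
  fixes P :: "nat \<Rightarrow> 'v::real_vector"
  assumes Y: "Y \<in> open_simplex N" and P0: "(\<Sum>i=1..N. P i) = 0"
  shows "(\<Sum>i=1..N. flux Y P i) = 0" "drive Y P = (\<Sum>i=1..N. g i *\<^sub>R flux Y P i)"
    "i \<in> {1..N} \<Longrightarrow> P i = Y i *\<^sub>R drive Y P - (g i + shift Y) *\<^sub>R flux Y P i"
proof -
  let ?S = "drive Y P"
  have pos: "g i + shift Y \<noteq> 0" if "i \<in> {1..N}" for i using flux_denominators(1)[OF Y that] by simp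
  have "(\<Sum>i=1..N. flux Y P i) = (\<Sum>i=1..N. (Y i * inverse (g i + shift Y)) *\<^sub>R ?S) - (\<Sum>i=1..N. inverse (g i + shift Y) *\<^sub>R P i)"
    unfolding flux_def by (simp add: scaleR_diff_right sum_subtractf mult.commute)
  also have "\<dots> = 0"
    using flux_denominators(2)[OF Y] unfolding scaleR_sum_left[symmetric] drive_def by simp
  finally show s0: "(\<Sum>i=1..N. flux Y P i) = 0" .
  show P: "P i = Y i *\<^sub>R ?S - (g i + shift Y) *\<^sub>R flux Y P i" if "i \<in> {1..N}" for i
    unfolding flux_def using pos[OF that] by simp
  have "0 = (\<Sum>i=1..N. Y i *\<^sub>R ?S - (g i + shift Y) *\<^sub>R flux Y P i)" using P0 P by simp
  also have "\<dots> = ?S - (\<Sum>i=1..N. g i *\<^sub>R flux Y P i)"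
    using s0 simplexD(2)[OF Y]
    by (simp add: sum_subtractf scaleR_sum_left[symmetric] scaleR_add_left sum.distrib scaleR_sum_right[symmetric])
  finally show "?S = (\<Sum>i=1..N. g i *\<^sub>R flux Y P i)" by simp
qed

text \<open>The identity behind the diagonalisation: at a root, the flux of the rational function is a multiple of the root gradient.\<close>

lemma flux_at_root:
  fixes P :: "nat \<Rightarrow> 'v::real_vector"
  assumes Y: "Y \<in> open_simplex N" and P0: "(\<Sum>i=1..N. P i) = 0" and z: "rat Y \<zeta> = 0"
    and ne: "\<And>i. i \<in> {1..N} \<Longrightarrow> g i \<noteq> \<zeta>" and sz: "shift Y + \<zeta> \<noteq> 0"
  shows "(\<Sum>i=1..N. inverse (g i - \<zeta>) *\<^sub>R flux Y P i) = - (inverse (shift Y + \<zeta>) *\<^sub>R (\<Sum>i=1..N. inverse (g i - \<zeta>) *\<^sub>R P i))"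
proof -
  let ?S = "drive Y P"
  have pos: "g i + shift Y \<noteq> 0" if "i \<in> {1..N}" for i using flux_denominators(1)[OF Y that] by simp
  have "(shift Y + \<zeta>) *\<^sub>R (inverse (g i - \<zeta>) *\<^sub>R flux Y P i) =
      (Y i * inverse (g i - \<zeta>)) *\<^sub>R ?S - inverse (g i - \<zeta>) *\<^sub>R P i - flux Y P i" if i: "i \<in> {1..N}" for i
  proof -
    \<comment> \<open>Partial fractions: s + \<zeta> is the difference of g_i + s, which meets the
      flux relation, and g_i - \<zeta>, which cancels the pole and leaves a sum of fluxes equal to
      zero.\<close>
    have "(shift Y + \<zeta>) * inverse (g i - \<zeta>) = (g i + shift Y) * inverse (g i - \<zeta>) - 1"
      using ne[OF i] by (simp add: field_simps)
    then have "(shift Y + \<zeta>) *\<^sub>R (inverse (g i - \<zeta>) *\<^sub>R flux Y P i) =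
        inverse (g i - \<zeta>) *\<^sub>R ((g i + shift Y) *\<^sub>R flux Y P i) - flux Y P i"
      by (simp add: scaleR_diff_left mult.commute)
    also have "(g i + shift Y) *\<^sub>R flux Y P i = Y i *\<^sub>R ?S - P i"
      unfolding flux_def using pos[OF i] by simp
    finally show ?thesis by (simp add: scaleR_diff_right mult.commute)
  qed
  then have "(shift Y + \<zeta>) *\<^sub>R (\<Sum>i=1..N. inverse (g i - \<zeta>) *\<^sub>R flux Y P i) =
      (\<Sum>i=1..N. (Y i * inverse (g i - \<zeta>)) *\<^sub>R ?S - inverse (g i - \<zeta>) *\<^sub>R P i - flux Y P i)"
    unfolding scaleR_sum_right by (intro sum.cong) auto
  also have "\<dots> = rat Y \<zeta> *\<^sub>R ?S - (\<Sum>i=1..N. inverse (g i - \<zeta>) *\<^sub>R P i)"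
    using flux_identities(1)[OF Y P0] by (simp add: sum_subtractf scaleR_sum_left rat_def divide_inverse)
  finally have "(shift Y + \<zeta>) *\<^sub>R (\<Sum>i=1..N. inverse (g i - \<zeta>) *\<^sub>R flux Y P i) = - (\<Sum>i=1..N. inverse (g i - \<zeta>) *\<^sub>R P i)"
    using z by simp
  then have "inverse (shift Y + \<zeta>) *\<^sub>R ((shift Y + \<zeta>) *\<^sub>R (\<Sum>i=1..N. inverse (g i - \<zeta>) *\<^sub>R flux Y P i))
      = inverse (shift Y + \<zeta>) *\<^sub>R (- (\<Sum>i=1..N. inverse (g i - \<zeta>) *\<^sub>R P i))" by simp
  then show ?thesis using sz by simp
qed

lemma f_max: "i \<in> {1..N} \<Longrightarrow> j \<in> {1..N} \<Longrightarrow> i \<noteq> j \<Longrightarrow> g i + g j \<le> f_max g N" "0 < f_max g N"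
proof -
  let ?A = "{additive_coeff g i j |i j. i \<in> {1..N} \<and> j \<in> {1..N} \<and> i \<noteq> j}"
  have "?A \<subseteq> (\<lambda>(i, j). additive_coeff g i j) ` ({1..N} \<times> {1..N})" by auto
  then have fin: "finite ?A" by (rule finite_subset) auto
  show le: "g i + g j \<le> f_max g N" if "i \<in> {1..N}" "j \<in> {1..N}" "i \<noteq> j" for i j
    unfolding f_max_def by (rule Max_ge[OF fin]) (use that in \<open>auto simp: additive_coeff_def\<close>)
  show "0 < f_max g N" using le[of 1 2] g_pos[of 1] g_pos[of 2] N2 by auto
qed

text \<open>Discrete integration by parts: exchanging the summation indices turns the terms with
  \<open>b j\<close> into those with \<open>b i\<close>, up to the sign of the difference of the
  a's.\<close>

lemma symmetric_double_sum:
  fixes a b :: "nat \<Rightarrow> 'v::real_inner"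
  assumes "\<And>i j. m i j = m j i"
  shows "(\<Sum>i=1..N. \<Sum>j=1..N. m i j * ((a i - a j) \<bullet> (b i - b j))) = 2 * (\<Sum>i=1..N. (\<Sum>j=1..N. m i j *\<^sub>R (a i - a j)) \<bullet> b i)"
proof -
  let ?X = "\<Sum>i=1..N. \<Sum>j=1..N. m i j * ((a i - a j) \<bullet> b i)"
  have "(\<Sum>i=1..N. \<Sum>j=1..N. m i j * ((a i - a j) \<bullet> (b i - b j))) = ?X - (\<Sum>i=1..N. \<Sum>j=1..N. m i j * ((a i - a j) \<bullet> b j))"
    by (simp add: inner_diff_right right_diff_distrib sum_subtractf)
  also have "(\<Sum>i=1..N. \<Sum>j=1..N. m i j * ((a i - a j) \<bullet> b j)) = (\<Sum>i=1..N. \<Sum>j=1..N. m j i * ((a j - a i) \<bullet> b i))"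
    by (rule sum.swap)
  also have "\<dots> = - ?X"
    unfolding sum_negf[symmetric] using assms by (intro sum.cong refl) (simp add: inner_diff_left algebra_simps)
  finally show ?thesis by (simp add: inner_sum_left)
qed

text \<open>
  With \<open>u\<^sub>i = J\<^sub>i / y\<^sub>i\<close> and \<open>v\<^sub>i = P\<^sub>i / y\<^sub>i\<close>, expanding the nonnegative quadratic form with coefficients
  \<open>f\<^sub>i\<^sub>jy\<^sub>iy\<^sub>j\<close> at \<open>u + v / f\<^sub>m\<^sub>a\<^sub>x\<close> gives the bound with the constant \<open>f\<^sub>m\<^sub>a\<^sub>x\<close>; estimating \<open>g\<^sub>i + s\<close> directly
  would not.
\<close>

lemma entropy_dissipation_ge:
  fixes P :: "nat \<Rightarrow> 'v::real_inner"
  assumes Y: "Y \<in> open_simplex N" and P0: "(\<Sum>i=1..N. P i) = 0"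
  shows "(\<Sum>i=1..N. (P i \<bullet> P i) / Y i) \<le> f_max g N * - (\<Sum>i=1..N. (flux Y P i \<bullet> P i) / Y i)"
proof -
  define f where "f = f_max g N"
  have f0: "0 < f" unfolding f_def by (rule f_max)
  define J where "J = flux Y P"
  define m where "m i j = (g i + g j) * (Y i * Y j)" for i j
  have ms: "m i j = m j i" for i j by (simp add: m_def mult.commute add.commute)
  define u where "u i = inverse (Y i) *\<^sub>R J i" for i
  define v where "v i = inverse (Y i) *\<^sub>R P i" for i
  have Y0: "0 < Y i" if "i \<in> {1..N}" for i using simplexD(1)[OF Y that] .
  \<comment> \<open>Applied to u, the operator of the quadratic form is the flux relation itself, so
    the pairings of u with u and with v become entropy production and Fisher information.\<close>
  have mu: "(\<Sum>j=1..N. m i j *\<^sub>R (u i - u j)) = - P i" if i: "i \<in> {1..N}" for i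
  proof -
    have "(\<Sum>j=1..N. m i j *\<^sub>R (u i - u j)) = (\<Sum>j=1..N. ((g i + g j) * Y j) *\<^sub>R J i - (Y i * (g i + g j)) *\<^sub>R J j)"
    proof (intro sum.cong refl)
      fix j assume j: "j \<in> {1..N}"
      have "m i j * inverse (Y i) = (g i + g j) * Y j" "m i j * inverse (Y j) = Y i * (g i + g j)"
        using Y0[OF i] Y0[OF j] by (simp_all add: m_def field_simps)
      then show "m i j *\<^sub>R (u i - u j) = ((g i + g j) * Y j) *\<^sub>R J i - (Y i * (g i + g j)) *\<^sub>R J j"
        by (simp add: u_def scaleR_diff_right)
    qed
    also have "\<dots> = (\<Sum>j=1..N. (g i + g j) * Y j) *\<^sub>R J i - (\<Sum>j=1..N. (Y i * g i) *\<^sub>R J j + Y i *\<^sub>R (g j *\<^sub>R J j))"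
      by (simp add: sum_subtractf scaleR_sum_left algebra_simps)
    also have "(\<Sum>j=1..N. (g i + g j) * Y j) = g i + shift Y"
      using simplexD(2)[OF Y] by (simp add: distrib_right sum.distrib shift_def sum_distrib_left[symmetric])
    also have "(\<Sum>j=1..N. (Y i * g i) *\<^sub>R J j + Y i *\<^sub>R (g j *\<^sub>R J j)) = Y i *\<^sub>R drive Y P"
      unfolding sum.distrib scaleR_sum_right[symmetric] J_def flux_identities(1,2)[OF Y P0] by simp
    finally show ?thesis using flux_identities(3)[OF Y P0 i] by (simp add: J_def)
  qed
  define E where "E a b = (\<Sum>i=1..N. \<Sum>j=1..N. m i j * ((a i - a j) \<bullet> (b i - b j)))" for a b :: "nat \<Rightarrow> 'v"
  define X where "X = (\<Sum>i=1..N. (P i \<bullet> P i) / Y i)"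
  define D where "D = - (\<Sum>i=1..N. (J i \<bullet> P i) / Y i)"
  have mub: "(\<Sum>i=1..N. (\<Sum>j=1..N. m i j *\<^sub>R (u i - u j)) \<bullet> b i) = (\<Sum>i=1..N. - (P i \<bullet> b i))" for b
    by (intro sum.cong refl) (simp only: mu inner_minus_left)
  have Euu: "E u u = 2 * D" and Euv: "E u v = - 2 * X"
    unfolding E_def symmetric_double_sum[OF ms] D_def X_def mub
    by (simp_all add: u_def v_def sum_negf divide_inverse inner_commute mult.commute)
  \<comment> \<open>Coefficients are replaced by their maximum; the diagonal terms vanish in any
    case, so the maximum over different indices suffices. With constant coefficients the zero sum of
    P makes the form explicit.\<close>
  have Evv: "E v v \<le> 2 * (f * X)"
  proof -
    have "E v v \<le> (\<Sum>i=1..N. \<Sum>j=1..N. (f * (Y i * Y j)) * ((v i - v j) \<bullet> (v i - v j)))"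
      unfolding E_def
    proof (intro sum_mono)
      fix i j assume ij: "i \<in> {1..N}" "j \<in> {1..N}"
      show "m i j * ((v i - v j) \<bullet> (v i - v j)) \<le> (f * (Y i * Y j)) * ((v i - v j) \<bullet> (v i - v j))"
      proof (cases "i = j")
        case False
        then show ?thesis unfolding m_def f_def
          using f_max(1)[OF ij] Y0[OF ij(1)] Y0[OF ij(2)] by (intro mult_right_mono) auto
      qed simp
    qed
    also have "\<dots> = 2 * (\<Sum>i=1..N. (\<Sum>j=1..N. (f * (Y i * Y j)) *\<^sub>R (v i - v j)) \<bullet> v i)"
      by (rule symmetric_double_sum) (simp add: mult.commute)
    also have "(\<Sum>i=1..N. (\<Sum>j=1..N. (f * (Y i * Y j)) *\<^sub>R (v i - v j)) \<bullet> v i) = (\<Sum>i=1..N. f * ((P i \<bullet> P i) / Y i))"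
    proof (intro sum.cong refl)
      fix i assume i: "i \<in> {1..N}"
      have "(\<Sum>j=1..N. (f * (Y i * Y j)) *\<^sub>R (v i - v j)) = (\<Sum>j=1..N. (f * Y j) *\<^sub>R P i - (f * Y i) *\<^sub>R P j)"
      proof (intro sum.cong refl)
        fix j assume j: "j \<in> {1..N}"
        have "f * (Y i * Y j) * inverse (Y i) = f * Y j" "f * (Y i * Y j) * inverse (Y j) = f * Y i"
          using Y0[OF i] Y0[OF j] by (simp_all add: field_simps)
        then show "(f * (Y i * Y j)) *\<^sub>R (v i - v j) = (f * Y j) *\<^sub>R P i - (f * Y i) *\<^sub>R P j"
          by (simp only: v_def scaleR_diff_right scaleR_scaleR)
      qed
      also have "\<dots> = f *\<^sub>R P i"
        using P0 simplexD(2)[OF Y]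
        by (simp add: sum_subtractf scaleR_sum_left[symmetric] scaleR_sum_right[symmetric] sum_distrib_left[symmetric])
      finally show "(\<Sum>j=1..N. (f * (Y i * Y j)) *\<^sub>R (v i - v j)) \<bullet> v i = f * ((P i \<bullet> P i) / Y i)"
        by (simp add: v_def divide_inverse mult_ac)
    qed
    finally show ?thesis by (simp add: X_def sum_distrib_left)
  qed
  \<comment> \<open>With c in place of the inverse of f the form at u + c v is at most 2 D - 4 c X +
    2 c^2 f X, a bound that is smallest at c = 1/f.\<close>
  define a where "a i = u i + inverse f *\<^sub>R v i" for i
  have "E a a = E u u + 2 * inverse f * E u v + inverse f * inverse f * E v v"
  proof -
    have "(a i - a j) \<bullet> (a i - a j) = (u i - u j) \<bullet> (u i - u j) + 2 * inverse f * ((u i - u j) \<bullet> (v i - v j))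
        + inverse f * inverse f * ((v i - v j) \<bullet> (v i - v j))" for i j
    proof -
      have "a i - a j = (u i - u j) + inverse f *\<^sub>R (v i - v j)" by (simp add: a_def scaleR_diff_right)
      then show ?thesis
        by (simp only: inner_add_left inner_add_right inner_scaleR_left inner_scaleR_right)
           (simp add: inner_commute distrib_left mult_ac)
    qed
    then show ?thesis unfolding E_def by (simp add: distrib_left sum.distrib sum_distrib_left mult_ac)
  qed
  moreover have "0 \<le> E a a"
    unfolding E_def m_def using Y0 g_pos by (intro sum_nonneg mult_nonneg_nonneg add_nonneg_nonneg) (auto intro: less_imp_le)
  moreover have "inverse f * inverse f * E v v \<le> 2 * inverse f * X"
  proof -
    have "inverse f * inverse f * (2 * (f * X)) = 2 * inverse f * X" using f0 by (simp add: field_simps)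
    moreover have "inverse f * inverse f * E v v \<le> inverse f * inverse f * (2 * (f * X))"
      by (rule mult_left_mono[OF Evv]) (use f0 in simp)
    ultimately show ?thesis by linarith
  qed
  ultimately have "0 \<le> 2 * D - 2 * inverse f * X" using Euu Euv by (simp add: algebra_simps)
  then have "X \<le> f * D" using f0 by (simp add: field_simps)
  then show ?thesis by (simp add: X_def D_def f_def J_def)
qed

end

section \<open>Integrals depending on time\<close>

text \<open>The set where the functions differ is open and null, hence empty, and equality extends
  to the closure by continuity. It upgrades almost-everywhere identities in space up to the
  boundary, and later also in time.\<close>

lemma AE_eq_continuous_imp_eq:
  fixes f h :: "'a::euclidean_space \<Rightarrow> 'b::real_normed_vector"
  assumes o: "open S" and f: "continuous_on (closure S) f" and h: "continuous_on (closure S) h"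
    and ae: "AE x in lebesgue_on S. f x = h x" and x: "x \<in> closure S"
  shows "f x = h x"
proof -
  define d where "d x = f x - h x" for x
  have dc: "continuous_on (closure S) d" unfolding d_def by (intro continuous_intros f h)
  have S: "S \<in> sets lebesgue" using o by simp
  let ?U = "{x \<in> S. d x \<noteq> 0}"
  have "open (S \<inter> d -` (- {0}))"
    by (rule continuous_open_preimage[OF continuous_on_subset[OF dc closure_subset] o]) (simp add: open_Compl)
  moreover have "S \<inter> d -` (- {0}) = ?U" by auto
  ultimately have oU: "open ?U" by simp
  have "AE x in lebesgue. x \<notin> ?U"
    using ae S by (simp add: AE_restrict_space_iff d_def)
  then have "negligible ?U"
    using oU by (simp add: negligible_iff_null_sets AE_iff_null_sets lborelD)
  then have "?U = {}" using open_not_negligible[OF oU] by blast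
  then have "d x = 0" if "x \<in> S" for x using that by auto
  from continuous_constant_on_closure[OF dc this x] show ?thesis by (simp add: d_def)
qed

lemma continuous_on_section:
  assumes "continuous_on (I \<times> S) (\<lambda>(t, x). f t x)" "t \<in> I"
  shows "continuous_on S (f t)"
  using continuous_on_compose2[OF assms(1) continuous_on_Pair[OF continuous_on_const[of S t] continuous_on_id]] assms(2)
  by auto

lemma continuous_on_LINT:
  fixes f :: "real \<Rightarrow> 'a::euclidean_space \<Rightarrow> real"
  assumes b: "bounded \<Omega>" and S: "\<Omega> \<in> sets lebesgue" and I: "compact I"
    and f: "continuous_on (I \<times> closure \<Omega>) (\<lambda>(t, x). f t x)"
  shows "continuous_on I (\<lambda>t. LINT x|lebesgue_on \<Omega>. f t x)"
proof -
  have K: "compact (closure \<Omega>)" using b by (simp add: compact_closure)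
  obtain B where B: "\<forall>z\<in>I \<times> closure \<Omega>. norm ((\<lambda>(t, x). f t x) z) \<le> B"
    using compact_continuous_bounded[OF compact_Times[OF I K] f] by blast
  have fx: "continuous_on (closure \<Omega>) (f t)" if "t \<in> I" for t
    by (rule continuous_on_section[OF f that])
  have ft: "continuous_on I (\<lambda>t. f t x)" if "x \<in> closure \<Omega>" for x
    using continuous_on_compose2[OF f continuous_on_Pair[OF continuous_on_id continuous_on_const[of I x]]] that
    by auto
  have int: "integrable (lebesgue_on \<Omega>) (f t)" if "t \<in> I" for t
    by (rule integrable_continuous_compact[OF K fx[OF that] S closure_subset])
  have lm: "\<Omega> \<in> lmeasurable" using b S by (rule bounded_set_imp_lmeasurable)
  have iB: "integrable (lebesgue_on \<Omega>) (\<lambda>x. B)"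
    using finite_measure.integrable_const[OF finite_measure_lebesgue_on[OF lm]] by blast
  show ?thesis
    unfolding continuous_on_sequentially
  proof (intro allI ballI impI, elim conjE)
    fix u t assume t: "t \<in> I" and u: "\<forall>n. u n \<in> I" "u \<longlonglongrightarrow> t"
    have "(\<lambda>n. LINT x|lebesgue_on \<Omega>. f (u n) x) \<longlonglongrightarrow> (LINT x|lebesgue_on \<Omega>. f t x)"
    proof (rule integral_dominated_convergence[where w="\<lambda>x. B"])
      show "AE x in lebesgue_on \<Omega>. (\<lambda>n. f (u n) x) \<longlonglongrightarrow> f t x"
      proof (rule AE_I2)
        fix x assume "x \<in> space (lebesgue_on \<Omega>)"
        then have "x \<in> closure \<Omega>" using closure_subset[of \<Omega>] by auto
        then show "(\<lambda>n. f (u n) x) \<longlonglongrightarrow> f t x"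
          using continuous_on_tendsto_compose[OF ft u(2) t] u(1) by simp
      qed
      show "AE x in lebesgue_on \<Omega>. norm (f (u n) x) \<le> B" for n
        using B u(1) closure_subset[of \<Omega>] by (intro AE_I2) auto
    qed (use int t u(1) iB in \<open>auto intro: borel_measurable_integrable\<close>)
    then show "((\<lambda>t. LINT x|lebesgue_on \<Omega>. f t x) \<circ> u) \<longlonglongrightarrow> (LINT x|lebesgue_on \<Omega>. f t x)" by (simp add: o_def)
  qed
qed

lemma DERIV_within_Icc_bound:
  fixes f :: "real \<Rightarrow> real"
  assumes "\<And>t. t \<in> {a..b} \<Longrightarrow> (f has_real_derivative f' t) (at t within {a..b})"
    and "\<And>t. t \<in> {a..b} \<Longrightarrow> \<bar>f' t\<bar> \<le> B" and "s \<in> {a..b}" "t \<in> {a..b}"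
  shows "\<bar>f s - f t\<bar> \<le> B * \<bar>s - t\<bar>"
  using field_differentiable_bound[of "{a..b}" f f' B s t] assms by simp

text \<open>The bound B for the derivative dominates all difference quotients by the mean value
  theorem. The derivative is one-sided at the ends of the interval.\<close>

lemma has_real_derivative_LINT:
  fixes f :: "real \<Rightarrow> 'a::euclidean_space \<Rightarrow> real"
  assumes S: "S \<in> lmeasurable" and int: "\<And>t. t \<in> {a..b} \<Longrightarrow> integrable (lebesgue_on S) (f t)"
    and d: "\<And>t x. t \<in> {a..b} \<Longrightarrow> x \<in> S \<Longrightarrow> ((\<lambda>t. f t x) has_real_derivative f' t x) (at t within {a..b})"
    and B: "\<And>t x. t \<in> {a..b} \<Longrightarrow> x \<in> S \<Longrightarrow> \<bar>f' t x\<bar> \<le> B" and m: "\<And>t. t \<in> {a..b} \<Longrightarrow> integrable (lebesgue_on S) (f' t)"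
    and t: "t \<in> {a..b}"
  shows "((\<lambda>t. LINT x|lebesgue_on S. f t x) has_real_derivative (LINT x|lebesgue_on S. f' t x)) (at t within {a..b})"
  unfolding has_field_derivative_iff tendsto_at_iff_sequentially
proof (intro allI impI)
  fix u assume u: "\<forall>n. u n \<in> {a..b} - {t}" "u \<longlonglongrightarrow> t"
  have iB: "integrable (lebesgue_on S) (\<lambda>x. B)"
    using finite_measure.integrable_const[OF finite_measure_lebesgue_on[OF S]] by blast
  have un: "u n \<in> {a..b}" "u n \<noteq> t" for n using u(1) by auto
  have "(\<lambda>n. LINT x|lebesgue_on S. (f (u n) x - f t x) / (u n - t)) \<longlonglongrightarrow> (LINT x|lebesgue_on S. f' t x)"
  proof (rule integral_dominated_convergence[where w="\<lambda>x. B"])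
    show "AE x in lebesgue_on S. (\<lambda>n. (f (u n) x - f t x) / (u n - t)) \<longlonglongrightarrow> f' t x"
    proof (rule AE_I2)
      fix x assume "x \<in> space (lebesgue_on S)"
      then have "((\<lambda>s. (f s x - f t x) / (s - t)) \<longlongrightarrow> f' t x) (at t within {a..b})"
        using d[OF t, of x] by (simp add: has_field_derivative_iff)
      then show "(\<lambda>n. (f (u n) x - f t x) / (u n - t)) \<longlonglongrightarrow> f' t x"
        using u unfolding tendsto_at_iff_sequentially by (auto simp: o_def)
    qed
    show "AE x in lebesgue_on S. norm ((f (u n) x - f t x) / (u n - t)) \<le> B" for n
    proof (rule AE_I2)
      fix x assume x: "x \<in> space (lebesgue_on S)"
      have "\<bar>f (u n) x - f t x\<bar> \<le> B * \<bar>u n - t\<bar>"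
        by (rule DERIV_within_Icc_bound[where f="\<lambda>t. f t x" and f'="\<lambda>t. f' t x"]) (use d B un t x in auto)
      then show "norm ((f (u n) x - f t x) / (u n - t)) \<le> B" using un(2)[of n] by (simp add: divide_le_eq)
    qed
  qed (use int un t iB m in \<open>auto intro: borel_measurable_integrable\<close>)
  moreover have eq: "(LINT x|lebesgue_on S. (f (u n) x - f t x) / (u n - t)) =
      ((LINT x|lebesgue_on S. f (u n) x) - (LINT x|lebesgue_on S. f t x)) / (u n - t)" for n
    using int[OF un(1)] int[OF t] by simp
  ultimately show "((\<lambda>s. ((LINT x|lebesgue_on S. f s x) - (LINT x|lebesgue_on S. f t x)) / (s - t)) \<circ> u) \<longlonglongrightarrow> (LINT x|lebesgue_on S. f' t x)"
    by (simp only: o_def eq)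
qed

text \<open>The function exp (- c t) E(t) is nonincreasing. The constant c may have any sign: zero
  yields conservation, a negative value decay, a positive one uniqueness from zero data.\<close>

lemma gronwall_decay:
  fixes E :: "real \<Rightarrow> real"
  assumes "a \<le> b" and d: "\<And>t. t \<in> {a..b} \<Longrightarrow> (E has_real_derivative E' t) (at t within {a..b})"
    and le: "\<And>t. t \<in> {a..b} \<Longrightarrow> E' t \<le> c * E t"
  shows "E b \<le> exp (c * (b - a)) * E a"
proof (cases "a = b")
  case False
  then have ab: "a < b" using assms(1) by simp
  define h where "h t = exp (- c * t) * E t" for t
  have hd: "(h has_real_derivative exp (- c * t) * (E' t - c * E t)) (at t within {a..b})" if "t \<in> {a..b}" for t
  proof -
    have "((\<lambda>t. exp (- c * t)) has_real_derivative - c * exp (- c * t)) (at t within {a..b})"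
      by (auto intro!: derivative_eq_intros)
    from DERIV_mult[OF this d[OF that]]
    have "(h has_real_derivative - c * exp (- c * t) * E t + E' t * exp (- c * t)) (at t within {a..b})"
      unfolding h_def[abs_def] .
    moreover have "- c * e * x + x' * e = e * (x' - c * x)" for e x x' :: real by (simp add: algebra_simps)
    ultimately show ?thesis by simp
  qed
  have cont: "continuous_on {a..b} h" by (rule DERIV_continuous_on[OF hd])
  have "(h has_real_derivative exp (- c * t) * (E' t - c * E t)) (at t)" if "a < t" "t < b" for t
    using hd[of t] that by (simp add: at_within_Icc_at)
  then have "\<exists>y. (h has_real_derivative y) (at t) \<and> y \<le> 0" if "a < t" "t < b" for t
    using le[of t] that by (intro exI conjI) (auto simp: mult_le_0_iff)
  then have "h b \<le> h a" by (intro DERIV_nonpos_imp_decreasing_open[OF assms(1) _ cont]) auto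
  then have "exp (c * b) * (exp (- c * b) * E b) \<le> exp (c * b) * (exp (- c * a) * E a)"
    unfolding h_def by (rule mult_left_mono) simp
  moreover have eq: "exp (c * b) * (exp (- c * r) * x) = exp (c * (b - r)) * x" for r x
    unfolding mult.assoc[symmetric] exp_add[symmetric] right_diff_distrib by simp
  ultimately show ?thesis by (simp only: eq) simp
qed simp

section \<open>Regularity classes\<close>

text \<open>A class closed under sums, products and inverses bounded away from zero. The flux is
  assembled by these operations, so its bounded derivative follows from that of y and its
  gradient.\<close>

definition C1b :: "'a::euclidean_space set \<Rightarrow> ('a \<Rightarrow> 'b::real_normed_vector) \<Rightarrow> bool" where
  "C1b S V \<longleftrightarrow> (\<exists>V'. bdd_deriv S V V') \<and> (\<exists>B. \<forall>x\<in>S. norm (V x) \<le> B)"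

lemma C1bE:
  assumes "C1b S V"
  obtains V' B where "bdd_deriv S V V'" "\<forall>x\<in>S. norm (V x) \<le> B"
  using assms unfolding C1b_def by blast

lemma C1b_const: "C1b S (\<lambda>x. c)"
  unfolding C1b_def using bdd_deriv_const by blast

lemma C1b_add:
  assumes "C1b S U" "C1b S V"
  shows "C1b S (\<lambda>x. U x + V x)"
proof -
  obtain U' B where U: "bdd_deriv S U U'" "\<forall>x\<in>S. norm (U x) \<le> B" by (rule C1bE[OF assms(1)])
  obtain V' B' where V: "bdd_deriv S V V'" "\<forall>x\<in>S. norm (V x) \<le> B'" by (rule C1bE[OF assms(2)])
  have "\<forall>x\<in>S. norm (U x + V x) \<le> B + B'" using U(2) V(2) by (simp add: norm_triangle_mono)
  then show ?thesis unfolding C1b_def using bdd_deriv_add[OF U(1) V(1)] by blast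
qed

lemma C1b_scaleR:
  assumes "C1b S u" "C1b S V"
  shows "C1b S (\<lambda>x. u x *\<^sub>R V x)"
proof -
  obtain u' B where U: "bdd_deriv S u u'" "\<forall>x\<in>S. norm (u x) \<le> B" by (rule C1bE[OF assms(1)])
  obtain V' B' where V: "bdd_deriv S V V'" "\<forall>x\<in>S. norm (V x) \<le> B'" by (rule C1bE[OF assms(2)])
  have "\<forall>x\<in>S. norm (u x *\<^sub>R V x) \<le> B * B'"
    unfolding norm_scaleR using U(2) V(2) by (auto intro!: mult_mono intro: order_trans[OF abs_ge_zero])
  then show ?thesis unfolding C1b_def
    using bdd_deriv_scaleR[OF U(1) _ V(1), of B B'] U(2) V(2) by blast
qed

lemma C1b_diff:
  assumes "C1b S U" "C1b S V"
  shows "C1b S (\<lambda>x. U x - V x)"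
  using C1b_add[OF assms(1) C1b_scaleR[OF C1b_const[of S "-1"] assms(2)]] by simp

lemma C1b_sum: "finite I \<Longrightarrow> (\<And>i. i \<in> I \<Longrightarrow> C1b S (V i)) \<Longrightarrow> C1b S (\<lambda>x. \<Sum>i\<in>I. V i x)"
  by (induction I rule: finite_induct) (auto intro: C1b_add C1b_const)

lemma C1b_mult: "C1b S u \<Longrightarrow> C1b S v \<Longrightarrow> C1b S (\<lambda>x. u x * v x :: real)"
  using C1b_scaleR[of S u v] by simp

lemma C1b_inverse:
  fixes u :: "'a::euclidean_space \<Rightarrow> real"
  assumes "C1b S u" "0 < c" "\<And>x. x \<in> S \<Longrightarrow> c \<le> u x"
  shows "C1b S (\<lambda>x. inverse (u x))"
proof -
  obtain u' B where U: "bdd_deriv S u u'" "\<forall>x\<in>S. norm (u x) \<le> B" by (rule C1bE[OF assms(1)])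
  obtain C where C: "0 < C" "\<And>x. x \<in> S \<Longrightarrow> (u has_derivative u' x) (at x)"
    "\<And>x h. x \<in> S \<Longrightarrow> norm (u' x h) \<le> C * norm h" using bdd_derivE[OF U(1)] by blast
  have i: "0 < inverse (u x)" "inverse (u x) \<le> inverse c" if "x \<in> S" for x
    using assms(2) assms(3)[OF that] by (auto intro: le_imp_inverse_le)
  have d: "((\<lambda>x. inverse (u x)) has_derivative (\<lambda>h. - (inverse (u x) * u' x h * inverse (u x)))) (at x)" if "x \<in> S" for x
    by (rule Deriv.has_derivative_inverse[OF _ C(2)[OF that]]) (use i[OF that] in auto)
  have "norm (- (inverse (u x) * u' x h * inverse (u x))) \<le> inverse c * C * inverse c * norm h" if "x \<in> S" for x h
  proof -
    have "\<bar>inverse (u x)\<bar> * \<bar>u' x h\<bar> * \<bar>inverse (u x)\<bar> \<le> inverse c * (C * norm h) * inverse c"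
      using i[OF that] C(1) C(3)[OF that, of h] assms(2) by (intro mult_mono mult_nonneg_nonneg) auto
    then show ?thesis by (simp add: abs_mult mult_ac)
  qed
  moreover have "\<forall>x\<in>S. norm (inverse (u x)) \<le> inverse c" using i by force
  moreover have "bdd_deriv S (\<lambda>x. inverse (u x)) (\<lambda>x h. - (inverse (u x) * u' x h * inverse (u x)))"
    unfolding bdd_deriv_def using calculation(1) d by (intro exI[of _ "inverse c * C * inverse c"]) simp
  ultimately show ?thesis unfolding C1b_def by blast
qed

lemma parabolic_holder_imp_continuous:
  assumes h: "parabolic_holder_on a b I S f" and ab: "0 < a" "0 < b"
  shows "continuous_on (I \<times> S) (\<lambda>(t, x). f t x)"
proof -
  obtain C where C: "\<And>t s x y. t \<in> I \<Longrightarrow> s \<in> I \<Longrightarrow> x \<in> S \<Longrightarrow> y \<in> S \<Longrightarrow>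
     norm (f t x - f s y) \<le> C * (\<bar>t - s\<bar> powr a + norm (x - y) powr b)"
    using h unfolding parabolic_holder_on_def by blast
  show ?thesis unfolding continuous_on_def
  proof
    fix z assume z: "z \<in> I \<times> S"
    let ?q = "\<lambda>w. C * (\<bar>fst w - fst z\<bar> powr a + norm (snd w - snd z) powr b)"
    have "((\<lambda>w. \<bar>fst w - fst z\<bar>) \<longlongrightarrow> \<bar>fst z - fst z\<bar>) (at z within I \<times> S)"
      "((\<lambda>w. norm (snd w - snd z)) \<longlongrightarrow> norm (snd z - snd z)) (at z within I \<times> S)" by (intro tendsto_intros)+
    then have l: "((\<lambda>w. \<bar>fst w - fst z\<bar>) \<longlongrightarrow> 0) (at z within I \<times> S)"
      "((\<lambda>w. norm (snd w - snd z)) \<longlongrightarrow> 0) (at z within I \<times> S)" by simp_all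
    have "((\<lambda>w. \<bar>fst w - fst z\<bar> powr a) \<longlongrightarrow> 0) (at z within I \<times> S)"
      by (rule tendsto_zero_powrI[OF l(1) tendsto_const _ ab(1)]) simp
    moreover have "((\<lambda>w. norm (snd w - snd z) powr b) \<longlongrightarrow> 0) (at z within I \<times> S)"
      by (rule tendsto_zero_powrI[OF l(2) tendsto_const _ ab(2)]) simp
    ultimately have "(?q \<longlongrightarrow> C * (0 + 0)) (at z within I \<times> S)" by (intro tendsto_mult tendsto_add tendsto_const)
    then have q: "(?q \<longlongrightarrow> 0) (at z within I \<times> S)" by simp
    have "((\<lambda>w. (case w of (t, x) \<Rightarrow> f t x) - (case z of (t, x) \<Rightarrow> f t x)) \<longlongrightarrow> 0) (at z within I \<times> S)"
    proof (rule Lim_null_comparison[OF _ q])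
      show "\<forall>\<^sub>F w in at z within I \<times> S. norm ((case w of (t, x) \<Rightarrow> f t x) - (case z of (t, x) \<Rightarrow> f t x)) \<le> ?q w"
        unfolding eventually_at_filter
      proof (rule always_eventually, intro allI impI)
        fix w assume "w \<in> I \<times> S"
        then show "norm ((case w of (t, x) \<Rightarrow> f t x) - (case z of (t, x) \<Rightarrow> f t x)) \<le> ?q w"
          using C[of "fst w" "fst z" "snd w" "snd z"] z by (auto simp: split_beta)
      qed
    qed
    then show "((\<lambda>(t, x). f t x) \<longlongrightarrow> (\<lambda>(t, x). f t x) z) (at z within I \<times> S)" by (rule LIM_zero_cancel)
  qed
qed

text \<open>Of the Hoelder bounds only continuity up to the closure is kept. The second derivatives
  survive just as a bound for the derivative of \<open>Du t\<close>, obtained by expanding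
  directions in the basis.\<close>

lemma parabolic_C12E:
  fixes u :: "real \<Rightarrow> 'a::euclidean_space \<Rightarrow> real"
  assumes u: "parabolic_C12 \<sigma> \<tau> T \<Omega> u" and \<sigma>: "0 < \<sigma>" and b: "bounded \<Omega>"
  shows "\<exists>ut Du. (\<forall>t\<in>{\<tau>..T}. \<forall>x\<in>\<Omega>. ((\<lambda>s. u s x) has_real_derivative ut t x) (at t within {\<tau>..T})) \<and>
    (\<forall>t\<in>{\<tau>..T}. \<forall>x\<in>\<Omega>. (u t has_derivative (\<lambda>h. Du t x \<bullet> h)) (at x)) \<and>
    (\<forall>t\<in>{\<tau>..T}. C1b \<Omega> (Du t)) \<and>
    continuous_on ({\<tau>..T} \<times> closure \<Omega>) (\<lambda>(t, x). u t x) \<and>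
    continuous_on ({\<tau>..T} \<times> closure \<Omega>) (\<lambda>(t, x). ut t x) \<and>
    continuous_on ({\<tau>..T} \<times> closure \<Omega>) (\<lambda>(t, x). Du t x)"
proof -
  obtain ut Du D2u where d: "\<And>t x. t \<in> {\<tau>..T} \<Longrightarrow> x \<in> \<Omega> \<Longrightarrow>
        ((\<lambda>s. u s x) has_real_derivative ut t x) (at t within {\<tau>..T}) \<and>
        (u t has_derivative (\<lambda>h. Du t x \<bullet> h)) (at x) \<and> (Du t has_derivative D2u t x) (at x)"
    and c: "continuous_on ({\<tau>..T} \<times> closure \<Omega>) (\<lambda>(t, x). u t x)"
    and h1: "parabolic_holder_on (\<sigma> / 2) \<sigma> {\<tau>..T} (closure \<Omega>) ut"
    and h2: "parabolic_holder_on ((1 + \<sigma>) / 2) \<sigma> {\<tau>..T} (closure \<Omega>) Du"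
    and h3: "\<And>b. b \<in> Basis \<Longrightarrow> parabolic_holder_on (\<sigma> / 2) \<sigma> {\<tau>..T} (closure \<Omega>) (\<lambda>t x. D2u t x b)"
    using u unfolding parabolic_C12_def by blast
  have c1: "continuous_on ({\<tau>..T} \<times> closure \<Omega>) (\<lambda>(t, x). ut t x)"
    by (rule parabolic_holder_imp_continuous[OF h1]) (use \<sigma> in auto)
  have c2: "continuous_on ({\<tau>..T} \<times> closure \<Omega>) (\<lambda>(t, x). Du t x)"
    by (rule parabolic_holder_imp_continuous[OF h2]) (use \<sigma> in auto)
  have c3: "continuous_on ({\<tau>..T} \<times> closure \<Omega>) (\<lambda>(t, x). D2u t x b)" if "b \<in> Basis" for b
    by (rule parabolic_holder_imp_continuous[OF h3[OF that]]) (use \<sigma> in auto)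
  have K: "compact ({\<tau>..T} \<times> closure \<Omega>)" using b by (intro compact_Times) (auto simp: compact_closure)
  have "\<forall>b\<in>Basis. \<exists>B. \<forall>z\<in>{\<tau>..T} \<times> closure \<Omega>. norm ((\<lambda>(t, x). D2u t x b) z) \<le> B"
    using compact_continuous_bounded[OF K c3] by blast
  then obtain B where "\<forall>b\<in>Basis. \<forall>z\<in>{\<tau>..T} \<times> closure \<Omega>. norm ((\<lambda>(t, x). D2u t x b) z) \<le> B b"
    unfolding bchoice_iff by blast
  then have B: "norm (D2u t x b) \<le> B b" if "b \<in> Basis" "t \<in> {\<tau>..T}" "x \<in> \<Omega>" for t x b
    using that closure_subset[of \<Omega>] by fastforce
  obtain B2 where B2: "\<forall>z\<in>{\<tau>..T} \<times> closure \<Omega>. norm ((\<lambda>(t, x). Du t x) z) \<le> B2"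
    using compact_continuous_bounded[OF K c2] by blast
  have "C1b \<Omega> (Du t)" if t: "t \<in> {\<tau>..T}" for t
  proof -
    have "norm (D2u t x h) \<le> (\<Sum>b\<in>Basis. B b) * norm h" if x: "x \<in> \<Omega>" for x h
    proof -
      have "(Du t has_derivative D2u t x) (at x)" using d[OF t x] by blast
      then have l: "linear (D2u t x)" by (rule has_derivative_linear)
      have "D2u t x h = D2u t x (\<Sum>b\<in>Basis. (h \<bullet> b) *\<^sub>R b)" by (simp add: euclidean_representation)
      also have "\<dots> = (\<Sum>b\<in>Basis. (h \<bullet> b) *\<^sub>R D2u t x b)"
        using l by (simp add: linear_sum linear_cmul)
      finally have "norm (D2u t x h) \<le> (\<Sum>b\<in>Basis. norm ((h \<bullet> b) *\<^sub>R D2u t x b))"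
        using norm_sum[of "\<lambda>b. (h \<bullet> b) *\<^sub>R D2u t x b" Basis] by (simp del: norm_scaleR)
      also have "\<dots> \<le> (\<Sum>b\<in>Basis. norm h * B b)"
        unfolding norm_scaleR using B[OF _ t x] Basis_le_norm by (intro sum_mono mult_mono) auto
      finally show ?thesis by (simp add: sum_distrib_left mult.commute)
    qed
    then have "bdd_deriv \<Omega> (Du t) (D2u t)" unfolding bdd_deriv_def using d[OF t] by blast
    moreover have "\<forall>x\<in>\<Omega>. norm (Du t x) \<le> B2" using B2 t closure_subset[of \<Omega>] by fastforce
    ultimately show ?thesis unfolding C1b_def by blast
  qed
  then show ?thesis using d c c1 c2 by (intro exI[of _ ut] exI[of _ Du]) simp
qed

section \<open>Bochner integrals tested by boxes\<close>

lemma Lp_norm_nonneg: "0 \<le> Lp_norm p \<Omega> u"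
  by (simp add: Lp_norm_def)

lemma X0_norm_ge: "l \<in> {1..m} \<Longrightarrow> Lp_norm p \<Omega> (\<lambda>x. v x l) \<le> X0_norm p m \<Omega> v"
  unfolding X0_norm_def by (rule member_le_sum) (auto simp: Lp_norm_nonneg)

lemma powr_add_bound:
  fixes a b p :: real
  assumes "0 \<le> a" "0 \<le> b" "0 < p"
  shows "(a + b) powr p \<le> 2 powr p * (a powr p + b powr p)"
proof -
  have "(a + b) powr p \<le> (2 * max a b) powr p" using assms by (intro powr_mono2) auto
  also have "\<dots> = 2 powr p * (max a b) powr p" using assms by (simp add: powr_mult)
  also have "(max a b) powr p \<le> a powr p + b powr p" by (simp add: max_def)
  finally show ?thesis by simp
qed

lemma in_Lp_scale: "in_Lp p \<Omega> u \<Longrightarrow> in_Lp p \<Omega> (\<lambda>x. c * u x)"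
  unfolding in_Lp_def by (auto simp: abs_mult powr_mult)

lemma in_Lp_add:
  assumes "in_Lp p \<Omega> u" "in_Lp p \<Omega> v" "0 < p"
  shows "in_Lp p \<Omega> (\<lambda>x. u x + v x)"
proof -
  have m: "u \<in> borel_measurable (lebesgue_on \<Omega>)" "v \<in> borel_measurable (lebesgue_on \<Omega>)"
    using assms by (auto simp: in_Lp_def)
  have "integrable (lebesgue_on \<Omega>) (\<lambda>x. 2 powr p * (\<bar>u x\<bar> powr p + \<bar>v x\<bar> powr p))"
    using assms by (auto simp: in_Lp_def)
  then have "integrable (lebesgue_on \<Omega>) (\<lambda>x. \<bar>u x + v x\<bar> powr p)"
  proof (rule Bochner_Integration.integrable_bound)
    show "(\<lambda>x. \<bar>u x + v x\<bar> powr p) \<in> borel_measurable (lebesgue_on \<Omega>)" using m by measurable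
    show "AE x in lebesgue_on \<Omega>. norm (\<bar>u x + v x\<bar> powr p) \<le> norm (2 powr p * (\<bar>u x\<bar> powr p + \<bar>v x\<bar> powr p))"
    proof (rule AE_I2)
      fix x
      have "\<bar>u x + v x\<bar> powr p \<le> (\<bar>u x\<bar> + \<bar>v x\<bar>) powr p" using assms(3) by (intro powr_mono2) auto
      also have "\<dots> \<le> 2 powr p * (\<bar>u x\<bar> powr p + \<bar>v x\<bar> powr p)" by (rule powr_add_bound) (use assms(3) in auto)
      finally show "norm (\<bar>u x + v x\<bar> powr p) \<le> norm (2 powr p * (\<bar>u x\<bar> powr p + \<bar>v x\<bar> powr p))" by simp
    qed
  qed
  then show ?thesis unfolding in_Lp_def using m by auto
qed

lemma in_Lp_diff: "in_Lp p \<Omega> u \<Longrightarrow> in_Lp p \<Omega> v \<Longrightarrow> 0 < p \<Longrightarrow> in_Lp p \<Omega> (\<lambda>x. u x - v x)"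
  using in_Lp_add[of p \<Omega> u "\<lambda>x. - 1 * v x"] in_Lp_scale[of p \<Omega> v "-1"] by simp

lemma in_Lp_sum:
  "finite I \<Longrightarrow> (\<And>i. i \<in> I \<Longrightarrow> in_Lp p \<Omega> (u i)) \<Longrightarrow> 0 < p \<Longrightarrow> in_Lp p \<Omega> (\<lambda>x. \<Sum>i\<in>I. u i x)"
proof (induction I rule: finite_induct)
  case empty
  then show ?case by (simp add: in_Lp_def)
next
  case (insert i I)
  then show ?case using in_Lp_add[of p \<Omega> "u i" "\<lambda>x. \<Sum>i\<in>I. u i x"] by simp
qed

text \<open>A scalar functional on fields that is continuous on the base space and determines a
  component once K runs through enough boxes. Statements about Bochner integrals are reduced to real
  integrals through it.\<close>

definition slice :: "'a::euclidean_space set \<Rightarrow> nat \<Rightarrow> 'a vfield \<Rightarrow> real" where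
  "slice K l v = (LINT x|lebesgue_on K. v x l)"

text \<open>
  \<open>L\<^sup>1\<close>-\<open>L\<^sup>p\<close> bound without Hoelder: \<open>\<bar>u\<bar> \<le> a + \<bar>u\<bar>\<^sup>p a\<^sup>1\<^sup>-\<^sup>p\<close> with \<open>a\<close> the norm of \<open>u\<close>.
\<close>

lemma integral_le_Lp_norm:
  fixes u :: "'a::euclidean_space \<Rightarrow> real"
  assumes u: "in_Lp p \<Omega> u" and p: "1 < p" and S: "\<Omega> \<in> sets lebesgue" and K: "K \<in> lmeasurable" "K \<subseteq> \<Omega>"
  shows "integrable (lebesgue_on K) u" "\<bar>LINT x|lebesgue_on K. u x\<bar> \<le> (measure lebesgue K + 1) * Lp_norm p \<Omega> u"
proof -
  have KS: "K \<in> sets lebesgue" using K(1) by (simp add: fmeasurable_def)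
  have um: "u \<in> borel_measurable (lebesgue_on \<Omega>)" and ui: "integrable (lebesgue_on \<Omega>) (\<lambda>x. \<bar>u x\<bar> powr p)"
    using u by (auto simp: in_Lp_def)
  have umK: "u \<in> borel_measurable (lebesgue_on K)"
    by (rule measurable_restrict_mono[OF um K(2)])
  have uiK: "integrable (lebesgue_on K) (\<lambda>x. \<bar>u x\<bar> powr p)"
    using integrable_indicator_subset[OF ui S KS K(2)] by (simp add: integrable_lebesgue_onI(1)[OF KS])
  have fm: "finite_measure (lebesgue_on K)" by (rule finite_measure_lebesgue_on[OF K(1)])
  have pw: "\<bar>s\<bar> \<le> a + \<bar>s\<bar> powr p * a powr (1 - p)" if "0 < a" for s a :: real
  proof (cases "\<bar>s\<bar> \<le> a")
    case True
    then show ?thesis by (simp add: add_increasing2)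
  next
    case False
    then have "\<bar>s\<bar> powr (1 - p) \<le> a powr (1 - p)" using that p by (intro powr_mono2') auto
    then have "\<bar>s\<bar> powr p * \<bar>s\<bar> powr (1 - p) \<le> \<bar>s\<bar> powr p * a powr (1 - p)" by (rule mult_left_mono) simp
    moreover have "\<bar>s\<bar> powr p * \<bar>s\<bar> powr (1 - p) = \<bar>s\<bar>" using False that by (simp add: powr_add[symmetric])
    ultimately show ?thesis using that by simp
  qed
  have bi: "integrable (lebesgue_on K) (\<lambda>x. a + \<bar>u x\<bar> powr p * a powr (1 - p))" for a
    using uiK finite_measure.integrable_const[OF fm, of a] by auto
  show iu: "integrable (lebesgue_on K) u"
    by (rule Bochner_Integration.integrable_bound[OF bi[of 1] umK]) (use pw[of 1] in \<open>auto intro!: AE_I2\<close>)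
  have bound: "\<bar>LINT x|lebesgue_on K. u x\<bar> \<le> measure lebesgue K * a + (LINT x|lebesgue_on \<Omega>. \<bar>u x\<bar> powr p) * a powr (1 - p)"
    if a: "0 < a" for a
  proof -
    have "\<bar>LINT x|lebesgue_on K. u x\<bar> \<le> (LINT x|lebesgue_on K. a + \<bar>u x\<bar> powr p * a powr (1 - p))"
      by (rule order_trans[OF integral_abs_bound integral_mono]) (use iu bi pw[OF a] in auto)
    also have "\<dots> = measure lebesgue K * a + (LINT x|lebesgue_on K. \<bar>u x\<bar> powr p) * a powr (1 - p)"
      using uiK finite_measure.integrable_const[OF fm, of a] KS
      by (simp add: measure_restrict_space)
    also have "(LINT x|lebesgue_on K. \<bar>u x\<bar> powr p) \<le> (LINT x|lebesgue_on \<Omega>. \<bar>u x\<bar> powr p)"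
      by (rule integral_mono_lebesgue_on_AE[OF ui _ _ K(2) KS S]) auto
    finally show ?thesis by (simp add: mult_right_mono)
  qed
  define Q where "Q = (LINT x|lebesgue_on \<Omega>. \<bar>u x\<bar> powr p)"
  have Q0: "0 \<le> Q" unfolding Q_def by simp
  define A where "A = Lp_norm p \<Omega> u"
  have A: "A = Q powr (1 / p)" by (simp add: A_def Lp_norm_def Q_def)
  show "\<bar>LINT x|lebesgue_on K. u x\<bar> \<le> (measure lebesgue K + 1) * Lp_norm p \<Omega> u"
  proof (cases "Q = 0")
    case True
    have "\<bar>LINT x|lebesgue_on K. u x\<bar> \<le> e" if "0 < e" for e
    proof -
      define a where "a = e / (measure lebesgue K + 1)"
      have d: "0 < measure lebesgue K + 1" by (simp add: add_nonneg_pos)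
      then have "0 < a" using that by (simp add: a_def)
      from bound[OF this] True have "\<bar>LINT x|lebesgue_on K. u x\<bar> \<le> measure lebesgue K * a" by (simp add: Q_def)
      also have "\<dots> \<le> (measure lebesgue K + 1) * a" using \<open>0 < a\<close> by (simp add: mult_right_mono)
      also have "\<dots> = e" using d by (simp add: a_def)
      finally show ?thesis .
    qed
    then have "\<bar>LINT x|lebesgue_on K. u x\<bar> \<le> 0" by (rule field_le_epsilon[of _ 0, simplified])
    then show ?thesis by (simp add: Lp_norm_nonneg add_nonneg_nonneg order_trans[OF _ mult_nonneg_nonneg])
  next
    case False
    then have "0 < Q" using Q0 by simp
    then have "0 < A" by (simp add: A)
    have "Q = A powr p" using p \<open>0 < Q\<close> by (simp add: A powr_powr)
    then have "Q * A powr (1 - p) = A" using \<open>0 < A\<close> by (simp add: powr_add[symmetric])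
    with bound[OF \<open>0 < A\<close>] show ?thesis by (simp add: Q_def A_def algebra_simps)
  qed
qed

text \<open>Continuity of \<open>slice\<close> in the norm of the base space, with a constant
  depending only on the measure of K; limits in that norm become limits of real numbers.\<close>

lemma slice_bounds:
  fixes \<Omega> :: "'a::euclidean_space set"
  assumes p: "1 < p" and S: "\<Omega> \<in> sets lebesgue" and K: "K \<in> lmeasurable" "K \<subseteq> \<Omega>" and l: "l \<in> {1..m}"
  shows "u \<in> X0 p m \<Omega> \<Longrightarrow> integrable (lebesgue_on K) (\<lambda>x. u x l)"
    "u \<in> X0 p m \<Omega> \<Longrightarrow> \<bar>slice K l u\<bar> \<le> (measure lebesgue K + 1) * X0_norm p m \<Omega> u"
    "u \<in> X0 p m \<Omega> \<Longrightarrow> v \<in> X0 p m \<Omega> \<Longrightarrow>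
      \<bar>slice K l u - slice K l v\<bar> \<le> (measure lebesgue K + 1) * X0_norm p m \<Omega> (\<lambda>x i. u x i - v x i)"
proof -
  show i: "integrable (lebesgue_on K) (\<lambda>x. u x l)" if "u \<in> X0 p m \<Omega>" for u
    using integral_le_Lp_norm(1)[OF _ p S K] that l by (auto simp: X0_def)
  show b: "\<bar>slice K l u\<bar> \<le> (measure lebesgue K + 1) * X0_norm p m \<Omega> u" if "u \<in> X0 p m \<Omega>" for u
  proof -
    have "\<bar>slice K l u\<bar> \<le> (measure lebesgue K + 1) * Lp_norm p \<Omega> (\<lambda>x. u x l)"
      unfolding slice_def using integral_le_Lp_norm(2)[OF _ p S K] that l by (auto simp: X0_def)
    also have "\<dots> \<le> (measure lebesgue K + 1) * X0_norm p m \<Omega> u"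
      by (intro mult_left_mono X0_norm_ge[OF l]) (simp add: add_nonneg_nonneg)
    finally show ?thesis .
  qed
  assume u: "u \<in> X0 p m \<Omega>" and v: "v \<in> X0 p m \<Omega>"
  have "(\<lambda>x i. u x i - v x i) \<in> X0 p m \<Omega>" using u v p by (auto simp: X0_def intro!: in_Lp_diff)
  from b[OF this] show "\<bar>slice K l u - slice K l v\<bar> \<le> (measure lebesgue K + 1) * X0_norm p m \<Omega> (\<lambda>x i. u x i - v x i)"
    using i[OF u] i[OF v] by (simp add: slice_def)
qed

lemma X0_scale: "u \<in> X0 p m \<Omega> \<Longrightarrow> (\<lambda>x i. c * u x i) \<in> X0 p m \<Omega>"
  by (auto simp: X0_def intro: in_Lp_scale)

text \<open>The last sum has the shape of \<open>simple_field_integral\<close>, so that for simple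
  functions slicing and integrating in time commute.\<close>

lemma simple_slice:
  fixes s :: "real \<Rightarrow> 'a::euclidean_space vfield"
  assumes s: "simple_function (lebesgue_on {0..T}) s"
  shows "(\<lambda>t. slice K l (s t)) \<in> borel_measurable (lebesgue_on {0..T})"
    "integrable (lebesgue_on {0..T}) (\<lambda>t. slice K l (s t))"
    "(LINT t|lebesgue_on {0..T}. slice K l (s t)) = (\<Sum>v\<in>s ` {0..T}. measure lebesgue {t \<in> {0..T}. s t = v} * slice K l v)"
proof -
  have fin: "finite (s ` {0..T})" using simple_functionD(1)[OF s] by simp
  have me: "{t \<in> {0..T}. s t = v} \<in> sets lebesgue" for v
  proof -
    have "s -` {v} \<inter> {0..T} \<in> sets (lebesgue_on {0..T})" using simple_functionD(2)[OF s, of "{v}"] by simp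
    moreover have "{0..T} \<in> sets lebesgue" by (rule fmeasurableD[OF lmeasurable_interval(1)])
    then have "{0..T} \<inter> space lebesgue \<in> sets lebesgue" by simp
    ultimately have "s -` {v} \<inter> {0..T} \<in> sets lebesgue" using sets_restrict_space_iff by blast
    moreover have "s -` {v} \<inter> {0..T} = {t \<in> {0..T}. s t = v}" by auto
    ultimately show ?thesis by simp
  qed
  have lm: "{0..T} \<in> lmeasurable" by simp
  have eq: "slice K l (s t) = (\<Sum>v\<in>s ` {0..T}. slice K l v * indicator {t \<in> {0..T}. s t = v} t)" if "t \<in> {0..T}" for t
  proof -
    have "(\<Sum>v\<in>s ` {0..T}. slice K l v * indicator {t \<in> {0..T}. s t = v} t) = (\<Sum>v\<in>s ` {0..T}. if v = s t then slice K l v else 0)"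
      using that by (intro sum.cong) (auto simp: indicator_def)
    then show ?thesis using fin that by simp
  qed
  let ?f = "\<lambda>t. \<Sum>v\<in>s ` {0..T}. slice K l v * indicator {t \<in> {0..T}. s t = v} t"
  have int1: "integrable (lebesgue_on {0..T}) (\<lambda>t. slice K l v * indicator {t \<in> {0..T}. s t = v} t)" for v
    by (intro integrable_mult_right integrable_indicator_lebesgue_on[OF lm me])
  then have int: "integrable (lebesgue_on {0..T}) ?f" by (intro Bochner_Integration.integrable_sum)
  have "integrable (lebesgue_on {0..T}) (\<lambda>t. slice K l (s t)) = integrable (lebesgue_on {0..T}) ?f"
    by (rule Bochner_Integration.integrable_cong) (use eq in auto)
  with int show i: "integrable (lebesgue_on {0..T}) (\<lambda>t. slice K l (s t))" by simp
  then show "(\<lambda>t. slice K l (s t)) \<in> borel_measurable (lebesgue_on {0..T})" by (rule borel_measurable_integrable)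
  have "(LINT t|lebesgue_on {0..T}. slice K l (s t)) = (LINT t|lebesgue_on {0..T}. ?f t)"
    by (rule Bochner_Integration.integral_cong) (use eq in auto)
  also have "\<dots> = (\<Sum>v\<in>s ` {0..T}. LINT t|lebesgue_on {0..T}. slice K l v * indicator {t \<in> {0..T}. s t = v} t)"
    using int1 by (intro Bochner_Integration.integral_sum)
  also have "\<dots> = (\<Sum>v\<in>s ` {0..T}. measure lebesgue {t \<in> {0..T}. s t = v} * slice K l v)"
  proof (intro sum.cong refl)
    fix v
    let ?A = "{t \<in> {0..T}. s t = v}"
    have "?A \<inter> {0..T} = ?A" by auto
    moreover have "measure (lebesgue_on {0..T}) ?A = measure lebesgue ?A"
      by (rule measure_restrict_space) (use fmeasurableD[OF lm] in auto)
    moreover have "(LINT t|lebesgue_on {0..T}. slice K l v * indicator ?A t) = slice K l v * measure (lebesgue_on {0..T}) (?A \<inter> {0..T})"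
      by simp
    ultimately show "(LINT t|lebesgue_on {0..T}. slice K l v * indicator ?A t) = measure lebesgue ?A * slice K l v"
      by (simp only: mult.commute)
  qed
  finally show "(LINT t|lebesgue_on {0..T}. slice K l (s t)) = (\<Sum>v\<in>s ` {0..T}. measure lebesgue {t \<in> {0..T}. s t = v} * slice K l v)" .
qed

text \<open>Completeness of Lebesgue measure: an almost-everywhere limit is measurable even if the
  sequence diverges, or has another limit, on a null set.\<close>

lemma borel_measurable_AE_limit:
  fixes u :: "nat \<Rightarrow> real \<Rightarrow> real"
  assumes S: "S \<in> sets lebesgue" and m: "\<And>n. u n \<in> borel_measurable (lebesgue_on S)"
    and l: "AE t in lebesgue_on S. (\<lambda>n. u n t) \<longlonglongrightarrow> v t"
  shows "v \<in> borel_measurable (lebesgue_on S)"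
proof -
  have "(\<lambda>t. if t \<in> S then u n t else 0) \<in> borel_measurable lebesgue" for n
    by (rule borel_measurable_if_I[OF m S])
  then have lm: "(\<lambda>t. lim (\<lambda>n. if t \<in> S then u n t else 0)) \<in> borel_measurable lebesgue"
    by (rule borel_measurable_lim_metric)
  have "AE t in lebesgue. t \<in> S \<longrightarrow> (\<lambda>n. u n t) \<longlonglongrightarrow> v t" using l S by (simp add: AE_restrict_space_iff)
  then have "AE t in lebesgue. lim (\<lambda>n. if t \<in> S then u n t else 0) = (if t \<in> S then v t else 0)"
  proof eventually_elim
    case (elim t)
    show ?case
    proof (cases "t \<in> S")
      case True
      then show ?thesis using elim limI[of "\<lambda>n. u n t" "v t"] by simp
    next
      case False
      then show ?thesis using limI[OF tendsto_const[of 0]] by simp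
    qed
  qed
  from borel_measurable_AE[OF lm this] show ?thesis by (rule borel_measurable_if_D)
qed

text \<open>Slices of the approximating simple functions converge at almost every time, which gives
  measurability; the bound a \<le> 1 + a^p for the norm a of the field gives integrability on the
  bounded interval.\<close>

lemma in_Lp_time_slice:
  fixes \<Omega> :: "'a::euclidean_space set"
  assumes f: "in_Lp_time p (X0 p m \<Omega>) (X0_norm p m \<Omega>) T f"
    and p: "1 < p" and S: "\<Omega> \<in> sets lebesgue" and K: "K \<in> lmeasurable" "K \<subseteq> \<Omega>" and l: "l \<in> {1..m}"
  shows "integrable (lebesgue_on {0..T}) (\<lambda>t. slice K l (f t))" "AE t in lebesgue_on {0..T}. f t \<in> X0 p m \<Omega>"
proof -
  note sb = slice_bounds[OF p S K l]
  define C where "C = measure lebesgue K + 1"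
  have C: "0 < C" by (simp add: C_def add_nonneg_pos)
  show ae: "AE t in lebesgue_on {0..T}. f t \<in> X0 p m \<Omega>" using f unfolding in_Lp_time_def by blast
  obtain s where s: "\<And>n. simple_function (lebesgue_on {0..T}) (s n)" "\<And>n t. t \<in> {0..T} \<Longrightarrow> s n t \<in> X0 p m \<Omega>"
    and sl: "AE t in lebesgue_on {0..T}. (\<lambda>n. X0_norm p m \<Omega> (\<lambda>x i. s n t x i - f t x i)) \<longlonglongrightarrow> 0"
    using f unfolding in_Lp_time_def by blast
  have "AE t in lebesgue_on {0..T}. (\<lambda>n. slice K l (s n t)) \<longlonglongrightarrow> slice K l (f t)"
    using ae sl AE_space[of "lebesgue_on {0..T}"]
  proof eventually_elim
    case (elim t)
    then have t: "t \<in> {0..T}" by simp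
    have lim: "(\<lambda>n. C * X0_norm p m \<Omega> (\<lambda>x i. s n t x i - f t x i)) \<longlonglongrightarrow> 0"
      using tendsto_mult[OF tendsto_const elim(2), of C] by simp
    have "\<forall>\<^sub>F n in sequentially. norm (slice K l (s n t) - slice K l (f t)) \<le> C * X0_norm p m \<Omega> (\<lambda>x i. s n t x i - f t x i)"
      using sb(3)[OF s(2)[OF t] elim(1)] by (simp add: C_def)
    from Lim_null_comparison[OF this lim] have "(\<lambda>n. slice K l (s n t) - slice K l (f t)) \<longlonglongrightarrow> 0" .
    then show ?case by (rule LIM_zero_cancel)
  qed
  then have m: "(\<lambda>t. slice K l (f t)) \<in> borel_measurable (lebesgue_on {0..T})"
    by (rule borel_measurable_AE_limit[rotated 2]) (use simple_slice(1)[OF s(1)] in auto)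
  have lm: "{0..T} \<in> lmeasurable" by simp
  have "integrable (lebesgue_on {0..T}) (\<lambda>t. C * (1 + X0_norm p m \<Omega> (f t) powr p))"
    using f finite_measure.integrable_const[OF finite_measure_lebesgue_on[OF lm], of 1] unfolding in_Lp_time_def by auto
  then show "integrable (lebesgue_on {0..T}) (\<lambda>t. slice K l (f t))"
  proof (rule Bochner_Integration.integrable_bound[OF _ m])
    show "AE t in lebesgue_on {0..T}. norm (slice K l (f t)) \<le> norm (C * (1 + X0_norm p m \<Omega> (f t) powr p))"
      using ae
    proof eventually_elim
      case (elim t)
      let ?a = "X0_norm p m \<Omega> (f t)"
      have a0: "0 \<le> ?a" unfolding X0_norm_def by (intro sum_nonneg Lp_norm_nonneg)
      have "?a \<le> 1 + ?a powr p"
      proof (cases "?a \<le> 1")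
        case False
        then have "?a powr 1 \<le> ?a powr p" using p by (intro powr_mono) auto
        then show ?thesis using a0 by simp
      qed (simp add: add_increasing2)
      then have "C * ?a \<le> C * (1 + ?a powr p)" using C by simp
      moreover have "norm (slice K l (f t)) \<le> C * ?a" using sb(2)[OF elim] by (simp add: C_def)
      moreover have "C * (1 + ?a powr p) \<le> norm (C * (1 + ?a powr p))" by simp
      ultimately show ?case by linarith
    qed
  qed
qed

text \<open>A continuous functional commutes with the Bochner integral: this holds for simple
  functions, and the integrals of the slices of the approximating sequence have both sides as
  limits.\<close>

lemma has_field_integral_slice:
  fixes \<Omega> :: "'a::euclidean_space set"
  assumes f: "has_field_integral (X0 p m \<Omega>) (X0_norm p m \<Omega>) T f v"
    and fX: "AE t in lebesgue_on {0..T}. f t \<in> X0 p m \<Omega>" and fi: "integrable (lebesgue_on {0..T}) (\<lambda>t. slice K l (f t))"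
    and p: "1 < p" and S: "\<Omega> \<in> sets lebesgue" and K: "K \<in> lmeasurable" "K \<subseteq> \<Omega>" and l: "l \<in> {1..m}"
  shows "(LINT t|lebesgue_on {0..T}. slice K l (f t)) = slice K l v"
proof -
  note sb = slice_bounds[OF p S K l]
  define C where "C = measure lebesgue K + 1"
  have C: "0 < C" by (simp add: C_def add_nonneg_pos)
  obtain s where s: "\<And>n. simple_function (lebesgue_on {0..T}) (s n)" "\<And>n t. t \<in> {0..T} \<Longrightarrow> s n t \<in> X0 p m \<Omega>"
    and s1: "(\<lambda>n. \<integral>\<^sup>+t. ennreal (X0_norm p m \<Omega> (\<lambda>x i. s n t x i - f t x i)) \<partial>lebesgue_on {0..T}) \<longlonglongrightarrow> 0"
    and s2: "(\<lambda>n. X0_norm p m \<Omega> (\<lambda>x i. simple_field_integral T (s n) x i - v x i)) \<longlonglongrightarrow> 0"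
    and v: "v \<in> X0 p m \<Omega>"
    using f unfolding has_field_integral_def by blast
  have fin: "finite (s n ` {0..T})" for n using simple_functionD(1)[OF s(1)[of n]] by simp
  have siX: "simple_field_integral T (s n) \<in> X0 p m \<Omega>" for n
    unfolding X0_def simple_field_integral_def
  proof (rule CollectI, rule ballI)
    fix i assume i: "i \<in> {1..m}"
    have "in_Lp p \<Omega> (\<lambda>x. w x i)" if "w \<in> s n ` {0..T}" for w
      using s(2)[of _ n] that i by (auto simp: X0_def)
    then show "in_Lp p \<Omega> (\<lambda>x. \<Sum>w\<in>s n ` {0..T}. measure lebesgue {t \<in> {0..T}. s n t = w} * w x i)"
      using p by (intro in_Lp_sum[OF fin]) (auto intro: in_Lp_scale)
  qed
  have si: "slice K l (simple_field_integral T (s n)) = (LINT t|lebesgue_on {0..T}. slice K l (s n t))" for n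
  proof -
    have "slice K l (simple_field_integral T (s n)) = (\<Sum>w\<in>s n ` {0..T}. LINT x|lebesgue_on K. measure lebesgue {t \<in> {0..T}. s n t = w} * w x l)"
      unfolding slice_def simple_field_integral_def
      by (rule Bochner_Integration.integral_sum) (use sb(1) s(2) in \<open>auto intro!: integrable_mult_right\<close>)
    then show ?thesis unfolding simple_slice(3)[OF s(1)] by (simp add: slice_def)
  qed
  have L1: "(\<lambda>n. slice K l (simple_field_integral T (s n))) \<longlonglongrightarrow> slice K l v"
  proof (rule LIM_zero_cancel, rule Lim_null_comparison)
    show "\<forall>\<^sub>F n in sequentially. norm (slice K l (simple_field_integral T (s n)) - slice K l v)
        \<le> C * X0_norm p m \<Omega> (\<lambda>x i. simple_field_integral T (s n) x i - v x i)"
      using sb(3)[OF siX v] by (simp add: C_def)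
    show "(\<lambda>n. C * X0_norm p m \<Omega> (\<lambda>x i. simple_field_integral T (s n) x i - v x i)) \<longlonglongrightarrow> 0"
      using tendsto_mult[OF tendsto_const s2, of C] by simp
  qed
  have L2: "(\<lambda>n. LINT t|lebesgue_on {0..T}. slice K l (s n t)) \<longlonglongrightarrow> (LINT t|lebesgue_on {0..T}. slice K l (f t))"
  proof (rule LIM_zero_cancel, rule Lim_null_comparison)
    let ?e = "\<lambda>n. \<integral>\<^sup>+t. ennreal (X0_norm p m \<Omega> (\<lambda>x i. s n t x i - f t x i)) \<partial>lebesgue_on {0..T}"
    have "(\<lambda>n. enn2real (?e n)) \<longlonglongrightarrow> 0" by (rule tendsto_enn2real) (use s1 in simp_all)
    then show "(\<lambda>n. C * enn2real (?e n)) \<longlonglongrightarrow> 0" using tendsto_mult[OF tendsto_const, of _ 0 sequentially C] by simp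
    have fin: "\<forall>\<^sub>F n in sequentially. ?e n < 1" by (rule order_tendstoD(2)[OF s1]) simp
    then show "\<forall>\<^sub>F n in sequentially. norm ((LINT t|lebesgue_on {0..T}. slice K l (s n t)) - (LINT t|lebesgue_on {0..T}. slice K l (f t)))
        \<le> C * enn2real (?e n)"
    proof eventually_elim
      case (elim n)
      let ?d = "\<lambda>t. (slice K l (s n t) - slice K l (f t)) / C"
      have di: "integrable (lebesgue_on {0..T}) ?d"
        using simple_slice(2)[OF s(1)] fi by auto
      have "ennreal (norm (LINT t|lebesgue_on {0..T}. ?d t)) \<le> (\<integral>\<^sup>+t. ennreal (norm (?d t)) \<partial>lebesgue_on {0..T})"
        by (rule integral_norm_bound_ennreal[OF di])
      also have "\<dots> \<le> ?e n"
      proof (rule nn_integral_mono_AE)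
        show "AE t in lebesgue_on {0..T}. ennreal (norm (?d t)) \<le> ennreal (X0_norm p m \<Omega> (\<lambda>x i. s n t x i - f t x i))"
          using fX AE_space[of "lebesgue_on {0..T}"]
        proof eventually_elim
          case (elim t)
          then have t: "t \<in> {0..T}" by simp
          show ?case using sb(3)[OF s(2)[OF t, of n] elim(1)] C
            by (intro ennreal_leI) (simp add: C_def[symmetric] abs_divide divide_le_eq mult.commute)
        qed
      qed
      finally have le: "ennreal (norm (LINT t|lebesgue_on {0..T}. ?d t)) \<le> ?e n" .
      have "?e n < top" using elim by (rule less_trans) simp
      then have "norm (LINT t|lebesgue_on {0..T}. ?d t) \<le> enn2real (?e n)"
        using enn2real_mono[OF le] by simp
      moreover have "(LINT t|lebesgue_on {0..T}. ?d t) = ((LINT t|lebesgue_on {0..T}. slice K l (s n t)) - (LINT t|lebesgue_on {0..T}. slice K l (f t))) / C"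
        using simple_slice(2)[OF s(1)[of n], of K l] fi by simp
      ultimately show ?case using C by (simp add: abs_divide divide_le_eq mult.commute)
    qed
  qed
  show ?thesis using LIMSEQ_unique[OF L2 L1[unfolded si]] by simp
qed

section \<open>Boxes with rational corners\<close>

lemma rational_between:
  fixes r e :: real
  assumes "0 < e"
  shows "\<exists>q\<in>\<rat>. r < q \<and> q < r + e"
  using Rats_dense_in_real[of r "r + e"] assms by auto

text \<open>A countable supply of corners. Exceptional null sets of times depend on the box, and
  only countably many of them may be united.\<close>

definition rational_points :: "'a::euclidean_space set" where
  "rational_points = (\<lambda>q. \<Sum>b\<in>Basis. q b *\<^sub>R b) ` (Basis \<rightarrow>\<^sub>E \<rat>)"

lemma countable_rational_points: "countable (rational_points :: 'a::euclidean_space set)"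
  unfolding rational_points_def by (intro countable_image countable_PiE) (auto simp: countable_rat)

lemma rational_point_near:
  fixes a :: "'a::euclidean_space"
  assumes "0 < e"
  shows "\<exists>q\<in>rational_points. \<forall>b\<in>Basis. a \<bullet> b < q \<bullet> b \<and> q \<bullet> b < a \<bullet> b + e"
proof -
  have "\<forall>b\<in>(Basis::'a set). \<exists>q. q \<in> \<rat> \<and> a \<bullet> b < q \<and> q < a \<bullet> b + e"
    using rational_between[OF assms] by blast
  then obtain f where f: "\<forall>b\<in>(Basis::'a set). f b \<in> \<rat> \<and> a \<bullet> b < f b \<and> f b < a \<bullet> b + e"
    unfolding bchoice_iff by blast
  define q where "q = (\<Sum>b\<in>(Basis::'a set). f b *\<^sub>R b)"
  have "q = (\<Sum>b\<in>(Basis::'a set). restrict f Basis b *\<^sub>R b)" unfolding q_def by (intro sum.cong) auto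
  moreover have "restrict f Basis \<in> Basis \<rightarrow>\<^sub>E \<rat>" using f by auto
  ultimately have "q \<in> rational_points" unfolding rational_points_def by blast
  moreover have "q \<bullet> b = f b" if "b \<in> Basis" for b using that by (simp add: q_def)
  ultimately show ?thesis using f by (intro bexI[of _ q]) auto
qed

text \<open>An arbitrary open box is exhausted from inside by closed boxes with rational corners,
  and dominated convergence carries the vanishing integrals over.\<close>

lemma AE_0_if_rational_box_integrals_0:
  fixes u :: "'a::euclidean_space \<Rightarrow> real"
  assumes o: "open \<Omega>" and int: "locally_integrable \<Omega> u"
    and box0: "\<And>a c. a \<in> rational_points \<Longrightarrow> c \<in> rational_points \<Longrightarrow> cbox a c \<subseteq> \<Omega> \<Longrightarrow> (LINT x|lebesgue_on (cbox a c). u x) = 0"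
  shows "AE x in lebesgue_on \<Omega>. u x = 0"
proof (rule AE_0_if_local_box_integrals_0[OF o int])
  fix a c :: 'a assume ac: "cbox a c \<subseteq> \<Omega>"
  define e where "e n = 1 / real (Suc n)" for n
  have e: "0 < e n" for n by (simp add: e_def)
  have e0: "e \<longlonglongrightarrow> 0" unfolding e_def[abs_def] by (rule LIMSEQ_Suc[OF lim_1_over_n])
  have "\<forall>n. \<exists>q. q \<in> rational_points \<and> (\<forall>b\<in>Basis. a \<bullet> b < q \<bullet> b \<and> q \<bullet> b < a \<bullet> b + e n)"
    using rational_point_near[OF e] by blast
  then obtain A where A: "\<And>n. A n \<in> rational_points" "\<And>n b. b \<in> Basis \<Longrightarrow> a \<bullet> b < A n \<bullet> b" "\<And>n b. b \<in> Basis \<Longrightarrow> A n \<bullet> b < a \<bullet> b + e n"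
    by metis
  \<comment> \<open>Rational points are supplied slightly above a given point, so the upper corner
    is approximated starting from c lowered by \<open>e n\<close> in every coordinate.\<close>
  have "\<forall>n. \<exists>q. q \<in> rational_points \<and> (\<forall>b\<in>Basis. (c - e n *\<^sub>R (\<Sum>b\<in>Basis. b)) \<bullet> b < q \<bullet> b \<and> q \<bullet> b < (c - e n *\<^sub>R (\<Sum>b\<in>Basis. b)) \<bullet> b + e n)"
    using rational_point_near[OF e] by blast
  moreover have "(c - e n *\<^sub>R (\<Sum>b\<in>Basis. b)) \<bullet> b = c \<bullet> b - e n" if "b \<in> Basis" for n b
    using that by (simp add: inner_diff_left inner_sum_left inner_Basis)
  ultimately have "\<forall>n. \<exists>q. q \<in> rational_points \<and> (\<forall>b\<in>Basis. c \<bullet> b - e n < q \<bullet> b \<and> q \<bullet> b < c \<bullet> b)" by simp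
  then obtain C where C: "\<And>n. C n \<in> rational_points" "\<And>n b. b \<in> Basis \<Longrightarrow> c \<bullet> b - e n < C n \<bullet> b" "\<And>n b. b \<in> Basis \<Longrightarrow> C n \<bullet> b < c \<bullet> b"
    by metis
  have sub: "cbox (A n) (C n) \<subseteq> box a c" for n
    unfolding cbox_def box_def
  proof (rule subsetI, rule CollectI, rule ballI)
    fix x b :: 'a assume "x \<in> {x. \<forall>i\<in>Basis. A n \<bullet> i \<le> x \<bullet> i \<and> x \<bullet> i \<le> C n \<bullet> i}" and b: "b \<in> Basis"
    then have "A n \<bullet> b \<le> x \<bullet> b \<and> x \<bullet> b \<le> C n \<bullet> b" by simp
    then show "a \<bullet> b < x \<bullet> b \<and> x \<bullet> b < c \<bullet> b" using A(2)[OF b, of n] C(3)[OF b, of n] by linarith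
  qed
  have cc: "compact (cbox a c)" by simp
  have "integrable (lebesgue_on (cbox a c)) u" using int ac unfolding locally_integrable_def by simp
  then have iu: "integrable lebesgue (\<lambda>x. indicator S x * u x)" if "S \<in> sets lebesgue" "S \<subseteq> cbox a c" for S
    by (rule integrable_indicator_subset[OF _ _ that]) simp
  have sub': "cbox (A n) (C n) \<subseteq> cbox a c" for n using sub[of n] box_subset_cbox[of a c] by blast
  have "(\<lambda>n. LINT x|lebesgue. indicator (cbox (A n) (C n)) x * u x) \<longlonglongrightarrow> (LINT x|lebesgue. indicator (box a c) x * u x)"
  proof (rule integral_dominated_convergence[where w="\<lambda>x. norm (indicator (cbox a c) x * u x)"])
    show "AE x in lebesgue. (\<lambda>n. indicator (cbox (A n) (C n)) x * u x) \<longlonglongrightarrow> indicator (box a c) x * u x"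
    proof (rule AE_I2)
      fix x
      show "(\<lambda>n. indicator (cbox (A n) (C n)) x * u x) \<longlonglongrightarrow> indicator (box a c) x * u x"
      proof (cases "x \<in> box a c")
        case True
        have "\<forall>\<^sub>F n in sequentially. \<forall>b\<in>Basis. e n < x \<bullet> b - a \<bullet> b \<and> e n < c \<bullet> b - x \<bullet> b"
        proof (intro eventually_ball_finite ballI eventually_conj)
          fix b :: 'a assume b: "b \<in> Basis"
          show "\<forall>\<^sub>F n in sequentially. e n < x \<bullet> b - a \<bullet> b" "\<forall>\<^sub>F n in sequentially. e n < c \<bullet> b - x \<bullet> b"
            using True b by (auto intro!: order_tendstoD(2)[OF e0] simp: mem_box)
        qed simp
        then have "\<forall>\<^sub>F n in sequentially. indicator (box a c) x * u x = indicator (cbox (A n) (C n)) x * u x"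
        proof eventually_elim
          case (elim n)
          have "x \<in> cbox (A n) (C n)"
            unfolding mem_box
          proof
            fix b :: 'a assume b: "b \<in> Basis"
            then show "A n \<bullet> b \<le> x \<bullet> b \<and> x \<bullet> b \<le> C n \<bullet> b"
              using elim[rule_format, OF b] A(3)[OF b, of n] C(2)[OF b, of n] by linarith
          qed
          then show ?case using True by simp
        qed
        then show ?thesis by (rule Lim_transform_eventually[OF tendsto_const])
      next
        case False
        then have "x \<notin> cbox (A n) (C n)" for n using sub by blast
        then show ?thesis using False by simp
      qed
    qed
    show "AE x in lebesgue. norm (indicator (cbox (A n) (C n)) x * u x) \<le> norm (indicator (cbox a c) x * u x)" for n
      using sub'[of n] by (intro AE_I2) (auto simp: indicator_def)
    show "(\<lambda>x. indicator (cbox (A n) (C n)) x * u x) \<in> borel_measurable lebesgue" for n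
      by (rule borel_measurable_integrable[OF iu]) (use sub' in auto)
    show "(\<lambda>x. indicator (box a c) x * u x) \<in> borel_measurable lebesgue"
      by (rule borel_measurable_integrable[OF iu]) (auto simp: box_subset_cbox)
    show "integrable lebesgue (\<lambda>x. norm (indicator (cbox a c) x * u x))"
      by (intro integrable_norm iu) auto
  qed
  moreover have "(LINT x|lebesgue. indicator (cbox (A n) (C n)) x * u x) = 0" for n
    using box0[OF A(1) C(1), of n n] sub'[of n] ac by (simp add: integrable_lebesgue_onI)
  ultimately show "(LINT x|lebesgue. indicator (box a c) x * u x) = 0" by (simp add: LIMSEQ_const_iff)
qed

lemma integrable_bounded_mult:
  fixes f h :: "'a \<Rightarrow> real"
  assumes "integrable M f" "h \<in> borel_measurable M" "\<And>x. \<bar>h x\<bar> \<le> B"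
  shows "integrable M (\<lambda>x. h x * f x)"
proof (rule Bochner_Integration.integrable_bound[where f="\<lambda>x. B * f x"])
  show "AE x in M. norm (h x * f x) \<le> norm (B * f x)"
  proof (rule AE_I2)
    fix x
    have "\<bar>h x\<bar> \<le> \<bar>B\<bar>" using assms(3)[of x] by linarith
    then show "norm (h x * f x) \<le> norm (B * f x)" by (simp add: abs_mult mult_right_mono)
  qed
qed (use assms in auto)

lemma test_function_mono: "test_function A \<phi> \<Longrightarrow> A \<subseteq> B \<Longrightarrow> test_function B \<phi>"
  unfolding test_function_def by (meson order_trans)

lemma slice_scale: "slice K l (\<lambda>x i. c * v x i) = c * slice K l v"
  by (simp add: slice_def)

lemma compact_support_bounded:
  fixes h :: "'a::euclidean_space \<Rightarrow> real"
  assumes "compact K" "continuous_on UNIV h" "\<And>x. x \<notin> K \<Longrightarrow> h x = 0"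
  shows "\<exists>B. \<forall>x. \<bar>h x\<bar> \<le> B"
proof -
  obtain B where B: "\<forall>x\<in>K. norm (h x) \<le> B"
    using compact_continuous_bounded[OF assms(1) continuous_on_subset[OF assms(2) subset_UNIV]] by blast
  have "\<bar>h x\<bar> \<le> max B 0" for x using B assms(3)[of x] by (cases "x \<in> K") auto
  then show ?thesis by blast
qed

lemma LINT_support:
  fixes f :: "'a::euclidean_space \<Rightarrow> real"
  assumes "A \<in> sets lebesgue" "B \<in> sets lebesgue" "A \<subseteq> B" "\<And>x. x \<in> B - A \<Longrightarrow> f x = 0"
  shows "(LINT x|lebesgue_on B. f x) = (LINT x|lebesgue_on A. f x)"
  unfolding integrable_lebesgue_onI(2)[OF assms(1)] integrable_lebesgue_onI(2)[OF assms(2)]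
  by (rule Bochner_Integration.integral_cong) (use assms(3,4) in \<open>auto simp: indicator_def\<close>)

text \<open>Slicing turns the vector-valued weak derivative into a scalar one. On an interval where
  the slice of w is differentiable with continuous derivative M, ordinary integration by parts in
  time shows that M has the same test integrals as the slice of w'.\<close>

lemma weak_time_derivative_slice:
  fixes \<Omega> :: "'a::euclidean_space set"
  assumes w: "in_W1p_time p (X0 p m \<Omega>) (X0_norm p m \<Omega>) T w w'"
    and p: "1 < p" and S: "\<Omega> \<in> sets lebesgue" and K: "K \<in> lmeasurable" "K \<subseteq> \<Omega>" and l: "l \<in> {1..m}"
    and \<tau>: "0 < \<tau>" and d: "\<And>t. t \<in> {\<tau>..T} \<Longrightarrow> ((\<lambda>t. slice K l (w t)) has_real_derivative M t) (at t within {\<tau>..T})"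
    and Mc: "continuous_on {\<tau>..T} M"
  shows "AE t in lebesgue_on {\<tau><..<T}. slice K l (w' t) = M t"
proof -
  let ?O = "{\<tau><..<T}"
  have wL: "in_Lp_time p (X0 p m \<Omega>) (X0_norm p m \<Omega>) T w" "in_Lp_time p (X0 p m \<Omega>) (X0_norm p m \<Omega>) T w'"
    using w unfolding in_W1p_time_def by auto
  note W = in_Lp_time_slice[OF wL(1) p S K l] and W' = in_Lp_time_slice[OF wL(2) p S K l]
  have sets: "?O \<in> sets lebesgue" "{0..T} \<in> sets lebesgue" "?O \<subseteq> {0..T}" "{\<tau>..T} \<in> sets lebesgue"
    using \<tau> fmeasurableD[OF lmeasurable_interval(1)] fmeasurableD[OF lmeasurable_interval(2)] by auto
  have Mi: "integrable (lebesgue_on A) M" if "A \<in> sets lebesgue" "A \<subseteq> {\<tau>..T}" for A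
    by (rule integrable_continuous_compact[OF compact_Icc Mc that])
  have W'i: "integrable (lebesgue_on A) (\<lambda>t. slice K l (w' t))" if "A \<in> sets lebesgue" "A \<subseteq> {0..T}" for A
    using integrable_indicator_subset[OF W'(1) sets(2) that] by (simp add: integrable_lebesgue_onI(1)[OF that(1)])
  have "AE t in lebesgue_on ?O. slice K l (w' t) - M t = 0"
  proof (rule AE_0_if_test_integrals_0)
    show "open ?O" by simp
    show "locally_integrable ?O (\<lambda>t. slice K l (w' t) - M t)"
      unfolding locally_integrable_def
    proof (intro allI impI)
      fix A assume A: "compact A \<and> A \<subseteq> ?O"
      then have "A \<in> sets lebesgue" "A \<subseteq> {0..T}" "A \<subseteq> {\<tau>..T}" using sets(3) by (auto dest: compact_imp_closed)
      then show "integrable (lebesgue_on A) (\<lambda>t. slice K l (w' t) - M t)"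
        by (intro Bochner_Integration.integrable_diff Mi W'i)
    qed
    fix \<eta> assume t\<eta>: "test_function ?O \<eta>"
    obtain A D where AD: "cutoff_data ?O \<eta> A D" using test_function_cutoff_data[OF t\<eta>] by blast
    note A = cutoff_dataD[OF AD]
    have "test_function {0<..<T} \<eta>" by (rule test_function_mono[OF t\<eta>]) (use \<tau> in auto)
    from w[unfolded in_W1p_time_def, THEN conjunct2, THEN conjunct2, rule_format, OF this]
    \<comment> \<open>One field I represents both Bochner integrals, up to sign; its slice links the
      integral with the derivative of \<eta> to that with w'.\<close>
    obtain I where I: "has_field_integral (X0 p m \<Omega>) (X0_norm p m \<Omega>) T (\<lambda>t x i. deriv \<eta> t * w t x i) I"
      "has_field_integral (X0 p m \<Omega>) (X0_norm p m \<Omega>) T (\<lambda>t x i. \<eta> t * w' t x i) (\<lambda>x i. - I x i)"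
      by (elim exE conjE)
    have D: "deriv \<eta> t = D t" for t
    proof -
      have "(\<eta> has_real_derivative D t) (at t)" using A(6)[of t] by (simp add: has_field_derivative_def inner_real_def)
      then show ?thesis by (rule DERIV_imp_deriv)
    qed
    obtain B where B: "\<forall>t. \<bar>\<eta> t\<bar> \<le> B" using compact_support_bounded[OF A(1,4,3)] by blast
    obtain B' where B': "\<forall>t. \<bar>D t\<bar> \<le> B'" using compact_support_bounded[OF A(1,5,8)] by blast
    have meas: "h \<in> borel_measurable (lebesgue_on {0..T})" if "continuous_on UNIV h" for h :: "real \<Rightarrow> real"
      by (rule continuous_imp_measurable_on_sets_lebesgue[OF continuous_on_subset[OF that subset_UNIV] sets(2)])
    have i1: "integrable (lebesgue_on {0..T}) (\<lambda>t. D t * slice K l (w t))"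
      by (rule integrable_bounded_mult[OF W(1) meas[OF A(5)]]) (use B' in blast)
    have i2: "integrable (lebesgue_on {0..T}) (\<lambda>t. \<eta> t * slice K l (w' t))"
      by (rule integrable_bounded_mult[OF W'(1) meas[OF A(4)]]) (use B in blast)
    have x1: "AE t in lebesgue_on {0..T}. (\<lambda>x i. D t * w t x i) \<in> X0 p m \<Omega>"
      using W(2) by eventually_elim (rule X0_scale)
    have x2: "AE t in lebesgue_on {0..T}. (\<lambda>x i. \<eta> t * w' t x i) \<in> X0 p m \<Omega>"
      using W'(2) by eventually_elim (rule X0_scale)
    have e1: "(LINT t|lebesgue_on {0..T}. D t * slice K l (w t)) = slice K l I"
      using has_field_integral_slice[OF I(1)[unfolded D] x1 _ p S K l] i1 by (simp add: slice_scale)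
    have e2: "(LINT t|lebesgue_on {0..T}. \<eta> t * slice K l (w' t)) = - slice K l I"
      using has_field_integral_slice[OF I(2) x2 _ p S K l] i2 slice_scale[of K l "-1" I] by (simp add: slice_scale)
    have s1: "(LINT t|lebesgue_on {0..T}. D t * slice K l (w t)) = (LINT t|lebesgue_on ?O. D t * slice K l (w t))"
    proof (rule LINT_support[OF sets(1,2,3)])
      fix x assume "x \<in> {0..T} - ?O"
      then have "D x = 0" by (intro A(8)) (use A(2) in blast)
      then show "D x * slice K l (w x) = 0" by simp
    qed
    have s2: "(LINT t|lebesgue_on {0..T}. \<eta> t * slice K l (w' t)) = (LINT t|lebesgue_on ?O. \<eta> t * slice K l (w' t))"
    proof (rule LINT_support[OF sets(1,2,3)])
      fix x assume "x \<in> {0..T} - ?O"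
      then have "\<eta> x = 0" by (intro A(3)) (use A(2) in blast)
      then show "\<eta> x * slice K l (w' x) = 0" by simp
    qed
    obtain BM where BM: "\<forall>t\<in>{\<tau>..T}. norm (M t) \<le> BM"
      using compact_continuous_bounded[OF compact_Icc Mc] by blast
    have dO: "((\<lambda>t. slice K l (w t)) has_derivative (\<lambda>h. M t * h)) (at t)" if "t \<in> ?O" for t
      using d[of t] that by (simp add: has_field_derivative_def at_within_Icc_at)
    have bd: "\<exists>C. \<forall>t\<in>A. \<forall>h. norm (M t * h) \<le> C * norm h" if "compact A" "A \<subseteq> ?O" for A
      using BM that(2) by (intro exI[of _ BM]) (auto simp: abs_mult intro!: mult_right_mono)
    have "(LINT t|lebesgue_on ?O. frechet_derivative \<eta> (at t) (slice K l (w t))) = - (LINT t|lebesgue_on ?O. dvg (\<lambda>h. M t * h) * \<eta> t)"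
      by (rule integral_test_div(3)[OF _ dO bd t\<eta>]) auto
    then have e3: "(LINT t|lebesgue_on ?O. D t * slice K l (w t)) = - (LINT t|lebesgue_on ?O. M t * \<eta> t)"
      by (simp add: A(7) dvg_def inner_real_def)
    have iO: "integrable (lebesgue_on ?O) (\<lambda>t. \<eta> t * slice K l (w' t))"
      using integrable_indicator_subset[OF i2 sets(2,1,3)] by (simp add: integrable_lebesgue_onI(1)[OF sets(1)])
    have meO: "\<eta> \<in> borel_measurable (lebesgue_on ?O)"
      by (rule measurable_restrict_mono[OF meas[OF A(4)] sets(3)])
    have iM: "integrable (lebesgue_on ?O) (\<lambda>t. \<eta> t * M t)"
      by (rule integrable_bounded_mult[OF Mi[OF sets(1)] meO]) (use B in auto)
    have "(LINT t|lebesgue_on ?O. \<eta> t * slice K l (w' t)) = (LINT t|lebesgue_on ?O. \<eta> t * M t)"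
      using e1 e2 e3 s1 s2 by (simp add: mult.commute)
    moreover have "(slice K l (w' t) - M t) * \<eta> t = \<eta> t * slice K l (w' t) - \<eta> t * M t" for t
      by (simp add: algebra_simps)
    ultimately show "(LINT t|lebesgue_on ?O. (slice K l (w' t) - M t) * \<eta> t) = 0"
      using iO iM by simp
  qed
  then show ?thesis by simp
qed

section \<open>The Neumann form of the equation\<close>

text \<open>Test functions that need not vanish at the boundary, among them constants, the
  logarithms of the concentrations and powers of truncated roots.\<close>

definition C1_closure :: "'a::euclidean_space set \<Rightarrow> ('a \<Rightarrow> real) \<Rightarrow> ('a \<Rightarrow> 'a) \<Rightarrow> bool" where
  "C1_closure \<Omega> \<psi> D\<psi> \<longleftrightarrow> continuous_on (closure \<Omega>) \<psi> \<and> continuous_on (closure \<Omega>) D\<psi> \<and>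
     (\<forall>x\<in>\<Omega>. (\<psi> has_derivative (\<lambda>h. D\<psi> x \<bullet> h)) (at x))"

text \<open>Interior test functions identify q with the classical divergence of F almost everywhere.
  For a test function \<psi> reaching the boundary the field \<psi> F is still tangential, so the
  divergence theorem has no boundary term.\<close>

lemma weak_neumann_form:
  fixes \<Omega> :: "'a::euclidean_space set"
  assumes dom: "C2_holder_domain \<alpha> \<Omega>" and b: "bounded \<Omega>"
    and Fc: "continuous_on (closure \<Omega>) F" and F: "C1b \<Omega> F"
    and nrm: "\<And>x. x \<in> frontier \<Omega> \<Longrightarrow> F x \<bullet> outward_normal \<Omega> x = 0"
    and q: "has_weak_div \<Omega> F q" and r: "continuous_on (closure \<Omega>) r" "AE x in lebesgue_on \<Omega>. q x = - r x"
    and \<psi>: "C1_closure \<Omega> \<psi> D\<psi>"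
  shows "(LINT x|lebesgue_on \<Omega>. F x \<bullet> D\<psi> x) = (LINT x|lebesgue_on \<Omega>. r x * \<psi> x)"
proof -
  have o: "open \<Omega>" using dom unfolding C2_holder_domain_def by blast
  have S: "\<Omega> \<in> sets lebesgue" using o by simp
  have K: "compact (closure \<Omega>)" using b by (simp add: compact_closure)
  obtain F' BF where F': "bdd_deriv \<Omega> F F'" "\<forall>x\<in>\<Omega>. norm (F x) \<le> BF" by (rule C1bE[OF F])
  obtain C where C: "0 < C" "\<And>x. x \<in> \<Omega> \<Longrightarrow> (F has_derivative F' x) (at x)"
    "\<And>x h. x \<in> \<Omega> \<Longrightarrow> norm (F' x h) \<le> C * norm h" using bdd_derivE[OF F'(1)] by blast
  note divF = divergence_theorem_tangential(1)[OF dom b Fc F'(1) nrm]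
  have ql: "locally_integrable \<Omega> q" using q unfolding has_weak_div_def by blast
  have dl: "locally_integrable \<Omega> (\<lambda>x. dvg (F' x))"
    unfolding locally_integrable_def
  proof (intro allI impI)
    fix A assume A: "compact A \<and> A \<subseteq> \<Omega>"
    then have AS: "A \<in> sets lebesgue" by (auto dest: compact_imp_closed)
    show "integrable (lebesgue_on A) (\<lambda>x. dvg (F' x))"
      using integrable_indicator_subset[OF divF S AS] A by (simp add: integrable_lebesgue_onI(1)[OF AS])
  qed
  have "AE x in lebesgue_on \<Omega>. dvg (F' x) - q x = 0"
  proof (rule AE_0_if_test_integrals_0[OF o])
    show "locally_integrable \<Omega> (\<lambda>x. dvg (F' x) - q x)"
      using ql dl unfolding locally_integrable_def by auto
    fix \<phi> assume t: "test_function \<Omega> \<phi>"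
    have bd: "\<exists>C. \<forall>x\<in>A. \<forall>h. norm (F' x h) \<le> C * norm h" if "A \<subseteq> \<Omega>" for A
      using C(3) that by (intro exI[of _ C]) auto
    have "- (LINT x|lebesgue_on \<Omega>. dvg (F' x) * \<phi> x) = - (LINT x|lebesgue_on \<Omega>. q x * \<phi> x)"
      using integral_test_div(3)[OF o C(2) bd t] q t unfolding has_weak_div_def by simp
    then show "(LINT x|lebesgue_on \<Omega>. (dvg (F' x) - q x) * \<phi> x) = 0"
      using locally_integrable_test[OF ql t o] locally_integrable_test[OF dl t o] by (simp add: left_diff_distrib)
  qed
  with r(2) have dr: "AE x in lebesgue_on \<Omega>. dvg (F' x) = - r x" by eventually_elim simp
  have c\<psi>: "continuous_on (closure \<Omega>) \<psi>" "continuous_on (closure \<Omega>) D\<psi>"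
    and d\<psi>: "\<And>x. x \<in> \<Omega> \<Longrightarrow> (\<psi> has_derivative (\<lambda>h. D\<psi> x \<bullet> h)) (at x)" using \<psi> unfolding C1_closure_def by auto
  obtain B1 where B1: "\<forall>x\<in>closure \<Omega>. norm (\<psi> x) \<le> B1" using compact_continuous_bounded[OF K c\<psi>(1)] by blast
  obtain B2 where B2: "\<forall>x\<in>closure \<Omega>. norm (D\<psi> x) \<le> B2" using compact_continuous_bounded[OF K c\<psi>(2)] by blast
  have b\<psi>: "bdd_deriv \<Omega> \<psi> (\<lambda>x h. D\<psi> x \<bullet> h)"
    unfolding bdd_deriv_def
  proof (intro exI[of _ B2] ballI conjI allI d\<psi>)
    fix x h assume "x \<in> \<Omega>"
    then have "norm (D\<psi> x) \<le> B2" using B2 closure_subset[of \<Omega>] by auto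
    then show "norm (D\<psi> x \<bullet> h) \<le> B2 * norm h"
      using Cauchy_Schwarz_ineq2[of "D\<psi> x" h] mult_right_mono[of "norm (D\<psi> x)" B2 "norm h"] by simp
  qed
  have bV: "bdd_deriv \<Omega> (\<lambda>x. \<psi> x *\<^sub>R F x) (\<lambda>x h. \<psi> x *\<^sub>R F' x h + (D\<psi> x \<bullet> h) *\<^sub>R F x)"
    by (rule bdd_deriv_scaleR[OF b\<psi> _ F'(1), of B1 BF]) (use B1 F'(2) closure_subset[of \<Omega>] in auto)
  have eq: "dvg (\<lambda>h. \<psi> x *\<^sub>R F' x h + (D\<psi> x \<bullet> h) *\<^sub>R F x) = \<psi> x * dvg (F' x) + F x \<bullet> D\<psi> x" for x
    by (simp add: dvg_add dvg_scaleR dvg_rank_one) (simp add: inner_commute)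
  have cV: "continuous_on (closure \<Omega>) (\<lambda>x. \<psi> x *\<^sub>R F x)" by (intro continuous_intros c\<psi> Fc)
  have nV: "(\<psi> x *\<^sub>R F x) \<bullet> outward_normal \<Omega> x = 0" if "x \<in> frontier \<Omega>" for x using nrm[OF that] by simp
  have V: "integrable (lebesgue_on \<Omega>) (\<lambda>x. \<psi> x * dvg (F' x) + F x \<bullet> D\<psi> x)"
    "(LINT x|lebesgue_on \<Omega>. \<psi> x * dvg (F' x) + F x \<bullet> D\<psi> x) = 0"
    using divergence_theorem_tangential[OF dom b cV bV nV] unfolding eq by auto
  have i1: "integrable (lebesgue_on \<Omega>) (\<lambda>x. F x \<bullet> D\<psi> x)" "integrable (lebesgue_on \<Omega>) (\<lambda>x. r x * \<psi> x)"
    by (rule integrable_continuous_compact[OF K _ S closure_subset]; intro continuous_intros c\<psi> Fc r(1))+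
  have "(LINT x|lebesgue_on \<Omega>. \<psi> x * dvg (F' x) + F x \<bullet> D\<psi> x) = (LINT x|lebesgue_on \<Omega>. F x \<bullet> D\<psi> x - r x * \<psi> x)"
  proof (rule integral_cong_AE)
    show "AE x in lebesgue_on \<Omega>. \<psi> x * dvg (F' x) + F x \<bullet> D\<psi> x = F x \<bullet> D\<psi> x - r x * \<psi> x"
      using dr by eventually_elim simp
  qed (use V(1) i1 in auto)
  then show ?thesis using V(2) i1 by simp
qed

context additive_MS
begin

text \<open>Vectors are functions on all natural numbers, and equalities between them are available
  only at the meaningful indices.\<close>

lemma conc_lin_cong:
  assumes "\<And>r. r \<in> {1..N} \<Longrightarrow> Y r = Y' r" "\<And>l. l \<in> {1..N-1} \<Longrightarrow> v l = v' l" "i \<in> {1..N}"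
  shows "conc_lin Y v i = conc_lin Y' v' i"
  unfolding conc_lin_def using assms by (auto intro!: arg_cong2[where f=minus] arg_cong2[where f=scaleR] sum.cong)

lemma continuous_on_flux:
  fixes P :: "'z::topological_space \<Rightarrow> nat \<Rightarrow> 'v::real_normed_vector"
  assumes "\<And>r. r \<in> {1..N} \<Longrightarrow> continuous_on Q (\<lambda>z. Y z r)" "\<And>r. r \<in> {1..N} \<Longrightarrow> continuous_on Q (\<lambda>z. P z r)"
    and Y: "\<And>z. z \<in> Q \<Longrightarrow> Y z \<in> open_simplex N" and i: "i \<in> {1..N}"
  shows "continuous_on Q (\<lambda>z. flux (Y z) (P z) i)"
proof -
  have "g r + shift (Y z) \<noteq> 0" if "z \<in> Q" "r \<in> {1..N}" for z r
    using flux_denominators(1)[OF Y[OF that(1)] that(2)] by simp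
  moreover have "(\<Sum>r=1..N. Y z r * inverse (g r + shift (Y z))) \<noteq> 0" if "z \<in> Q" for z
    using flux_denominators(2)[OF Y[OF that]] by simp
  moreover have "continuous_on Q (\<lambda>z. shift (Y z))" unfolding shift_def by (intro continuous_intros assms)
  ultimately show ?thesis unfolding flux_def drive_def using i
    by (intro continuous_intros assms ballI) auto
qed

lemma C1b_flux:
  fixes P :: "'z::euclidean_space \<Rightarrow> nat \<Rightarrow> 'v::real_normed_vector"
  assumes Yc: "\<And>r. r \<in> {1..N} \<Longrightarrow> C1b Q (\<lambda>z. Y z r)" and Pc: "\<And>r. r \<in> {1..N} \<Longrightarrow> C1b Q (\<lambda>z. P z r)"
    and Y: "\<And>z. z \<in> Q \<Longrightarrow> Y z \<in> open_simplex N" and i: "i \<in> {1..N}"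
  shows "C1b Q (\<lambda>z. flux (Y z) (P z) i)"
proof -
  have sh: "C1b Q (\<lambda>z. shift (Y z))" unfolding shift_def by (intro C1b_sum C1b_mult C1b_const Yc finite_atLeastAtMost)
  have inv: "C1b Q (\<lambda>z. inverse (g r + shift (Y z)))" if r: "r \<in> {1..N}" for r
  proof (rule C1b_inverse[where c="g r"])
    show "C1b Q (\<lambda>z. g r + shift (Y z))" by (intro C1b_add C1b_const sh)
    show "0 < g r" by (rule g_pos[OF r])
    show "g r \<le> g r + shift (Y z)" if "z \<in> Q" for z using shift_pos[OF Y[OF that]] by simp
  qed
  have gN: "0 < g N" using g_pos[of N] N2 by simp
  \<comment> \<open>Each g_r + s is at most 2 g_N and the weights sum to 1, hence the lower bound 1
    / (2 g_N) for the sum being inverted.\<close>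
  have den: "C1b Q (\<lambda>z. inverse (\<Sum>r=1..N. Y z r * inverse (g r + shift (Y z))))"
  proof (rule C1b_inverse[where c="1 / (2 * g N)"])
    show "C1b Q (\<lambda>z. \<Sum>r=1..N. Y z r * inverse (g r + shift (Y z)))" by (intro C1b_sum C1b_mult Yc inv finite_atLeastAtMost)
    show "0 < 1 / (2 * g N)" using gN by simp
    fix z assume z: "z \<in> Q"
    have "Y z r * (1 / (2 * g N)) \<le> Y z r * inverse (g r + shift (Y z))" if r: "r \<in> {1..N}" for r
    proof (rule mult_left_mono)
      have "g r + shift (Y z) \<le> 2 * g N" using g_bounds(2)[OF r] shift_le[OF Y[OF z]] by simp
      then show "1 / (2 * g N) \<le> inverse (g r + shift (Y z))"
        using flux_denominators(1)[OF Y[OF z] r] by (simp add: inverse_eq_divide frac_le)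
    qed (use simplexD(1)[OF Y[OF z] r] in simp)
    then have "(\<Sum>r=1..N. Y z r * (1 / (2 * g N))) \<le> (\<Sum>r=1..N. Y z r * inverse (g r + shift (Y z)))" by (rule sum_mono)
    then show "1 / (2 * g N) \<le> (\<Sum>r=1..N. Y z r * inverse (g r + shift (Y z)))"
      using simplexD(2)[OF Y[OF z]] by (simp only: sum_distrib_right[symmetric] mult_1)
  qed
  show ?thesis unfolding flux_def drive_def
    by (intro C1b_scaleR C1b_diff C1b_sum inv den Yc Pc i finite_atLeastAtMost)
qed

section \<open>Classical solutions on strips of positive time\<close>

text \<open>All that the estimates use about the solution: derivatives inside
  \<open>\<Omega>\<close> that are continuous up to the closure, and the Neumann form with the
  explicit flux at every time of the strip. Entropy variables and Bochner spaces no longer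
  occur.\<close>

definition strip_solution ::
  "real \<Rightarrow> real \<Rightarrow> 'a::euclidean_space set \<Rightarrow> (real \<Rightarrow> 'a vfield) \<Rightarrow> (real \<Rightarrow> 'a vfield) \<Rightarrow> (real \<Rightarrow> 'a \<Rightarrow> nat \<Rightarrow> 'a) \<Rightarrow> bool" where
  "strip_solution \<tau> T \<Omega> y yt Dy \<longleftrightarrow>
    (\<forall>t\<in>{\<tau>..T}. \<forall>x\<in>closure \<Omega>. y t x \<in> open_simplex N \<and> (\<Sum>i=1..N. Dy t x i) = 0) \<and>
    (\<forall>i\<in>{1..N}. continuous_on ({\<tau>..T} \<times> closure \<Omega>) (\<lambda>(t, x). y t x i) \<and>
       continuous_on ({\<tau>..T} \<times> closure \<Omega>) (\<lambda>(t, x). yt t x i) \<and>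
       continuous_on ({\<tau>..T} \<times> closure \<Omega>) (\<lambda>(t, x). Dy t x i)) \<and>
    (\<forall>i\<in>{1..N}. \<forall>t\<in>{\<tau>..T}. \<forall>x\<in>\<Omega>.
       ((\<lambda>s. y s x i) has_real_derivative yt t x i) (at t within {\<tau>..T}) \<and>
       ((\<lambda>x. y t x i) has_derivative (\<lambda>h. Dy t x i \<bullet> h)) (at x)) \<and>
    (\<forall>i\<in>{1..N}. \<forall>t\<in>{\<tau>..T}. \<forall>\<psi> D\<psi>. C1_closure \<Omega> \<psi> D\<psi> \<longrightarrow>
       (LINT x|lebesgue_on \<Omega>. flux (y t x) (Dy t x) i \<bullet> D\<psi> x) = (LINT x|lebesgue_on \<Omega>. yt t x i * \<psi> x))"

text \<open>Uniqueness identifies the given flux with the explicit one almost everywhere. Both are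
  continuous up to the closure, so they agree at the boundary as well, and the no-flux condition
  passes to the explicit flux.\<close>

lemma flux_eq_if_MS_equation:
  fixes \<Omega> :: "'a::euclidean_space set"
  assumes o: "open \<Omega>" and eq: "MS_equation g N \<Omega> w w'"
    and Dw: "\<And>l x. l \<in> {1..N-1} \<Longrightarrow> x \<in> \<Omega> \<Longrightarrow> ((\<lambda>x. w x l) has_derivative (\<lambda>h. Du l x \<bullet> h)) (at x)"
    and Duc: "\<And>l. l \<in> {1..N-1} \<Longrightarrow> continuous_on \<Omega> (Du l)"
    and Y: "\<And>x. x \<in> closure \<Omega> \<Longrightarrow> Y x \<in> open_simplex N"
    and wY: "\<And>x i. x \<in> closure \<Omega> \<Longrightarrow> i \<in> {1..N} \<Longrightarrow> conc_of_entropy g N (w x) i = Y x i"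
    and F: "\<And>i. i \<in> {1..N} \<Longrightarrow> continuous_on (closure \<Omega>) (\<lambda>x. flux (Y x) (\<lambda>i. conc_lin (Y x) (\<lambda>l. Du l x) i) i)"
    and i: "i \<in> {1..N}"
  shows "has_weak_div \<Omega> (\<lambda>x. flux (Y x) (\<lambda>i. conc_lin (Y x) (\<lambda>l. Du l x) i) i) (\<lambda>x. - conc_lin (Y x) (w' x) i)"
    "\<And>x. x \<in> frontier \<Omega> \<Longrightarrow> flux (Y x) (\<lambda>i. conc_lin (Y x) (\<lambda>l. Du l x) i) i \<bullet> outward_normal \<Omega> x = 0"
proof -
  let ?P = "\<lambda>x i. conc_lin (Y x) (\<lambda>l. Du l x) i"
  obtain J :: "nat \<Rightarrow> 'a \<Rightarrow> 'a" where J: "\<And>i. i \<in> {1..N} \<Longrightarrow> continuous_on (closure \<Omega>) (J i)"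
    and ae: "AE x in lebesgue_on \<Omega>.
        (\<forall>i\<in>{1..N}. \<forall>k\<in>Basis.
           conc_deriv g N (w x) (\<lambda>l. weak_deriv \<Omega> k (\<lambda>x. w x l) x) i =
             (\<Sum>j=1..N. MS_matrix (additive_coeff g) N (conc_of_entropy g N (w x)) i j * (J j x \<bullet> k))) \<and>
        (\<Sum>i=1..N. J i x) = 0"
    and div: "\<And>i. i \<in> {1..N} \<Longrightarrow> has_weak_div \<Omega> (J i) (\<lambda>x. - conc_deriv g N (w x) (w' x) i)"
    and nrm: "\<And>i x. i \<in> {1..N} \<Longrightarrow> x \<in> frontier \<Omega> \<Longrightarrow> J i x \<bullet> outward_normal \<Omega> x = 0"
    using eq unfolding MS_equation_def by blast
  have S: "\<Omega> \<in> sets lebesgue" using o by simp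
  have "AE x in lebesgue_on \<Omega>. \<forall>l\<in>{1..N-1}. \<forall>k\<in>Basis. weak_deriv \<Omega> k (\<lambda>x. w x l) x = Du l x \<bullet> k"
  proof (intro AE_ball_countable')
    fix l k assume l: "l \<in> {1..N-1}" and k: "k \<in> (Basis :: 'a set)"
    show "AE x in lebesgue_on \<Omega>. weak_deriv \<Omega> k (\<lambda>x. w x l) x = Du l x \<bullet> k"
      by (rule weak_deriv_classical_AE[OF o Dw[OF l] Duc[OF l] k])
  qed (auto intro: countable_finite)
  with ae have "AE x in lebesgue_on \<Omega>. x \<in> \<Omega> \<longrightarrow> (\<forall>i\<in>{1..N}. J i x = flux (Y x) (?P x) i)"
  proof eventually_elim
    case (elim x)
    show ?case
    proof (intro impI ballI)
      fix i assume x: "x \<in> \<Omega>" and i: "i \<in> {1..N}"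
      have xc: "x \<in> closure \<Omega>" using x closure_subset by blast
      have P: "?P x i = (\<Sum>j=1..N. MS_matrix (additive_coeff g) N (Y x) i j *\<^sub>R J j x)" if i: "i \<in> {1..N}" for i
      proof (rule euclidean_eqI)
        fix k :: 'a assume k: "k \<in> Basis"
        have "?P x i \<bullet> k = conc_lin (conc_of_entropy g N (w x)) (\<lambda>l. weak_deriv \<Omega> k (\<lambda>x. w x l) x) i"
          unfolding conc_lin_inner by (rule conc_lin_cong) (use wY[OF xc] elim(2) k i in auto)
        also have "\<dots> = (\<Sum>j=1..N. MS_matrix (additive_coeff g) N (conc_of_entropy g N (w x)) i j * (J j x \<bullet> k))"
          using elim(1) i k by (simp add: conc_deriv_eq)
        also have "\<dots> = (\<Sum>j=1..N. MS_matrix (additive_coeff g) N (Y x) i j * (J j x \<bullet> k))"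
        proof (intro sum.cong refl arg_cong2[where f=times])
          fix j
          have "(\<Sum>l\<in>{1..N} - {i}. additive_coeff g i l * conc_of_entropy g N (w x) l) = (\<Sum>l\<in>{1..N} - {i}. additive_coeff g i l * Y x l)"
            by (intro sum.cong refl) (use wY[OF xc] in auto)
          then show "MS_matrix (additive_coeff g) N (conc_of_entropy g N (w x)) i j = MS_matrix (additive_coeff g) N (Y x) i j"
            using wY[OF xc i] by (simp only: MS_matrix_def)
        qed
        finally show "?P x i \<bullet> k = (\<Sum>j=1..N. MS_matrix (additive_coeff g) N (Y x) i j *\<^sub>R J j x) \<bullet> k"
          by (simp add: inner_sum_left)
      qed
      show "J i x = flux (Y x) (?P x) i"
        by (rule flux_unique[OF Y[OF xc] _ P i]) (use elim(1) in auto)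
    qed
  qed
  with AE_space[of "lebesgue_on \<Omega>"] have "AE x in lebesgue_on \<Omega>. J i x = flux (Y x) (?P x) i"
    by eventually_elim (use i in simp)
  then have Ji: "J i x = flux (Y x) (?P x) i" if "x \<in> closure \<Omega>" for x
    using AE_eq_continuous_imp_eq[OF o J[OF i] F[OF i] _ that] by blast
  then show "\<And>x. x \<in> frontier \<Omega> \<Longrightarrow> flux (Y x) (?P x) i \<bullet> outward_normal \<Omega> x = 0"
    using nrm[OF i] by (simp add: frontier_def)
  have q: "conc_deriv g N (w x) (w' x) i = conc_lin (Y x) (w' x) i" if "x \<in> \<Omega>" for x
    unfolding conc_deriv_eq by (rule conc_lin_cong) (use wY[of x] i that closure_subset[of \<Omega>] in auto)
  have l1: "locally_integrable \<Omega> f \<longleftrightarrow> locally_integrable \<Omega> h" if "\<And>x. x \<in> \<Omega> \<Longrightarrow> f x = h x"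
    for f h :: "'a \<Rightarrow> 'b::euclidean_space"
    unfolding locally_integrable_def
  proof (intro all_cong1 imp_cong refl)
    fix K assume "compact K \<and> K \<subseteq> \<Omega>"
    then show "integrable (lebesgue_on K) f = integrable (lebesgue_on K) h"
      by (intro Bochner_Integration.integrable_cong) (use that in auto)
  qed
  have "J i x = flux (Y x) (?P x) i" if "x \<in> \<Omega>" for x using Ji[of x] that closure_subset[of \<Omega>] by blast
  note JF = this
  have "(LINT x|lebesgue_on \<Omega>. frechet_derivative \<phi> (at x) (J i x)) = (LINT x|lebesgue_on \<Omega>. frechet_derivative \<phi> (at x) (flux (Y x) (?P x) i))"
    "(LINT x|lebesgue_on \<Omega>. - conc_deriv g N (w x) (w' x) i * \<phi> x) = (LINT x|lebesgue_on \<Omega>. - conc_lin (Y x) (w' x) i * \<phi> x)" for \<phi>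
    by (rule Bochner_Integration.integral_cong; simp add: JF q)+
  then show "has_weak_div \<Omega> (\<lambda>x. flux (Y x) (?P x) i) (\<lambda>x. - conc_lin (Y x) (w' x) i)"
    using div[OF i] l1[of "J i", OF JF] l1[of "\<lambda>x. - conc_deriv g N (w x) (w' x) i" "\<lambda>x. - conc_lin (Y x) (w' x) i"] q
    unfolding has_weak_div_def by auto
qed

text \<open>For a fixed box the slice of w' is the integral of the classical derivative at almost
  every time. Restricting to rational boxes makes one null set of times serve all of them, and at
  the remaining times the two functions have equal integrals over enough boxes.\<close>

lemma time_derivative_identified:
  fixes \<Omega> :: "'a::euclidean_space set"
  assumes o: "open \<Omega>" and b: "bounded \<Omega>" and w: "in_W1p_time p (X0 p m \<Omega>) (X0_norm p m \<Omega>) T w w'"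
    and p: "1 < p" and l: "l \<in> {1..m}" and \<tau>: "0 < \<tau>"
    and wc: "continuous_on ({\<tau>..T} \<times> closure \<Omega>) (\<lambda>(t, x). w t x l)"
    and utc: "continuous_on ({\<tau>..T} \<times> closure \<Omega>) (\<lambda>(t, x). ut t x)"
    and d: "\<And>t x. t \<in> {\<tau>..T} \<Longrightarrow> x \<in> \<Omega> \<Longrightarrow> ((\<lambda>s. w s x l) has_real_derivative ut t x) (at t within {\<tau>..T})"
  shows "AE t in lebesgue_on {\<tau><..<T}. AE x in lebesgue_on \<Omega>. w' t x l = ut t x"
proof -
  have S: "\<Omega> \<in> sets lebesgue" using o by simp
  have K: "compact (closure \<Omega>)" using b by (simp add: compact_closure)
  obtain B where B: "\<forall>z\<in>{\<tau>..T} \<times> closure \<Omega>. norm ((\<lambda>(t, x). ut t x) z) \<le> B"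
    using compact_continuous_bounded[OF compact_Times[OF compact_Icc K] utc] by blast
  let ?Q = "{(a, c) \<in> rational_points \<times> rational_points. cbox a c \<subseteq> \<Omega>}"
  have cQ: "countable ?Q"
    by (rule countable_subset[of _ "rational_points \<times> rational_points"]) (auto intro: countable_rational_points)
  have box: "AE t in lebesgue_on {\<tau><..<T}. slice (cbox a c) l (w' t) = (LINT x|lebesgue_on (cbox a c). ut t x)" if sub: "cbox a c \<subseteq> \<Omega>" for a c
  proof (rule weak_time_derivative_slice[OF w p S lmeasurable_cbox sub l \<tau>])
    have subc: "cbox a c \<subseteq> closure \<Omega>" using sub closure_subset[of \<Omega>] by blast
    have int: "integrable (lebesgue_on (cbox a c)) (f t)" if "continuous_on ({\<tau>..T} \<times> closure \<Omega>) (\<lambda>(t, x). f t x)" "t \<in> {\<tau>..T}"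
      for f :: "real \<Rightarrow> 'a \<Rightarrow> real" and t
      by (rule integrable_continuous_compact[OF K continuous_on_section[OF that] _ subc]) simp
    show "((\<lambda>t. slice (cbox a c) l (w t)) has_real_derivative (LINT x|lebesgue_on (cbox a c). ut t x)) (at t within {\<tau>..T})"
      if t: "t \<in> {\<tau>..T}" for t
      unfolding slice_def
    proof (rule has_real_derivative_LINT[OF lmeasurable_cbox _ _ _ _ t, where B=B])
      show "\<bar>ut t x\<bar> \<le> B" if "t \<in> {\<tau>..T}" "x \<in> cbox a c" for t x
        using B that subc by fastforce
    qed (use int[OF wc] int[OF utc] d sub in auto)
    have cl: "closure (cbox a c) = cbox a c" by simp
    show "continuous_on {\<tau>..T} (\<lambda>t. LINT x|lebesgue_on (cbox a c). ut t x)"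
      by (rule continuous_on_LINT) (use continuous_on_subset[OF utc, of "{\<tau>..T} \<times> cbox a c"] subc in auto)
  qed
  have "AE t in lebesgue_on {\<tau><..<T}. \<forall>(a, c)\<in>?Q. slice (cbox a c) l (w' t) = (LINT x|lebesgue_on (cbox a c). ut t x)"
    using box by (intro AE_ball_countable'[OF _ cQ]) auto
  moreover have "AE t in lebesgue_on {\<tau><..<T}. w' t \<in> X0 p m \<Omega>"
  proof -
    have "in_Lp_time p (X0 p m \<Omega>) (X0_norm p m \<Omega>) T w'" using w unfolding in_W1p_time_def by blast
    then have "AE t in lebesgue_on {0..T}. w' t \<in> X0 p m \<Omega>" unfolding in_Lp_time_def by blast
    then show ?thesis
      using fmeasurableD[OF lmeasurable_interval(1)[of 0 T]] fmeasurableD[OF lmeasurable_interval(2)[of \<tau> T]] \<tau>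
      by (auto simp: AE_restrict_space_iff elim!: eventually_mono)
  qed
  ultimately show ?thesis using AE_space[of "lebesgue_on {\<tau><..<T}"]
  proof eventually_elim
    case (elim t)
    then have t: "t \<in> {\<tau>..T}" by simp
    have iw: "integrable (lebesgue_on A) (\<lambda>x. w' t x l)" if "A \<in> lmeasurable" "A \<subseteq> \<Omega>" for A
      by (rule slice_bounds(1)[OF p S that l elim(2)])
    have iu: "integrable (lebesgue_on A) (ut t)" if "A \<in> lmeasurable" "A \<subseteq> \<Omega>" for A
      by (rule integrable_continuous_compact[OF K continuous_on_section[OF utc t] fmeasurableD[OF that(1)]])
         (use that(2) closure_subset[of \<Omega>] in blast)
    have "AE x in lebesgue_on \<Omega>. w' t x l - ut t x = 0"
    proof (rule AE_0_if_rational_box_integrals_0[OF o])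
      show "locally_integrable \<Omega> (\<lambda>x. w' t x l - ut t x)"
        unfolding locally_integrable_def
      proof (intro allI impI)
        fix A assume "compact A \<and> A \<subseteq> \<Omega>"
        then have "A \<in> lmeasurable" "A \<subseteq> \<Omega>" by (auto intro: lmeasurable_compact)
        then show "integrable (lebesgue_on A) (\<lambda>x. w' t x l - ut t x)"
          by (intro Bochner_Integration.integrable_diff iw iu)
      qed
      fix a c :: 'a assume ac: "a \<in> rational_points" "c \<in> rational_points" "cbox a c \<subseteq> \<Omega>"
      then have "slice (cbox a c) l (w' t) = (LINT x|lebesgue_on (cbox a c). ut t x)" using elim(1) by blast
      then show "(LINT x|lebesgue_on (cbox a c). w' t x l - ut t x) = 0"
        using iw[OF lmeasurable_cbox ac(3)] iu[OF lmeasurable_cbox ac(3)] by (simp add: slice_def)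
    qed
    then show ?case by simp
  qed
qed

text \<open>Regularity of the entropy variables passes to y through the closed form of the inverse
  map, with \<open>conc_lin\<close> as its derivative both in time and in space. The equation is
  then available with classical coefficients at almost every time.\<close>

theorem strip_solution_exists:
  fixes \<Omega> :: "'a::euclidean_space set"
  assumes dom: "C2_holder_domain \<alpha> \<Omega>" and b: "bounded \<Omega>" and sol: "global_solution p g N \<Omega> y"
    and p: "1 < p" and \<tau>: "0 < \<tau>" "\<tau> < T"
  shows "\<exists>yt Dy. strip_solution \<tau> T \<Omega> y yt Dy"
proof -
  let ?I = "{\<tau>..T}"
  have o: "open \<Omega>" using dom unfolding C2_holder_domain_def by blast
  have S: "\<Omega> \<in> sets lebesgue" using o by simp
  have K: "compact (closure \<Omega>)" using b by (simp add: compact_closure)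
  define w where "w t x = entropy_var g N (y t x)" for t x
  have simp: "y t x \<in> open_simplex N" if "0 \<le> t" "x \<in> closure \<Omega>" for t x
    using sol that unfolding global_solution_def maximal_Lp_solution_def by blast
  then have simp': "y t x \<in> open_simplex N" if "t \<in> ?I" "x \<in> closure \<Omega>" for t x using that \<tau> by auto
  have wy: "conc_of_entropy g N (w t x) i = y t x i" if "t \<in> ?I" "x \<in> closure \<Omega>" "i \<in> {1..N}" for t x i
    unfolding w_def by (rule conc_of_entropy_var[OF simp'[OF that(1,2)] that(3)])
  have "classical_on_strips g N \<Omega> y" using sol unfolding global_solution_def by blast
  then obtain \<sigma> where \<sigma>: "0 < \<sigma>" "\<And>l. l \<in> {1..N-1} \<Longrightarrow> parabolic_C12 \<sigma> \<tau> T \<Omega> (\<lambda>t x. w t x l)"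
    using \<tau> unfolding classical_on_strips_def w_def by blast
  have "\<forall>l\<in>{1..N-1}. \<exists>ut Du. (\<forall>t\<in>?I. \<forall>x\<in>\<Omega>. ((\<lambda>s. w s x l) has_real_derivative ut t x) (at t within ?I)) \<and>
    (\<forall>t\<in>?I. \<forall>x\<in>\<Omega>. ((\<lambda>x. w t x l) has_derivative (\<lambda>h. Du t x \<bullet> h)) (at x)) \<and>
    (\<forall>t\<in>?I. C1b \<Omega> (Du t)) \<and>
    continuous_on (?I \<times> closure \<Omega>) (\<lambda>(t, x). w t x l) \<and>
    continuous_on (?I \<times> closure \<Omega>) (\<lambda>(t, x). ut t x) \<and>
    continuous_on (?I \<times> closure \<Omega>) (\<lambda>(t, x). Du t x)"
    using parabolic_C12E[OF \<sigma>(2) \<sigma>(1) b] by blast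
  then obtain ut Du where reg: "\<forall>l\<in>{1..N-1}. (\<forall>t\<in>?I. \<forall>x\<in>\<Omega>. ((\<lambda>s. w s x l) has_real_derivative ut l t x) (at t within ?I)) \<and>
    (\<forall>t\<in>?I. \<forall>x\<in>\<Omega>. ((\<lambda>x. w t x l) has_derivative (\<lambda>h. Du l t x \<bullet> h)) (at x)) \<and>
    (\<forall>t\<in>?I. C1b \<Omega> (Du l t)) \<and>
    continuous_on (?I \<times> closure \<Omega>) (\<lambda>(t, x). w t x l) \<and>
    continuous_on (?I \<times> closure \<Omega>) (\<lambda>(t, x). ut l t x) \<and>
    continuous_on (?I \<times> closure \<Omega>) (\<lambda>(t, x). Du l t x)"
    unfolding bchoice_iff by blast
  have d1: "((\<lambda>s. w s x l) has_real_derivative ut l t x) (at t within ?I)"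
    and d2: "((\<lambda>x. w t x l) has_derivative (\<lambda>h. Du l t x \<bullet> h)) (at x)" if "l \<in> {1..N-1}" "t \<in> ?I" "x \<in> \<Omega>" for l t x
    using reg that by blast+
  have CDu: "C1b \<Omega> (Du l t)" if "l \<in> {1..N-1}" "t \<in> ?I" for l t using reg that by blast
  have cw: "continuous_on (?I \<times> closure \<Omega>) (\<lambda>(t, x). w t x l)"
    and cut: "continuous_on (?I \<times> closure \<Omega>) (\<lambda>(t, x). ut l t x)"
    and cDu: "continuous_on (?I \<times> closure \<Omega>) (\<lambda>(t, x). Du l t x)" if "l \<in> {1..N-1}" for l
    using reg that by blast+
  define yt where "yt t x i = conc_lin (y t x) (\<lambda>l. ut l t x) i" for t x i
  define Dy where "Dy t x i = conc_lin (y t x) (\<lambda>l. Du l t x) i" for t x i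
  have cy: "continuous_on (?I \<times> closure \<Omega>) (\<lambda>(t, x). y t x i)" if i: "i \<in> {1..N}" for i
  proof -
    have pos: "(\<Sum>r=1..N. exp (\<Sum>l=1..N-1. g r ^ l * w (fst z) (snd z) l)) \<noteq> 0" for z
      using sum_pos[of "{1..N}" "\<lambda>r. exp (\<Sum>l=1..N-1. g r ^ l * w (fst z) (snd z) l)"] N2 by simp
    have "continuous_on (?I \<times> closure \<Omega>) (\<lambda>z. conc_of_entropy g N (w (fst z) (snd z)) i)"
      unfolding conc_of_entropy_def using cw pos by (intro continuous_intros) (auto simp: case_prod_unfold)
    then show ?thesis
      by (rule continuous_on_cong[THEN iffD1, rotated 2]) (use wy i in auto)
  qed
  have cyt: "continuous_on (?I \<times> closure \<Omega>) (\<lambda>(t, x). yt t x i)"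
    and cDy: "continuous_on (?I \<times> closure \<Omega>) (\<lambda>(t, x). Dy t x i)" if i: "i \<in> {1..N}" for i
    unfolding yt_def Dy_def conc_lin_def case_prod_unfold
    using cy cut cDu i unfolding case_prod_unfold by (intro continuous_intros; simp)+
  have dt: "((\<lambda>s. y s x i) has_real_derivative yt t x i) (at t within ?I)"
    and dx: "((\<lambda>x. y t x i) has_derivative (\<lambda>h. Dy t x i \<bullet> h)) (at x)"
    if i: "i \<in> {1..N}" and t: "t \<in> ?I" and x: "x \<in> \<Omega>" for i t x
  proof -
    have xc: "x \<in> closure \<Omega>" using x closure_subset by blast
    have "((\<lambda>s. conc_of_entropy g N (w s x) i) has_derivative
        (\<lambda>h. conc_lin (conc_of_entropy g N (w t x)) (\<lambda>l. ut l t x * h) i)) (at t within ?I)"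
      by (rule conc_of_entropy_has_derivative) (use d1[OF _ t x] in \<open>simp add: has_field_derivative_def\<close>)
    moreover have "conc_lin (conc_of_entropy g N (w t x)) (\<lambda>l. ut l t x * h) i = yt t x i * h" for h
    proof -
      have "conc_lin (conc_of_entropy g N (w t x)) (\<lambda>l. ut l t x * h) i = conc_lin (y t x) (\<lambda>l. ut l t x * h) i"
        by (rule conc_lin_cong) (use wy[OF t xc] i in auto)
      then show ?thesis unfolding yt_def conc_lin_def real_scaleR_def
        by (simp add: sum_distrib_left sum_distrib_right right_diff_distrib left_diff_distrib mult_ac)
    qed
    ultimately have "((\<lambda>s. conc_of_entropy g N (w s x) i) has_real_derivative yt t x i) (at t within ?I)"
      by (simp add: has_field_derivative_def)
    then show "((\<lambda>s. y s x i) has_real_derivative yt t x i) (at t within ?I)"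
      by (rule has_field_derivative_transform_within[OF _ zero_less_one t]) (use wy xc i in auto)
    have "((\<lambda>x. conc_of_entropy g N (w t x) i) has_derivative
        (\<lambda>h. conc_lin (conc_of_entropy g N (w t x)) (\<lambda>l. Du l t x \<bullet> h) i)) (at x)"
      by (rule conc_of_entropy_has_derivative) (rule d2[OF _ t x])
    moreover have "conc_lin (conc_of_entropy g N (w t x)) (\<lambda>l. Du l t x \<bullet> h) i = Dy t x i \<bullet> h" for h
      unfolding Dy_def conc_lin_inner by (rule conc_lin_cong) (use wy[OF t xc] i in auto)
    ultimately have "((\<lambda>x. conc_of_entropy g N (w t x) i) has_derivative (\<lambda>h. Dy t x i \<bullet> h)) (at x)" by simp
    then show "((\<lambda>x. y t x i) has_derivative (\<lambda>h. Dy t x i \<bullet> h)) (at x)"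
      by (rule has_derivative_transform_within_open[OF _ o x]) (use wy[OF t] i closure_subset[of \<Omega>] in auto)
  qed
  have cfl: "continuous_on (?I \<times> closure \<Omega>) (\<lambda>z. flux (y (fst z) (snd z)) (Dy (fst z) (snd z)) i)" if i: "i \<in> {1..N}" for i
    by (rule continuous_on_flux[OF _ _ _ i]) (use cy cDy simp' in \<open>auto simp: case_prod_unfold\<close>)
  have cfl_t: "continuous_on (closure \<Omega>) (\<lambda>x. flux (y t x) (Dy t x) i)" if "i \<in> {1..N}" "t \<in> ?I" for i t
    by (rule continuous_on_section[where f="\<lambda>t x. flux (y t x) (Dy t x) i"]) (use cfl that in \<open>auto simp: case_prod_unfold\<close>)
  have Cy: "C1b \<Omega> (\<lambda>x. y t x i)" if i: "i \<in> {1..N}" and t: "t \<in> ?I" for i t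
  proof -
    obtain B where B: "\<forall>x\<in>closure \<Omega>. norm (Dy t x i) \<le> B"
      using compact_continuous_bounded[OF K continuous_on_section[where f="\<lambda>t x. Dy t x i", OF cDy[OF i] t]] by blast
    have "norm (Dy t x i \<bullet> h) \<le> B * norm h" if x: "x \<in> \<Omega>" for x h
    proof -
      have "norm (Dy t x i) \<le> B" using B x closure_subset[of \<Omega>] by blast
      then show ?thesis
        using Cauchy_Schwarz_ineq2[of "Dy t x i" h] mult_right_mono[of "norm (Dy t x i)" B "norm h"] by simp
    qed
    then have "bdd_deriv \<Omega> (\<lambda>x. y t x i) (\<lambda>x h. Dy t x i \<bullet> h)" unfolding bdd_deriv_def using dx[OF i t] by blast
    moreover have "norm (y t x i) \<le> 1" if "x \<in> \<Omega>" for x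
    proof -
      have "y t x \<in> open_simplex N" using simp'[OF t] that closure_subset[of \<Omega>] by blast
      from simplexD(1)[OF this i] simplex_le_1[OF this i] show ?thesis by simp
    qed
    ultimately show ?thesis unfolding C1b_def by blast
  qed
  \<comment> \<open>This is where the second derivatives of the entropy variables enter: the
    divergence theorem asks for a bounded derivative of the flux, which itself contains first
    derivatives.\<close>
  have Cfl: "C1b \<Omega> (\<lambda>x. flux (y t x) (Dy t x) i)" if i: "i \<in> {1..N}" and t: "t \<in> ?I" for i t
  proof (rule C1b_flux[OF Cy[OF _ t] _ _ i])
    show "C1b \<Omega> (\<lambda>x. Dy t x r)" if "r \<in> {1..N}" for r
      unfolding Dy_def conc_lin_def
      by (intro C1b_scaleR C1b_diff C1b_sum C1b_const Cy[OF _ t] CDu[OF _ t] that finite_atLeastAtMost)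
    show "y t x \<in> open_simplex N" if "x \<in> \<Omega>" for x using simp'[OF t] that closure_subset[of \<Omega>] by blast
  qed
  have "\<exists>w'. (\<forall>T>0. in_W1p_time p (X0 p (N - 1) \<Omega>) (X0_norm p (N - 1) \<Omega>) T w w') \<and>
      (AE t in lebesgue_on {0..}. MS_equation g N \<Omega> (w t) (w' t))"
    using sol unfolding global_solution_def maximal_Lp_solution_def Let_def w_def[abs_def] by (elim conjE)
  then obtain w' where w'0: "\<forall>T>0. in_W1p_time p (X0 p (N - 1) \<Omega>) (X0_norm p (N - 1) \<Omega>) T w w'"
    and ms: "AE t in lebesgue_on {0..}. MS_equation g N \<Omega> (w t) (w' t)" by (elim exE conjE)
  have w': "in_W1p_time p (X0 p (N - 1) \<Omega>) (X0_norm p (N - 1) \<Omega>) T w w'" using w'0 \<tau> by simp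
  have "AE t in lebesgue_on {\<tau><..<T}. \<forall>l\<in>{1..N-1}. AE x in lebesgue_on \<Omega>. w' t x l = ut l t x"
  proof (rule AE_ball_countable')
    fix l assume l: "l \<in> {1..N-1}"
    show "AE t in lebesgue_on {\<tau><..<T}. AE x in lebesgue_on \<Omega>. w' t x l = ut l t x"
      by (rule time_derivative_identified[OF o b w' p l \<tau>(1) cw[OF l] cut[OF l] d1[OF l]])
  qed (auto intro: countable_finite)
  moreover have "AE t in lebesgue_on {\<tau><..<T}. MS_equation g N \<Omega> (w t) (w' t)"
  proof -
    have "{0::real..} \<in> sets lebesgue" "{\<tau><..<T} \<in> sets lebesgue" by auto
    then show ?thesis using ms \<tau> by (auto simp: AE_restrict_space_iff elim!: eventually_mono)
  qed
  ultimately have weak_ae: "AE t in lebesgue_on {\<tau><..<T}. \<forall>i\<in>{1..N}. \<forall>\<psi> D\<psi>. C1_closure \<Omega> \<psi> D\<psi> \<longrightarrow>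
       (LINT x|lebesgue_on \<Omega>. flux (y t x) (Dy t x) i \<bullet> D\<psi> x) = (LINT x|lebesgue_on \<Omega>. yt t x i * \<psi> x)"
    using AE_space[of "lebesgue_on {\<tau><..<T}"]
  proof eventually_elim
    case (elim t)
    then have t: "t \<in> ?I" by simp
    show ?case
    proof (intro ballI allI impI)
      fix i \<psi> D\<psi> assume i: "i \<in> {1..N}" and \<psi>: "C1_closure \<Omega> \<psi> D\<psi>"
      have F: "continuous_on (closure \<Omega>) (\<lambda>x. flux (y t x) (\<lambda>i. conc_lin (y t x) (\<lambda>l. Du l t x) i) i)" if "i \<in> {1..N}" for i
        using cfl_t[OF that t] by (simp add: Dy_def[abs_def])
      have Duc: "continuous_on \<Omega> (Du l t)" if "l \<in> {1..N-1}" for l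
        by (rule continuous_on_subset[OF continuous_on_section[OF cDu[OF that] t] closure_subset])
      note fe = flux_eq_if_MS_equation[OF o elim(2), of "\<lambda>l. Du l t" "y t", OF d2[OF _ t] Duc simp'[OF t] wy[OF t] F i]
      have q: "has_weak_div \<Omega> (\<lambda>x. flux (y t x) (Dy t x) i) (\<lambda>x. - conc_lin (y t x) (w' t x) i)"
        unfolding Dy_def[abs_def] by (rule fe(1)) auto
      have nrm: "flux (y t x) (Dy t x) i \<bullet> outward_normal \<Omega> x = 0" if "x \<in> frontier \<Omega>" for x
        unfolding Dy_def[abs_def] by (rule fe(2)) (use that in auto)
      have "AE x in lebesgue_on \<Omega>. \<forall>l\<in>{1..N-1}. w' t x l = ut l t x"
        using elim(1) by (intro AE_ball_countable') (auto intro: countable_finite)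
      then have r: "AE x in lebesgue_on \<Omega>. - conc_lin (y t x) (w' t x) i = - yt t x i"
      proof eventually_elim
        case (elim x)
        then show ?case unfolding yt_def using conc_lin_cong[of "y t x" "y t x" "w' t x" "\<lambda>l. ut l t x" i] i by simp
      qed
      show "(LINT x|lebesgue_on \<Omega>. flux (y t x) (Dy t x) i \<bullet> D\<psi> x) = (LINT x|lebesgue_on \<Omega>. yt t x i * \<psi> x)"
        by (rule weak_neumann_form[OF dom b cfl_t[OF i t] Cfl[OF i t] nrm q continuous_on_section[where f="\<lambda>t x. yt t x i", OF cyt[OF i] t] r \<psi>])
    qed
  qed
  \<comment> \<open>Both sides depend continuously on time, so the identity extends from almost
    every time to all times of the closed strip, end points included.\<close>
  have weak: "(LINT x|lebesgue_on \<Omega>. flux (y t x) (Dy t x) i \<bullet> D\<psi> x) = (LINT x|lebesgue_on \<Omega>. yt t x i * \<psi> x)"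
    if i: "i \<in> {1..N}" and t: "t \<in> ?I" and \<psi>: "C1_closure \<Omega> \<psi> D\<psi>" for i t \<psi> D\<psi>
  proof -
    have c\<psi>: "continuous_on (closure \<Omega>) \<psi>" "continuous_on (closure \<Omega>) D\<psi>" using \<psi> unfolding C1_closure_def by auto
    have c\<psi>': "continuous_on (?I \<times> closure \<Omega>) (\<lambda>z. \<psi> (snd z))" "continuous_on (?I \<times> closure \<Omega>) (\<lambda>z. D\<psi> (snd z))"
      by (rule continuous_on_compose2[OF c\<psi>(1)] continuous_on_compose2[OF c\<psi>(2)]; auto intro!: continuous_intros)+
    have c1: "continuous_on ?I (\<lambda>t. LINT x|lebesgue_on \<Omega>. flux (y t x) (Dy t x) i \<bullet> D\<psi> x)"
      by (rule continuous_on_LINT[OF b S compact_Icc])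
         (use continuous_on_inner[OF cfl[OF i] c\<psi>'(2)] in \<open>simp add: case_prod_unfold\<close>)
    have c2: "continuous_on ?I (\<lambda>t. LINT x|lebesgue_on \<Omega>. yt t x i * \<psi> x)"
      by (rule continuous_on_LINT[OF b S compact_Icc])
         (use continuous_on_mult[OF cyt[OF i, unfolded case_prod_unfold] c\<psi>'(1)] in \<open>simp add: case_prod_unfold\<close>)
    have cl: "closure {\<tau><..<T} = ?I" using \<tau> by simp
    have ae: "AE t in lebesgue_on {\<tau><..<T}. (LINT x|lebesgue_on \<Omega>. flux (y t x) (Dy t x) i \<bullet> D\<psi> x) = (LINT x|lebesgue_on \<Omega>. yt t x i * \<psi> x)"
      using weak_ae by eventually_elim (use i \<psi> in blast)
    show ?thesis
      by (rule AE_eq_continuous_imp_eq[of "{\<tau><..<T}", unfolded cl, OF _ c1 c2 ae t]) simp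
  qed
  have sum0: "(\<Sum>i=1..N. Dy t x i) = 0" if "t \<in> ?I" "x \<in> closure \<Omega>" for t x
    unfolding Dy_def by (rule conc_lin_sum_0[OF simp'[OF that]])
  show ?thesis unfolding strip_solution_def
    by (intro exI[of _ yt] exI[of _ Dy] conjI ballI allI impI simp' sum0 cy cyt cDy dt dx weak)
qed

end

section \<open>The maximum principle for the roots\<close>

text \<open>Since d vanishes at x, the variation of c is multiplied by a factor of first order and
  is negligible to that order; continuity of c at x is enough.\<close>

lemma has_derivative_mult_continuous_zero:
  fixes c d :: "'a::real_normed_vector \<Rightarrow> real"
  assumes c: "(c \<longlongrightarrow> c x) (at x within S)" and d: "(d has_derivative d') (at x within S)" and d0: "d x = 0"
  shows "((\<lambda>y. c y * d y) has_derivative (\<lambda>h. c x * d' h)) (at x within S)"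
proof -
  have bl: "bounded_linear d'" by (rule has_derivative_bounded_linear[OF d])
  obtain K where K: "\<And>h. norm (d' h) \<le> norm h * K" using bounded_linear.bounded[OF bl] by blast
  let ?r = "\<lambda>y. norm (d y - d' (y - x)) / norm (y - x)"
  have r: "(?r \<longlongrightarrow> 0) (at x within S)"
    using d d0 by (simp add: has_derivative_iff_norm)
  have "((\<lambda>y. \<bar>c y - c x\<bar> * (?r y + K) + \<bar>c x\<bar> * ?r y) \<longlongrightarrow> \<bar>c x - c x\<bar> * (0 + K) + \<bar>c x\<bar> * 0) (at x within S)"
    by (intro tendsto_intros c r)
  then have lim: "((\<lambda>y. \<bar>c y - c x\<bar> * (?r y + K) + \<bar>c x\<bar> * ?r y) \<longlongrightarrow> 0) (at x within S)" by simp
  have "((\<lambda>y. norm (c y * d y - c x * d x - c x * d' (y - x)) / norm (y - x)) \<longlongrightarrow> 0) (at x within S)"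
  proof (rule Lim_null_comparison[OF _ lim], unfold eventually_at_filter, rule always_eventually, intro allI impI)
    fix y assume y: "y \<noteq> x" and "y \<in> S"
    have n: "0 < norm (y - x)" using y by simp
    have "\<bar>c y * d y - c x * d x - c x * d' (y - x)\<bar> = \<bar>(c y - c x) * d y + c x * (d y - d' (y - x))\<bar>"
      using d0 by (simp add: algebra_simps)
    also have "\<dots> \<le> \<bar>c y - c x\<bar> * \<bar>d y\<bar> + \<bar>c x\<bar> * \<bar>d y - d' (y - x)\<bar>"
      unfolding abs_mult[symmetric] by (rule abs_triangle_ineq)
    also have "\<bar>d y\<bar> \<le> \<bar>d y - d' (y - x)\<bar> + norm (y - x) * K" using K[of "y - x"] by simp
    finally have le: "\<bar>c y * d y - c x * d x - c x * d' (y - x)\<bar>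
        \<le> \<bar>c y - c x\<bar> * (\<bar>d y - d' (y - x)\<bar> + norm (y - x) * K) + \<bar>c x\<bar> * \<bar>d y - d' (y - x)\<bar>"
      by (simp add: mult_left_mono)
    have "\<bar>c y * d y - c x * d x - c x * d' (y - x)\<bar> / norm (y - x)
        \<le> (\<bar>c y - c x\<bar> * (\<bar>d y - d' (y - x)\<bar> + norm (y - x) * K) + \<bar>c x\<bar> * \<bar>d y - d' (y - x)\<bar>) / norm (y - x)"
      by (rule divide_right_mono[OF le]) simp
    also have "\<dots> = \<bar>c y - c x\<bar> * (?r y + K) + \<bar>c x\<bar> * ?r y"
      using n by (simp add: field_simps)
    finally show "norm (norm (c y * d y - c x * d x - c x * d' (y - x)) / norm (y - x)) \<le> \<bar>c y - c x\<bar> * (?r y + K) + \<bar>c x\<bar> * ?r y"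
      by simp
  qed
  moreover have "bounded_linear (\<lambda>h. c x * d' h)" using bl by (rule bounded_linear_const_mult)
  ultimately show ?thesis unfolding has_derivative_iff_norm by simp
qed

text \<open>Caratheodory's form of differentiability: the coefficients \<open>c\<close> need only be continuous.\<close>

lemma has_derivative_caratheodory:
  fixes f :: "'a::real_normed_vector \<Rightarrow> real"
  assumes fin: "finite I" and f: "\<And>y. y \<in> S \<Longrightarrow> f y - f x = (\<Sum>i\<in>I. c i y * (u i y - u i x))"
    and c: "\<And>i. i \<in> I \<Longrightarrow> (c i \<longlongrightarrow> c i x) (at x within S)"
    and u: "\<And>i. i \<in> I \<Longrightarrow> (u i has_derivative u' i) (at x within S)" and x: "x \<in> S"
  shows "(f has_derivative (\<lambda>h. \<Sum>i\<in>I. c i x * u' i h)) (at x within S)"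
proof -
  have "((\<lambda>y. c i y * (u i y - u i x)) has_derivative (\<lambda>h. c i x * u' i h)) (at x within S)" if i: "i \<in> I" for i
  proof (rule has_derivative_mult_continuous_zero[OF c[OF i]])
    show "((\<lambda>y. u i y - u i x) has_derivative u' i) (at x within S)"
      using has_derivative_diff[OF u[OF i] has_derivative_const] by simp
  qed simp
  then have "((\<lambda>y. \<Sum>i\<in>I. c i y * (u i y - u i x)) has_derivative (\<lambda>h. \<Sum>i\<in>I. c i x * u' i h)) (at x within S)"
    by (rule has_derivative_sum)
  then have "((\<lambda>y. f x + (\<Sum>i\<in>I. c i y * (u i y - u i x))) has_derivative (\<lambda>h. 0 + (\<Sum>i\<in>I. c i x * u' i h))) (at x within S)"
    by (intro has_derivative_add has_derivative_const)
  then have "((\<lambda>y. f x + (\<Sum>i\<in>I. c i y * (u i y - u i x))) has_derivative (\<lambda>h. \<Sum>i\<in>I. c i x * u' i h)) (at x within S)" by simp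
  then show ?thesis
    by (rule has_derivative_transform[OF x, rotated]) (use f in \<open>simp add: algebra_simps\<close>)
qed

text \<open>The double successor encodes an exponent of at least two, for which the kink of the
  positive part at 0 disappears. The square and the cube are used below.\<close>

lemma pos_part_power_deriv:
  "((\<lambda>s::real. (max 0 s) ^ Suc (Suc n)) has_real_derivative real (Suc (Suc n)) * (max 0 s) ^ Suc n) (at s)"
proof -
  consider "s < 0" | "s > 0" | "s = 0" by linarith
  then show ?thesis
  proof cases
    case 1
    have "((\<lambda>s::real. 0) has_real_derivative 0) (at s)" by simp
    then have "((\<lambda>s::real. (max 0 s) ^ Suc (Suc n)) has_real_derivative 0) (at s)"
      by (rule has_field_derivative_transform_within_open[where S="{..<0}"]) (use 1 in auto)
    then show ?thesis using 1 by simp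
  next
    case 2
    have "((\<lambda>s::real. s ^ Suc (Suc n)) has_real_derivative real (Suc (Suc n)) * s ^ Suc n) (at s)"
      using DERIV_pow[of "Suc (Suc n)" s] by simp
    then have "((\<lambda>s::real. (max 0 s) ^ Suc (Suc n)) has_real_derivative real (Suc (Suc n)) * s ^ Suc n) (at s)"
      by (rule has_field_derivative_transform_within_open[where S="{0<..}"]) (use 2 in auto)
    then show ?thesis using 2 by simp
  next
    case 3
    have "((\<lambda>h. (max 0 h) ^ Suc n) \<longlongrightarrow> (max 0 0) ^ Suc n) (at (0::real))" by (intro tendsto_intros)
    then have "((\<lambda>h::real. (max 0 h) ^ Suc n) \<longlongrightarrow> 0) (at 0)" by simp
    moreover have "\<forall>\<^sub>F h in at (0::real). (max 0 h) ^ Suc n = (max 0 (0 + h) ^ Suc (Suc n) - max 0 0 ^ Suc (Suc n)) / h"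
      unfolding eventually_at_filter by (rule always_eventually) (auto simp: max_def)
    ultimately have "((\<lambda>h::real. (max 0 (0 + h) ^ Suc (Suc n) - max 0 0 ^ Suc (Suc n)) / h) \<longlongrightarrow> 0) (at 0)"
      by (rule Lim_transform_eventually)
    then show ?thesis using 3 by (simp add: DERIV_def)
  qed
qed

context additive_MS
begin

section \<open>Derivatives of the root coordinates\<close>

text \<open>Minus the partial derivative of the j-th root with respect to the i-th concentration, by
  implicit differentiation of the equation for the root.\<close>

definition root_weight :: "nat \<Rightarrow> (nat \<Rightarrow> real) \<Rightarrow> nat \<Rightarrow> real" where
  "root_weight j Y i = inverse (g i - root_coord g N Y j) * inverse (dquot Y (root_coord g N Y j) (root_coord g N Y j))"

definition root_grad :: "nat \<Rightarrow> (nat \<Rightarrow> real) \<Rightarrow> (nat \<Rightarrow> 'v::real_vector) \<Rightarrow> 'v" where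
  "root_grad j Y P = - (\<Sum>i=1..N. root_weight j Y i *\<^sub>R P i)"

text \<open>If P consists of the gradients of the concentrations, this is the gradient of the
  diagonal \<open>dquot\<close> at the root; the cubes come from moving the root in the squared
  denominators.\<close>

definition dquot_grad :: "nat \<Rightarrow> (nat \<Rightarrow> real) \<Rightarrow> (nat \<Rightarrow> 'v::real_vector) \<Rightarrow> 'v" where
  "dquot_grad j Y P = (\<Sum>i=1..N. (inverse (g i - root_coord g N Y j))\<^sup>2 *\<^sub>R P i
     + (2 * Y i * (inverse (g i - root_coord g N Y j)) ^ 3) *\<^sub>R root_grad j Y P)"

definition weight_grad :: "nat \<Rightarrow> (nat \<Rightarrow> real) \<Rightarrow> (nat \<Rightarrow> 'v::real_vector) \<Rightarrow> nat \<Rightarrow> 'v" where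
  "weight_grad j Y P i =
     ((inverse (g i - root_coord g N Y j))\<^sup>2 * inverse (dquot Y (root_coord g N Y j) (root_coord g N Y j))) *\<^sub>R root_grad j Y P
     - (inverse (g i - root_coord g N Y j) * (inverse (dquot Y (root_coord g N Y j) (root_coord g N Y j)))\<^sup>2) *\<^sub>R dquot_grad j Y P"

text \<open>The vector left after the gradient of the root has been factored out of the pairing of
  the fluxes with the gradients of the weights.\<close>

definition root_drift :: "nat \<Rightarrow> (nat \<Rightarrow> real) \<Rightarrow> (nat \<Rightarrow> 'v::real_vector) \<Rightarrow> 'v" where
  "root_drift j Y P = inverse (dquot Y (root_coord g N Y j) (root_coord g N Y j)) *\<^sub>R
     ((\<Sum>i=1..N. (inverse (g i - root_coord g N Y j))\<^sup>2 *\<^sub>R flux Y P i)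
      - inverse (shift Y + root_coord g N Y j) *\<^sub>R dquot_grad j Y P)"

lemma root_nonzero:
  assumes "Y \<in> open_simplex N" "j \<in> {1..N-1}"
  shows "i \<in> {1..N} \<Longrightarrow> g i - root_coord g N Y j \<noteq> 0" "0 < dquot Y (root_coord g N Y j) (root_coord g N Y j)"
    "0 < shift Y + root_coord g N Y j" "shift Y + root_coord g N Y j \<le> 2 * g N"
proof -
  note z = root_coord[OF assms]
  show "g i - root_coord g N Y j \<noteq> 0" if "i \<in> {1..N}"
    using interval_signs(3)[OF that assms(2) z(1,2) z(1,2)] by simp
  show "0 < dquot Y (root_coord g N Y j) (root_coord g N Y j)" by (rule dquot_ge(2)[OF assms z(1,2) z(1,2)])
  have j: "j \<in> {1..N}" "Suc j \<in> {1..N}" using assms(2) by auto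
  show "0 < shift Y + root_coord g N Y j" using shift_pos[OF assms(1)] z(1) g_pos[OF j(1)] by linarith
  show "shift Y + root_coord g N Y j \<le> 2 * g N" using shift_le[OF assms(1)] z(2) g_bounds(2)[OF j(2)] by linarith
qed

text \<open>The first identity is the one at a root, divided by \<open>dquot\<close>. In the second,
  one part of \<open>weight_grad\<close> carries the root gradient explicitly; the other pairs the
  weighted flux sum with \<open>dquot_grad\<close>, and that sum is a multiple of the root gradient
  by the first identity. So the lower-order term has the root gradient as a factor.\<close>

lemma weighted_flux:
  fixes P :: "nat \<Rightarrow> 'v::real_inner"
  assumes Y: "Y \<in> open_simplex N" and j: "j \<in> {1..N-1}" and P0: "(\<Sum>i=1..N. P i) = 0"
  shows "(\<Sum>i=1..N. root_weight j Y i *\<^sub>R flux Y P i) = inverse (shift Y + root_coord g N Y j) *\<^sub>R root_grad j Y P"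
    "(\<Sum>i=1..N. flux Y P i \<bullet> weight_grad j Y P i) = root_grad j Y P \<bullet> root_drift j Y P"
proof -
  let ?z = "root_coord g N Y j"
  let ?D = "dquot Y ?z ?z"
  note nz = root_nonzero[OF Y j]
  have G: "(\<Sum>i=1..N. inverse (g i - ?z) *\<^sub>R flux Y P i) = - (inverse (shift Y + ?z) *\<^sub>R (\<Sum>i=1..N. inverse (g i - ?z) *\<^sub>R P i))"
    by (rule flux_at_root[OF Y P0 root_coord(3)[OF Y j]]) (use nz(1,3) in auto)
  have w: "(\<Sum>i=1..N. root_weight j Y i *\<^sub>R V i) = inverse ?D *\<^sub>R (\<Sum>i=1..N. inverse (g i - ?z) *\<^sub>R V i)" for V :: "nat \<Rightarrow> 'v"
    unfolding root_weight_def scaleR_sum_right by (simp add: mult.commute)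
  show 1: "(\<Sum>i=1..N. root_weight j Y i *\<^sub>R flux Y P i) = inverse (shift Y + ?z) *\<^sub>R root_grad j Y P"
    unfolding root_grad_def w G by simp
  have G2: "inverse ?D *\<^sub>R (\<Sum>i=1..N. inverse (g i - ?z) *\<^sub>R flux Y P i) = inverse (shift Y + ?z) *\<^sub>R root_grad j Y P"
    using 1 unfolding w .
  have "(\<Sum>i=1..N. flux Y P i \<bullet> weight_grad j Y P i)
      = (\<Sum>i=1..N. inverse ?D * ((inverse (g i - ?z))\<^sup>2 * (flux Y P i \<bullet> root_grad j Y P)))
        - inverse ?D * (\<Sum>i=1..N. inverse ?D * (inverse (g i - ?z) * (flux Y P i \<bullet> dquot_grad j Y P)))"
    unfolding weight_grad_def sum_distrib_left sum_subtractf[symmetric]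
    by (intro sum.cong refl) (simp add: inner_diff_right power2_eq_square mult_ac)
  also have "(\<Sum>i=1..N. inverse ?D * (inverse (g i - ?z) * (flux Y P i \<bullet> dquot_grad j Y P)))
      = (inverse ?D *\<^sub>R (\<Sum>i=1..N. inverse (g i - ?z) *\<^sub>R flux Y P i)) \<bullet> dquot_grad j Y P"
    by (simp add: inner_sum_left sum_distrib_left)
  also have "\<dots> = inverse (shift Y + ?z) * (root_grad j Y P \<bullet> dquot_grad j Y P)" unfolding G2 by simp
  also have "(\<Sum>i=1..N. inverse ?D * ((inverse (g i - ?z))\<^sup>2 * (flux Y P i \<bullet> root_grad j Y P)))
      = inverse ?D * (root_grad j Y P \<bullet> (\<Sum>i=1..N. (inverse (g i - ?z))\<^sup>2 *\<^sub>R flux Y P i))"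
    by (simp add: inner_sum_right sum_distrib_left inner_commute)
  finally show "(\<Sum>i=1..N. flux Y P i \<bullet> weight_grad j Y P i) = root_grad j Y P \<bullet> root_drift j Y P"
    unfolding root_drift_def by (simp add: inner_diff_right right_diff_distrib)
qed

text \<open>The Lipschitz estimate is used with the base point in the distinguished role: the
  constant depends on how far its root is from the poles, which is enough for continuity at that
  point.\<close>

lemma continuous_on_root:
  fixes Y :: "'z::metric_space \<Rightarrow> nat \<Rightarrow> real"
  assumes Yc: "\<And>r. r \<in> {1..N} \<Longrightarrow> continuous_on Q (\<lambda>z. Y z r)" and Y: "\<And>z. z \<in> Q \<Longrightarrow> Y z \<in> open_simplex N"
    and j: "j \<in> {1..N-1}"
  shows "continuous_on Q (\<lambda>z. root_coord g N (Y z) j)"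
  unfolding continuous_on_def
proof
  fix z assume z: "z \<in> Q"
  let ?\<zeta> = "root_coord g N (Y z) j"
  define \<delta> where "\<delta> = Min ((\<lambda>i. \<bar>g i - ?\<zeta>\<bar>) ` {1..N})"
  have \<delta>: "0 < \<delta>" "\<And>i. i \<in> {1..N} \<Longrightarrow> \<delta> \<le> \<bar>g i - ?\<zeta>\<bar>"
    unfolding \<delta>_def using N2 root_nonzero(1)[OF Y[OF z] j] by auto
  have "((\<lambda>v. width\<^sup>2 / \<delta> * (\<Sum>i=1..N. \<bar>Y z i - Y v i\<bar>)) \<longlongrightarrow> width\<^sup>2 / \<delta> * (\<Sum>i=1..N. \<bar>Y z i - Y z i\<bar>)) (at z within Q)"
    by (intro tendsto_intros) (use Yc z in \<open>auto simp: continuous_on_def\<close>)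
  then have lim: "((\<lambda>v. width\<^sup>2 / \<delta> * (\<Sum>i=1..N. \<bar>Y z i - Y v i\<bar>)) \<longlongrightarrow> 0) (at z within Q)" by simp
  have "((\<lambda>v. root_coord g N (Y v) j - ?\<zeta>) \<longlongrightarrow> 0) (at z within Q)"
  proof (rule Lim_null_comparison[OF _ lim], unfold eventually_at_filter, rule always_eventually, intro allI impI)
    fix v assume "v \<in> Q"
    then show "norm (root_coord g N (Y v) j - ?\<zeta>) \<le> width\<^sup>2 / \<delta> * (\<Sum>i=1..N. \<bar>Y z i - Y v i\<bar>)"
      using root_lipschitz[OF Y Y[OF z] j \<delta>, of v] by (simp add: abs_minus_commute)
  qed
  then show "((\<lambda>v. root_coord g N (Y v) j) \<longlongrightarrow> ?\<zeta>) (at z within Q)" by (rule LIM_zero_cancel)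
qed

lemma continuous_on_root_functions:
  fixes P :: "'z::metric_space \<Rightarrow> nat \<Rightarrow> 'v::real_normed_vector"
  assumes Yc: "\<And>r. r \<in> {1..N} \<Longrightarrow> continuous_on Q (\<lambda>z. Y z r)" and Pc: "\<And>r. r \<in> {1..N} \<Longrightarrow> continuous_on Q (\<lambda>z. P z r)"
    and Y: "\<And>z. z \<in> Q \<Longrightarrow> Y z \<in> open_simplex N" and j: "j \<in> {1..N-1}"
  shows "i \<in> {1..N} \<Longrightarrow> continuous_on Q (\<lambda>z. root_weight j (Y z) i)" "continuous_on Q (\<lambda>z. root_grad j (Y z) (P z))"
    "i \<in> {1..N} \<Longrightarrow> continuous_on Q (\<lambda>z. weight_grad j (Y z) (P z) i)" "continuous_on Q (\<lambda>z. root_drift j (Y z) (P z))"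
proof -
  note z = continuous_on_root[OF Yc Y j]
  note nz = root_nonzero[OF Y j]
  have inv: "continuous_on Q (\<lambda>z. inverse (g i - root_coord g N (Y z) j))" if "i \<in> {1..N}" for i
    by (intro continuous_intros z) (use nz(1) that in auto)
  have "continuous_on Q (\<lambda>z. dquot (Y z) (root_coord g N (Y z) j) (root_coord g N (Y z) j))"
    unfolding dquot_def by (intro continuous_intros z Yc) (use nz(1) in auto)
  then have invD: "continuous_on Q (\<lambda>z. inverse (dquot (Y z) (root_coord g N (Y z) j) (root_coord g N (Y z) j)))"
    by (rule continuous_on_inverse) (use nz(2) in force)
  show w: "continuous_on Q (\<lambda>z. root_weight j (Y z) i)" if "i \<in> {1..N}" for i
    unfolding root_weight_def by (intro continuous_intros inv[OF that] invD)
  show rg: "continuous_on Q (\<lambda>z. root_grad j (Y z) (P z))"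
    unfolding root_grad_def by (intro continuous_intros w Pc)
  have dg: "continuous_on Q (\<lambda>z. dquot_grad j (Y z) (P z))"
    unfolding dquot_grad_def by (intro continuous_intros inv rg Pc Yc)
  show "continuous_on Q (\<lambda>z. weight_grad j (Y z) (P z) i)" if "i \<in> {1..N}" for i
    unfolding weight_grad_def by (intro continuous_intros inv[OF that] invD rg dg)
  have "continuous_on Q (\<lambda>z. shift (Y z) + root_coord g N (Y z) j)"
    unfolding shift_def by (intro continuous_intros Yc z)
  then have sh: "continuous_on Q (\<lambda>z. inverse (shift (Y z) + root_coord g N (Y z) j))"
    by (rule continuous_on_inverse) (use nz(3) in force)
  show "continuous_on Q (\<lambda>z. root_drift j (Y z) (P z))"
    unfolding root_drift_def
    by (intro continuous_intros inv invD dg sh continuous_on_flux[OF Yc Pc Y])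
qed

text \<open>The exact difference formula is a Caratheodory representation, and its coefficients are
  continuous because the root is. Stated relative to a set, it covers time derivatives on a closed
  interval as well as spatial ones.\<close>

lemma root_has_derivative:
  fixes Y :: "'z::real_normed_vector \<Rightarrow> nat \<Rightarrow> real"
  assumes Y: "\<And>x. x \<in> S \<Longrightarrow> Y x \<in> open_simplex N" and j: "j \<in> {1..N-1}" and x: "x \<in> S"
    and d: "\<And>r. r \<in> {1..N} \<Longrightarrow> ((\<lambda>x. Y x r) has_derivative Y' r) (at x within S)"
  shows "((\<lambda>x. root_coord g N (Y x) j) has_derivative (\<lambda>h. \<Sum>i=1..N. - root_weight j (Y x) i * Y' i h)) (at x within S)"
proof -
  let ?z = "\<lambda>x. root_coord g N (Y x) j"
  define c where "c i y = - 1 / ((g i - ?z y) * dquot (Y x) (?z y) (?z x))" for i y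
  have Ylim: "((\<lambda>y. Y y r) \<longlongrightarrow> Y x r) (at x within S)" if "r \<in> {1..N}" for r
    using has_derivative_continuous[OF d[OF that]] by (simp add: continuous_within)
  define \<delta> where "\<delta> = Min ((\<lambda>i. \<bar>g i - ?z x\<bar>) ` {1..N})"
  have \<delta>: "0 < \<delta>" "\<And>i. i \<in> {1..N} \<Longrightarrow> \<delta> \<le> \<bar>g i - ?z x\<bar>"
    unfolding \<delta>_def using N2 root_nonzero(1)[OF Y[OF x] j] by auto
  have "((\<lambda>v. width\<^sup>2 / \<delta> * (\<Sum>i=1..N. \<bar>Y x i - Y v i\<bar>)) \<longlongrightarrow> width\<^sup>2 / \<delta> * (\<Sum>i=1..N. \<bar>Y x i - Y x i\<bar>)) (at x within S)"
    by (intro tendsto_intros Ylim)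
  then have lim: "((\<lambda>v. width\<^sup>2 / \<delta> * (\<Sum>i=1..N. \<bar>Y x i - Y v i\<bar>)) \<longlongrightarrow> 0) (at x within S)" by simp
  have "((\<lambda>v. ?z v - ?z x) \<longlongrightarrow> 0) (at x within S)"
  proof (rule Lim_null_comparison[OF _ lim], unfold eventually_at_filter, rule always_eventually, intro allI impI)
    fix v assume "v \<in> S"
    then show "norm (?z v - ?z x) \<le> width\<^sup>2 / \<delta> * (\<Sum>i=1..N. \<bar>Y x i - Y v i\<bar>)"
      using root_lipschitz[OF Y Y[OF x] j \<delta>, of v] by (simp add: abs_minus_commute)
  qed
  then have zlim: "(?z \<longlongrightarrow> ?z x) (at x within S)" by (rule LIM_zero_cancel)
  note nz = root_nonzero[OF Y[OF x] j]
  have clim: "(c i \<longlongrightarrow> c i x) (at x within S)" if i: "i \<in> {1..N}" for i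
  proof -
    have "((\<lambda>y. dquot (Y x) (?z y) (?z x)) \<longlongrightarrow> dquot (Y x) (?z x) (?z x)) (at x within S)"
      unfolding dquot_def by (intro tendsto_intros zlim) (use nz(1) in auto)
    then show ?thesis unfolding c_def
      by (intro tendsto_intros zlim) (use nz(1)[OF i] nz(2) in auto)
  qed
  have "(?z has_derivative (\<lambda>h. \<Sum>i=1..N. c i x * Y' i h)) (at x within S)"
  proof (rule has_derivative_caratheodory[where u="\<lambda>i x. Y x i"])
    show "?z y - ?z x = (\<Sum>i=1..N. c i y * (Y y i - Y x i))" if "y \<in> S" for y
      using root_diff[OF Y[OF x] Y[OF that] j] unfolding c_def .
  qed (use clim d x in auto)
  moreover have "c i x = - root_weight j (Y x) i" for i
    unfolding c_def root_weight_def by (simp add: divide_inverse)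
  ultimately show ?thesis by simp
qed

lemma space_derivatives_at_root:
  fixes y :: "'a::euclidean_space \<Rightarrow> nat \<Rightarrow> real"
  assumes o: "open \<Omega>" and Y: "\<And>x. x \<in> \<Omega> \<Longrightarrow> y x \<in> open_simplex N" and j: "j \<in> {1..N-1}" and x: "x \<in> \<Omega>"
    and d: "\<And>r. r \<in> {1..N} \<Longrightarrow> ((\<lambda>x. y x r) has_derivative (\<lambda>h. P r \<bullet> h)) (at x)"
  shows "((\<lambda>x. root_coord g N (y x) j) has_derivative (\<lambda>h. root_grad j (y x) P \<bullet> h)) (at x)"
    "i \<in> {1..N} \<Longrightarrow> ((\<lambda>x. root_weight j (y x) i) has_derivative (\<lambda>h. weight_grad j (y x) P i \<bullet> h)) (at x)"
proof -
  let ?z = "\<lambda>x. root_coord g N (y x) j"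
  note nz = root_nonzero[OF Y[OF x] j]
  have "((\<lambda>x. root_coord g N (y x) j) has_derivative (\<lambda>h. \<Sum>i=1..N. - root_weight j (y x) i * (P i \<bullet> h))) (at x within \<Omega>)"
    by (rule root_has_derivative[OF Y j x has_derivative_at_withinI[OF d]])
  moreover have "(\<Sum>i=1..N. - root_weight j (y x) i * (P i \<bullet> h)) = root_grad j (y x) P \<bullet> h" for h
    by (simp add: root_grad_def inner_sum_left sum_negf)
  ultimately show dz: "(?z has_derivative (\<lambda>h. root_grad j (y x) P \<bullet> h)) (at x)"
    using at_within_open[OF x o] by simp
  have dinv: "((\<lambda>x. inverse (g i - ?z x)) has_derivative (\<lambda>h. (inverse (g i - ?z x))\<^sup>2 * (root_grad j (y x) P \<bullet> h))) (at x)"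
    if i: "i \<in> {1..N}" for i
  proof -
    have "((\<lambda>x. g i - ?z x) has_derivative (\<lambda>h. - (root_grad j (y x) P \<bullet> h))) (at x)"
      using has_derivative_diff[OF has_derivative_const dz, of "g i"] by simp
    from Deriv.has_derivative_inverse[OF nz(1)[OF i] this] show ?thesis by (simp add: power2_eq_square mult_ac)
  qed
  let ?D = "\<lambda>x. dquot (y x) (?z x) (?z x)"
  have "((\<lambda>x. \<Sum>i=1..N. y x i * (inverse (g i - ?z x) * inverse (g i - ?z x))) has_derivative
      (\<lambda>h. \<Sum>i=1..N. y x i * (inverse (g i - ?z x) * ((inverse (g i - ?z x))\<^sup>2 * (root_grad j (y x) P \<bullet> h))
          + (inverse (g i - ?z x))\<^sup>2 * (root_grad j (y x) P \<bullet> h) * inverse (g i - ?z x))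
        + (P i \<bullet> h) * (inverse (g i - ?z x) * inverse (g i - ?z x)))) (at x)"
    by (intro has_derivative_sum has_derivative_mult d dinv)
  moreover have "(\<Sum>i=1..N. y x i * (inverse (g i - ?z x) * inverse (g i - ?z x))) = ?D x" for x
    unfolding dquot_def by (simp add: divide_inverse)
  moreover have "(\<Sum>i=1..N. y x i * (inverse (g i - ?z x) * ((inverse (g i - ?z x))\<^sup>2 * (root_grad j (y x) P \<bullet> h))
          + (inverse (g i - ?z x))\<^sup>2 * (root_grad j (y x) P \<bullet> h) * inverse (g i - ?z x))
        + (P i \<bullet> h) * (inverse (g i - ?z x) * inverse (g i - ?z x))) = dquot_grad j (y x) P \<bullet> h" for h
    unfolding dquot_grad_def inner_sum_left
    by (intro sum.cong refl) (simp add: inner_add_left power2_eq_square power3_eq_cube distrib_left mult_ac)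
  ultimately have dD: "(?D has_derivative (\<lambda>h. dquot_grad j (y x) P \<bullet> h)) (at x)" by simp
  have dDi: "((\<lambda>x. inverse (?D x)) has_derivative (\<lambda>h. - (inverse (?D x) * (dquot_grad j (y x) P \<bullet> h) * inverse (?D x)))) (at x)"
    by (rule Deriv.has_derivative_inverse[OF _ dD]) (use nz(2) in simp)
  show "((\<lambda>x. root_weight j (y x) i) has_derivative (\<lambda>h. weight_grad j (y x) P i \<bullet> h)) (at x)" if i: "i \<in> {1..N}"
  proof -
    have "weight_grad j (y x) P i \<bullet> h = inverse (g i - ?z x) * - (inverse (?D x) * (dquot_grad j (y x) P \<bullet> h) * inverse (?D x))
        + (inverse (g i - ?z x))\<^sup>2 * (root_grad j (y x) P \<bullet> h) * inverse (?D x)" for h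
      unfolding weight_grad_def by (simp add: inner_diff_left power2_eq_square mult_ac)
    then show ?thesis using has_derivative_mult[OF dinv[OF i] dDi] unfolding root_weight_def by simp
  qed
qed

section \<open>Comparison of the roots with their initial range\<close>

lemma strip_solutionD:
  assumes "strip_solution \<tau> T \<Omega> y yt Dy"
  shows "t \<in> {\<tau>..T} \<Longrightarrow> x \<in> closure \<Omega> \<Longrightarrow> y t x \<in> open_simplex N"
    "t \<in> {\<tau>..T} \<Longrightarrow> x \<in> closure \<Omega> \<Longrightarrow> (\<Sum>i=1..N. Dy t x i) = 0"
    "i \<in> {1..N} \<Longrightarrow> continuous_on ({\<tau>..T} \<times> closure \<Omega>) (\<lambda>z. y (fst z) (snd z) i)"
    "i \<in> {1..N} \<Longrightarrow> continuous_on ({\<tau>..T} \<times> closure \<Omega>) (\<lambda>z. yt (fst z) (snd z) i)"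
    "i \<in> {1..N} \<Longrightarrow> continuous_on ({\<tau>..T} \<times> closure \<Omega>) (\<lambda>z. Dy (fst z) (snd z) i)"
    "i \<in> {1..N} \<Longrightarrow> t \<in> {\<tau>..T} \<Longrightarrow> x \<in> \<Omega> \<Longrightarrow> ((\<lambda>s. y s x i) has_real_derivative yt t x i) (at t within {\<tau>..T})"
    "i \<in> {1..N} \<Longrightarrow> t \<in> {\<tau>..T} \<Longrightarrow> x \<in> \<Omega> \<Longrightarrow> ((\<lambda>x. y t x i) has_derivative (\<lambda>h. Dy t x i \<bullet> h)) (at x)"
    "i \<in> {1..N} \<Longrightarrow> t \<in> {\<tau>..T} \<Longrightarrow> C1_closure \<Omega> \<psi> D\<psi> \<Longrightarrow>
       (LINT x|lebesgue_on \<Omega>. flux (y t x) (Dy t x) i \<bullet> D\<psi> x) = (LINT x|lebesgue_on \<Omega>. yt t x i * \<psi> x)"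
  using assms unfolding strip_solution_def case_prod_unfold by blast+

text \<open>
  The energy \<open>\<integral> (\<plusminus>(z\<^sub>j - M))\<^sub>+\<^sup>3\<close> satisfies a linear differential inequality: since the drift
  multiplies \<open>\<nabla>z\<^sub>j\<close>, it is absorbed by the dissipation.
\<close>

lemma root_comparison_strip:
  fixes \<Omega> :: "'a::euclidean_space set"
  assumes o: "open \<Omega>" and b: "bounded \<Omega>" and strip: "strip_solution \<tau> T \<Omega> y yt Dy" and \<tau>: "\<tau> < T"
    and j: "j \<in> {1..N-1}" and s: "s * s = (1::real)"
    and init: "\<And>x. x \<in> closure \<Omega> \<Longrightarrow> s * (root_coord g N (y \<tau> x) j - M) \<le> 0" and x0: "x0 \<in> closure \<Omega>"
  shows "s * (root_coord g N (y T x0) j - M) \<le> 0"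
proof -
  note sol = strip_solutionD[OF strip]
  let ?I = "{\<tau>..T}"
  let ?Q = "?I \<times> closure \<Omega>"
  have S: "\<Omega> \<in> sets lebesgue" using o by simp
  have lm: "\<Omega> \<in> lmeasurable" using o b by (simp add: lmeasurable_open)
  have K: "compact (closure \<Omega>)" using b by (simp add: compact_closure)
  have KQ: "compact ?Q" by (rule compact_Times[OF compact_Icc K])
  define Y where "Y z = y (fst z) (snd z)" for z
  define P where "P z = Dy (fst z) (snd z)" for z
  have YQ: "Y z \<in> open_simplex N" if "z \<in> ?Q" for z unfolding Y_def using that sol(1) by auto
  have Yc: "continuous_on ?Q (\<lambda>z. Y z r)" and Pc: "continuous_on ?Q (\<lambda>z. P z r)" if "r \<in> {1..N}" for r
    unfolding Y_def P_def using sol(3,5) that by auto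
  have zc: "continuous_on ?Q (\<lambda>z. root_coord g N (Y z) j)"
    by (rule continuous_on_root[OF _ _ j]) (fact Yc, fact YQ)
  have rc1: "continuous_on ?Q (\<lambda>z. root_weight j (Y z) i)" and rc3: "continuous_on ?Q (\<lambda>z. weight_grad j (Y z) (P z) i)"
    if i: "i \<in> {1..N}" for i
    by (rule continuous_on_root_functions(1)[OF _ _ _ j i], fact Yc, fact Pc, fact YQ)
       (rule continuous_on_root_functions(3)[OF _ _ _ j i], fact Yc, fact Pc, fact YQ)
  have rc2: "continuous_on ?Q (\<lambda>z. root_grad j (Y z) (P z))"
    by (rule continuous_on_root_functions(2)[OF _ _ _ j]) (fact Yc, fact Pc, fact YQ)
  have rc4: "continuous_on ?Q (\<lambda>z. root_drift j (Y z) (P z))"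
    by (rule continuous_on_root_functions(4)[OF _ _ _ j]) (fact Yc, fact Pc, fact YQ)
  note rc = rc1 rc2 rc3 rc4
  \<comment> \<open>The sign s is 1 for the upper bound and -1 for the lower one, so that one
    computation covers both.\<close>
  define q where "q z = max 0 (s * (root_coord g N (Y z) j - M))" for z
  have qc: "continuous_on ?Q q" unfolding q_def[abs_def] by (intro continuous_intros zc)
  have q0: "0 \<le> q z" for z by (simp add: q_def)
  define zt where "zt z = (\<Sum>i=1..N. - root_weight j (Y z) i * yt (fst z) (snd z) i)" for z
  have ztc: "continuous_on ?Q zt" unfolding zt_def[abs_def] by (intro continuous_intros rc(1) sol(4))
  have sec: "continuous_on (closure \<Omega>) (\<lambda>x. f (t, x))" if "continuous_on ?Q f" "t \<in> ?I" for f :: "real \<times> 'a \<Rightarrow> 'b::topological_space" and t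
    by (rule continuous_on_section[of ?I "closure \<Omega>" "\<lambda>t x. f (t, x)"]) (use that in simp_all)
  have int: "integrable (lebesgue_on \<Omega>) (\<lambda>x. f (t, x))" if "continuous_on ?Q f" "t \<in> ?I" for f :: "real \<times> 'a \<Rightarrow> real" and t
    by (rule integrable_continuous_compact[OF K sec[OF that] S closure_subset])
  \<comment> \<open>The cube makes the associated test function, which contains the square of q,
    continuously differentiable.\<close>
  define E where "E t = (LINT x|lebesgue_on \<Omega>. (q (t, x)) ^ 3)" for t
  define F where "F z = 3 * (q z)\<^sup>2 * (s * zt z)" for z
  have Fc: "continuous_on ?Q F" unfolding F_def[abs_def] by (intro continuous_intros qc ztc)
  obtain BF where BF: "\<forall>z\<in>?Q. norm (F z) \<le> BF" using compact_continuous_bounded[OF KQ Fc] by blast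
  have Ed: "(E has_real_derivative (LINT x|lebesgue_on \<Omega>. F (t, x))) (at t within ?I)" if t: "t \<in> ?I" for t
    unfolding E_def[abs_def]
  proof (rule has_real_derivative_LINT[OF lm _ _ _ _ t, where B=BF])
    show "integrable (lebesgue_on \<Omega>) (\<lambda>x. q (t, x) ^ 3)" if "t \<in> ?I" for t
      by (rule int[OF _ that]) (intro continuous_intros qc)
    show "integrable (lebesgue_on \<Omega>) (\<lambda>x. F (t, x))" if "t \<in> ?I" for t by (rule int[OF Fc that])
    show "\<bar>F (t, x)\<bar> \<le> BF" if "t \<in> ?I" "x \<in> \<Omega>" for t x
    proof -
      have "(t, x) \<in> ?Q" using that closure_subset[of \<Omega>] by auto
      then show ?thesis using BF by fastforce
    qed
    fix t x assume t: "t \<in> ?I" and x: "x \<in> \<Omega>"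
    have xc: "x \<in> closure \<Omega>" using x closure_subset by blast
    have "((\<lambda>r. root_coord g N (y r x) j) has_derivative (\<lambda>h. \<Sum>i=1..N. - root_weight j (y t x) i * (yt t x i * h))) (at t within ?I)"
      by (rule root_has_derivative[where Y="\<lambda>r. y r x"])
         (use sol(1,6) xc x t j in \<open>auto simp: has_field_derivative_def\<close>)
    moreover have "(\<Sum>i=1..N. - root_weight j (y t x) i * (yt t x i * h)) = zt (t, x) * h" for h
      by (simp add: zt_def Y_def sum_distrib_right mult.assoc)
    ultimately have "((\<lambda>r. root_coord g N (y r x) j) has_real_derivative zt (t, x)) (at t within ?I)"
      by (simp add: has_field_derivative_def)
    then have "((\<lambda>r. s * (root_coord g N (y r x) j - M)) has_real_derivative s * zt (t, x)) (at t within ?I)"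
      by (auto intro!: derivative_eq_intros)
    from DERIV_chain2[OF pos_part_power_deriv[of 1] this]
    show "((\<lambda>t. q (t, x) ^ 3) has_real_derivative F (t, x)) (at t within ?I)"
      by (simp add: q_def Y_def F_def power2_eq_square power3_eq_cube mult_ac)
  qed
  define gr where "gr z = root_grad j (Y z) (P z)" for z
  define dr where "dr z = root_drift j (Y z) (P z)" for z
  have grc: "continuous_on ?Q gr" unfolding gr_def[abs_def] by (rule rc(2))
  have drc: "continuous_on ?Q dr" unfolding dr_def[abs_def] by (rule rc(4))
  obtain B where B: "\<forall>z\<in>?Q. norm (dr z) \<le> B" using compact_continuous_bounded[OF KQ drc] by blast
  \<comment> \<open>The maximum over X of 3 Q^2 X B - 3 Q X^2 / g_N, attained at X = g_N B Q / 2, is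
    C Q^3. The bound B of the drift, and with it C, depends on the strip; as E vanishes at the
    initial end, its size does not matter.\<close>
  define C where "C = 3 / 4 * g N * B\<^sup>2"
  have gN: "0 < g N" using g_pos[of N] N2 by simp
  have El: "(LINT x|lebesgue_on \<Omega>. F (t, x)) \<le> C * E t" if t: "t \<in> ?I" for t
  proof -
    \<comment> \<open>The test function for species i is minus the partial derivative of the energy
      density with respect to y_i, the weights being minus the derivatives of the root.\<close>
    define \<psi> where "\<psi> i x = 3 * (q (t, x))\<^sup>2 * s * root_weight j (Y (t, x)) i" for i x
    define D\<psi> where "D\<psi> i x = (3 * (q (t, x))\<^sup>2 * s) *\<^sub>R weight_grad j (Y (t, x)) (P (t, x)) i
        + (6 * q (t, x) * root_weight j (Y (t, x)) i) *\<^sub>R gr (t, x)" for i x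
    have cl: "C1_closure \<Omega> (\<psi> i) (D\<psi> i)" if i: "i \<in> {1..N}" for i
      unfolding C1_closure_def
    proof (intro conjI ballI)
      have "continuous_on ?Q (\<lambda>z. 3 * (q z)\<^sup>2 * s * root_weight j (Y z) i)" by (intro continuous_intros qc rc(1)[OF i])
      from sec[OF this t] show "continuous_on (closure \<Omega>) (\<psi> i)" unfolding \<psi>_def[abs_def] .
      have "continuous_on ?Q (\<lambda>z. (3 * (q z)\<^sup>2 * s) *\<^sub>R weight_grad j (Y z) (P z) i + (6 * q z * root_weight j (Y z) i) *\<^sub>R gr z)"
        by (intro continuous_intros qc rc(1)[OF i] rc(3)[OF i] grc)
      from sec[OF this t] show "continuous_on (closure \<Omega>) (D\<psi> i)" unfolding D\<psi>_def[abs_def] .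
      fix x assume x: "x \<in> \<Omega>"
      have Yx: "y t x \<in> open_simplex N" if "x \<in> \<Omega>" for x using sol(1)[OF t] that closure_subset[of \<Omega>] by blast
      note sd = space_derivatives_at_root[OF o Yx j x sol(7)[OF _ t x]]
      have "((\<lambda>x. s * (root_coord g N (y t x) j - M)) has_derivative (\<lambda>h. s * (root_grad j (y t x) (Dy t x) \<bullet> h))) (at x)"
        using sd(1) by (auto intro!: derivative_eq_intros)
      from has_derivative_compose[OF this pos_part_power_deriv[of 0, unfolded has_field_derivative_def]]
      have "((\<lambda>x. (q (t, x))\<^sup>2) has_derivative (\<lambda>h. 2 * q (t, x) * (s * (gr (t, x) \<bullet> h)))) (at x)"
        by (simp add: q_def Y_def P_def gr_def power2_eq_square)
      then have "((\<lambda>x. 3 * (q (t, x))\<^sup>2 * s) has_derivative (\<lambda>h. 3 * (2 * q (t, x) * (s * (gr (t, x) \<bullet> h))) * s)) (at x)"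
        by (intro has_derivative_mult_left has_derivative_mult_right)
      moreover have "3 * (2 * q (t, x) * (s * (gr (t, x) \<bullet> h))) * s = 6 * q (t, x) * (gr (t, x) \<bullet> h)" for h
      proof -
        have "3 * (2 * q (t, x) * (s * (gr (t, x) \<bullet> h))) * s = (s * s) * (6 * q (t, x) * (gr (t, x) \<bullet> h))" by (simp add: mult_ac)
        then show ?thesis using s by simp
      qed
      ultimately have "((\<lambda>x. 3 * (q (t, x))\<^sup>2 * s) has_derivative (\<lambda>h. 6 * q (t, x) * (gr (t, x) \<bullet> h))) (at x)" by (simp only:)
      from has_derivative_mult[OF this sd(2)[OF _ _ i]]
      show "(\<psi> i has_derivative (\<lambda>h. D\<psi> i x \<bullet> h)) (at x)"
        unfolding \<psi>_def[abs_def] D\<psi>_def by (simp add: Y_def P_def gr_def inner_add_left mult_ac)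
    qed
    let ?J = "\<lambda>i x. flux (y t x) (Dy t x) i"
    have Jc: "continuous_on (closure \<Omega>) (\<lambda>x. ?J i x)" if "i \<in> {1..N}" for i
      using sec[OF continuous_on_flux[OF Yc Pc YQ that] t] by (simp add: Y_def P_def)
    have i1: "integrable (lebesgue_on \<Omega>) (\<lambda>x. ?J i x \<bullet> D\<psi> i x)" if i: "i \<in> {1..N}" for i
      by (rule integrable_continuous_compact[OF K _ S closure_subset])
         (use cl[OF i] Jc[OF i] in \<open>auto simp: C1_closure_def intro!: continuous_intros\<close>)
    have ytc: "continuous_on (closure \<Omega>) (\<lambda>x. yt t x i)" if "i \<in> {1..N}" for i
      using sec[OF sol(4)[OF that] t] by simp
    have i2: "integrable (lebesgue_on \<Omega>) (\<lambda>x. yt t x i * \<psi> i x)" if i: "i \<in> {1..N}" for i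
      by (rule integrable_continuous_compact[OF K _ S closure_subset])
         (use cl[OF i] ytc[OF i] in \<open>auto simp: C1_closure_def intro!: continuous_intros\<close>)
    have "F (t, x) = - (\<Sum>i=1..N. yt t x i * \<psi> i x)" for x
      unfolding F_def zt_def \<psi>_def sum_negf[symmetric] sum_distrib_left by (intro sum.cong refl) (simp add: mult_ac)
    then have "(LINT x|lebesgue_on \<Omega>. F (t, x)) = - (\<Sum>i=1..N. LINT x|lebesgue_on \<Omega>. yt t x i * \<psi> i x)"
      using i2 by (simp add: Bochner_Integration.integral_sum)
    also have "\<dots> = - (\<Sum>i=1..N. LINT x|lebesgue_on \<Omega>. ?J i x \<bullet> D\<psi> i x)"
      using sol(8)[OF _ t cl] by simp
    also have "\<dots> = (LINT x|lebesgue_on \<Omega>. - (\<Sum>i=1..N. ?J i x \<bullet> D\<psi> i x))"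
      using i1 by (simp add: Bochner_Integration.integral_sum)
    also have "\<dots> \<le> (LINT x|lebesgue_on \<Omega>. C * (q (t, x)) ^ 3)"
    proof (rule integral_mono)
      show "integrable (lebesgue_on \<Omega>) (\<lambda>x. - (\<Sum>i=1..N. ?J i x \<bullet> D\<psi> i x))" using i1 by auto
      show "integrable (lebesgue_on \<Omega>) (\<lambda>x. C * (q (t, x)) ^ 3)"
        by (rule int[OF _ t]) (intro continuous_intros qc)
      fix x assume "x \<in> space (lebesgue_on \<Omega>)"
      then have xc: "x \<in> closure \<Omega>" using closure_subset[of \<Omega>] by auto
      then have zQ: "(t, x) \<in> ?Q" using t by simp
      note wf = weighted_flux[OF sol(1)[OF t xc] j sol(2)[OF t xc]] and nz = root_nonzero[OF sol(1)[OF t xc] j]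
      let ?Q0 = "q (t, x)" and ?a = "inverse (shift (y t x) + root_coord g N (y t x) j)"
      have "(\<Sum>i=1..N. ?J i x \<bullet> D\<psi> i x) = 3 * ?Q0\<^sup>2 * s * (\<Sum>i=1..N. ?J i x \<bullet> weight_grad j (y t x) (Dy t x) i)
          + 6 * ?Q0 * ((\<Sum>i=1..N. root_weight j (y t x) i *\<^sub>R ?J i x) \<bullet> gr (t, x))"
        unfolding D\<psi>_def by (simp add: inner_add_right sum.distrib sum_distrib_left inner_sum_left Y_def P_def mult_ac)
      \<comment> \<open>Everything is now expressed through the gradient of the root: a dissipation
        quadratic in it with one factor q, and a drift linear in it with two factors q.\<close>
      also have "\<dots> = 3 * ?Q0\<^sup>2 * s * (gr (t, x) \<bullet> dr (t, x)) + 6 * ?Q0 * (?a * (norm (gr (t, x)))\<^sup>2)"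
        unfolding wf by (simp add: gr_def dr_def Y_def P_def power2_norm_eq_inner)
      finally have eq: "(\<Sum>i=1..N. ?J i x \<bullet> D\<psi> i x) = 3 * ?Q0\<^sup>2 * s * (gr (t, x) \<bullet> dr (t, x)) + 6 * ?Q0 * (?a * (norm (gr (t, x)))\<^sup>2)" .
      let ?X = "norm (gr (t, x))"
      have "\<bar>s\<bar> = 1" using s by (metis abs_mult_self_eq abs_one abs_eq_iff square_eq_1_iff)
      then have "\<bar>s * (gr (t, x) \<bullet> dr (t, x))\<bar> \<le> ?X * norm (dr (t, x))"
        using Cauchy_Schwarz_ineq2[of "gr (t, x)" "dr (t, x)"] by (simp add: abs_mult)
      also have "\<dots> \<le> ?X * B" using B zQ by (intro mult_left_mono) auto
      finally have d: "- (s * (gr (t, x) \<bullet> dr (t, x))) \<le> ?X * B" by linarith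
      have a: "1 / (2 * g N) \<le> ?a" using nz(3,4) by (simp add: inverse_eq_divide frac_le)
      have "3 * ?Q0\<^sup>2 * - (s * (gr (t, x) \<bullet> dr (t, x))) \<le> 3 * ?Q0\<^sup>2 * (?X * B)" using d by (intro mult_left_mono) auto
      moreover have "6 * ?Q0 * (1 / (2 * g N) * ?X\<^sup>2) \<le> 6 * ?Q0 * (?a * ?X\<^sup>2)"
        using a q0[of "(t, x)"] by (intro mult_left_mono mult_right_mono) auto
      moreover have "3 * ?Q0\<^sup>2 * (?X * B) - 6 * ?Q0 * (1 / (2 * g N) * ?X\<^sup>2) \<le> C * ?Q0 ^ 3"
      proof -
        have "C * ?Q0 ^ 3 - (3 * ?Q0\<^sup>2 * (?X * B) - 6 * ?Q0 * (1 / (2 * g N) * ?X\<^sup>2)) = 3 * ?Q0 / g N * (?X - g N * B * ?Q0 / 2)\<^sup>2"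
          using gN unfolding C_def by (simp add: field_simps power2_eq_square power3_eq_cube)
        moreover have "0 \<le> 3 * ?Q0 / g N * (?X - g N * B * ?Q0 / 2)\<^sup>2" using gN q0 by simp
        ultimately show ?thesis by linarith
      qed
      moreover have "- (3 * ?Q0\<^sup>2 * s * (gr (t, x) \<bullet> dr (t, x)) + 6 * ?Q0 * (?a * ?X\<^sup>2)) = 3 * ?Q0\<^sup>2 * - (s * (gr (t, x) \<bullet> dr (t, x))) - 6 * ?Q0 * (?a * ?X\<^sup>2)"
        by (simp add: algebra_simps)
      ultimately show "- (\<Sum>i=1..N. ?J i x \<bullet> D\<psi> i x) \<le> C * ?Q0 ^ 3" unfolding eq by linarith
    qed
    also have "\<dots> = C * E t" by (simp add: E_def)
    finally show ?thesis .
  qed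
  have "E T \<le> exp (C * (T - \<tau>)) * E \<tau>" by (rule gronwall_decay[OF less_imp_le[OF \<tau>] Ed El])
  moreover have "E \<tau> = 0"
  proof -
    have "q (\<tau>, x) = 0" if "x \<in> closure \<Omega>" for x using init[OF that] by (simp add: q_def Y_def)
    then have "E \<tau> = (LINT x|lebesgue_on \<Omega>. 0)"
      unfolding E_def using closure_subset[of \<Omega>] by (intro Bochner_Integration.integral_cong) auto
    then show ?thesis by simp
  qed
  ultimately have "E T \<le> 0" by simp
  have T: "T \<in> ?I" using \<tau> by simp
  have q3: "continuous_on ?Q (\<lambda>z. (q z) ^ 3)" by (intro continuous_intros qc)
  have "0 \<le> E T" unfolding E_def by (intro integral_nonneg_AE AE_I2) (simp add: q0)
  then have "E T = 0" using \<open>E T \<le> 0\<close> by simp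
  then have ae: "AE x in lebesgue_on \<Omega>. q (T, x) ^ 3 = 0"
    unfolding E_def using integral_nonneg_eq_0_iff_AE[OF int[OF q3 T]] q0 by auto
  have "q (T, x0) ^ 3 = 0" by (rule AE_eq_continuous_imp_eq[OF o sec[OF q3 T] continuous_on_const ae x0])
  then have "max 0 (s * (root_coord g N (y T x0) j - M)) = 0" unfolding q_def Y_def by simp
  then show ?thesis using max.cobounded2[of "s * (root_coord g N (y T x0) j - M)" 0] by linarith
qed

text \<open>The initial roots keep a positive distance from the poles, uniformly on the compact
  closure. With the initial state in the distinguished role, the Lipschitz estimate turns uniform
  convergence of y into uniform convergence of the roots.\<close>

lemma roots_near_initial:
  fixes \<Omega> :: "'a::euclidean_space set"
  assumes b: "bounded \<Omega>" and Y: "\<And>t x. 0 \<le> t \<Longrightarrow> x \<in> closure \<Omega> \<Longrightarrow> y t x \<in> open_simplex N"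
    and yc: "\<And>i. i \<in> {1..N} \<Longrightarrow> continuous_C1 \<Omega> (\<lambda>t x. y t x i)" and j: "j \<in> {1..N-1}" and \<epsilon>: "0 < \<epsilon>" and T: "0 < T"
  shows "\<exists>\<tau>. 0 < \<tau> \<and> \<tau> < T \<and> (\<forall>x\<in>closure \<Omega>. \<bar>root_coord g N (y \<tau> x) j - root_coord g N (y 0 x) j\<bar> \<le> \<epsilon>)"
proof -
  have K: "compact (closure \<Omega>)" using b by (simp add: compact_closure)
  have c0: "continuous_on (closure \<Omega>) (\<lambda>x. y 0 x i)" and ul: "uniform_limit (closure \<Omega>) (\<lambda>t x. y t x i) (\<lambda>x. y 0 x i) (at 0 within {0..})"
    if "i \<in> {1..N}" for i
    using yc[OF that] unfolding continuous_C1_def by auto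
  have zc: "continuous_on (closure \<Omega>) (\<lambda>x. root_coord g N (y 0 x) j)"
    by (rule continuous_on_root[OF c0 Y j]) auto
  have "\<exists>\<delta>>0. \<forall>x\<in>closure \<Omega>. \<delta> \<le> \<bar>g i - root_coord g N (y 0 x) j\<bar>" if i: "i \<in> {1..N}" for i
  proof (cases "closure \<Omega> = {}")
    case False
    have "continuous_on (closure \<Omega>) (\<lambda>x. \<bar>g i - root_coord g N (y 0 x) j\<bar>)" by (intro continuous_intros zc)
    from continuous_attains_inf[OF K False this] obtain x where x: "x \<in> closure \<Omega>"
      "\<forall>v\<in>closure \<Omega>. \<bar>g i - root_coord g N (y 0 x) j\<bar> \<le> \<bar>g i - root_coord g N (y 0 v) j\<bar>" by blast
    have "0 < \<bar>g i - root_coord g N (y 0 x) j\<bar>" using root_nonzero(1)[OF Y[OF _ x(1)] j i, of 0] by simp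
    then show ?thesis using x(2) by blast
  qed (auto intro: exI[of _ 1])
  then have "\<forall>i\<in>{1..N}. \<exists>\<delta>>0. \<forall>x\<in>closure \<Omega>. \<delta> \<le> \<bar>g i - root_coord g N (y 0 x) j\<bar>" by blast
  then obtain d where d: "\<forall>i\<in>{1..N}. 0 < d i \<and> (\<forall>x\<in>closure \<Omega>. d i \<le> \<bar>g i - root_coord g N (y 0 x) j\<bar>)"
    unfolding bchoice_iff by blast
  define \<delta> where "\<delta> = Min (d ` {1..N})"
  have \<delta>: "0 < \<delta>" unfolding \<delta>_def using d N2 by auto
  have \<delta>le: "\<delta> \<le> \<bar>g i - root_coord g N (y 0 x) j\<bar>" if "i \<in> {1..N}" "x \<in> closure \<Omega>" for i x
  proof -
    have "\<delta> \<le> d i" unfolding \<delta>_def using that(1) by simp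
    then show ?thesis using d that by force
  qed
  \<comment> \<open>Chosen so that the Lipschitz constant \<open>width\<^sup>2 / \<delta>\<close>
    times N such errors is exactly \<epsilon>.\<close>
  define e where "e = \<epsilon> * \<delta> / (width\<^sup>2 * N)"
  have Npos: "0 < real N" using N2 by simp
  have e: "0 < e" unfolding e_def using \<epsilon> \<delta> width_pos Npos by simp
  have "\<forall>\<^sub>F t in at 0 within {0..}. \<forall>i\<in>{1..N}. \<forall>x\<in>closure \<Omega>. dist (y t x i) (y 0 x i) < e"
    by (rule eventually_ball_finite) (use ul e in \<open>auto simp: uniform_limit_iff\<close>)
  then obtain t0 where t0: "0 < t0" "\<And>t i x. t \<in> {0..} \<Longrightarrow> t \<noteq> 0 \<Longrightarrow> dist t 0 < t0 \<Longrightarrow> i \<in> {1..N} \<Longrightarrow> x \<in> closure \<Omega> \<Longrightarrow> dist (y t x i) (y 0 x i) < e"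
    unfolding eventually_at by blast
  define \<tau> where "\<tau> = min t0 T / 2"
  have \<tau>: "0 < \<tau>" "\<tau> < T" "\<tau> < t0" using t0(1) T by (auto simp: \<tau>_def min_def)
  have "\<bar>root_coord g N (y \<tau> x) j - root_coord g N (y 0 x) j\<bar> \<le> \<epsilon>" if x: "x \<in> closure \<Omega>" for x
  proof -
    have "\<bar>root_coord g N (y 0 x) j - root_coord g N (y \<tau> x) j\<bar> \<le> width\<^sup>2 / \<delta> * (\<Sum>i=1..N. \<bar>y 0 x i - y \<tau> x i\<bar>)"
      by (rule root_lipschitz[OF _ _ j \<delta>]) (use Y x \<tau> \<delta>le in auto)
    also have "\<dots> \<le> width\<^sup>2 / \<delta> * (\<Sum>i=1..N. e)"
      using t0(2)[of \<tau> _ x] \<tau> x \<delta> by (intro mult_left_mono sum_mono) (auto simp: dist_real_def abs_minus_commute intro: less_imp_le)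
    also have "\<dots> = \<epsilon>" unfolding e_def using \<delta> width_pos Npos by simp
    finally show ?thesis by (simp add: abs_minus_commute)
  qed
  then show ?thesis using \<tau> by blast
qed

text \<open>The threshold is relaxed to M + s \<epsilon>, which the roots respect at some small
  positive time; from there the strip comparison leads to time t, and \<epsilon> tends to 0 at fixed
  t and x.\<close>

theorem root_comparison:
  fixes \<Omega> :: "'a::euclidean_space set"
  assumes dom: "C2_holder_domain \<alpha> \<Omega>" and b: "bounded \<Omega>" and sol: "global_solution p g N \<Omega> y" and p: "1 < p"
    and j: "j \<in> {1..N-1}" and s: "s * s = (1::real)"
    and init: "\<And>x. x \<in> closure \<Omega> \<Longrightarrow> s * (root_coord g N (y 0 x) j - M) \<le> 0" and x: "x \<in> closure \<Omega>" and t: "0 \<le> t"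
  shows "s * (root_coord g N (y t x) j - M) \<le> 0"
proof (cases "t = 0")
  case False
  then have t: "0 < t" using t by simp
  have o: "open \<Omega>" using dom unfolding C2_holder_domain_def by blast
  have Y: "y t x \<in> open_simplex N" if "0 \<le> t" "x \<in> closure \<Omega>" for t x
    using sol that unfolding global_solution_def maximal_Lp_solution_def by blast
  have yc: "continuous_C1 \<Omega> (\<lambda>t x. y t x i)" if "i \<in> {1..N}" for i
    using sol that unfolding global_solution_def by blast
  have "s * (root_coord g N (y t x) j - M) \<le> \<epsilon>" if \<epsilon>: "0 < \<epsilon>" for \<epsilon>
  proof -
    obtain \<tau> where \<tau>: "0 < \<tau>" "\<tau> < t" "\<forall>x\<in>closure \<Omega>. \<bar>root_coord g N (y \<tau> x) j - root_coord g N (y 0 x) j\<bar> \<le> \<epsilon>"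
      using roots_near_initial[OF b Y yc j \<epsilon> t] by blast
    obtain yt Dy where strip: "strip_solution \<tau> t \<Omega> y yt Dy" using strip_solution_exists[OF dom b sol p \<tau>(1,2)] by blast
    have s1: "\<bar>s\<bar> = 1" using s by (metis abs_mult_self_eq abs_one abs_eq_iff square_eq_1_iff)
    have ss: "s * (r - (M + s * \<epsilon>)) = s * (r - M) - \<epsilon>" for r
    proof -
      have "s * (r - (M + s * \<epsilon>)) = s * (r - M) - (s * s) * \<epsilon>" by (simp add: algebra_simps)
      then show ?thesis using s by simp
    qed
    have "s * (root_coord g N (y t x) j - (M + s * \<epsilon>)) \<le> 0"
    proof (rule root_comparison_strip[OF o b strip \<tau>(2) j s _ x])
      fix v assume v: "v \<in> closure \<Omega>"
      have "s * (root_coord g N (y \<tau> v) j - M) = s * (root_coord g N (y \<tau> v) j - root_coord g N (y 0 v) j) + s * (root_coord g N (y 0 v) j - M)"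
        by (simp add: algebra_simps)
      also have "s * (root_coord g N (y \<tau> v) j - root_coord g N (y 0 v) j) \<le> \<epsilon>"
        using \<tau>(3) v s1 abs_ge_self[of "s * (root_coord g N (y \<tau> v) j - root_coord g N (y 0 v) j)"] by (force simp: abs_mult)
      finally show "s * (root_coord g N (y \<tau> v) j - (M + s * \<epsilon>)) \<le> 0" using init[OF v] unfolding ss by simp
    qed
    then show ?thesis unfolding ss by simp
  qed
  then show ?thesis by (rule field_le_epsilon[of _ 0, simplified])
qed (use init x in simp)

end

section \<open>Entropy decay and convergence to equilibrium\<close>

lemma ln_diff_ge_diff:
  fixes x y :: real
  assumes "0 < x" "x \<le> y" "y \<le> 1"
  shows "y - x \<le> ln y - ln x"
proof -
  have "ln (x / y) \<le> x / y - 1" by (rule ln_le_minus_one) (use assms in simp)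
  moreover have "ln (x / y) = ln x - ln y" using assms by (simp add: ln_div)
  moreover have "(y - x) * y \<le> (y - x) * 1" using assms by (intro mult_left_mono) auto
  then have "x / y - 1 \<le> x - y" using assms by (simp add: field_simps)
  ultimately show ?thesis by linarith
qed

text \<open>The difference of the two sides vanishes at a = b, and its derivative ln x - ln b - (x -
  b) has the sign of x - b because the logarithm has slope at least 1 on (0,1]. It is a pointwise
  substitute for the Csiszar-Kullback-Pinsker inequality, giving the L2 norm.\<close>

lemma relative_entropy_ge_square:
  fixes a b :: real
  assumes "0 < a" "0 < b" "a \<le> 1" "b \<le> 1"
  shows "(a - b)\<^sup>2 / 2 \<le> a * ln (a / b) - a + b"
proof -
  define f where "f x = x * (ln x - ln b) - x + b - (x - b)\<^sup>2 / 2" for x :: real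
  have d: "(f has_real_derivative (ln x - ln b - (x - b))) (at x)" if "0 < x" for x
    unfolding f_def[abs_def] using that by (auto intro!: derivative_eq_intros simp: field_simps)
  have "f b \<le> f a"
  proof (cases "b \<le> a")
    case True
    show ?thesis
    proof (rule DERIV_nonneg_imp_nondecreasing[OF True])
      fix x assume "b \<le> x" "x \<le> a"
      then show "\<exists>y. (f has_real_derivative y) (at x) \<and> 0 \<le> y"
        using d[of x] ln_diff_ge_diff[of b x] assms by (intro exI[of _ "ln x - ln b - (x - b)"]) auto
    qed
  next
    case False
    show ?thesis
    proof (rule DERIV_nonpos_imp_nonincreasing[of a b])
      show "a \<le> b" using False by simp
      fix x assume "a \<le> x" "x \<le> b"
      then show "\<exists>y. (f has_real_derivative y) (at x) \<and> y \<le> 0"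
        using d[of x] ln_diff_ge_diff[of x b] assms by (intro exI[of _ "ln x - ln b - (x - b)"]) auto
    qed
  qed
  then show ?thesis using assms by (simp add: f_def ln_div algebra_simps)
qed

lemma measure_open_pos:
  fixes \<Omega> :: "'a::euclidean_space set"
  assumes o: "open \<Omega>" and b: "bounded \<Omega>" and ne: "\<Omega> \<noteq> {}"
  shows "0 < measure lebesgue \<Omega>"
proof (rule ccontr)
  assume "\<not> ?thesis"
  then have m: "measure lebesgue \<Omega> = 0" using measure_nonneg[of lebesgue \<Omega>] by linarith
  have S: "\<Omega> \<in> sets lebesgue" using o by simp
  have i: "integrable (lebesgue_on \<Omega>) (\<lambda>x. 1::real)"
    by (rule integrable_continuous_compact[OF _ continuous_on_const S closure_subset]) (use b in simp)
  have "(LINT x|lebesgue_on \<Omega>. 1::real) = 0" using m S by (simp add: measure_restrict_space)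
  then have "AE x in lebesgue_on \<Omega>. (1::real) = 0" using integral_nonneg_eq_0_iff_AE[OF i] by auto
  then have "(1::real) = 0" if "x \<in> closure \<Omega>" for x
    by (rule AE_eq_continuous_imp_eq[OF o continuous_on_const continuous_on_const _ that])
  then show False using ne closure_subset[of \<Omega>] by auto
qed

lemma mean_const:
  fixes \<Omega> :: "'a::euclidean_space set"
  assumes "open \<Omega>" "bounded \<Omega>" "\<Omega> \<noteq> {}"
  shows "mean \<Omega> (\<lambda>x. c) = c"
  using measure_open_pos[OF assms] assms(1) by (simp add: mean_def measure_restrict_space)

lemma mean_ge:
  fixes \<Omega> :: "'a::euclidean_space set"
  assumes o: "open \<Omega>" and b: "bounded \<Omega>" and ne: "\<Omega> \<noteq> {}"
    and u: "continuous_on (closure \<Omega>) u" "\<And>x. x \<in> \<Omega> \<Longrightarrow> c \<le> u x"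
  shows "c \<le> mean \<Omega> u"
proof -
  have S: "\<Omega> \<in> sets lebesgue" using o by simp
  have K: "compact (closure \<Omega>)" using b by simp
  note i = integrable_continuous_compact[OF K _ S closure_subset]
  have "(LINT x|lebesgue_on \<Omega>. c) \<le> (LINT x|lebesgue_on \<Omega>. u x)"
    by (rule integral_mono[OF i[OF continuous_on_const] i[OF u(1)]]) (use u(2) in auto)
  then show ?thesis using measure_open_pos[OF o b ne] S by (simp add: mean_def measure_restrict_space pos_le_divide_eq mult.commute)
qed

lemma mean_pos:
  fixes \<Omega> :: "'a::euclidean_space set"
  assumes o: "open \<Omega>" and b: "bounded \<Omega>" and ne: "\<Omega> \<noteq> {}"
    and u: "continuous_on (closure \<Omega>) u" "\<And>x. x \<in> closure \<Omega> \<Longrightarrow> 0 < u x"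
  shows "0 < mean \<Omega> u"
proof -
  have "closure \<Omega> \<noteq> {}" using ne by simp
  then obtain x where x: "x \<in> closure \<Omega>" "\<forall>v\<in>closure \<Omega>. u x \<le> u v"
    using continuous_attains_inf[OF _ _ u(1)] b by (meson compact_closure)
  have "u x \<le> mean \<Omega> u" by (rule mean_ge[OF o b ne u(1)]) (use x(2) closure_subset in blast)
  then show ?thesis using u(2)[OF x(1)] by linarith
qed

lemma in_Lp_continuous:
  fixes \<Omega> :: "'a::euclidean_space set"
  assumes o: "open \<Omega>" and b: "bounded \<Omega>" and u: "continuous_on (closure \<Omega>) u" and p: "0 < p"
  shows "in_Lp p \<Omega> u"
proof -
  have S: "\<Omega> \<in> sets lebesgue" using o by simp
  have K: "compact (closure \<Omega>)" using b by simp
  have "integrable (lebesgue_on \<Omega>) u" by (rule integrable_continuous_compact[OF K u S closure_subset])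
  moreover have "continuous_on (closure \<Omega>) (\<lambda>x. \<bar>u x\<bar> powr p)"
    by (rule continuous_on_powr') (use u p in \<open>auto intro!: continuous_intros\<close>)
  then have "integrable (lebesgue_on \<Omega>) (\<lambda>x. \<bar>u x\<bar> powr p)"
    by (rule integrable_continuous_compact[OF K _ S closure_subset])
  ultimately show ?thesis unfolding in_Lp_def by (simp add: borel_measurable_integrable)
qed

section \<open>The logarithmic Sobolev inequality for positive classical densities\<close>

text \<open>Positivity up to the closure makes the square root differentiable with continuous
  gradient D / (2 sqrt \<rho>), so the weak gradient is the classical one and its square is the
  integrand on the right.\<close>

lemma log_sobolev_classical:
  fixes \<Omega> :: "'a::euclidean_space set"
  assumes o: "open \<Omega>" and b: "bounded \<Omega>" and ne: "\<Omega> \<noteq> {}" and LS: "log_sobolev_constant \<Omega> C"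
    and \<rho>: "continuous_on (closure \<Omega>) \<rho>" "\<And>x. x \<in> closure \<Omega> \<Longrightarrow> 0 < \<rho> x"
    and D: "continuous_on (closure \<Omega>) D" "\<And>x. x \<in> \<Omega> \<Longrightarrow> (\<rho> has_derivative (\<lambda>h. D x \<bullet> h)) (at x)"
  shows "(LINT x|lebesgue_on \<Omega>. \<rho> x * ln (\<rho> x / mean \<Omega> \<rho>)) \<le> C * (LINT x|lebesgue_on \<Omega>. (D x \<bullet> D x) / (4 * \<rho> x))"
proof -
  define Du where "Du x = (1 / (2 * sqrt (\<rho> x))) *\<^sub>R D x" for x
  have p: "0 < \<rho> x" if "x \<in> \<Omega>" for x using \<rho>(2) that closure_subset by blast
  have nz: "2 * sqrt (\<rho> x) \<noteq> 0" if "x \<in> closure \<Omega>" for x using \<rho>(2)[OF that] by simp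
  have Duc: "continuous_on (closure \<Omega>) Du" unfolding Du_def[abs_def]
    by (intro continuous_intros \<rho>(1) D(1)) (use nz in blast)
  have Duc': "continuous_on \<Omega> Du" by (rule continuous_on_subset[OF Duc closure_subset])
  have uc: "continuous_on (closure \<Omega>) (\<lambda>x. sqrt (\<rho> x))" by (intro continuous_intros \<rho>(1))
  have du: "((\<lambda>x. sqrt (\<rho> x)) has_derivative (\<lambda>h. Du x \<bullet> h)) (at x)" if x: "x \<in> \<Omega>" for x
  proof -
    have "(sqrt has_derivative (\<lambda>h. inverse (sqrt (\<rho> x)) / 2 * h)) (at (\<rho> x))"
      using DERIV_real_sqrt[OF p[OF x]] unfolding has_field_derivative_def .
    from has_derivative_compose[OF D(2)[OF x] this] show ?thesis by (simp add: Du_def field_simps)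
  qed
  note wd = has_weak_deriv_classical[OF o du Duc'] and wa = weak_deriv_classical_AE[OF o du Duc']
  have "in_W1p 2 \<Omega> (\<lambda>x. sqrt (\<rho> x))"
    unfolding in_W1p_def
  proof (intro conjI ballI)
    show "in_Lp 2 \<Omega> (\<lambda>x. sqrt (\<rho> x))" by (rule in_Lp_continuous[OF o b uc]) simp
    fix e :: 'a assume e: "e \<in> Basis"
    have "continuous_on (closure \<Omega>) (\<lambda>x. Du x \<bullet> e)" by (intro continuous_intros Duc)
    then have "in_Lp 2 \<Omega> (\<lambda>x. Du x \<bullet> e)" by (rule in_Lp_continuous[OF o b]) simp
    then show "\<exists>v. has_weak_deriv \<Omega> e (\<lambda>x. sqrt (\<rho> x)) v \<and> in_Lp 2 \<Omega> v" using wd[OF _ e] by blast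
  qed
  moreover have "0 < mean \<Omega> \<rho>" by (rule mean_pos[OF o b ne \<rho>])
  moreover have "\<forall>x\<in>\<Omega>. 0 \<le> \<rho> x" using p less_imp_le by blast
  ultimately have "(LINT x|lebesgue_on \<Omega>. \<rho> x * ln (\<rho> x / mean \<Omega> \<rho>)) \<le>
      C * (LINT x|lebesgue_on \<Omega>. (\<Sum>e\<in>Basis. (weak_deriv \<Omega> e (\<lambda>x. sqrt (\<rho> x)) x)\<^sup>2))"
    using LS unfolding log_sobolev_constant_def by blast
  also have "(LINT x|lebesgue_on \<Omega>. (\<Sum>e\<in>Basis. (weak_deriv \<Omega> e (\<lambda>x. sqrt (\<rho> x)) x)\<^sup>2)) = (LINT x|lebesgue_on \<Omega>. (\<Sum>e\<in>Basis. (Du x \<bullet> e)\<^sup>2))"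
  proof -
    have "AE x in lebesgue_on \<Omega>. \<forall>e\<in>Basis. weak_deriv \<Omega> e (\<lambda>x. sqrt (\<rho> x)) x = Du x \<bullet> e"
      by (rule AE_finite_allI[OF finite_Basis]) (rule wa)
    then have ae: "AE x in lebesgue_on \<Omega>. (\<Sum>e\<in>Basis. (weak_deriv \<Omega> e (\<lambda>x. sqrt (\<rho> x)) x)\<^sup>2) = (\<Sum>e\<in>Basis. (Du x \<bullet> e)\<^sup>2)"
      by eventually_elim simp
    have "continuous_on (closure \<Omega>) (\<lambda>x. \<Sum>e\<in>Basis. (Du x \<bullet> e)\<^sup>2)" by (intro continuous_intros Duc)
    then have "integrable (lebesgue_on \<Omega>) (\<lambda>x. \<Sum>e\<in>Basis. (Du x \<bullet> e)\<^sup>2)"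
      by (rule integrable_continuous_compact[OF _ _ _ closure_subset, rotated]) (use o b in simp_all)
    then have m: "(\<lambda>x. \<Sum>e\<in>Basis. (Du x \<bullet> e)\<^sup>2) \<in> borel_measurable (lebesgue_on \<Omega>)" by (rule borel_measurable_integrable)
    \<comment> \<open>The representatives chosen by \<open>weak_deriv\<close> are known only up to
      null sets; the sum of their squares is measurable because it equals a continuous function
      almost everywhere.\<close>
    have "(\<lambda>x. \<Sum>e\<in>Basis. (weak_deriv \<Omega> e (\<lambda>x. sqrt (\<rho> x)) x)\<^sup>2) \<in> borel_measurable (lebesgue_on \<Omega>)"
    proof (rule borel_measurable_if_D[OF borel_measurable_AE[OF borel_measurable_if_I[OF m]]])
      show "AE x in lebesgue. (if x \<in> \<Omega> then \<Sum>e\<in>Basis. (Du x \<bullet> e)\<^sup>2 else 0) =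
          (if x \<in> \<Omega> then \<Sum>e\<in>Basis. (weak_deriv \<Omega> e (\<lambda>x. sqrt (\<rho> x)) x)\<^sup>2 else 0)"
        using ae o by (simp add: AE_restrict_space_iff) (auto elim: eventually_mono)
    qed (use o in simp)
    then show ?thesis by (rule integral_cong_AE[OF _ m ae])
  qed
  also have "\<dots> = (LINT x|lebesgue_on \<Omega>. (D x \<bullet> D x) / (4 * \<rho> x))"
  proof (rule Bochner_Integration.integral_cong[OF refl])
    fix x assume "x \<in> space (lebesgue_on \<Omega>)"
    then have x: "0 < \<rho> x" using p by simp
    have "(\<Sum>e\<in>Basis. (Du x \<bullet> e)\<^sup>2) = Du x \<bullet> Du x" by (subst euclidean_inner) (simp add: power2_eq_square)
    also have "\<dots> = (D x \<bullet> D x) / (4 * \<rho> x)" using x by (simp add: Du_def field_simps)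
    finally show "(\<Sum>e\<in>Basis. (Du x \<bullet> e)\<^sup>2) = (D x \<bullet> D x) / (4 * \<rho> x)" .
  qed
  finally show ?thesis .
qed

text \<open>A nonconstant density has strictly positive entropy relative to its mean, while the
  integral on the right is nonnegative, so a constant that is not positive would contradict the
  inequality. This is what gives \<kappa> > 0.\<close>

lemma log_sobolev_constant_pos:
  fixes \<Omega> :: "'a::euclidean_space set"
  assumes o: "open \<Omega>" and b: "bounded \<Omega>" and ne: "\<Omega> \<noteq> {}" and LS: "log_sobolev_constant \<Omega> C"
  shows "0 < C"
proof -
  obtain e :: 'a where e: "e \<in> Basis" using nonempty_Basis by blast
  have K: "compact (closure \<Omega>)" using b by simp
  have S: "\<Omega> \<in> sets lebesgue" using o by simp
  obtain B where B: "\<forall>x\<in>closure \<Omega>. norm x \<le> B" using compact_continuous_bounded[OF K continuous_on_id] by auto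
  \<comment> \<open>Affine, positive on the closure by the choice of B, and not constant on any open
    set; its square has a smooth square root.\<close>
  define l where "l x = B + 1 + x \<bullet> e" for x
  have l: "0 < l x" if "x \<in> closure \<Omega>" for x
  proof -
    have "\<bar>x \<bullet> e\<bar> \<le> norm x" using Basis_le_norm[OF e] .
    then show ?thesis using B that by (force simp: l_def)
  qed
  define \<rho> where "\<rho> x = (l x)\<^sup>2" for x
  define D where "D x = (2 * l x) *\<^sub>R e" for x
  have lc: "continuous_on (closure \<Omega>) l" unfolding l_def[abs_def] by (intro continuous_intros)
  have c: "continuous_on (closure \<Omega>) \<rho>" "continuous_on (closure \<Omega>) D"
    unfolding \<rho>_def[abs_def] D_def[abs_def] by (intro continuous_intros lc)+
  have \<rho>: "0 < \<rho> x" if "x \<in> closure \<Omega>" for x using l[OF that] by (simp add: \<rho>_def)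
  have ld: "(l has_derivative (\<lambda>h. h \<bullet> e)) (at x)" for x unfolding l_def[abs_def] by (auto intro!: derivative_eq_intros)
  have d: "(\<rho> has_derivative (\<lambda>h. D x \<bullet> h)) (at x)" for x
    unfolding \<rho>_def[abs_def] power2_eq_square
    by (rule has_derivative_eq_rhs[OF has_derivative_mult[OF ld ld]]) (auto simp: D_def inner_commute)
  define m where "m = mean \<Omega> \<rho>"
  have m: "0 < m" unfolding m_def by (rule mean_pos[OF o b ne c(1) \<rho>])
  \<comment> \<open>Subtracting \<rho> and adding its mean m leaves the integral unchanged and makes
    the integrand nonnegative, with zeros only where \<rho> equals m.\<close>
  define h where "h x = \<rho> x * ln (\<rho> x / m) - \<rho> x + m" for x
  have pc: "continuous_on (closure \<Omega>) (\<lambda>x. \<rho> x * ln (\<rho> x / m))"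
    by (intro continuous_intros c(1)) (use \<rho> m in fastforce)+
  have hc: "continuous_on (closure \<Omega>) h" unfolding h_def[abs_def] by (intro continuous_intros pc c(1))
  note int = integrable_continuous_compact[OF K _ S closure_subset]
  have hx: "0 \<le> h x \<and> (h x = 0 \<longrightarrow> \<rho> x = m)" if "x \<in> closure \<Omega>" for x
  proof -
    have q: "0 < m / \<rho> x" using \<rho>[OF that] m by simp
    have eq: "h x = \<rho> x * (m / \<rho> x - 1 - ln (m / \<rho> x))"
      using \<rho>[OF that] m unfolding h_def by (simp add: ln_div field_simps)
    have "0 \<le> h x" unfolding eq using \<rho>[OF that] ln_le_minus_one[OF q] by (intro mult_nonneg_nonneg) auto
    moreover have "\<rho> x = m" if "h x = 0"
      using that ln_eq_minus_one[OF q] \<rho>[OF \<open>x \<in> closure \<Omega>\<close>] unfolding eq by simp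
    ultimately show ?thesis by blast
  qed
  have hx': "0 \<le> h x" if "x \<in> \<Omega>" for x using hx that closure_subset by blast
  have "(LINT x|lebesgue_on \<Omega>. h x) \<noteq> 0"
  proof
    assume "(LINT x|lebesgue_on \<Omega>. h x) = 0"
    then have "AE x in lebesgue_on \<Omega>. h x = 0" using integral_nonneg_eq_0_iff_AE[OF int[OF hc] AE_I2] hx' by simp
    then have z: "h x = 0" if "x \<in> closure \<Omega>" for x by (rule AE_eq_continuous_imp_eq[OF o hc continuous_on_const _ that])
    have lm: "l x = sqrt m" if "x \<in> \<Omega>" for x
    proof -
      have xc: "x \<in> closure \<Omega>" using that closure_subset by blast
      then have "(l x)\<^sup>2 = m" using z[OF xc] hx[OF xc] by (simp add: \<rho>_def)
      then show ?thesis using l[OF xc] by (simp add: real_sqrt_unique)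
    qed
    \<comment> \<open>Moving by r along e inside a ball contained in \<open>\<Omega>\<close> changes
      l, so l cannot be constant there.\<close>
    obtain x r where x: "x \<in> \<Omega>" and r: "0 < r" "cball x r \<subseteq> \<Omega>" using ne o by (meson all_not_in_conv open_contains_cball)
    have "x + r *\<^sub>R e \<in> \<Omega>" using r e by (intro subsetD[OF r(2)]) (simp add: dist_norm)
    then have "l (x + r *\<^sub>R e) = l x" using lm x by simp
    then show False using r(1) e by (simp add: l_def inner_add_left)
  qed
  moreover have "0 \<le> (LINT x|lebesgue_on \<Omega>. h x)" by (intro integral_nonneg_AE AE_I2) (use hx' in auto)
  ultimately have h0: "0 < (LINT x|lebesgue_on \<Omega>. h x)" by linarith
  have mp: "0 < measure lebesgue \<Omega>" by (rule measure_open_pos[OF o b ne])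
  have mI: "(LINT x|lebesgue_on \<Omega>. m) = (LINT x|lebesgue_on \<Omega>. \<rho> x)"
    using mp S by (simp add: m_def mean_def measure_restrict_space)
  have "(LINT x|lebesgue_on \<Omega>. h x) = (LINT x|lebesgue_on \<Omega>. \<rho> x * ln (\<rho> x / m)) - (LINT x|lebesgue_on \<Omega>. \<rho> x) + (LINT x|lebesgue_on \<Omega>. m)"
    unfolding h_def using int[OF pc] int[OF c(1)] int[OF continuous_on_const[of _ m]]
    by (simp only: Bochner_Integration.integral_add Bochner_Integration.integral_diff Bochner_Integration.integrable_diff)
  also have "\<dots> = (LINT x|lebesgue_on \<Omega>. \<rho> x * ln (\<rho> x / m))" unfolding mI by simp
  also have "\<dots> \<le> C * (LINT x|lebesgue_on \<Omega>. (D x \<bullet> D x) / (4 * \<rho> x))"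
    unfolding m_def by (rule log_sobolev_classical[OF o b ne LS c(1) \<rho> c(2) d])
  finally have "0 < C * (LINT x|lebesgue_on \<Omega>. (D x \<bullet> D x) / (4 * \<rho> x))" using h0 by linarith
  moreover have "0 \<le> (LINT x|lebesgue_on \<Omega>. (D x \<bullet> D x) / (4 * \<rho> x))"
    by (intro integral_nonneg_AE AE_I2) (auto simp: \<rho>_def)
  ultimately show ?thesis by (simp add: zero_less_mult_iff)
qed

section \<open>Transfer of distances between coordinate systems\<close>

text \<open>The square of a sum of N absolute values is at most N times the sum of their squares,
  and n components are added; hence the factor n N under the root.\<close>

lemma L2_dist_lipschitz:
  fixes \<Omega> :: "'a::euclidean_space set"
  assumes le: "\<And>x j. x \<in> \<Omega> \<Longrightarrow> j \<in> {1..n} \<Longrightarrow> \<bar>u x j - c j\<bar> \<le> L * (\<Sum>i=1..N. \<bar>v x i - d i\<bar>)" and L: "0 \<le> L"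
    and int: "integrable (lebesgue_on \<Omega>) (\<lambda>x. \<Sum>i=1..N. (v x i - d i)\<^sup>2)"
  shows "L2_dist n \<Omega> u c \<le> sqrt (n * N) * L * L2_dist N \<Omega> v d"
proof -
  have "(\<Sum>j=1..n. (u x j - c j)\<^sup>2) \<le> (n * N) * L\<^sup>2 * (\<Sum>i=1..N. (v x i - d i)\<^sup>2)" if x: "x \<in> \<Omega>" for x
  proof -
    have "(\<Sum>j=1..n. (u x j - c j)\<^sup>2) \<le> (\<Sum>j=1..n. (L * (\<Sum>i=1..N. \<bar>v x i - d i\<bar>))\<^sup>2)"
    proof (rule sum_mono)
      fix j assume "j \<in> {1..n}"
      from power_mono[OF le[OF x this] abs_ge_zero, of 2]
      show "(u x j - c j)\<^sup>2 \<le> (L * (\<Sum>i=1..N. \<bar>v x i - d i\<bar>))\<^sup>2" by simp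
    qed
    also have "\<dots> = n * L\<^sup>2 * (\<Sum>i=1..N. \<bar>v x i - d i\<bar>)\<^sup>2" by (simp add: power_mult_distrib)
    also have "\<dots> \<le> n * L\<^sup>2 * ((\<Sum>i=1..N. \<bar>v x i - d i\<bar>\<^sup>2) * card {1..N})"
      by (intro mult_left_mono sum_squared_le_sum_of_squares) simp
    finally show ?thesis by (simp add: mult_ac)
  qed
  then have "(LINT x|lebesgue_on \<Omega>. (\<Sum>j=1..n. (u x j - c j)\<^sup>2)) \<le> (LINT x|lebesgue_on \<Omega>. (n * N) * L\<^sup>2 * (\<Sum>i=1..N. (v x i - d i)\<^sup>2))"
    by (intro integral_mono' integrable_mult_right int) (auto intro!: mult_nonneg_nonneg sum_nonneg)
  also have "\<dots> = (n * N) * L\<^sup>2 * (LINT x|lebesgue_on \<Omega>. (\<Sum>i=1..N. (v x i - d i)\<^sup>2))" by simp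
  finally have "L2_dist n \<Omega> u c \<le> sqrt ((n * N) * L\<^sup>2 * (LINT x|lebesgue_on \<Omega>. (\<Sum>i=1..N. (v x i - d i)\<^sup>2)))"
    unfolding L2_dist_def by (rule real_sqrt_le_mono)
  also have "\<dots> = sqrt (n * N) * L * L2_dist N \<Omega> v d" using L by (simp add: L2_dist_def real_sqrt_mult)
  finally show ?thesis .
qed

text \<open>The sum of all absolute coefficients is a crude constant, but one and the same for all
  components l.\<close>

lemma abs_linear_comb_le:
  fixes a :: "nat \<Rightarrow> nat \<Rightarrow> real"
  assumes "l \<in> {1..n}"
  shows "\<bar>\<Sum>i=1..N. a i l * d i\<bar> \<le> (\<Sum>l=1..n. \<Sum>i=1..N. \<bar>a i l\<bar>) * (\<Sum>i=1..N. \<bar>d i\<bar>)"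
proof -
  have "\<bar>a i l\<bar> \<le> (\<Sum>l=1..n. \<Sum>i=1..N. \<bar>a i l\<bar>)" if "i \<in> {1..N}" for i
  proof -
    have "\<bar>a i l\<bar> \<le> (\<Sum>i=1..N. \<bar>a i l\<bar>)" by (rule member_le_sum[OF that, of "\<lambda>i. \<bar>a i l\<bar>"]) auto
    also have "\<dots> \<le> (\<Sum>l=1..n. \<Sum>i=1..N. \<bar>a i l\<bar>)"
      by (rule member_le_sum[OF assms, of "\<lambda>l. \<Sum>i=1..N. \<bar>a i l\<bar>"]) (auto intro: sum_nonneg)
    finally show ?thesis .
  qed
  then have "(\<Sum>i=1..N. \<bar>a i l * d i\<bar>) \<le> (\<Sum>i=1..N. (\<Sum>l=1..n. \<Sum>i=1..N. \<bar>a i l\<bar>) * \<bar>d i\<bar>)"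
    unfolding abs_mult by (intro sum_mono mult_right_mono) auto
  then show ?thesis using sum_abs[of "\<lambda>i. a i l * d i" "{1..N}"] unfolding sum_distrib_left by linarith
qed

lemma ln_lipschitz:
  fixes a b :: real
  assumes "0 < \<delta>" "\<delta> \<le> a" "\<delta> \<le> b"
  shows "\<bar>ln a - ln b\<bar> \<le> \<bar>a - b\<bar> / \<delta>"
proof -
  have *: "ln x - ln y \<le> \<bar>x - y\<bar> / \<delta>" if "\<delta> \<le> x" "\<delta> \<le> y" for x y
  proof -
    have "ln x - ln y \<le> (x - y) / y" using ln_diff_le[of x y] that assms(1) by linarith
    also have "\<dots> \<le> \<bar>x - y\<bar> / y" using that assms(1) by (intro divide_right_mono) auto
    also have "\<dots> \<le> \<bar>x - y\<bar> / \<delta>" using that assms(1) by (intro divide_left_mono) auto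
    finally show ?thesis .
  qed
  show ?thesis using *[of a b] *[of b a] assms by (auto simp: abs_minus_commute abs_le_iff)
qed

context additive_MS
begin

section \<open>Mass and entropy on a strip\<close>

lemma global_solutionD:
  assumes "global_solution p g N \<Omega> y" "0 \<le> t"
  shows "x \<in> closure \<Omega> \<Longrightarrow> y t x \<in> open_simplex N"
    "i \<in> {1..N} \<Longrightarrow> continuous_on (closure \<Omega>) (\<lambda>x. y t x i)"
    "i \<in> {1..N} \<Longrightarrow> x \<in> closure \<Omega> \<Longrightarrow> ((\<lambda>s. y s x i) \<longlongrightarrow> y t x i) (at t within {0..})"
proof -
  show "x \<in> closure \<Omega> \<Longrightarrow> y t x \<in> open_simplex N"
    using assms unfolding global_solution_def maximal_Lp_solution_def by blast
  have c: "\<exists>G. \<forall>t\<ge>0. continuous_on (closure \<Omega>) (\<lambda>x. y t x i) \<and> continuous_on (closure \<Omega>) (G t) \<and>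
     (\<forall>x\<in>\<Omega>. ((\<lambda>x. y t x i) has_derivative (\<lambda>h. G t x \<bullet> h)) (at x)) \<and>
     uniform_limit (closure \<Omega>) (\<lambda>t x. y t x i) (\<lambda>x. y t x i) (at t within {0..}) \<and>
     uniform_limit (closure \<Omega>) G (G t) (at t within {0..})" if "i \<in> {1..N}" for i
    using assms(1) that unfolding global_solution_def continuous_C1_def by blast
  show "i \<in> {1..N} \<Longrightarrow> continuous_on (closure \<Omega>) (\<lambda>x. y t x i)" using c[of i] assms(2) by blast
  assume i: "i \<in> {1..N}" and x: "x \<in> closure \<Omega>"
  have "uniform_limit (closure \<Omega>) (\<lambda>t x. y t x i) (\<lambda>x. y t x i) (at t within {0..})" using c[OF i] assms(2) by blast
  from tendsto_uniform_limitI[OF this x] show "((\<lambda>s. y s x i) \<longlongrightarrow> y t x i) (at t within {0..})" .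
qed

text \<open>The constant function 1 is an admissible test function and shows that the mass has zero
  derivative; Gronwall with c = 0, for the mass and for its negative, gives equality.\<close>

lemma strip_mass_conserved:
  fixes \<Omega> :: "'a::euclidean_space set"
  assumes o: "open \<Omega>" and b: "bounded \<Omega>" and strip: "strip_solution \<tau> T \<Omega> y yt Dy" and \<tau>: "\<tau> < T" and i: "i \<in> {1..N}"
  shows "(LINT x|lebesgue_on \<Omega>. y T x i) = (LINT x|lebesgue_on \<Omega>. y \<tau> x i)"
proof -
  note sol = strip_solutionD[OF strip]
  have S: "\<Omega> \<in> sets lebesgue" using o by simp
  have lm: "\<Omega> \<in> lmeasurable" using o b by (simp add: lmeasurable_open)
  have K: "compact (closure \<Omega>)" using b by simp
  have KQ: "compact ({\<tau>..T} \<times> closure \<Omega>)" by (rule compact_Times[OF compact_Icc K])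
  have sec: "continuous_on (closure \<Omega>) (\<lambda>x. f t x)" if "continuous_on ({\<tau>..T} \<times> closure \<Omega>) (\<lambda>z. f (fst z) (snd z))" "t \<in> {\<tau>..T}"
    for f :: "real \<Rightarrow> 'a \<Rightarrow> real" and t
    by (rule continuous_on_section[of "{\<tau>..T}" "closure \<Omega>" f]) (use that in \<open>simp_all add: case_prod_unfold\<close>)
  note int = integrable_continuous_compact[OF K _ S closure_subset]
  obtain B where B: "\<forall>z\<in>{\<tau>..T} \<times> closure \<Omega>. norm (yt (fst z) (snd z) i) \<le> B"
    using compact_continuous_bounded[OF KQ sol(4)[OF i]] by blast
  have d: "((\<lambda>t. LINT x|lebesgue_on \<Omega>. y t x i) has_real_derivative (LINT x|lebesgue_on \<Omega>. yt t x i)) (at t within {\<tau>..T})"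
    if t: "t \<in> {\<tau>..T}" for t
  proof (rule has_real_derivative_LINT[OF lm _ _ _ _ t, where B=B])
    show "integrable (lebesgue_on \<Omega>) (\<lambda>x. y t x i)" "integrable (lebesgue_on \<Omega>) (\<lambda>x. yt t x i)" if "t \<in> {\<tau>..T}" for t
      by (rule int[OF sec[OF sol(3)[OF i] that]], rule int[OF sec[OF sol(4)[OF i] that]])
    show "\<bar>yt t x i\<bar> \<le> B" if "t \<in> {\<tau>..T}" "x \<in> \<Omega>" for t x
      using bspec[OF B, of "(t, x)"] that closure_subset[of \<Omega>] by auto
  qed (use sol(6)[OF i] in blast)
  have "C1_closure \<Omega> (\<lambda>x. 1) (\<lambda>x. 0)" by (simp add: C1_closure_def)
  from sol(8)[OF i _ this] have z: "(LINT x|lebesgue_on \<Omega>. yt t x i) = 0" if "t \<in> {\<tau>..T}" for t using that by simp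
  have "(LINT x|lebesgue_on \<Omega>. y T x i) \<le> exp (0 * (T - \<tau>)) * (LINT x|lebesgue_on \<Omega>. y \<tau> x i)"
    by (rule gronwall_decay[OF less_imp_le[OF \<tau>] d]) (simp_all add: z)
  moreover have "- (LINT x|lebesgue_on \<Omega>. y T x i) \<le> exp (0 * (T - \<tau>)) * - (LINT x|lebesgue_on \<Omega>. y \<tau> x i)"
    by (rule gronwall_decay[OF less_imp_le[OF \<tau>] DERIV_minus[OF d]]) (simp_all add: z)
  ultimately show ?thesis by simp
qed

text \<open>
  Testing the equation for \<open>y\<^sub>i\<close> with \<open>log (y\<^sub>i / c\<^sub>i) + 1\<close> gives the entropy production, which bounds
  \<open>\<Sum>\<^sub>i |\<nabla>y\<^sub>i|\<^sup>2 / y\<^sub>i = 4 \<Sum>\<^sub>i |\<nabla>\<surd>y\<^sub>i|\<^sup>2\<close>; the logarithmic Sobolev inequality is applied to each \<open>y\<^sub>i\<close> separately.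
\<close>

lemma strip_entropy_decay:
  fixes \<Omega> :: "'a::euclidean_space set"
  assumes o: "open \<Omega>" and b: "bounded \<Omega>" and ne: "\<Omega> \<noteq> {}" and LS: "log_sobolev_constant \<Omega> C"
    and strip: "strip_solution \<tau> T \<Omega> y yt Dy" and \<tau>: "\<tau> < T"
    and c: "\<And>i t. i \<in> {1..N} \<Longrightarrow> t \<in> {\<tau>..T} \<Longrightarrow> mean \<Omega> (\<lambda>x. y t x i) = c i" and c0: "\<And>i. i \<in> {1..N} \<Longrightarrow> 0 < c i"
  shows "rel_entropy N \<Omega> (y T) c \<le> exp (- kappa_LS g N C * (T - \<tau>)) * rel_entropy N \<Omega> (y \<tau>) c"
proof -
  note sol = strip_solutionD[OF strip]
  let ?I = "{\<tau>..T}"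
  let ?Q = "?I \<times> closure \<Omega>"
  have S: "\<Omega> \<in> sets lebesgue" using o by simp
  have lm: "\<Omega> \<in> lmeasurable" using o b by (simp add: lmeasurable_open)
  have K: "compact (closure \<Omega>)" using b by simp
  have KQ: "compact ?Q" by (rule compact_Times[OF compact_Icc K])
  have cl: "x \<in> closure \<Omega>" if "x \<in> \<Omega>" for x using that closure_subset by blast
  note int = integrable_continuous_compact[OF K _ S closure_subset]
  have C: "0 < C" by (rule log_sobolev_constant_pos[OF o b ne LS])
  have sec: "continuous_on (closure \<Omega>) (\<lambda>x. f t x)" if "continuous_on ?Q (\<lambda>z. f (fst z) (snd z))" "t \<in> ?I"
    for f :: "real \<Rightarrow> 'a \<Rightarrow> 'b::topological_space" and t
    by (rule continuous_on_section[of ?I "closure \<Omega>" f]) (use that in \<open>simp_all add: case_prod_unfold\<close>)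
  have y0: "0 < y t x i" if "i \<in> {1..N}" "t \<in> ?I" "x \<in> closure \<Omega>" for i t x
    by (rule simplexD(1)[OF sol(1)[OF that(2,3)] that(1)])
  have nz: "c i \<noteq> 0" "\<And>z. z \<in> ?Q \<Longrightarrow> y (fst z) (snd z) i / c i \<noteq> 0" "\<And>z. z \<in> ?Q \<Longrightarrow> y (fst z) (snd z) i \<noteq> 0" if "i \<in> {1..N}" for i
  proof -
    show "c i \<noteq> 0" using c0[OF that] by simp
    then show "y (fst z) (snd z) i / c i \<noteq> 0" "y (fst z) (snd z) i \<noteq> 0" if "z \<in> ?Q" for z
      using y0[OF \<open>i \<in> {1..N}\<close>, of "fst z" "snd z"] that by auto
  qed
  define L where "L i t x = ln (y t x i / c i)" for i t x
  have Lc: "continuous_on ?Q (\<lambda>z. L i (fst z) (snd z))" if i: "i \<in> {1..N}" for i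
    unfolding L_def by (intro continuous_on_ln continuous_on_divide sol(3)[OF i] continuous_on_const ballI nz(1,2)[OF i])
  define h where "h t x = (\<Sum>i=1..N. y t x i * L i t x)" for t x
  define h' where "h' t x = (\<Sum>i=1..N. yt t x i * (L i t x + 1))" for t x
  have hc: "continuous_on ?Q (\<lambda>z. h (fst z) (snd z))"
    unfolding h_def by (intro continuous_on_sum continuous_on_mult sol(3) Lc)
  have h'c: "continuous_on ?Q (\<lambda>z. h' (fst z) (snd z))"
    unfolding h'_def by (intro continuous_on_sum continuous_on_mult continuous_on_add continuous_on_const sol(4) Lc)
  obtain B where B: "\<forall>z\<in>?Q. norm (h' (fst z) (snd z)) \<le> B" using compact_continuous_bounded[OF KQ h'c] by blast
  define E where "E t = (LINT x|lebesgue_on \<Omega>. h t x)" for t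
  have Ed: "(E has_real_derivative (LINT x|lebesgue_on \<Omega>. h' t x)) (at t within ?I)" if t: "t \<in> ?I" for t
    unfolding E_def[abs_def]
  proof (rule has_real_derivative_LINT[OF lm _ _ _ _ t, where B=B])
    show "integrable (lebesgue_on \<Omega>) (h t)" "integrable (lebesgue_on \<Omega>) (h' t)" if "t \<in> ?I" for t
      by (rule int[OF sec[OF hc that]], rule int[OF sec[OF h'c that]])
    show "\<bar>h' t x\<bar> \<le> B" if "t \<in> ?I" "x \<in> \<Omega>" for t x
      using bspec[OF B, of "(t, x)"] that cl by auto
    fix t x assume t: "t \<in> ?I" and x: "x \<in> \<Omega>"
    have "((\<lambda>t. y t x i * L i t x) has_real_derivative yt t x i * (L i t x + 1)) (at t within ?I)" if i: "i \<in> {1..N}" for i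
    proof -
      have "((\<lambda>t. L i t x) has_real_derivative inverse (y t x i / c i) * (yt t x i / c i)) (at t within ?I)"
        unfolding L_def using y0[OF i t cl[OF x]] c0[OF i]
        by (intro DERIV_chain2[OF DERIV_ln] DERIV_cdivide sol(6)[OF i t x]) simp
      from DERIV_mult[OF sol(6)[OF i t x] this] show ?thesis
        using y0[OF i t cl[OF x]] c0[OF i] by (simp add: field_simps)
    qed
    then show "((\<lambda>t. h t x) has_real_derivative h' t x) (at t within ?I)" unfolding h_def h'_def by (rule DERIV_sum)
  qed
  have El: "(LINT x|lebesgue_on \<Omega>. h' t x) \<le> - kappa_LS g N C * E t" if t: "t \<in> ?I" for t
  proof -
    \<comment> \<open>The gradient of ln (y_i / c_i), in which the constant c_i has no
      share.\<close>
    define D where "D i x = inverse (y t x i) *\<^sub>R Dy t x i" for i x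
    have Yc: "continuous_on (closure \<Omega>) (\<lambda>x. y t x i)" if i: "i \<in> {1..N}" for i by (rule sec[OF sol(3)[OF i] t])
    have Pc: "continuous_on (closure \<Omega>) (\<lambda>x. Dy t x i)" if i: "i \<in> {1..N}" for i by (rule sec[OF sol(5)[OF i] t])
    have ytc: "continuous_on (closure \<Omega>) (\<lambda>x. yt t x i)" if i: "i \<in> {1..N}" for i by (rule sec[OF sol(4)[OF i] t])
    have Lc': "continuous_on (closure \<Omega>) (\<lambda>x. L i t x)" if i: "i \<in> {1..N}" for i by (rule sec[OF Lc[OF i] t])
    have y1: "y t x i \<noteq> 0" if "x \<in> closure \<Omega>" "i \<in> {1..N}" for x i using y0[OF that(2) t that(1)] by simp
    have Dc: "continuous_on (closure \<Omega>) (D i)" if i: "i \<in> {1..N}" for i unfolding D_def[abs_def]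
      by (intro continuous_on_scaleR continuous_on_inverse Yc[OF i] Pc[OF i] ballI y1 i)
    have Jc: "continuous_on (closure \<Omega>) (\<lambda>x. flux (y t x) (Dy t x) i)" if i: "i \<in> {1..N}" for i
      by (rule continuous_on_flux) (use Yc Pc sol(1)[OF t] i in auto)
    have Gc: "continuous_on (closure \<Omega>) (\<lambda>x. (Dy t x i \<bullet> Dy t x i) / (4 * y t x i))" if i: "i \<in> {1..N}" for i
      by (intro continuous_on_divide continuous_on_inner continuous_on_mult continuous_on_const Yc[OF i] Pc[OF i] ballI) (use y1[OF _ i] in simp)
    have JDc: "continuous_on (closure \<Omega>) (\<lambda>x. flux (y t x) (Dy t x) i \<bullet> D i x)" if i: "i \<in> {1..N}" for i
      by (intro continuous_on_inner Jc[OF i] Dc[OF i])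
    have C1: "C1_closure \<Omega> (\<lambda>x. L i t x + 1) (D i)" if i: "i \<in> {1..N}" for i
      unfolding C1_closure_def
    proof (intro conjI ballI)
      show "continuous_on (closure \<Omega>) (\<lambda>x. L i t x + 1)" by (intro continuous_on_add Lc'[OF i] continuous_on_const)
      show "continuous_on (closure \<Omega>) (D i)" by (rule Dc[OF i])
      fix x assume x: "x \<in> \<Omega>"
      have p: "0 < y t x i / c i" using y0[OF i t cl[OF x]] c0[OF i] by simp
      have "((\<lambda>x. y t x i / c i) has_derivative (\<lambda>h. (Dy t x i \<bullet> h) / c i)) (at x)"
        using has_derivative_mult_left[OF sol(7)[OF i t x], of "inverse (c i)"] by (simp add: field_simps)
      from has_derivative_compose[OF this DERIV_ln[OF p, unfolded has_field_derivative_def]]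
      have "((\<lambda>x. L i t x) has_derivative (\<lambda>h. D i x \<bullet> h)) (at x)"
        using c0[OF i] by (simp add: L_def D_def field_simps)
      from has_derivative_add_const[OF this] show "((\<lambda>x. L i t x + 1) has_derivative (\<lambda>h. D i x \<bullet> h)) (at x)" .
    qed
    have i1: "integrable (lebesgue_on \<Omega>) (\<lambda>x. yt t x i * (L i t x + 1))" if i: "i \<in> {1..N}" for i
      by (rule int) (intro continuous_on_mult continuous_on_add continuous_on_const ytc[OF i] Lc'[OF i])
    have i2: "integrable (lebesgue_on \<Omega>) (\<lambda>x. flux (y t x) (Dy t x) i \<bullet> D i x)" if i: "i \<in> {1..N}" for i
      by (rule int[OF JDc[OF i]])
    have i3: "integrable (lebesgue_on \<Omega>) (\<lambda>x. (Dy t x i \<bullet> Dy t x i) / (4 * y t x i))" if i: "i \<in> {1..N}" for i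
      by (rule int[OF Gc[OF i]])
    have i4: "integrable (lebesgue_on \<Omega>) (\<lambda>x. y t x i * L i t x)" if i: "i \<in> {1..N}" for i
      by (rule int) (intro continuous_on_mult Yc[OF i] Lc'[OF i])
    have "(LINT x|lebesgue_on \<Omega>. h' t x) = (\<Sum>i=1..N. LINT x|lebesgue_on \<Omega>. yt t x i * (L i t x + 1))"
      unfolding h'_def by (rule Bochner_Integration.integral_sum) (rule i1)
    also have "\<dots> = (\<Sum>i=1..N. LINT x|lebesgue_on \<Omega>. flux (y t x) (Dy t x) i \<bullet> D i x)"
      by (intro sum.cong refl sol(8)[OF _ t C1, symmetric])
    also have "\<dots> = (LINT x|lebesgue_on \<Omega>. (\<Sum>i=1..N. flux (y t x) (Dy t x) i \<bullet> D i x))"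
      by (rule Bochner_Integration.integral_sum[symmetric]) (rule i2)
    finally have A: "f_max g N * - (LINT x|lebesgue_on \<Omega>. h' t x) = (LINT x|lebesgue_on \<Omega>. f_max g N * - (\<Sum>i=1..N. flux (y t x) (Dy t x) i \<bullet> D i x))"
      by simp
    have "4 * (LINT x|lebesgue_on \<Omega>. (\<Sum>i=1..N. (Dy t x i \<bullet> Dy t x i) / (4 * y t x i)))
        = (LINT x|lebesgue_on \<Omega>. 4 * (\<Sum>i=1..N. (Dy t x i \<bullet> Dy t x i) / (4 * y t x i)))" by simp
    also have "\<dots> \<le> (LINT x|lebesgue_on \<Omega>. f_max g N * - (\<Sum>i=1..N. flux (y t x) (Dy t x) i \<bullet> D i x))"
    proof (rule integral_mono)
      show "integrable (lebesgue_on \<Omega>) (\<lambda>x. 4 * (\<Sum>i=1..N. (Dy t x i \<bullet> Dy t x i) / (4 * y t x i)))"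
        by (intro integrable_mult_right Bochner_Integration.integrable_sum i3)
      show "integrable (lebesgue_on \<Omega>) (\<lambda>x. f_max g N * - (\<Sum>i=1..N. flux (y t x) (Dy t x) i \<bullet> D i x))"
        by (intro integrable_mult_right Bochner_Integration.integrable_minus Bochner_Integration.integrable_sum i2)
      fix x assume "x \<in> space (lebesgue_on \<Omega>)"
      then have xc: "x \<in> closure \<Omega>" using cl by simp
      have "4 * (\<Sum>i=1..N. (Dy t x i \<bullet> Dy t x i) / (4 * y t x i)) = (\<Sum>i=1..N. (Dy t x i \<bullet> Dy t x i) / y t x i)"
        unfolding sum_distrib_left by (intro sum.cong refl) simp
      also have "\<dots> \<le> f_max g N * - (\<Sum>i=1..N. (flux (y t x) (Dy t x) i \<bullet> Dy t x i) / y t x i)"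
        by (rule entropy_dissipation_ge[OF sol(1)[OF t xc] sol(2)[OF t xc]])
      also have "(\<Sum>i=1..N. (flux (y t x) (Dy t x) i \<bullet> Dy t x i) / y t x i) = (\<Sum>i=1..N. flux (y t x) (Dy t x) i \<bullet> D i x)"
        by (intro sum.cong refl) (simp add: D_def divide_inverse_commute)
      finally show "4 * (\<Sum>i=1..N. (Dy t x i \<bullet> Dy t x i) / (4 * y t x i)) \<le> f_max g N * - (\<Sum>i=1..N. flux (y t x) (Dy t x) i \<bullet> D i x)" .
    qed
    finally have 1: "4 * (LINT x|lebesgue_on \<Omega>. (\<Sum>i=1..N. (Dy t x i \<bullet> Dy t x i) / (4 * y t x i))) \<le> f_max g N * - (LINT x|lebesgue_on \<Omega>. h' t x)"
      unfolding A .
    have "E t = (\<Sum>i=1..N. LINT x|lebesgue_on \<Omega>. y t x i * L i t x)"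
      unfolding E_def h_def by (rule Bochner_Integration.integral_sum) (rule i4)
    also have "\<dots> \<le> (\<Sum>i=1..N. C * (LINT x|lebesgue_on \<Omega>. (Dy t x i \<bullet> Dy t x i) / (4 * y t x i)))"
    proof (rule sum_mono)
      fix i assume i: "i \<in> {1..N}"
      \<comment> \<open>Conservation of mass enters here: c_i is the mean at the present time t, so
        the relative entropy of y_i is taken with respect to its own mean, as the logarithmic
        Sobolev inequality requires.\<close>
      show "(LINT x|lebesgue_on \<Omega>. y t x i * L i t x) \<le> C * (LINT x|lebesgue_on \<Omega>. (Dy t x i \<bullet> Dy t x i) / (4 * y t x i))"
        unfolding L_def c[OF i t, symmetric]
        by (rule log_sobolev_classical[OF o b ne LS Yc[OF i] y0[OF i t] Pc[OF i] sol(7)[OF i t]])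
    qed
    also have "\<dots> = C * (LINT x|lebesgue_on \<Omega>. (\<Sum>i=1..N. (Dy t x i \<bullet> Dy t x i) / (4 * y t x i)))"
      unfolding sum_distrib_left[symmetric] by (subst Bochner_Integration.integral_sum) (use i3 in auto)
    finally have 2: "E t \<le> C * (LINT x|lebesgue_on \<Omega>. (\<Sum>i=1..N. (Dy t x i \<bullet> Dy t x i) / (4 * y t x i)))" .
    \<comment> \<open>The rate is assembled here: 4 E is at most C times the Fisher information,
      which is at most f_max times the entropy production, and dividing by C f_max leaves
      \<kappa>.\<close>
    have "4 * E t \<le> C * (4 * (LINT x|lebesgue_on \<Omega>. (\<Sum>i=1..N. (Dy t x i \<bullet> Dy t x i) / (4 * y t x i))))" using 2 by simp
    also have "\<dots> \<le> C * (f_max g N * - (LINT x|lebesgue_on \<Omega>. h' t x))" using 1 C by (intro mult_left_mono) auto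
    finally show ?thesis using C f_max(2) by (simp add: kappa_LS_def field_simps)
  qed
  have "E T \<le> exp (- kappa_LS g N C * (T - \<tau>)) * E \<tau>" by (rule gronwall_decay[OF less_imp_le[OF \<tau>] Ed El])
  then show ?thesis unfolding E_def h_def L_def rel_entropy_def .
qed


text \<open>From ln (1/a) \<le> 1/a - 1 one gets that a ln a is bounded by 1 on (0,1]. The bound
  does not depend on a and serves as dominating constant as time tends to 0.\<close>

lemma abs_entropy_term_le:
  fixes a c :: real
  assumes "0 < a" "a \<le> 1" "0 < c"
  shows "\<bar>a * ln (a / c)\<bar> \<le> 1 + \<bar>ln c\<bar>"
proof -
  have "ln (1 / a) \<le> 1 / a - 1" by (rule ln_le_minus_one) (use assms in simp)
  then have "a * - ln a \<le> a * (1 / a - 1)" using assms by (intro mult_left_mono) (auto simp: ln_div)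
  then have "a * - ln a \<le> 1" using assms by (simp add: algebra_simps)
  moreover have "a * ln a \<le> 0" using assms by (intro mult_nonneg_nonpos) auto
  ultimately have "\<bar>a * ln a\<bar> \<le> 1" by simp
  moreover have "\<bar>a * ln c\<bar> \<le> 1 * \<bar>ln c\<bar>" unfolding abs_mult using assms by (intro mult_right_mono) auto
  moreover have "a * ln (a / c) = a * ln a - a * ln c" using assms by (simp add: ln_div algebra_simps)
  ultimately show ?thesis by linarith
qed

section \<open>Passage to the initial time\<close>

text \<open>The times t / (n + 2) lie strictly between 0 and t for every n, so each of them is the
  start of a strip that ends at t.\<close>

lemma initial_limit:
  assumes sol: "global_solution p g N \<Omega> y" and t: "0 < t" and i: "i \<in> {1..N}" and x: "x \<in> closure \<Omega>"
  shows "(\<lambda>n. y (t / real (n + 2)) x i) \<longlonglongrightarrow> y 0 x i"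
proof -
  have l: "(\<lambda>n. t / real (n + 2)) \<longlonglongrightarrow> 0"
    using LIMSEQ_ignore_initial_segment[OF lim_const_over_n[of t], of 2] by simp
  have m: "\<forall>n. t / real (n + 2) \<in> {0..} - {0}" using t by simp
  have "((\<lambda>s. y s x i) \<circ> (\<lambda>n. t / real (n + 2))) \<longlonglongrightarrow> y 0 x i"
    by (rule global_solutionD(3)[OF sol order_refl i x, unfolded tendsto_at_iff_sequentially, THEN spec, THEN mp, THEN mp, OF m l])
  then show ?thesis by (simp add: o_def)
qed

text \<open>All values of y lie in the simplex, where F is bounded, so a constant is an integrable
  majorant on the bounded domain and pointwise convergence suffices.\<close>

lemma LINT_initial_limit:
  fixes \<Omega> :: "'a::euclidean_space set" and F :: "(nat \<Rightarrow> real) \<Rightarrow> real"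
  assumes o: "open \<Omega>" and b: "bounded \<Omega>" and sol: "global_solution p g N \<Omega> y" and t: "0 < t"
    and c: "\<And>t. 0 \<le> t \<Longrightarrow> continuous_on (closure \<Omega>) (\<lambda>x. F (y t x))"
    and B: "\<And>Y. Y \<in> open_simplex N \<Longrightarrow> \<bar>F Y\<bar> \<le> B"
    and l: "\<And>x. x \<in> \<Omega> \<Longrightarrow> (\<lambda>n. F (y (t / real (n + 2)) x)) \<longlonglongrightarrow> F (y 0 x)"
  shows "(\<lambda>n. LINT x|lebesgue_on \<Omega>. F (y (t / real (n + 2)) x)) \<longlonglongrightarrow> (LINT x|lebesgue_on \<Omega>. F (y 0 x))"
proof (rule integral_dominated_convergence[where w="\<lambda>x. B"])
  have S: "\<Omega> \<in> sets lebesgue" using o by simp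
  have K: "compact (closure \<Omega>)" using b by simp
  note int = integrable_continuous_compact[OF K _ S closure_subset]
  show "(\<lambda>x. F (y 0 x)) \<in> borel_measurable (lebesgue_on \<Omega>)" by (rule borel_measurable_integrable[OF int[OF c]]) simp
  show "(\<lambda>x. F (y (t / real (n + 2)) x)) \<in> borel_measurable (lebesgue_on \<Omega>)" for n
    by (rule borel_measurable_integrable[OF int[OF c]]) (use t in simp)
  show "integrable (lebesgue_on \<Omega>) (\<lambda>x. B)" by (rule int[OF continuous_on_const])
  show "AE x in lebesgue_on \<Omega>. (\<lambda>n. F (y (t / real (n + 2)) x)) \<longlonglongrightarrow> F (y 0 x)" by (rule AE_I2, rule l) simp
  show "AE x in lebesgue_on \<Omega>. norm (F (y (t / real (n + 2)) x)) \<le> B" for n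
  proof (rule AE_I2)
    fix x assume "x \<in> space (lebesgue_on \<Omega>)"
    then have "x \<in> closure \<Omega>" using closure_subset by auto
    then have "y (t / real (n + 2)) x \<in> open_simplex N" by (rule global_solutionD(1)[OF sol, rotated]) (use t in simp)
    then show "norm (F (y (t / real (n + 2)) x)) \<le> B" using B by simp
  qed
qed

lemma mean_conserved:
  fixes \<Omega> :: "'a::euclidean_space set"
  assumes dom: "C2_holder_domain \<alpha> \<Omega>" and b: "bounded \<Omega>" and sol: "global_solution p g N \<Omega> y" and p: "1 < p"
    and i: "i \<in> {1..N}" and t: "0 \<le> t"
  shows "mean \<Omega> (\<lambda>x. y t x i) = mean \<Omega> (\<lambda>x. y 0 x i)"
proof (cases "t = 0")
  case False
  then have t: "0 < t" using t by simp
  have o: "open \<Omega>" using dom unfolding C2_holder_domain_def by blast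
  have eq: "(LINT x|lebesgue_on \<Omega>. y t x i) = (LINT x|lebesgue_on \<Omega>. y (t / real (n + 2)) x i)" for n
  proof -
    have \<tau>: "0 < t / real (n + 2)" "t / real (n + 2) < t" using t by (simp_all add: divide_less_eq)
    obtain yt Dy where "strip_solution (t / real (n + 2)) t \<Omega> y yt Dy" using strip_solution_exists[OF dom b sol p \<tau>] by blast
    from strip_mass_conserved[OF o b this \<tau>(2) i] show ?thesis .
  qed
  have "(\<lambda>n. LINT x|lebesgue_on \<Omega>. y (t / real (n + 2)) x i) \<longlonglongrightarrow> (LINT x|lebesgue_on \<Omega>. y 0 x i)"
  proof (rule LINT_initial_limit[OF o b sol t, where F="\<lambda>Y. Y i" and B=1])
    show "continuous_on (closure \<Omega>) (\<lambda>x. y t x i)" if "0 \<le> t" for t by (rule global_solutionD(2)[OF sol that i])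
    show "\<bar>Y i\<bar> \<le> 1" if "Y \<in> open_simplex N" for Y using simplexD(1)[OF that i] simplex_le_1[OF that i] by simp
    show "(\<lambda>n. y (t / real (n + 2)) x i) \<longlonglongrightarrow> y 0 x i" if "x \<in> \<Omega>" for x
      by (rule initial_limit[OF sol t i]) (use that closure_subset in blast)
  qed
  then show ?thesis unfolding eq[symmetric] mean_def by (simp add: LIMSEQ_const_iff)
qed simp

lemma mean_in_simplex:
  fixes \<Omega> :: "'a::euclidean_space set"
  assumes o: "open \<Omega>" and b: "bounded \<Omega>" and ne: "\<Omega> \<noteq> {}" and sol: "global_solution p g N \<Omega> y"
  shows "(\<lambda>i. mean \<Omega> (\<lambda>x. y 0 x i)) \<in> open_simplex N"
proof -
  have S: "\<Omega> \<in> sets lebesgue" using o by simp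
  have K: "compact (closure \<Omega>)" using b by simp
  note y = global_solutionD[OF sol order_refl]
  have "0 < mean \<Omega> (\<lambda>x. y 0 x i)" if i: "i \<in> {1..N}" for i
    by (rule mean_pos[OF o b ne y(2)[OF i] simplexD(1)[OF y(1) i]])
  moreover have "(\<Sum>i=1..N. mean \<Omega> (\<lambda>x. y 0 x i)) = 1"
  proof -
    have "(\<Sum>i=1..N. LINT x|lebesgue_on \<Omega>. y 0 x i) = (LINT x|lebesgue_on \<Omega>. (\<Sum>i=1..N. y 0 x i))"
      by (rule Bochner_Integration.integral_sum[symmetric]) (rule integrable_continuous_compact[OF K y(2) S closure_subset])
    also have "\<dots> = (LINT x|lebesgue_on \<Omega>. 1)"
      using simplexD(2)[OF y(1)] closure_subset by (intro Bochner_Integration.integral_cong refl) auto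
    finally have "(\<Sum>i=1..N. mean \<Omega> (\<lambda>x. y 0 x i)) = mean \<Omega> (\<lambda>x. 1)"
      unfolding mean_def sum_divide_distrib[symmetric] by simp
    then show ?thesis using mean_const[OF o b ne, of 1] by simp
  qed
  ultimately show ?thesis unfolding open_simplex_def by simp
qed

lemma continuous_on_entropy_density:
  fixes \<Omega> :: "'a::euclidean_space set"
  assumes sol: "global_solution p g N \<Omega> y" and t: "0 \<le> t" and c: "\<And>i. i \<in> {1..N} \<Longrightarrow> 0 < c i"
  shows "continuous_on (closure \<Omega>) (\<lambda>x. \<Sum>i=1..N. y t x i * ln (y t x i / c i))"
proof (rule continuous_on_sum)
  fix i assume i: "i \<in> {1..N}"
  have "\<forall>x\<in>closure \<Omega>. y t x i / c i \<noteq> 0" using simplexD(1)[OF global_solutionD(1)[OF sol t] i] c[OF i] by fastforce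
  moreover have "\<forall>x\<in>closure \<Omega>. c i \<noteq> 0" using c[OF i] by simp
  ultimately show "continuous_on (closure \<Omega>) (\<lambda>x. y t x i * ln (y t x i / c i))"
    by (intro continuous_on_mult continuous_on_ln continuous_on_divide continuous_on_const global_solutionD(2)[OF sol t i])
qed

text \<open>The rate is the same for every strip, so the decay estimates on strips starting at t /
  (n + 2) converge to the one starting at 0; the entropy itself is continuous there by dominated
  convergence.\<close>

theorem entropy_decay:
  fixes \<Omega> :: "'a::euclidean_space set"
  assumes dom: "C2_holder_domain \<alpha> \<Omega>" and b: "bounded \<Omega>" and LS: "log_sobolev_constant \<Omega> C"
    and sol: "global_solution p g N \<Omega> y" and p: "1 < p" and t: "0 \<le> t"
  defines "c \<equiv> \<lambda>i. mean \<Omega> (\<lambda>x. y 0 x i)"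
  shows "rel_entropy N \<Omega> (y t) c \<le> exp (- kappa_LS g N C * t) * rel_entropy N \<Omega> (y 0) c"
proof (cases "t = 0")
  case False
  then have t: "0 < t" using t by simp
  have o: "open \<Omega>" and ne: "\<Omega> \<noteq> {}" using dom unfolding C2_holder_domain_def by blast+
  have c: "c \<in> open_simplex N" unfolding c_def by (rule mean_in_simplex[OF o b ne sol])
  let ?\<kappa> = "kappa_LS g N C"
  let ?F = "\<lambda>Y. \<Sum>i=1..N. Y i * ln (Y i / c i)"
  have "rel_entropy N \<Omega> (y t) c \<le> exp (- ?\<kappa> * (t - t / real (n + 2))) * rel_entropy N \<Omega> (y (t / real (n + 2))) c" for n
  proof -
    have \<tau>: "0 < t / real (n + 2)" "t / real (n + 2) < t" using t by (simp_all add: divide_less_eq)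
    obtain yt Dy where "strip_solution (t / real (n + 2)) t \<Omega> y yt Dy" using strip_solution_exists[OF dom b sol p \<tau>] by blast
    then show ?thesis
    proof (rule strip_entropy_decay[OF o b ne LS _ \<tau>(2) _ simplexD(1)[OF c]])
      fix i r assume i: "i \<in> {1..N}" and "r \<in> {t / real (n + 2)..t}"
      then have "0 \<le> r" using \<tau>(1) by simp
      from mean_conserved[OF dom b sol p i this] show "mean \<Omega> (\<lambda>x. y r x i) = c i" unfolding c_def .
    qed
  qed
  moreover have "(\<lambda>n. exp (- ?\<kappa> * (t - t / real (n + 2))) * rel_entropy N \<Omega> (y (t / real (n + 2))) c)
      \<longlonglongrightarrow> exp (- ?\<kappa> * (t - 0)) * rel_entropy N \<Omega> (y 0) c"
  proof (intro tendsto_mult tendsto_exp tendsto_diff tendsto_const)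
    show "(\<lambda>n. t / real (n + 2)) \<longlonglongrightarrow> 0"
      using LIMSEQ_ignore_initial_segment[OF lim_const_over_n[of t], of 2] by simp
    show "(\<lambda>n. rel_entropy N \<Omega> (y (t / real (n + 2))) c) \<longlonglongrightarrow> rel_entropy N \<Omega> (y 0) c"
      unfolding rel_entropy_def
    proof (rule LINT_initial_limit[OF o b sol t, where F="?F" and B="\<Sum>i=1..N. 1 + \<bar>ln (c i)\<bar>"])
      show "continuous_on (closure \<Omega>) (\<lambda>x. ?F (y t x))" if "0 \<le> t" for t
        by (rule continuous_on_entropy_density[OF sol that simplexD(1)[OF c]])
      show "\<bar>?F Y\<bar> \<le> (\<Sum>i=1..N. 1 + \<bar>ln (c i)\<bar>)" if Y: "Y \<in> open_simplex N" for Y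
        by (rule order_trans[OF sum_abs]) (intro sum_mono abs_entropy_term_le simplexD(1)[OF Y] simplex_le_1[OF Y] simplexD(1)[OF c])
      fix x assume "x \<in> \<Omega>"
      then have x: "x \<in> closure \<Omega>" using closure_subset by blast
      show "(\<lambda>n. ?F (y (t / real (n + 2)) x)) \<longlonglongrightarrow> ?F (y 0 x)"
      proof (rule tendsto_sum)
        fix i assume i: "i \<in> {1..N}"
        have "y 0 x i / c i \<noteq> 0" "c i \<noteq> 0"
          using simplexD(1)[OF c i] simplexD(1)[OF global_solutionD(1)[OF sol order_refl x] i] by auto
        then show "(\<lambda>n. y (t / real (n + 2)) x i * ln (y (t / real (n + 2)) x i / c i)) \<longlonglongrightarrow> y 0 x i * ln (y 0 x i / c i)"
          by (intro tendsto_mult tendsto_ln tendsto_divide tendsto_const initial_limit[OF sol t i x])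
      qed
    qed
  qed
  ultimately have "rel_entropy N \<Omega> (y t) c \<le> exp (- ?\<kappa> * (t - 0)) * rel_entropy N \<Omega> (y 0) c"
    by (intro LIMSEQ_le_const) auto
  then show ?thesis by simp
qed simp

text \<open>The linear terms of the pointwise inequality cancel in the sum over the species, because
  both states have total concentration 1.\<close>

lemma L2_dist_le_entropy:
  fixes \<Omega> :: "'a::euclidean_space set"
  assumes o: "open \<Omega>" and b: "bounded \<Omega>" and sol: "global_solution p g N \<Omega> y" and t: "0 \<le> t" and c: "c \<in> open_simplex N"
  shows "L2_dist N \<Omega> (y t) c \<le> sqrt (2 * rel_entropy N \<Omega> (y t) c)"
    "integrable (lebesgue_on \<Omega>) (\<lambda>x. \<Sum>i=1..N. (y t x i - c i)\<^sup>2)"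
proof -
  have S: "\<Omega> \<in> sets lebesgue" using o by simp
  have K: "compact (closure \<Omega>)" using b by simp
  note int = integrable_continuous_compact[OF K _ S closure_subset]
  note y = global_solutionD[OF sol t]
  have "continuous_on (closure \<Omega>) (\<lambda>x. \<Sum>i=1..N. (y t x i - c i)\<^sup>2)"
    by (intro continuous_on_sum continuous_on_power continuous_on_diff continuous_on_const y(2))
  from int[OF this] show i1: "integrable (lebesgue_on \<Omega>) (\<lambda>x. \<Sum>i=1..N. (y t x i - c i)\<^sup>2)" .
  have i2: "integrable (lebesgue_on \<Omega>) (\<lambda>x. \<Sum>i=1..N. y t x i * ln (y t x i / c i))"
    by (rule int[OF continuous_on_entropy_density[OF sol t simplexD(1)[OF c]]])
  have "(LINT x|lebesgue_on \<Omega>. (\<Sum>i=1..N. (y t x i - c i)\<^sup>2)) \<le> (LINT x|lebesgue_on \<Omega>. 2 * (\<Sum>i=1..N. y t x i * ln (y t x i / c i)))"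
  proof (rule integral_mono[OF i1 integrable_mult_right[OF i2]])
    fix x assume "x \<in> space (lebesgue_on \<Omega>)"
    then have "x \<in> closure \<Omega>" using closure_subset by auto
    note Y = y(1)[OF this]
    have "(\<Sum>i=1..N. (y t x i - c i)\<^sup>2 / 2) \<le> (\<Sum>i=1..N. y t x i * ln (y t x i / c i) - y t x i + c i)"
      by (intro sum_mono relative_entropy_ge_square simplexD(1)[OF Y] simplex_le_1[OF Y] simplexD(1)[OF c] simplex_le_1[OF c])
    also have "\<dots> = (\<Sum>i=1..N. y t x i * ln (y t x i / c i))"
      using simplexD(2)[OF Y] simplexD(2)[OF c] by (simp add: sum.distrib sum_subtractf)
    finally show "(\<Sum>i=1..N. (y t x i - c i)\<^sup>2) \<le> 2 * (\<Sum>i=1..N. y t x i * ln (y t x i / c i))"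
      unfolding sum_divide_distrib[symmetric] by simp
  qed
  then show "L2_dist N \<Omega> (y t) c \<le> sqrt (2 * rel_entropy N \<Omega> (y t) c)"
    unfolding L2_dist_def rel_entropy_def by (intro real_sqrt_le_mono) simp
qed

section \<open>The invariant root box and the final constants\<close>

text \<open>On the compact closure the continuous initial roots attain their extrema, and an
  attained value lies strictly between its two poles.\<close>

lemma root_range:
  fixes \<Omega> :: "'a::euclidean_space set"
  assumes b: "bounded \<Omega>" and ne: "\<Omega> \<noteq> {}" and sol: "global_solution p g N \<Omega> y" and j: "j \<in> {1..N-1}"
  defines "z \<equiv> \<lambda>x. root_coord g N (y 0 x) j"
  shows "g j < (INF x\<in>closure \<Omega>. z x)" "(SUP x\<in>closure \<Omega>. z x) < g (Suc j)"
    "x \<in> closure \<Omega> \<Longrightarrow> (INF x\<in>closure \<Omega>. z x) \<le> z x" "x \<in> closure \<Omega> \<Longrightarrow> z x \<le> (SUP x\<in>closure \<Omega>. z x)"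
proof -
  note y = global_solutionD[OF sol order_refl]
  have K: "compact (closure \<Omega>)" using b by simp
  have ne': "closure \<Omega> \<noteq> {}" using ne by simp
  have zc: "continuous_on (closure \<Omega>) z" unfolding z_def by (rule continuous_on_root[OF y(2) y(1) j])
  obtain u where u: "u \<in> closure \<Omega>" "\<forall>v\<in>closure \<Omega>. z u \<le> z v" using continuous_attains_inf[OF K ne' zc] by blast
  obtain v where v: "v \<in> closure \<Omega>" "\<forall>x\<in>closure \<Omega>. z x \<le> z v" using continuous_attains_sup[OF K ne' zc] by blast
  have bb: "bdd_below (z ` closure \<Omega>)" unfolding bdd_below_def using u(2) by blast
  have ba: "bdd_above (z ` closure \<Omega>)" unfolding bdd_above_def using v(2) by blast
  have "z u \<le> (INF x\<in>closure \<Omega>. z x)" by (rule cINF_greatest[OF ne']) (use u(2) in blast)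
  then show "g j < (INF x\<in>closure \<Omega>. z x)" using root_coord(1)[OF y(1)[OF u(1)] j] unfolding z_def by linarith
  have "(SUP x\<in>closure \<Omega>. z x) \<le> z v" by (rule cSUP_least[OF ne']) (use v(2) in blast)
  then show "(SUP x\<in>closure \<Omega>. z x) < g (Suc j)" using root_coord(2)[OF y(1)[OF v(1)] j] unfolding z_def by linarith
  show "x \<in> closure \<Omega> \<Longrightarrow> (INF x\<in>closure \<Omega>. z x) \<le> z x" by (rule cINF_lower[OF bb])
  show "x \<in> closure \<Omega> \<Longrightarrow> z x \<le> (SUP x\<in>closure \<Omega>. z x)" by (rule cSUP_upper[OF _ ba])
qed

text \<open>The smallest of the finitely many gaps to the poles. It is formulated for the points of
  the box, so that solutions with the same box share it.\<close>

lemma root_box_margin: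
  fixes \<Omega> :: "'a::euclidean_space set"
  assumes b: "bounded \<Omega>" and ne: "\<Omega> \<noteq> {}" and sol: "global_solution p g N \<Omega> y"
  shows "\<exists>\<delta>>0. \<forall>r\<in>root_box g N \<Omega> (y 0). \<forall>j\<in>{1..N-1}. g j + \<delta> \<le> r j \<and> r j \<le> g (Suc j) - \<delta>"
proof -
  define I where "I j = (INF x\<in>closure \<Omega>. root_coord g N (y 0 x) j)" for j
  define M where "M j = (SUP x\<in>closure \<Omega>. root_coord g N (y 0 x) j)" for j
  define d where "d j = min (I j - g j) (g (Suc j) - M j)" for j
  define \<delta> where "\<delta> = Min (d ` {1..N-1})"
  have d: "0 < d j" if "j \<in> {1..N-1}" for j
    using root_range(1,2)[OF b ne sol that] by (simp add: d_def I_def M_def)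
  have "0 < \<delta>" unfolding \<delta>_def using d N2 by (subst Min_gr_iff) auto
  moreover have "g j + \<delta> \<le> r j \<and> r j \<le> g (Suc j) - \<delta>" if r: "r \<in> root_box g N \<Omega> (y 0)" and j: "j \<in> {1..N-1}" for r j
  proof -
    have "\<delta> \<le> d j" unfolding \<delta>_def using j by simp
    then have "\<delta> \<le> I j - g j" "\<delta> \<le> g (Suc j) - M j" unfolding d_def by simp_all
    moreover have "r j \<in> {I j..M j}" using r j unfolding root_box_def I_def M_def by (rule PiE_mem)
    ultimately show ?thesis by auto
  qed
  ultimately show ?thesis by blast
qed

lemma compactin_root_box: "compactin (product_topology (\<lambda>_. euclideanreal) {1..N-1}) (root_box g N \<Omega> Y)"
  unfolding root_box_def compactin_PiE by simp

theorem roots_in_root_box: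
  fixes \<Omega> :: "'a::euclidean_space set"
  assumes dom: "C2_holder_domain \<alpha> \<Omega>" and b: "bounded \<Omega>" and sol: "global_solution p g N \<Omega> y" and p: "1 < p"
    and t: "0 \<le> t" and x: "x \<in> closure \<Omega>"
  shows "(\<lambda>j\<in>{1..N-1}. root_coord g N (y t x) j) \<in> root_box g N \<Omega> (y 0)"
  unfolding root_box_def
proof (rule restrict_PiE_iff[THEN iffD2], rule ballI)
  fix j assume j: "j \<in> {1..N-1}"
  have ne: "\<Omega> \<noteq> {}" using dom unfolding C2_holder_domain_def by blast
  note r = root_range[OF b ne sol j]
  have "1 * (root_coord g N (y t x) j - (SUP x\<in>closure \<Omega>. root_coord g N (y 0 x) j)) \<le> 0"
    by (rule root_comparison[OF dom b sol p j _ _ x t]) (use r(4) in simp_all)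
  moreover have "- 1 * (root_coord g N (y t x) j - (INF x\<in>closure \<Omega>. root_coord g N (y 0 x) j)) \<le> 0"
    by (rule root_comparison[OF dom b sol p j _ _ x t]) (use r(3) in simp_all)
  ultimately show "root_coord g N (y t x) j \<in> {INF x\<in>closure \<Omega>. root_coord g N (y 0 x) j..SUP x\<in>closure \<Omega>. root_coord g N (y 0 x) j}"
    by simp
qed

lemma root_coord_margin:
  fixes \<Omega> :: "'a::euclidean_space set"
  assumes dom: "C2_holder_domain \<alpha> \<Omega>" and b: "bounded \<Omega>" and sol: "global_solution p g N \<Omega> y" and p: "1 < p"
    and \<delta>: "\<forall>r\<in>root_box g N \<Omega> (y 0). \<forall>j\<in>{1..N-1}. g j + \<delta> \<le> r j \<and> r j \<le> g (Suc j) - \<delta>"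
    and t: "0 \<le> t" and x: "x \<in> closure \<Omega>" and j: "j \<in> {1..N-1}"
  shows "g j + \<delta> \<le> root_coord g N (y t x) j \<and> root_coord g N (y t x) j \<le> g (Suc j) - \<delta>"
  using bspec[OF bspec[OF \<delta> roots_in_root_box[OF dom b sol p t x]] j] j by simp

text \<open>The constant depends on the initial state only through the distance \<open>\<delta>\<close> of its root box from the poles.\<close>

lemma coordinates_L2_bound:
  fixes \<Omega> :: "'a::euclidean_space set"
  assumes dom: "C2_holder_domain \<alpha> \<Omega>" and b: "bounded \<Omega>" and p: "1 < p" and \<delta>0: "0 < \<delta>"
  shows "\<exists>K\<ge>0. \<forall>y. global_solution p g N \<Omega> y \<and>
     (\<forall>r\<in>root_box g N \<Omega> (y 0). \<forall>j\<in>{1..N-1}. g j + \<delta> \<le> r j \<and> r j \<le> g (Suc j) - \<delta>) \<longrightarrow>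
     (\<forall>t\<ge>0. L2_dist N \<Omega> (y t) (\<lambda>i. mean \<Omega> (\<lambda>x. y 0 x i))
        + L2_dist (N - 1) \<Omega> (\<lambda>x. root_coord g N (y t x)) (root_coord g N (\<lambda>i. mean \<Omega> (\<lambda>x. y 0 x i)))
        + L2_dist (N - 1) \<Omega> (\<lambda>x. moment g N (y t x)) (moment g N (\<lambda>i. mean \<Omega> (\<lambda>x. y 0 x i)))
        + L2_dist (N - 1) \<Omega> (\<lambda>x. entropy_var g N (y t x)) (entropy_var g N (\<lambda>i. mean \<Omega> (\<lambda>x. y 0 x i)))
      \<le> K * L2_dist N \<Omega> (y t) (\<lambda>i. mean \<Omega> (\<lambda>x. y 0 x i)))"
proof -
  have o: "open \<Omega>" and ne: "\<Omega> \<noteq> {}" using dom unfolding C2_holder_domain_def by blast+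
  \<comment> \<open>The lower bound for all concentrations that the product formula yields from a
    distance \<delta> of the roots from the poles; means inherit it.\<close>
  define \<delta>' where "\<delta>' = (\<delta> / width) ^ (N - 1)"
  have \<delta>': "0 < \<delta>'" using \<delta>0 width_pos by (simp add: \<delta>'_def)
  define Lz where "Lz = width\<^sup>2 / \<delta>"
  define LU where "LU = (\<Sum>l=1..N-1. \<Sum>i=1..N. \<bar>g i ^ l\<bar>)"
  define A where "A = (\<Sum>l=1..N-1. \<Sum>i=1..N. \<bar>lc i l\<bar>)"
  define s where "s = sqrt (real ((N - 1) * N))"
  have nn: "0 \<le> Lz" "0 \<le> LU" "0 \<le> A" "0 \<le> A / \<delta>'" "0 \<le> s"
    using \<delta>0 \<delta>' by (auto simp: Lz_def LU_def A_def s_def intro!: sum_nonneg divide_nonneg_nonneg)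
  define K where "K = 1 + s * Lz + s * LU + s * (A / \<delta>')"
  show ?thesis
  proof (intro exI[of _ K] conjI allI impI)
    show "0 \<le> K" unfolding K_def using nn by (intro add_nonneg_nonneg mult_nonneg_nonneg) auto
    fix y t assume *: "global_solution p g N \<Omega> y \<and>
     (\<forall>r\<in>root_box g N \<Omega> (y 0). \<forall>j\<in>{1..N-1}. g j + \<delta> \<le> r j \<and> r j \<le> g (Suc j) - \<delta>)" and t: "(0::real) \<le> t"
    then have sol: "global_solution p g N \<Omega> y"
      and \<delta>: "\<forall>r\<in>root_box g N \<Omega> (y 0). \<forall>j\<in>{1..N-1}. g j + \<delta> \<le> r j \<and> r j \<le> g (Suc j) - \<delta>" by blast+
    define c where "c i = mean \<Omega> (\<lambda>x. y 0 x i)" for i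
    have c: "c \<in> open_simplex N" using mean_in_simplex[OF o b ne sol] unfolding c_def[abs_def] .
    note y = global_solutionD[OF sol]
    note m = root_coord_margin[OF dom b sol p \<delta>]
    have low: "\<delta>' \<le> y t x i" if "0 \<le> t" "x \<in> closure \<Omega>" "i \<in> {1..N}" for t x i
      unfolding \<delta>'_def by (rule conc_lower_bound[OF y(1)[OF that(1,2)] \<delta>0 m[OF that(1,2)] that(3)])
    have lowc: "\<delta>' \<le> c i" if "i \<in> {1..N}" for i
      unfolding c_def by (rule mean_ge[OF o b ne y(2)[OF order_refl that]]) (use low[OF order_refl _ that] closure_subset in blast)
    have cl: "x \<in> closure \<Omega>" if "x \<in> \<Omega>" for x using that closure_subset by blast
    note i2 = L2_dist_le_entropy(2)[OF o b sol t c]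
    have z: "L2_dist (N - 1) \<Omega> (\<lambda>x. root_coord g N (y t x)) (root_coord g N c) \<le> s * Lz * L2_dist N \<Omega> (y t) c"
      unfolding s_def
    proof (rule L2_dist_lipschitz[OF _ nn(1) i2])
      fix x j assume x: "x \<in> \<Omega>" and j: "j \<in> {1..N-1}"
      \<comment> \<open>The distance from the poles is used for the root of \<open>y t x\<close>,
        where the invariant box provides it; the mean enters merely as a point of the
        simplex.\<close>
      show "\<bar>root_coord g N (y t x) j - root_coord g N c j\<bar> \<le> Lz * (\<Sum>i=1..N. \<bar>y t x i - c i\<bar>)"
        unfolding Lz_def by (rule root_lipschitz[OF c y(1)[OF t cl[OF x]] j \<delta>0 root_gap[OF y(1)[OF t cl[OF x]] m[OF t cl[OF x]] _ j]])
    qed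
    have U: "L2_dist (N - 1) \<Omega> (\<lambda>x. moment g N (y t x)) (moment g N c) \<le> s * LU * L2_dist N \<Omega> (y t) c"
      unfolding s_def
    proof (rule L2_dist_lipschitz[OF _ nn(2) i2])
      fix x l assume "x \<in> \<Omega>" and l: "l \<in> {1..N-1}"
      have "moment g N (y t x) l - moment g N c l = (\<Sum>i=1..N. g i ^ l * (y t x i - c i))"
        unfolding moment_def by (simp add: algebra_simps sum_subtractf)
      then show "\<bar>moment g N (y t x) l - moment g N c l\<bar> \<le> LU * (\<Sum>i=1..N. \<bar>y t x i - c i\<bar>)"
        unfolding LU_def using abs_linear_comb_le[OF l, where a="\<lambda>i l. g i ^ l" and d="\<lambda>i. y t x i - c i"] by simp
    qed
    have w: "L2_dist (N - 1) \<Omega> (\<lambda>x. entropy_var g N (y t x)) (entropy_var g N c) \<le> s * (A / \<delta>') * L2_dist N \<Omega> (y t) c"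
      unfolding s_def
    proof (rule L2_dist_lipschitz[OF _ nn(4) i2])
      fix x l assume x: "x \<in> \<Omega>" and l: "l \<in> {1..N-1}"
      have "entropy_var g N (y t x) l - entropy_var g N c l = (\<Sum>i=1..N. lc i l * (ln (y t x i) - ln (c i)))"
        unfolding entropy_var_eq[OF y(1)[OF t cl[OF x]] l] entropy_var_eq[OF c l] by (simp add: algebra_simps sum_subtractf)
      then have "\<bar>entropy_var g N (y t x) l - entropy_var g N c l\<bar> \<le> A * (\<Sum>i=1..N. \<bar>ln (y t x i) - ln (c i)\<bar>)"
        unfolding A_def using abs_linear_comb_le[OF l, where a=lc and d="\<lambda>i. ln (y t x i) - ln (c i)"] by simp
      also have "\<dots> \<le> A * (\<Sum>i=1..N. \<bar>y t x i - c i\<bar> / \<delta>')"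
        by (intro mult_left_mono sum_mono ln_lipschitz[OF \<delta>'] low[OF t cl[OF x]] lowc nn(3))
      also have "\<dots> = A / \<delta>' * (\<Sum>i=1..N. \<bar>y t x i - c i\<bar>)" by (simp only: sum_divide_distrib[symmetric] times_divide_eq_left times_divide_eq_right)
      finally show "\<bar>entropy_var g N (y t x) l - entropy_var g N c l\<bar> \<le> A / \<delta>' * (\<Sum>i=1..N. \<bar>y t x i - c i\<bar>)" .
    qed
    have "L2_dist N \<Omega> (y t) c + L2_dist (N - 1) \<Omega> (\<lambda>x. root_coord g N (y t x)) (root_coord g N c)
        + L2_dist (N - 1) \<Omega> (\<lambda>x. moment g N (y t x)) (moment g N c)
        + L2_dist (N - 1) \<Omega> (\<lambda>x. entropy_var g N (y t x)) (entropy_var g N c)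
      \<le> K * L2_dist N \<Omega> (y t) c"
      using z U w unfolding K_def distrib_right by linarith
    then show "L2_dist N \<Omega> (y t) (\<lambda>i. mean \<Omega> (\<lambda>x. y 0 x i))
        + L2_dist (N - 1) \<Omega> (\<lambda>x. root_coord g N (y t x)) (root_coord g N (\<lambda>i. mean \<Omega> (\<lambda>x. y 0 x i)))
        + L2_dist (N - 1) \<Omega> (\<lambda>x. moment g N (y t x)) (moment g N (\<lambda>i. mean \<Omega> (\<lambda>x. y 0 x i)))
        + L2_dist (N - 1) \<Omega> (\<lambda>x. entropy_var g N (y t x)) (entropy_var g N (\<lambda>i. mean \<Omega> (\<lambda>x. y 0 x i)))
      \<le> K * L2_dist N \<Omega> (y t) (\<lambda>i. mean \<Omega> (\<lambda>x. y 0 x i))"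
      unfolding c_def[abs_def] .
  qed
qed

text \<open>The square root of the entropy estimate, hence half the rate.\<close>

lemma L2_decay:
  fixes \<Omega> :: "'a::euclidean_space set"
  assumes dom: "C2_holder_domain \<alpha> \<Omega>" and b: "bounded \<Omega>" and LS: "log_sobolev_constant \<Omega> C"
    and sol: "global_solution p g N \<Omega> y" and p: "1 < p" and t: "0 \<le> t"
  defines "c \<equiv> \<lambda>i. mean \<Omega> (\<lambda>x. y 0 x i)"
  shows "L2_dist N \<Omega> (y t) c \<le> sqrt 2 * exp (- kappa_LS g N C * t / 2) * sqrt (rel_entropy N \<Omega> (y 0) c)"
proof -
  have o: "open \<Omega>" and ne: "\<Omega> \<noteq> {}" using dom unfolding C2_holder_domain_def by blast+
  have c: "c \<in> open_simplex N" unfolding c_def by (rule mean_in_simplex[OF o b ne sol])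
  let ?\<kappa> = "kappa_LS g N C"
  have "exp (- ?\<kappa> * t) = (exp (- ?\<kappa> * t / 2))\<^sup>2" by (simp add: exp_double[symmetric])
  then have e: "sqrt (exp (- ?\<kappa> * t)) = exp (- ?\<kappa> * t / 2)" by simp
  have "L2_dist N \<Omega> (y t) c \<le> sqrt (2 * rel_entropy N \<Omega> (y t) c)" by (rule L2_dist_le_entropy(1)[OF o b sol t c])
  also have "\<dots> \<le> sqrt (2 * (exp (- ?\<kappa> * t) * rel_entropy N \<Omega> (y 0) c))"
    using entropy_decay[OF dom b LS sol p t] unfolding c_def by (intro real_sqrt_le_mono mult_left_mono) auto
  also have "\<dots> = sqrt 2 * exp (- ?\<kappa> * t / 2) * sqrt (rel_entropy N \<Omega> (y 0) c)"
    unfolding real_sqrt_mult e by simp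
  finally show ?thesis .
qed

end

text \<open>The constant is a function of the root box, chosen before the solution: solutions with
  the same box get the same constant.\<close>

theorem theorem15p3:
  fixes N :: nat and g :: "nat \<Rightarrow> real" and \<Omega> :: "'a::euclidean_space set"
    and \<alpha> p C_LS :: real
  assumes "2 \<le> N" and "2 \<le> DIM('a)"
    and "0 < g 1" and "strict_mono_on {1..N} g"
    and "0 < \<alpha>" and "\<alpha> < 1" and "bounded \<Omega>" and "C2_holder_domain \<alpha> \<Omega>"
    and "p > real (DIM('a)) + 2"
    and "log_sobolev_constant \<Omega> C_LS"
  shows "0 < kappa_LS g N C_LS \<and>
    (\<exists>C :: (nat \<Rightarrow> real) set \<Rightarrow> real. \<forall>y. global_solution p g N \<Omega> y \<longrightarrow>
      (let yb = (\<lambda>i. mean \<Omega> (\<lambda>x. y 0 x i));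
           R0 = root_box g N \<Omega> (y 0);
           \<kappa> = kappa_LS g N C_LS
       in
         compactin (product_topology (\<lambda>_. euclideanreal) {1..N-1}) R0 \<and>
         R0 \<subseteq> (\<Pi>\<^sub>E j\<in>{1..N-1}. {g j<..<g (Suc j)}) \<and>
         (\<forall>t\<ge>0. \<forall>x\<in>closure \<Omega>. (\<lambda>j\<in>{1..N-1}. root_coord g N (y t x) j) \<in> R0) \<and>
         (\<forall>t\<ge>0. rel_entropy N \<Omega> (y t) yb \<le> exp (- \<kappa> * t) * rel_entropy N \<Omega> (y 0) yb) \<and>
         (\<forall>t\<ge>0.
            L2_dist N \<Omega> (y t) yb
            + L2_dist (N - 1) \<Omega> (\<lambda>x. root_coord g N (y t x)) (root_coord g N yb)
            + L2_dist (N - 1) \<Omega> (\<lambda>x. moment g N (y t x)) (moment g N yb)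
            + L2_dist (N - 1) \<Omega> (\<lambda>x. entropy_var g N (y t x)) (entropy_var g N yb)
            \<le> C R0 * exp (- \<kappa> * t / 2) * sqrt (rel_entropy N \<Omega> (y 0) yb))))"
proof -
  interpret additive_MS N g using assms(1,3,4) by unfold_locales
  note b = assms(7) and dom = assms(8) and LS = assms(10)
  have o: "open \<Omega>" and ne: "\<Omega> \<noteq> {}" using dom unfolding C2_holder_domain_def by blast+
  have p: "1 < p" using assms(9) of_nat_0_le_iff[of "DIM('a)"] by linarith
  have \<kappa>: "0 < kappa_LS g N C_LS"
    using log_sobolev_constant_pos[OF o b ne LS] f_max(2) by (simp add: kappa_LS_def)
  define yb where "yb y i = mean \<Omega> (\<lambda>x. y (0::real) x i)" for y :: "real \<Rightarrow> 'a vfield" and i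
  define dist where "dist y t = L2_dist N \<Omega> (y t) (yb y)
            + L2_dist (N - 1) \<Omega> (\<lambda>x. root_coord g N (y t x)) (root_coord g N (yb y))
            + L2_dist (N - 1) \<Omega> (\<lambda>x. moment g N (y t x)) (moment g N (yb y))
            + L2_dist (N - 1) \<Omega> (\<lambda>x. entropy_var g N (y t x)) (entropy_var g N (yb y))" for y t
  \<comment> \<open>For a set R that is not the box of any solution the claim is vacuous. Otherwise
    the margin \<delta> is read off from one solution and, being a property of R, applies to all
    others with this box; the constants are collected into a function of R by choice.\<close>
  have "\<exists>K. \<forall>y. global_solution p g N \<Omega> y \<and> root_box g N \<Omega> (y 0) = R \<longrightarrow>
      (\<forall>t\<ge>0. dist y t \<le> K * exp (- kappa_LS g N C_LS * t / 2) * sqrt (rel_entropy N \<Omega> (y 0) (yb y)))" for R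
  proof (cases "\<exists>y. global_solution p g N \<Omega> y \<and> root_box g N \<Omega> (y 0) = R")
    case True
    then obtain y0 where y0: "global_solution p g N \<Omega> y0" "root_box g N \<Omega> (y0 0) = R" by blast
    from root_box_margin[OF b ne y0(1)] obtain \<delta> where \<delta>: "0 < \<delta>"
      "\<forall>r\<in>R. \<forall>j\<in>{1..N-1}. g j + \<delta> \<le> r j \<and> r j \<le> g (Suc j) - \<delta>" unfolding y0(2) by blast
    have "\<exists>K\<ge>0. \<forall>y. global_solution p g N \<Omega> y \<and>
       (\<forall>r\<in>root_box g N \<Omega> (y 0). \<forall>j\<in>{1..N-1}. g j + \<delta> \<le> r j \<and> r j \<le> g (Suc j) - \<delta>) \<longrightarrow>
       (\<forall>t\<ge>0. dist y t \<le> K * L2_dist N \<Omega> (y t) (yb y))"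
      using coordinates_L2_bound[OF dom b p \<delta>(1)] unfolding dist_def yb_def[abs_def] .
    then obtain K where K: "0 \<le> K" "\<forall>y. global_solution p g N \<Omega> y \<and>
       (\<forall>r\<in>root_box g N \<Omega> (y 0). \<forall>j\<in>{1..N-1}. g j + \<delta> \<le> r j \<and> r j \<le> g (Suc j) - \<delta>) \<longrightarrow>
       (\<forall>t\<ge>0. dist y t \<le> K * L2_dist N \<Omega> (y t) (yb y))" by (elim exE conjE) (rule that)
    have "dist y t \<le> K * sqrt 2 * exp (- kappa_LS g N C_LS * t / 2) * sqrt (rel_entropy N \<Omega> (y 0) (yb y))"
      if sol: "global_solution p g N \<Omega> y" and R: "root_box g N \<Omega> (y 0) = R" and t: "0 \<le> t" for y t
    proof -
      have "dist y t \<le> K * L2_dist N \<Omega> (y t) (yb y)" 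
        by (rule K(2)[THEN spec, THEN mp, THEN spec, THEN mp, OF _ t]) (use sol R \<delta>(2) in blast)
      also have "\<dots> \<le> K * (sqrt 2 * exp (- kappa_LS g N C_LS * t / 2) * sqrt (rel_entropy N \<Omega> (y 0) (yb y)))"
        using L2_decay[OF dom b LS sol p t] K(1) unfolding yb_def[abs_def] by (rule mult_left_mono)
      finally show ?thesis by (simp only: mult.assoc)
    qed
    then show ?thesis by blast
  qed blast
  then have "\<exists>C. \<forall>R. \<forall>y. global_solution p g N \<Omega> y \<and> root_box g N \<Omega> (y 0) = R \<longrightarrow>
      (\<forall>t\<ge>0. dist y t \<le> C R * exp (- kappa_LS g N C_LS * t / 2) * sqrt (rel_entropy N \<Omega> (y 0) (yb y)))"
    by (intro choice allI)
  then obtain C where C: "\<And>y t. global_solution p g N \<Omega> y \<Longrightarrow> 0 \<le> t \<Longrightarrow>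
      dist y t \<le> C (root_box g N \<Omega> (y 0)) * exp (- kappa_LS g N C_LS * t / 2) * sqrt (rel_entropy N \<Omega> (y 0) (yb y))"
    by blast
  have sub: "root_box g N \<Omega> (y 0) \<subseteq> (\<Pi>\<^sub>E j\<in>{1..N-1}. {g j<..<g (Suc j)})" if "global_solution p g N \<Omega> y" for y
  proof -
    have "{(INF x\<in>closure \<Omega>. root_coord g N (y 0 x) j)..(SUP x\<in>closure \<Omega>. root_coord g N (y 0 x) j)} \<subseteq> {g j<..<g (Suc j)}"
      if "j \<in> {1..N-1}" for j
      using root_range(1,2)[OF b ne \<open>global_solution p g N \<Omega> y\<close> that] by auto
    then show ?thesis unfolding root_box_def by (rule PiE_mono)
  qed
  show ?thesis unfolding Let_def
  proof (intro conjI exI[of _ C] allI impI ballI)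
    show "0 < kappa_LS g N C_LS" by (rule \<kappa>)
  next
    fix y assume sol: "global_solution p g N \<Omega> y"
    show "compactin (product_topology (\<lambda>_. euclideanreal) {1..N-1}) (root_box g N \<Omega> (y 0))" by (rule compactin_root_box)
    show "root_box g N \<Omega> (y 0) \<subseteq> (\<Pi>\<^sub>E j\<in>{1..N-1}. {g j<..<g (Suc j)})" by (rule sub[OF sol])
    show "(\<lambda>j\<in>{1..N-1}. root_coord g N (y t x) j) \<in> root_box g N \<Omega> (y 0)" if "0 \<le> t" "x \<in> closure \<Omega>" for t x
      by (rule roots_in_root_box[OF dom b sol p that])
    show "rel_entropy N \<Omega> (y t) (\<lambda>i. mean \<Omega> (\<lambda>x. y 0 x i)) \<le> exp (- kappa_LS g N C_LS * t) * rel_entropy N \<Omega> (y 0) (\<lambda>i. mean \<Omega> (\<lambda>x. y 0 x i))"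
      if "0 \<le> t" for t by (rule entropy_decay[OF dom b LS sol p that])
    show "L2_dist N \<Omega> (y t) (\<lambda>i. mean \<Omega> (\<lambda>x. y 0 x i))
            + L2_dist (N - 1) \<Omega> (\<lambda>x. root_coord g N (y t x)) (root_coord g N (\<lambda>i. mean \<Omega> (\<lambda>x. y 0 x i)))
            + L2_dist (N - 1) \<Omega> (\<lambda>x. moment g N (y t x)) (moment g N (\<lambda>i. mean \<Omega> (\<lambda>x. y 0 x i)))
            + L2_dist (N - 1) \<Omega> (\<lambda>x. entropy_var g N (y t x)) (entropy_var g N (\<lambda>i. mean \<Omega> (\<lambda>x. y 0 x i)))
            \<le> C (root_box g N \<Omega> (y 0)) * exp (- kappa_LS g N C_LS * t / 2) * sqrt (rel_entropy N \<Omega> (y 0) (\<lambda>i. mean \<Omega> (\<lambda>x. y 0 x i)))"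
      if "0 \<le> t" for t using C[OF sol that] unfolding dist_def yb_def[abs_def] .
  qed
qed

end
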